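(* Let $\kappa$ be a field which is a $\mathcal Z$-algebra and let $r,s,n$ be positive integers with $n\ge r+s$. For any $(f,\lambda)\in\Lambda_{r,s}$, let $S(\lambda)=\{v_{\lambda,\mathfrak t,d}\mid \mathfrak t\in\mathscr T^{std}(\lambda'),\ d\in\mathscr D^f_{r,s}\}$. Then $S(\lambda)$ is a basis of the $\kappa$-space spanned by all singular vectors of $V^{r,s}_\kappa$ with highest weight $\tilde\lambda$.
   Context: Let $\mathcal Z=\mathbb Z[q,q^{-1}]$, $[m]=(q^m-q^{-m})/(q-q^{-1})$. Quantum group. $\mathbf U_q(\mathfrak{gl}_n)$ is the $\mathbb Q(q)$-algebra with generators $E_i,F_i$ ($1\le i\le n-1$), $q^h$ ($h\in\bigoplus_{i=1}^n\mathbb Zh_i$), with $\varepsilon_i(h_j)=\delta_{ij}$, $\alpha_i=\varepsilon_i-\varepsilon_{i+1}$, $K_i=q^{h_i-h_{i+1}}$ and the usual relations $q^0=1$, $q^hq^{h'}=q^{h+h'}$, $q^hE_iq^{-h}=q^{\alpha_i(h)}E_i$, $q^hF_iq^{-h}=q^{-\alpha_i(h)}F_i$, $E_iF_j-F_jE_i=\delta_{ij}(K_i-K_i^{-1})/(q-q^{-1})$ and quantum Serre relations; comultiplication $\Delta(E_i)=E_i\otimes K_i^{-1}+1\otimes E_i$, $\Delta(F_i)=F_i\otimes1+K_i\otimes F_i$, $\Delta(q^h)=q^h\otimes q^h$. $\mathbf U_{\mathcal Z}$ is the $\mathcal Z$-subalgebra generated by all $q^h$ and divided powers $E_i^{(\ell)}=E_i^\ell/[\ell]!$,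 $F_i^{(\ell)}=F_i^\ell/[\ell]!$; $\mathbf U_\kappa=\mathbf U_{\mathcal Z}\otimes_{\mathcal Z}\kappa$. For $\lambda\in\mathbb Z^n$, a vector $m$ has weight $\lambda$ if $q^{h_i}m=q^{\lambda_i}m$ for all $i$ (over $\kappa$: lies in the weight space obtained by base change). A singular vector of highest weight $\lambda$ (with $\lambda_1\ge\cdots\ge\lambda_n$) is a nonzero vector of weight $\lambda$ killed by all $E_i^{(\ell)}$, $1\le i\le n-1$, $\ell>0$. Mixed tensor space. $V$ is free over $\mathcal Z$ with basis $v_1,\dots,v_n$: $q^hv_j=q^{\varepsilon_j(h)}v_j$, $E_iv_j=\delta_{j,i+1}v_i$, $F_iv_j=\delta_{i,j}v_{i+1}$. $W=V^*$ has dual basis $v_j^*$: $q^hv_j^*=q^{-\varepsilon_j(h)}v_j^*$, $E_iv_j^*=-\delta_{i,j}q^{-1}v_{i+1}^*$, $F_iv_j^*=-\delta_{i+1,j}q\,v_i^*$. $V^{r,s}=V^{\otimes r}\otimes W^{\otimes s}$ with basis $v_{\mathbf i|\mathbf j}=v_{i_r}\otimes\cdots\otimes v_{i_1}\otimes v^*_{j_1}\otimes\cdots\otimes v^*_{j_s}$, and $V_\kappa^{r,s}=V^{r,s}\otimes_{\mathcal Z}\kappa$. Algebra $\mathscr B_{r,s}$ (with $\rho=q^n$) over $\mathcal Z$: generators $e_1,g_i$ ($1\le i<r$), $g_j^*$ ($1\le j<s$); relations $(g_i-q^{-1})(g_i+q)=0$ and braid relations for the $g_i$, the same for the $g_j^*$;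 $g_ig_j^*=g_j^*g_i$; $e_1$ commutes with $g_i,g_i^*$ for $i\neq1$; $e_1g_1e_1=q^{-n}e_1=e_1g_1^*e_1$; $e_1^2=[n]e_1$; $e_1g_1^{-1}g_1^*e_1g_1=e_1g_1^{-1}g_1^*e_1g_1^*$; $g_1e_1g_1^{-1}g_1^*e_1=g_1^*e_1g_1^{-1}g_1^*e_1$. It acts on $V^{r,s}$ on the right, commuting with $\mathbf U_{\mathcal Z}$: $v_{\mathbf i|\mathbf j}e_1=\delta_{i_1,j_1}q^{-n-1+2i_1}\sum_{k=1}^n v_{i_r}\otimes\cdots\otimes v_{i_2}\otimes v_k\otimes v_k^*\otimes v_{j_2}^*\otimes\cdots\otimes v_{j_s}^*$; $v_{\mathbf i|\mathbf j}g_k=q^{-1}v_{\mathbf i|\mathbf j}$ if $i_k=i_{k+1}$, $=v_{\mathbf is_k|\mathbf j}$ if $i_k>i_{k+1}$, $=v_{\mathbf is_k|\mathbf j}+(q^{-1}-q)v_{\mathbf i|\mathbf j}$ if $i_k<i_{k+1}$; $v_{\mathbf i|\mathbf j}g_k^*=q^{-1}v_{\mathbf i|\mathbf j}$ if $j_k=j_{k+1}$, $=v_{\mathbf i|\mathbf js_k^*}$ if $j_k>j_{k+1}$, $=v_{\mathbf i|\mathbf js_k^*}+(q^{-1}-q)v_{\mathbf i|\mathbf j}$ if $j_k<j_{k+1}$, where $s_k$ (resp. $s_k^*$) interchanges the entries with indices $k,k+1$. Combinatorics. $\Lambda_{r,s}=\{(f,\lambda):0\le f\le\min\{r,s\},\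 \lambda=(\lambda^{(1)},\lambda^{(2)}),\ \lambda^{(1)}\vdash r-f,\ \lambda^{(2)}\vdash s-f\}$; $\lambda'$ is the componentwise conjugate. $\tilde\lambda=\phi(f,\lambda)=(\lambda^{(1)}_1,\lambda^{(1)}_2,\dots,0,\dots,0,\dots,-\lambda^{(2)}_2,-\lambda^{(2)}_1)\in\mathbb Z^n$. For a bipartition $\nu\in\Lambda^+(r-f)\times\Lambda^+(s-f)$, where $\Lambda^+(m)$ is the set of partitions of $m$: $\nu^{(1)}$-tableaux have entries $f+1,\dots,r$, $\nu^{(2)}$-tableaux have entries $f+1,\dots,s$; $\mathfrak t^{\nu^{(i)}}$ has its entries increasing along successive rows; $\mathscr T^{std}(\nu)$ is the set of pairs $\mathfrak t=(\mathfrak t_1,\mathfrak t_2)$ of standard tableaux; permutations act on the right, $\mathfrak t^{\nu^{(i)}}d(\mathfrak t_i)=\mathfrak t_i$, $g_{d(\mathfrak t)}=g_{d(\mathfrak t_1)}g^*_{d(\mathfrak t_2)}$, with $g_w=g_{i_1}\cdots g_{i_k}$ for reduced $w=s_{i_1}\cdots s_{i_k}$. $\mathfrak n_\nu=\mathfrak n_{\nu^{(1)}}\mathfrak n_{\nu^{(2)}}$ with $\mathfrak n_{\nu^{(1)}}=\sum_w(-q)^{\ell(w)}g_w$ over the row stabilizer of $\mathfrak t^{\nu^{(1)}}$, and $\mathfrak n_{\nu^{(2)}}$ analogous with $g_w^*$. For $i<j$: $s_{i,j}=s_i\cdots s_{j-1}$, $s_{i,i}=1$, $g_{i,j}=g_{s_{i,j}}$,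 similarly starred. $\mathscr D^f_{r,s}=\{s_{f,i_f}s^*_{f,j_f}\cdots s_{1,i_1}s^*_{1,j_1}:k\le j_k\le s,\ 1\le i_1<\cdots<i_f\le r\}$ and $g_d=g_{f,i_f}g^*_{f,j_f}\cdots g_{1,i_1}g^*_{1,j_1}$. Vectors. For $(f,\lambda)\in\Lambda_{r,s}$ write $\lambda'=(\alpha,\beta)$. Let $\mathbf i_\lambda=(\alpha_{r-f},\dots,2,1,\ \alpha_{r-f-1},\dots,2,1,\ \dots,\ \alpha_1,\dots,2,1)$ (blocks with $\alpha_k=0$ empty), $\mathbf j_\lambda=(n,n-1,\dots,n-\beta_1+1,\ \dots,\ n,n-1,\dots,n-\beta_{s-f}+1)$. Let $v_{\mathbf i_\lambda}$, $v^*_{\mathbf j_\lambda}$ be the tensor products, left to right, of the corresponding $v_i$, $v_j^*$. Let $v^1=\sum_{k=1}^nv_k\otimes v_k^*$, $v^f=\sum_{k=1}^nv_k\otimes v^{f-1}\otimes v_k^*$. Put $v_{f,\lambda}=v_{\mathbf i_\lambda}\otimes v^f\otimes v^*_{\mathbf j_\lambda}$ (and $v_{0,\lambda}=v_{\mathbf i_\lambda}\otimes v^*_{\mathbf j_\lambda}$), and $v_{\lambda,\mathfrak t,d}=v_{f,\lambda}\,\mathfrak n_{\lambda'}\,g_{d(\mathfrak t)}\,g_d\in V_\kappa^{r,s}$. *)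

theory Defs
  imports
    "HOL-Computational_Algebra.Polynomial"
    "HOL-Computational_Algebra.Fraction_Field"
    "HOL-Combinatorics.Permutations"
    "HOL-Library.Function_Algebras"
    "HOL-Library.FuncSet"
begin

section \<open>Ground rings\<close>

type_synonym Qq = "rat poly fract"

definition qq :: Qq where
  "qq = Fract [:0, 1:] 1"

text \<open>The subring of integral Laurent polynomials in the field of rational functions.\<close>

definition ZZq :: "Qq set" where
  "ZZq = {Fract (map_poly of_int p) ([:0, 1:] ^ k) | (p :: int poly) k. True}"

text \<open>
  A structure map making the field \<open>'k\<close> an algebra over \<^const>\<open>ZZq\<close>; the values of \<open>\<phi>\<close> outside
  \<^const>\<open>ZZq\<close> are irrelevant and never matter below.
\<close>

definition ZZq_algebra :: "(Qq \<Rightarrow> 'k::field) \<Rightarrow> bool" where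
  "ZZq_algebra \<phi> \<longleftrightarrow> \<phi> 1 = 1 \<and>
     (\<forall>a\<in>ZZq. \<forall>b\<in>ZZq. \<phi> (a + b) = \<phi> a + \<phi> b \<and> \<phi> (a * b) = \<phi> a * \<phi> b)"

definition qint :: "'a::field \<Rightarrow> nat \<Rightarrow> 'a" where
  "qint q m = (q ^ m - inverse q ^ m) / (q - inverse q)"

definition qfact :: "'a::field \<Rightarrow> nat \<Rightarrow> 'a" where
  "qfact q l = (\<Prod>m = 1..l. qint q m)"


section \<open>Tensors\<close>

text \<open>
  \<open>Vec j\<close> stands for $v_j$ and \<open>Dual j\<close> for $v_j^*$. A tensor is given by its coefficients on the
  pure tensors of basis vectors, which are written as words, read left to right.
\<close>

datatype letter = Vec nat | Dual nat

type_synonym 'a tensor = "letter list \<Rightarrow> 'a"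

definition bas :: "letter list \<Rightarrow> 'a::zero_neq_one tensor" where
  "bas w = (\<lambda>u. if u = w then 1 else 0)"

definition scl :: "'a::times \<Rightarrow> 'a tensor \<Rightarrow> 'a tensor"  (infixr "\<odot>" 75) where
  "c \<odot> x = (\<lambda>w. c * x w)"

definition tens :: "'a::comm_semiring_0 tensor \<Rightarrow> 'a tensor \<Rightarrow> 'a tensor"  (infixr "\<otimes>" 72) where
  "x \<otimes> y = (\<lambda>w. \<Sum>k\<le>length w. x (take k w) * y (drop k w))"

text \<open>
  The lists \<open>I\<close>, \<open>J\<close> hold $(i_1,\dots,i_r)$ and $(j_1,\dots,j_s)$; the tensor
  $v_{\mathbf i|\mathbf j}$ lists the $i$'s in the opposite order.
\<close>

definition multi_idx :: "nat \<Rightarrow> nat \<Rightarrow> nat \<Rightarrow> (nat list \<times> nat list) set" where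
  "multi_idx n r s =
     {(I, J). length I = r \<and> length J = s \<and> set I \<subseteq> {1..n} \<and> set J \<subseteq> {1..n}}"

definition mono_word :: "nat list \<Rightarrow> nat list \<Rightarrow> letter list" where
  "mono_word I J = map Vec (rev I) @ map Dual J"

definition mixed :: "nat \<Rightarrow> nat \<Rightarrow> nat \<Rightarrow> 'a::zero tensor set" where
  "mixed n r s =
     {x. \<forall>w. w \<notin> (\<lambda>(I, J). mono_word I J) ` multi_idx n r s \<longrightarrow> x w = 0}"

text \<open>The linear map on the mixed tensor space with the given images of basis vectors.\<close>

definition lin_ext ::
  "nat \<Rightarrow> nat \<Rightarrow> nat \<Rightarrow> (nat list \<Rightarrow> nat list \<Rightarrow> 'a tensor) \<Rightarrow> 'a tensor \<Rightarrow> 'a::field tensor" where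
  "lin_ext n r s T x = (\<Sum>(I, J)\<in>multi_idx n r s. x (mono_word I J) \<odot> T I J)"

definition lattice :: "nat \<Rightarrow> nat \<Rightarrow> nat \<Rightarrow> Qq tensor set" where
  "lattice n r s = {m \<in> mixed n r s. range m \<subseteq> ZZq}"


section \<open>Action of the quantum group\<close>

text \<open>An element $h = \sum_j c_j h_j$ is given by its coefficient function \<open>c\<close>.\<close>

fun qh_letter :: "'a::field \<Rightarrow> (nat \<Rightarrow> int) \<Rightarrow> letter \<Rightarrow> 'a tensor" where
  "qh_letter q c (Vec j) = (q powi c j) \<odot> bas [Vec j]"
| "qh_letter q c (Dual j) = (q powi (- c j)) \<odot> bas [Dual j]"

fun E_letter :: "'a::field \<Rightarrow> nat \<Rightarrow> letter \<Rightarrow> 'a tensor" where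
  "E_letter q i (Vec j) = (if j = i + 1 then bas [Vec i] else 0)"
| "E_letter q i (Dual j) = (if j = i then (- inverse q) \<odot> bas [Dual (i + 1)] else 0)"

definition alpha_check :: "nat \<Rightarrow> nat \<Rightarrow> int" where
  "alpha_check i = (\<lambda>j. (if j = i then 1 else 0) - (if j = i + 1 then 1 else 0))"

text \<open>
  Action on pure tensors by iterating $\Delta(q^h) = q^h \otimes q^h$ and
  $\Delta(E_i) = E_i \otimes K_i^{-1} + 1 \otimes E_i$; the empty word carries the counit.
\<close>

fun qh_word :: "'a::field \<Rightarrow> (nat \<Rightarrow> int) \<Rightarrow> letter list \<Rightarrow> 'a tensor" where
  "qh_word q c [] = bas []"
| "qh_word q c (x # w) = qh_letter q c x \<otimes> qh_word q c w"

fun E_word :: "'a::field \<Rightarrow> nat \<Rightarrow> letter list \<Rightarrow> 'a tensor" where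
  "E_word q i [] = 0"
| "E_word q i (x # w) =
     E_letter q i x \<otimes> qh_word q (- alpha_check i) w + bas [x] \<otimes> E_word q i w"

definition qh_act ::
  "'a::field \<Rightarrow> nat \<Rightarrow> nat \<Rightarrow> nat \<Rightarrow> (nat \<Rightarrow> int) \<Rightarrow> 'a tensor \<Rightarrow> 'a tensor" where
  "qh_act q n r s c = lin_ext n r s (\<lambda>I J. qh_word q c (mono_word I J))"

definition E_act :: "'a::field \<Rightarrow> nat \<Rightarrow> nat \<Rightarrow> nat \<Rightarrow> nat \<Rightarrow> 'a tensor \<Rightarrow> 'a tensor" where
  "E_act q n r s i = lin_ext n r s (\<lambda>I J. E_word q i (mono_word I J))"

definition E_div :: "nat \<Rightarrow> nat \<Rightarrow> nat \<Rightarrow> nat \<Rightarrow> nat \<Rightarrow> Qq tensor \<Rightarrow> Qq tensor" where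
  "E_div n r s i l x = inverse (qfact qq l) \<odot> (E_act qq n r s i ^^ l) x"

text \<open>
  The divided powers preserve \<^const>\<open>lattice\<close>; over \<open>'k\<close> they act through the base change along
  \<open>\<phi>\<close> of their matrices. They cannot be computed inside \<open>'k\<close>, where quantum factorials may vanish.
\<close>

definition E_div_base ::
  "(Qq \<Rightarrow> 'k::field) \<Rightarrow> nat \<Rightarrow> nat \<Rightarrow> nat \<Rightarrow> nat \<Rightarrow> nat \<Rightarrow> 'k tensor \<Rightarrow> 'k tensor" where
  "E_div_base \<phi> n r s i l =
     lin_ext n r s (\<lambda>I J. \<phi> \<circ> E_div n r s i l (bas (mono_word I J)))"

text \<open>For \<open>\<mu>\<close> only the values at \<open>1, \<dots>, n\<close> matter.\<close>

definition weight_lattice :: "nat \<Rightarrow> nat \<Rightarrow> nat \<Rightarrow> (nat \<Rightarrow> int) \<Rightarrow> Qq tensor set" where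
  "weight_lattice n r s \<mu> = {m \<in> lattice n r s.
     \<forall>i\<in>{1..n}. qh_act qq n r s (\<lambda>j. if j = i then 1 else 0) m = (qq powi \<mu> i) \<odot> m}"

definition weight_space ::
  "(Qq \<Rightarrow> 'k::field) \<Rightarrow> nat \<Rightarrow> nat \<Rightarrow> nat \<Rightarrow> (nat \<Rightarrow> int) \<Rightarrow> 'k tensor set" where
  "weight_space \<phi> n r s \<mu> = module.span (\<odot>) ((\<lambda>m. \<phi> \<circ> m) ` weight_lattice n r s \<mu>)"

definition singular_vectors ::
  "(Qq \<Rightarrow> 'k::field) \<Rightarrow> nat \<Rightarrow> nat \<Rightarrow> nat \<Rightarrow> (nat \<Rightarrow> int) \<Rightarrow> 'k tensor set" where
  "singular_vectors \<phi> n r s \<mu> = {x \<in> weight_space \<phi> n r s \<mu>. x \<noteq> 0 \<and>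
     (\<forall>i\<in>{1..n}. \<forall>j\<in>{1..n}. i \<le> j \<longrightarrow> \<mu> j \<le> \<mu> i) \<and>
     (\<forall>i\<in>{1..<n}. \<forall>l>0. E_div_base \<phi> n r s i l x = 0)}"


section \<open>Right action of the generators $g_k$ and $g_k^*$\<close>

text \<open>Positions are one-based: \<open>swap_at k\<close> interchanges the entries with indices $k$ and $k+1$.\<close>

definition swap_at :: "nat \<Rightarrow> nat list \<Rightarrow> nat list" where
  "swap_at k I = I[k - 1 := I ! k, k := I ! (k - 1)]"

definition g_act :: "'a::field \<Rightarrow> nat \<Rightarrow> nat \<Rightarrow> nat \<Rightarrow> nat \<Rightarrow> 'a tensor \<Rightarrow> 'a tensor" where
  "g_act q n r s k = lin_ext n r s (\<lambda>I J.
     let a = I ! (k - 1); b = I ! k in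
     if a = b then inverse q \<odot> bas (mono_word I J)
     else if a > b then bas (mono_word (swap_at k I) J)
     else bas (mono_word (swap_at k I) J) + (inverse q - q) \<odot> bas (mono_word I J))"

definition gs_act :: "'a::field \<Rightarrow> nat \<Rightarrow> nat \<Rightarrow> nat \<Rightarrow> nat \<Rightarrow> 'a tensor \<Rightarrow> 'a tensor" where
  "gs_act q n r s k = lin_ext n r s (\<lambda>I J.
     let a = J ! (k - 1); b = J ! k in
     if a = b then inverse q \<odot> bas (mono_word I J)
     else if a > b then bas (mono_word I (swap_at k J))
     else bas (mono_word I (swap_at k J)) + (inverse q - q) \<odot> bas (mono_word I J))"

text \<open>
  Permutations act on the right, so the word $k_1 \dots k_l$ stands for the map applying
  $s_{k_1}$ first. Correspondingly $x g_{k_1} \cdots g_{k_l}$ is a \<^const>\<open>fold\<close> over the word.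
\<close>

definition perm_of :: "nat list \<Rightarrow> nat \<Rightarrow> nat" where
  "perm_of ks = fold (\<lambda>k. transpose k (Suc k)) ks"

definition perm_words :: "nat \<Rightarrow> (nat \<Rightarrow> nat) \<Rightarrow> nat list set" where
  "perm_words m w = {ks. set ks \<subseteq> {1..<m} \<and> perm_of ks = w}"

definition perm_len :: "nat \<Rightarrow> (nat \<Rightarrow> nat) \<Rightarrow> nat" where
  "perm_len m w = (LEAST l. \<exists>ks\<in>perm_words m w. length ks = l)"

definition reduced_words :: "nat \<Rightarrow> (nat \<Rightarrow> nat) \<Rightarrow> nat list set" where
  "reduced_words m w = {ks \<in> perm_words m w. length ks = perm_len m w}"

text \<open>
  The action of $g_w$ for $w$ in the symmetric group on \<open>{1..m}\<close>, where \<open>G k\<close> is the action of the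
  \<open>k\<close>-th generator. By the braid relations the chosen reduced word does not matter.
\<close>

definition gw_act ::
  "(nat \<Rightarrow> 'a tensor \<Rightarrow> 'a tensor) \<Rightarrow> nat \<Rightarrow> (nat \<Rightarrow> nat) \<Rightarrow> 'a tensor \<Rightarrow> 'a tensor" where
  "gw_act G m w = fold G (SOME ks. ks \<in> reduced_words m w)"


section \<open>Partitions and tableaux\<close>

text \<open>Parts are indexed from zero: \<open>p i\<close> is the $(i+1)$-st part.\<close>

definition partitions :: "nat \<Rightarrow> (nat \<Rightarrow> nat) set" where
  "partitions m = {p. antimono p \<and> finite {i. p i \<noteq> 0} \<and> (\<Sum>i | p i \<noteq> 0. p i) = m}"

definition conjugate :: "(nat \<Rightarrow> nat) \<Rightarrow> nat \<Rightarrow> nat" where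
  "conjugate p j = card {i. p i > j}"

definition bipart_conj :: "(nat \<Rightarrow> nat) \<times> (nat \<Rightarrow> nat) \<Rightarrow> (nat \<Rightarrow> nat) \<times> (nat \<Rightarrow> nat)" where
  "bipart_conj lam = (conjugate (fst lam), conjugate (snd lam))"

definition Lambda_rs :: "nat \<Rightarrow> nat \<Rightarrow> (nat \<times> (nat \<Rightarrow> nat) \<times> (nat \<Rightarrow> nat)) set" where
  "Lambda_rs r s =
     {(f, lam). f \<le> min r s \<and> fst lam \<in> partitions (r - f) \<and> snd lam \<in> partitions (s - f)}"

text \<open>
  For \<open>n \<ge> r + s\<close> at most one of the two terms is nonzero, so this is
  $(\lambda^{(1)}_1, \lambda^{(1)}_2, \dots, 0, \dots, 0, \dots, -\lambda^{(2)}_2, -\lambda^{(2)}_1)$.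
\<close>

definition tilde_weight :: "nat \<Rightarrow> (nat \<Rightarrow> nat) \<times> (nat \<Rightarrow> nat) \<Rightarrow> nat \<Rightarrow> int" where
  "tilde_weight n lam i = int (fst lam (i - 1)) - int (snd lam (n - i))"

definition diagram :: "(nat \<Rightarrow> nat) \<Rightarrow> (nat \<times> nat) set" where
  "diagram p = {(i, j). j < p i}"

text \<open>Standard tableaux of shape \<open>p\<close> with entries $f+1, \dots, m$.\<close>

definition std_tableaux :: "nat \<Rightarrow> nat \<Rightarrow> (nat \<Rightarrow> nat) \<Rightarrow> (nat \<times> nat \<Rightarrow> nat) set" where
  "std_tableaux f m p = {t \<in> extensional (diagram p). bij_betw t (diagram p) {f + 1..m} \<and>
     (\<forall>i j j'. j < j' \<and> j' < p i \<longrightarrow> t (i, j) < t (i, j')) \<and>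
     (\<forall>i i' j. i < i' \<and> j < p i' \<longrightarrow> t (i, j) < t (i', j))}"

definition row_tableau :: "nat \<Rightarrow> (nat \<Rightarrow> nat) \<Rightarrow> nat \<times> nat \<Rightarrow> nat" where
  "row_tableau f p = restrict (\<lambda>(i, j). f + (\<Sum>k<i. p k) + j + 1) (diagram p)"

definition std_bitableaux ::
  "nat \<Rightarrow> nat \<Rightarrow> nat \<Rightarrow> (nat \<Rightarrow> nat) \<times> (nat \<Rightarrow> nat) \<Rightarrow>
     ((nat \<times> nat \<Rightarrow> nat) \<times> (nat \<times> nat \<Rightarrow> nat)) set" where
  "std_bitableaux r s f nu = std_tableaux f r (fst nu) \<times> std_tableaux f s (snd nu)"

text \<open>The permutation $d(\mathfrak t)$ of $f+1, \dots, m$ with $\mathfrak t^p d(\mathfrak t) = \mathfrak t$.\<close>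

definition d_perm :: "nat \<Rightarrow> nat \<Rightarrow> (nat \<Rightarrow> nat) \<Rightarrow> (nat \<times> nat \<Rightarrow> nat) \<Rightarrow> nat \<Rightarrow> nat" where
  "d_perm f m p t =
     (THE w. w permutes {f + 1..m} \<and> (\<forall>b\<in>diagram p. w (row_tableau f p b) = t b))"

definition row_stabilizer :: "nat \<Rightarrow> nat \<Rightarrow> (nat \<Rightarrow> nat) \<Rightarrow> (nat \<Rightarrow> nat) set" where
  "row_stabilizer f m p = {w. w permutes {f + 1..m} \<and>
     (\<forall>i. w ` {row_tableau f p (i, j) | j. j < p i} = {row_tableau f p (i, j) | j. j < p i})}"

definition antisym_act ::
  "(nat \<Rightarrow> 'a tensor \<Rightarrow> 'a tensor) \<Rightarrow> 'a::field \<Rightarrow> nat \<Rightarrow> nat \<Rightarrow> (nat \<Rightarrow> nat) \<Rightarrow>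
     'a tensor \<Rightarrow> 'a tensor" where
  "antisym_act G q f m p x =
     (\<Sum>w\<in>row_stabilizer f m p. ((- q) ^ perm_len m w) \<odot> gw_act G m w x)"


section \<open>The set $\mathscr D^f_{r,s}$\<close>

definition s_perm :: "nat \<Rightarrow> nat \<Rightarrow> nat \<Rightarrow> nat" where
  "s_perm i j = perm_of [i..<j]"

text \<open>The index data $(i_1, \dots, i_f)$ and $(j_1, \dots, j_f)$.\<close>

definition D_data :: "nat \<Rightarrow> nat \<Rightarrow> nat \<Rightarrow> (nat list \<times> nat list) set" where
  "D_data r s f = {(I, J). length I = f \<and> length J = f \<and>
     sorted_wrt (<) I \<and> set I \<subseteq> {1..r} \<and> (\<forall>k\<in>{1..f}. J ! (k - 1) \<in> {k..s})}"

text \<open>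
  $s_{f,i_f} s^*_{f,j_f} \cdots s_{1,i_1} s^*_{1,j_1}$, as an element of the product of the two
  symmetric groups; in the right action the factors with subscript $f$ are applied first.
\<close>

definition D_perm :: "nat list \<times> nat list \<Rightarrow> (nat \<Rightarrow> nat) \<times> (nat \<Rightarrow> nat)" where
  "D_perm = (\<lambda>(I, J).
     (fold (\<lambda>k. s_perm k (I ! (k - 1))) (rev [1..<Suc (length I)]),
      fold (\<lambda>k. s_perm k (J ! (k - 1))) (rev [1..<Suc (length J)])))"

definition D_set :: "nat \<Rightarrow> nat \<Rightarrow> nat \<Rightarrow> ((nat \<Rightarrow> nat) \<times> (nat \<Rightarrow> nat)) set" where
  "D_set r s f = D_perm ` D_data r s f"

text \<open>
  $g_d = g_{f,i_f} g^*_{f,j_f} \cdots g_{1,i_1} g^*_{1,j_1}$; the index data are determined by $d$.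
\<close>

definition gd_act ::
  "'a::field \<Rightarrow> nat \<Rightarrow> nat \<Rightarrow> nat \<Rightarrow> nat \<Rightarrow> (nat \<Rightarrow> nat) \<times> (nat \<Rightarrow> nat) \<Rightarrow>
     'a tensor \<Rightarrow> 'a tensor" where
  "gd_act q n r s f d =
     (let (I, J) = (THE D. D \<in> D_data r s f \<and> D_perm D = d) in
      fold (\<lambda>k x. gw_act (gs_act q n r s) s (s_perm k (J ! (k - 1)))
                    (gw_act (g_act q n r s) r (s_perm k (I ! (k - 1))) x))
        (rev [1..<Suc f]))"


section \<open>The vectors $v_{\lambda,\mathfrak t,d}$\<close>

text \<open>
  The entries of \<open>i_lambda\<close> and \<open>j_lambda\<close> are listed in the left to right order of the tensor
  factors. Note that \<open>alpha k\<close> is the $(k+1)$-st part.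
\<close>

definition i_lambda :: "nat \<Rightarrow> (nat \<Rightarrow> nat) \<Rightarrow> nat list" where
  "i_lambda m alpha = concat (map (\<lambda>k. rev [1..<Suc (alpha k)]) (rev [0..<m]))"

definition j_lambda :: "nat \<Rightarrow> nat \<Rightarrow> (nat \<Rightarrow> nat) \<Rightarrow> nat list" where
  "j_lambda n m beta = concat (map (\<lambda>k. rev [n + 1 - beta k..<Suc n]) [0..<m])"

fun v_pow :: "nat \<Rightarrow> nat \<Rightarrow> 'a::field tensor" where
  "v_pow n 0 = bas []"
| "v_pow n (Suc f) = (\<Sum>k = 1..n. bas [Vec k] \<otimes> v_pow n f \<otimes> bas [Dual k])"

definition v_f_lambda ::
  "nat \<Rightarrow> nat \<Rightarrow> nat \<Rightarrow> nat \<Rightarrow> (nat \<Rightarrow> nat) \<times> (nat \<Rightarrow> nat) \<Rightarrow> 'a::field tensor" where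
  "v_f_lambda n r s f lam =
     bas (map Vec (i_lambda (r - f) (fst (bipart_conj lam)))) \<otimes> v_pow n f \<otimes>
     bas (map Dual (j_lambda n (s - f) (snd (bipart_conj lam))))"

text \<open>Here \<open>q\<close> is the image in the field of the indeterminate.\<close>

definition v_vec ::
  "'a::field \<Rightarrow> nat \<Rightarrow> nat \<Rightarrow> nat \<Rightarrow> nat \<Rightarrow> (nat \<Rightarrow> nat) \<times> (nat \<Rightarrow> nat) \<Rightarrow>
     (nat \<times> nat \<Rightarrow> nat) \<times> (nat \<times> nat \<Rightarrow> nat) \<Rightarrow> (nat \<Rightarrow> nat) \<times> (nat \<Rightarrow> nat) \<Rightarrow> 'a tensor" where
  "v_vec q n r s f lam t d =
     (let G = g_act q n r s; Gs = gs_act q n r s; nu = bipart_conj lam;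
          x0 = v_f_lambda n r s f lam;
          x1 = antisym_act Gs q f s (snd nu) (antisym_act G q f r (fst nu) x0);
          x2 = gw_act Gs s (d_perm f s (snd nu) (snd t))
                 (gw_act G r (d_perm f r (fst nu) (fst t)) x1)
      in gd_act q n r s f d x2)"

definition S_set ::
  "'a::field \<Rightarrow> nat \<Rightarrow> nat \<Rightarrow> nat \<Rightarrow> nat \<Rightarrow> (nat \<Rightarrow> nat) \<times> (nat \<Rightarrow> nat) \<Rightarrow> 'a tensor set" where
  "S_set q n r s f lam =
     {v_vec q n r s f lam t d | t d. t \<in> std_bitableaux r s f (bipart_conj lam) \<and> d \<in> D_set r s f}"

text \<open>A linearly independent set spanning the subspace \<open>U\<close>.\<close>

definition is_basis_of :: "'k::field tensor set \<Rightarrow> 'k tensor set \<Rightarrow> bool" where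
  "is_basis_of S U \<longleftrightarrow> \<not> module.dependent (\<odot>) S \<and> module.span (\<odot>) S = U"

lemma vector_space_tensor: "vector_space ((\<odot>) :: 'k::field \<Rightarrow> 'k tensor \<Rightarrow> 'k tensor)"
  by unfold_locales (auto simp: scl_def fun_eq_iff algebra_simps)

end

theory Submission imports Defs begin

text \<open>
  A singular vector is determined by its coefficients at dominant words, those all of whose suffixes
  satisfy the weak inequalities of a dominant weight: otherwise it would have a component of negative
  weight killed by high divided powers of some \<open>E\<^sub>i\<close>. So the singular vectors of weight
  \<open>\<lambda>\<close> span a space of dimension at most the number of dominant words of that weight. Read
  from the right, such a word is a walk in Young's lattice of bipartitions: each of the \<open>s\<close> dual letters
  adds a box to the second component, and then each of the \<open>r\<close> vector letters adds a box to the first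
  component or, \<open>f\<close> times, removes one from the second. The relation \<open>DU - UD = 1\<close> of Young's lattice
  shows that there are at most as many walks as pairs \<open>(t, d)\<close>.

  Each vector \<open>v(t, d)\<close> is singular: \<open>E\<^sub>i\<close> commutes with the Hecke operators, kills \<open>v\<^sup>f\<close>, and
  produces from the initial word two equal neighbours in a row, which the antisymmetrizer kills. The
  vectors are independent over every field. Fill the caps with the letters \<open>r - f + 1, \<dots>, r\<close>, which
  occur nowhere else. Among the words with the resulting content, \<open>v(t, d)\<close> has a unique largest word
  in the dominance order, and \<open>t\<close> and \<open>d\<close> can be recovered from that word.
\<close>

section \<open>Reduced words in the symmetric group\<close>

text \<open>The obstacle is that \<open>\<phi> qq\<close> may be a root of unity: the mixed tensor
  space need not be semisimple then, quantum factorials may vanish, and E_i alone no longer detects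
  singular vectors. The upper and the lower bound for the dimension are therefore each obtained by
  an argument that works for every invertible q, and they meet numerically in the product of (r
  choose f), s (s - 1) ... (s - f + 1) and the number of bitableaux; spanning is a consequence of
  independence. For the upper bound the divided powers are rewritten as a recursion over the letters
  (\<open>eop\<close>) without denominators, which survives base change. Singularity is proved over
  the rational functions, where being killed by E_i is enough, and then transported by
  \<open>\<phi>\<close>. The hypothesis n >= r + s keeps the two partitions in disjoint ranges of
  coordinates and leaves the letters r - f + 1, ..., r free between the vector letters, at most r -
  f, and the dual letters, greater than r. Since \<open>gw_act\<close> folds over an unspecified
  reduced word, computations with it rest on Matsumoto's theorem.\<close>

definition inversions :: "(nat \<Rightarrow> nat) \<Rightarrow> (nat \<times> nat) set" where
  "inversions w = {(x, y). x < y \<and> w y < w x}"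

abbreviation simple_tr :: "nat \<Rightarrow> nat \<Rightarrow> nat" where
  "simple_tr k \<equiv> transpose k (Suc k)"

lemma simple_tr_cancel [simp]: "simple_tr k \<circ> (simple_tr k \<circ> w) = w"
  by (simp add: fun_eq_iff)

lemma perm_of_Nil [simp]: "perm_of [] = id"
  by (auto simp: perm_of_def)

lemma perm_of_snoc [simp]: "perm_of (ks @ [k]) = simple_tr k \<circ> perm_of ks"
  by (auto simp: perm_of_def)

lemma perm_of_Cons: "perm_of (k # ks) = perm_of ks \<circ> simple_tr k"
  by (auto simp: perm_of_def fun_eq_iff)

lemma simple_tr_permutes: "a \<le> k \<Longrightarrow> Suc k \<le> b \<Longrightarrow> simple_tr k permutes {a..b}"
  by (rule permutes_swap_id) auto

lemma perm_of_permutes: "set ks \<subseteq> {1..<m} \<Longrightarrow> perm_of ks permutes {1..m}"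
proof (induction ks rule: rev_induct)
  case (snoc k ks)
  then show ?case
    using permutes_compose[OF _ simple_tr_permutes[of 1 k m], of "perm_of ks"] by (simp add: comp_def)
qed (auto simp: permutes_id)

lemma inversions_subset:
  assumes w: "w permutes {a..b}"
  shows "inversions w \<subseteq> {a..b} \<times> {a..b}"
proof -
  have *: "w x \<in> {a..b} \<longleftrightarrow> x \<in> {a..b}" for x
    using w by (rule permutes_in_image)
  have **: "w x = x" if "x \<notin> {a..b}" for x
    using w that by (rule permutes_not_in)
  show ?thesis
  proof (clarsimp simp: inversions_def)
    fix x y assume xy: "x < y" "w y < w x"
    show "a \<le> x \<and> x \<le> b \<and> a \<le> y \<and> y \<le> b"
      using xy *[of x] *[of y] **[of x] **[of y] by (cases "x \<in> {a..b}"; cases "y \<in> {a..b}") auto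
  qed
qed

lemma finite_inversions: "w permutes {a..b::nat} \<Longrightarrow> finite (inversions w)"
  by (rule finite_subset[OF inversions_subset]) auto

lemma inversions_id [simp]: "inversions id = {}"
  by (auto simp: inversions_def)

text \<open>Without inversions both \<open>w\<close> and its inverse are strictly increasing, and a
  strictly increasing map of the natural numbers satisfies x <= w x; the two inequalities give w x =
  x.\<close>

lemma inversions_empty:
  assumes w: "w permutes {a..b}" and e: "inversions w = {}"
  shows "w = id"
proof -
  have "w x < w y" if "x < y" for x y
    using e that permutes_inj[OF w] unfolding inversions_def
    by (metis (mono_tags, lifting) case_prodI empty_iff inj_eq linorder_neqE_nat mem_Collect_eq order_less_irrefl)
  then have m: "strict_mono w" by (rule strict_monoI)
  have "inv w x < inv w y" if "x < y" for x y
    by (metis m permutes_inverses(1) strict_mono_less that w)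
  then have m': "strict_mono (inv w)" by (rule strict_monoI)
  have "w x = x" for x
    using strict_mono_imp_increasing[OF m, of x] strict_mono_imp_increasing[OF m', of "w x"]
    by (simp add: permutes_inverses[OF w])
  then show ?thesis by auto
qed

lemma simple_tr_less:
  "a < b \<Longrightarrow> simple_tr k b < simple_tr k a \<longleftrightarrow> a = k \<and> b = Suc k"
  by (auto simp: transpose_def)

text \<open>Composing with s_k on the left exchanges the values k and k + 1, so only the pair of
  positions carrying these two values changes its relative order.\<close>

lemma inversions_simple_tr:
  assumes w: "w permutes S" and l: "inv w k < inv w (Suc k)"
  shows "inversions (simple_tr k \<circ> w) = insert (inv w k, inv w (Suc k)) (inversions w)"
    and "(inv w k, inv w (Suc k)) \<notin> inversions w"
proof -
  have i: "inj w" by (rule permutes_inj[OF w])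
  have e: "w x = y \<longleftrightarrow> x = inv w y" for x y
    using permutes_inverses[OF w] by auto
  show "(inv w k, inv w (Suc k)) \<notin> inversions w"
    by (simp add: inversions_def permutes_inverses[OF w])
  have "(x, y) \<in> inversions (simple_tr k \<circ> w) \<longleftrightarrow> (x, y) = (inv w k, inv w (Suc k)) \<or> (x, y) \<in> inversions w" for x y
  proof (cases "x < y")
    case True
    consider "w x < w y" | "w y < w x"
      using i True by (metis inj_eq linorder_neqE_nat order_less_irrefl)
    then show ?thesis
    proof cases
      case 1
      then show ?thesis
        using True simple_tr_less[OF 1, of k] by (auto simp: inversions_def e)
    next
      case 2
      have "\<not> simple_tr k (w x) < simple_tr k (w y)"
        using simple_tr_less[OF 2, of k] l True by (auto simp: e)
      moreover have "simple_tr k (w x) \<noteq> simple_tr k (w y)"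
        using 2 by (metis order_less_irrefl transpose_eq_imp_eq)
      ultimately show ?thesis
        using True 2 by (auto simp: inversions_def)
    qed
  next
    case False
    then show ?thesis using l by (auto simp: inversions_def)
  qed
  then show "inversions (simple_tr k \<circ> w) = insert (inv w k, inv w (Suc k)) (inversions w)"
    by auto
qed

lemma inv_simple_tr_comp:
  assumes "w permutes S"
  shows "inv (simple_tr k \<circ> w) x = inv w (simple_tr k x)"
  using assms by (simp add: o_inv_distrib permutes_bij)

lemma card_inversions_up:
  assumes "w permutes {a..b}" "inv w k < inv w (Suc k)"
  shows "card (inversions (simple_tr k \<circ> w)) = Suc (card (inversions w))"
  using inversions_simple_tr[OF assms] finite_inversions[OF assms(1)] by simp

lemma card_inversions_down:
  assumes w: "w permutes {a..b}" and k: "a \<le> k" "Suc k \<le> b" "inv w (Suc k) < inv w k"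
  shows "card (inversions w) = Suc (card (inversions (simple_tr k \<circ> w)))"
proof -
  have w': "simple_tr k \<circ> w permutes {a..b}"
    using w k by (auto intro!: permutes_compose simple_tr_permutes)
  have "card (inversions (simple_tr k \<circ> (simple_tr k \<circ> w))) = Suc (card (inversions (simple_tr k \<circ> w)))"
    using w' by (rule card_inversions_up) (use k in \<open>auto simp: inv_simple_tr_comp[OF w]\<close>)
  then show ?thesis by simp
qed

lemma inv_neq:
  assumes "w permutes S" "x \<noteq> y" shows "inv w x \<noteq> inv w y"
  using assms by (metis permutes_inverses(1))

lemma card_inversions_le:
  "set ks \<subseteq> {1..<m} \<Longrightarrow> card (inversions (perm_of ks)) \<le> length ks"
proof (induction ks rule: rev_induct)
  case (snoc k ks)
  have p: "perm_of ks permutes {1..m}" using snoc by (intro perm_of_permutes) auto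
  show ?case
    using card_inversions_up[OF p, of k] card_inversions_down[OF p, of k] inv_neq[OF p, of k "Suc k"] snoc
    by (cases "inv (perm_of ks) k < inv (perm_of ks) (Suc k)") (auto simp: comp_def)
qed auto

text \<open>Reducedness is expressed through the number of inversions, which is easy to follow
  letter by letter, instead of the minimum in \<open>perm_len\<close>;
  \<open>reduced_words_eq\<close> shows that both agree.\<close>

definition rword :: "nat \<Rightarrow> nat list \<Rightarrow> bool" where
  "rword m ks \<longleftrightarrow> set ks \<subseteq> {1..<m} \<and> length ks = card (inversions (perm_of ks))"

lemma rword_Nil [simp]: "rword m []"
  by (simp add: rword_def)

lemma rword_snoc:
  "rword m (ks @ [k]) \<longleftrightarrow>
     k \<in> {1..<m} \<and> rword m ks \<and> inv (perm_of ks) k < inv (perm_of ks) (Suc k)"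
  (is "?L \<longleftrightarrow> ?R")
proof (cases "set ks \<subseteq> {1..<m} \<and> k \<in> {1..<m}")
  case True
  then have p: "perm_of ks permutes {1..m}" by (intro perm_of_permutes) auto
  show ?thesis
    using card_inversions_up[OF p, of k] card_inversions_down[OF p, of k] inv_neq[OF p, of k "Suc k"] True
      card_inversions_le[of ks m]
    by (cases "inv (perm_of ks) k < inv (perm_of ks) (Suc k)") (auto simp: rword_def)
qed (auto simp: rword_def)

text \<open>For an inversion (x, y) the values w y < w x have preimages y > x, so somewhere between
  w y and w x the inverse of \<open>w\<close> must drop from one value to the next.\<close>

lemma exists_descent:
  assumes w: "w permutes {a..b}" and "w \<noteq> id"
  obtains k where "a \<le> k" "k < b" "inv w (Suc k) < inv w k"
proof -
  have "inversions w \<noteq> {}"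
    using inversions_empty[OF w] assms(2) by blast
  then obtain x y where xy: "(x, y) \<in> inversions w"
    by auto
  then have l: "x < y" "w y < w x" and ab: "x \<in> {a..b}" "y \<in> {a..b}"
    using inversions_subset[OF w] by (auto simp: inversions_def)
  have wab: "w x \<in> {a..b}" "w y \<in> {a..b}" using ab permutes_in_image[OF w] by blast+
  have "\<exists>k\<in>{w y..<w x}. inv w (Suc k) < inv w k"
  proof (rule ccontr)
    assume n: "\<not> ?thesis"
    have "inv w (w y) \<le> inv w z" if "w y \<le> z" "z \<le> w x" for z
      using that
    proof (induction z rule: dec_induct)
      case (step z)
      then show ?case using n by (auto simp: not_less intro: order_trans)
    qed simp
    from this[of "w x"] l show False by (simp add: permutes_inverses[OF w])
  qed
  then obtain k where "w y \<le> k" "k < w x" "inv w (Suc k) < inv w k" by auto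
  then show ?thesis using that[of k] wab by simp
qed

lemma ex_rword:
  "w permutes {1..m} \<Longrightarrow> \<exists>ks. rword m ks \<and> perm_of ks = w"
proof (induction "card (inversions w)" arbitrary: w)
  case 0
  then have "w = id" using inversions_empty finite_inversions by fastforce
  then show ?case by (auto intro!: exI[of _ "[]"])
next
  case (Suc c)
  then have "w \<noteq> id" by auto
  then obtain k where k: "1 \<le> k" "k < m" "inv w (Suc k) < inv w k"
    using exists_descent[OF Suc.prems] by blast
  have p: "simple_tr k \<circ> w permutes {1..m}"
    using Suc.prems k by (auto intro!: permutes_compose simple_tr_permutes)
  have "card (inversions w) = Suc (card (inversions (simple_tr k \<circ> w)))"
    using card_inversions_down[OF Suc.prems, of k] k by auto
  then obtain ks where ks: "rword m ks" "perm_of ks = simple_tr k \<circ> w"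
    using Suc.hyps p by force
  have "rword m (ks @ [k])"
    using ks k by (auto simp: rword_snoc inv_simple_tr_comp[OF Suc.prems])
  moreover have "perm_of (ks @ [k]) = w"
    using ks by simp
  ultimately show ?case by blast
qed

lemma perm_len_eq:
  assumes w: "w permutes {1..m}"
  shows "perm_len m w = card (inversions w)"
proof -
  obtain ks where ks: "rword m ks" "perm_of ks = w" using ex_rword[OF w] by blast
  show ?thesis
    unfolding perm_len_def
  proof (rule Least_equality)
    show "\<exists>ks\<in>perm_words m w. length ks = card (inversions w)"
      using ks by (intro bexI[of _ ks]) (auto simp: rword_def perm_words_def)
    show "card (inversions w) \<le> l" if "\<exists>ks\<in>perm_words m w. length ks = l" for l
      using that card_inversions_le[of _ m] by (auto simp: perm_words_def)
  qed
qed

lemma reduced_words_eq: "w permutes {1..m} \<Longrightarrow> reduced_words m w = {ks. rword m ks \<and> perm_of ks = w}"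
  by (auto simp: reduced_words_def perm_words_def perm_len_eq rword_def)

lemma some_reduced:
  assumes w: "w permutes {1..m}"
  shows "rword m (SOME ks. ks \<in> reduced_words m w) \<and> perm_of (SOME ks. ks \<in> reduced_words m w) = w"
proof -
  obtain ks where "ks \<in> reduced_words m w"
    using ex_rword[OF w] unfolding reduced_words_eq[OF w] by blast
  then have "(SOME ks. ks \<in> reduced_words m w) \<in> reduced_words m w"
    by (rule someI)
  then show ?thesis
    unfolding reduced_words_eq[OF w] by blast
qed

text \<open>Every letter of a reduced word adds one inversion and destroys none. So what is known
  about the inversions of the full permutation can be used at each intermediate stage, as in
  \<open>pact_rword_induct\<close>.\<close>

lemma rword_inversions_mono:
  assumes "rword m (ks @ ls)"
  shows "rword m ks \<and> inversions (perm_of ks) \<subseteq> inversions (perm_of (ks @ ls))"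
  using assms
proof (induction ls rule: rev_induct)
  case (snoc l ls)
  have r: "rword m (ks @ ls)" "l \<in> {1..<m}" "inv (perm_of (ks @ ls)) l < inv (perm_of (ks @ ls)) (Suc l)"
    using snoc.prems rword_snoc[of m "ks @ ls" l] by simp_all
  have "perm_of (ks @ ls) permutes {1..m}"
    using r(1) unfolding rword_def by (intro perm_of_permutes) simp
  from inversions_simple_tr(1)[OF this r(3)] snoc.IH[OF r(1)]
  show ?case
    unfolding append_assoc[symmetric] perm_of_snoc by blast
qed simp

lemma rword_snoc_inversion:
  assumes "rword m (ks @ [k])"
  shows "(inv (perm_of ks) k, inv (perm_of ks) (Suc k)) \<in> inversions (perm_of (ks @ [k]))"
proof -
  have r: "rword m ks" "inv (perm_of ks) k < inv (perm_of ks) (Suc k)"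
    using assms by (simp_all add: rword_snoc)
  have "perm_of ks permutes {1..m}"
    using r(1) unfolding rword_def by (intro perm_of_permutes) simp
  from inversions_simple_tr(1)[OF this r(2)] show ?thesis
    unfolding perm_of_snoc by blast
qed

lemma rword_extend:
  assumes w: "w permutes {1..m}" and k: "k \<in> {1..<m}" "inv w (Suc k) < inv w k"
    and ks: "rword m ks" "perm_of ks = simple_tr k \<circ> w"
  shows "rword m (ks @ [k]) \<and> perm_of (ks @ [k]) = w"
  unfolding rword_snoc perm_of_snoc ks(2) inv_simple_tr_comp[OF w] using ks(1) k by simp

text \<open>Matsumoto's theorem for the symmetric group.\<close>

lemma fold_rword_cong:
  fixes G :: "nat \<Rightarrow> 'b \<Rightarrow> 'b"
  assumes X: "\<And>k x. k \<in> {1..<m} \<Longrightarrow> x \<in> X \<Longrightarrow> G k x \<in> X"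
    and comm: "\<And>j k x. j \<in> {1..<m} \<Longrightarrow> k \<in> {1..<m} \<Longrightarrow> Suc j < k \<Longrightarrow> x \<in> X \<Longrightarrow> G j (G k x) = G k (G j x)"
    and braid: "\<And>k x. k \<in> {1..<m} \<Longrightarrow> Suc k \<in> {1..<m} \<Longrightarrow> x \<in> X \<Longrightarrow>
      G k (G (Suc k) (G k x)) = G (Suc k) (G k (G (Suc k) x))"
    and "rword m ks" "rword m ls" "perm_of ks = perm_of ls" "x \<in> X"
  shows "fold G ks x = fold G ls x"
  using assms(4-6)
proof (induction "length ks" arbitrary: ks ls rule: less_induct)
  case less
  have fX: "fold G as x \<in> X" if "set as \<subseteq> {1..<m}" for as
    using that
  proof (induction as rule: rev_induct)
    case Nil
    show ?case using \<open>x \<in> X\<close> by simp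
  next
    case (snoc a as)
    then have "fold G as x \<in> X" "a \<in> {1..<m}" by simp_all
    then show ?case using X[of a "fold G as x"] by simp
  qed
  have len: "length ks = length ls" using less.prems unfolding rword_def by argo
  show ?case
  proof (cases ks rule: rev_cases)
    case Nil
    then show ?thesis using len by simp
  next
    case (snoc as k)
    then obtain bs j where ls: "ls = bs @ [j]" using len by (cases ls rule: rev_cases) auto
    define w where "w = perm_of ks"
    have w: "w permutes {1..m}" unfolding w_def using less.prems(1) by (intro perm_of_permutes) (simp add: rword_def)
    have IH: "fold G cs x = fold G ds x"
      if "rword m cs" "rword m ds" "perm_of cs = perm_of ds" "length cs < length ks" for cs ds
      using less.hyps that by blast
    have as: "rword m as" "k \<in> {1..<m}" "w = simple_tr k \<circ> perm_of as"
      using less.prems(1) unfolding w_def snoc rword_snoc perm_of_snoc by blast+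
    have bs: "rword m bs" "j \<in> {1..<m}" "w = simple_tr j \<circ> perm_of bs"
      using less.prems(2) unfolding w_def less.prems(3) ls rword_snoc perm_of_snoc by blast+
    have as': "perm_of as = simple_tr k \<circ> w"
      unfolding as(3) by simp
    have bs': "perm_of bs = simple_tr j \<circ> w"
      unfolding bs(3) by simp
    have dk: "inv w (Suc k) < inv w k" and dj: "inv w (Suc j) < inv w j"
      using less.prems(1,2) unfolding snoc ls rword_snoc as' bs' inv_simple_tr_comp[OF w] by simp_all
    have sp: "simple_tr i \<circ> u permutes {1..m}" if "i \<in> {1..<m}" "u permutes {1..m}" for i u
      using that by (auto intro!: permutes_compose simple_tr_permutes)
    \<comment> \<open>Both last letters are descents of \<open>w\<close>. If they differ,
      \<open>w\<close> has reduced words that start with a common \<open>cs\<close> and end in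
      either alternating product of s_k and s_j of length 2 or 3; the induction hypothesis links
      them to the two given words, and one commutation or braid relation links them to each
      other.\<close>
    consider "k = j" | "Suc k < j \<or> Suc j < k" | "j = Suc k \<or> k = Suc j" by linarith
    then show ?thesis
    proof cases
      case 1
      then show ?thesis using IH[OF as(1) bs(1)] as' bs' by (simp add: snoc ls)
    next
      case 2
      define u where "u = simple_tr j \<circ> (simple_tr k \<circ> w)"
      have u2: "u = simple_tr k \<circ> (simple_tr j \<circ> w)"
        using 2 by (auto simp: u_def fun_eq_iff transpose_def)
      obtain cs where cs: "rword m cs" "perm_of cs = u"
        using ex_rword[of u m] sp[OF bs(2) sp[OF as(2) w]] unfolding u_def by blast
      have dj': "inv (simple_tr k \<circ> w) (Suc j) < inv (simple_tr k \<circ> w) j"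
        using 2 dj by (auto simp: inv_simple_tr_comp[OF w] transpose_def)
      have dk': "inv (simple_tr j \<circ> w) (Suc k) < inv (simple_tr j \<circ> w) k"
        using 2 dk by (auto simp: inv_simple_tr_comp[OF w] transpose_def)
      have 3: "rword m (cs @ [j]) \<and> perm_of (cs @ [j]) = simple_tr k \<circ> w"
        using rword_extend[OF sp[OF as(2) w] bs(2) dj' cs(1)] cs(2) unfolding u_def by blast
      have 4: "rword m (cs @ [k]) \<and> perm_of (cs @ [k]) = simple_tr j \<circ> w"
        using rword_extend[OF sp[OF bs(2) w] as(2) dk' cs(1)] cs(2) unfolding u2 by blast
      have "fold G as x = fold G (cs @ [j]) x" "fold G bs x = fold G (cs @ [k]) x"
        by (rule IH; use as(1) bs(1) as' bs' 3 4 len in \<open>simp add: snoc ls rword_def\<close>)+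
      moreover have "G k (G j (fold G cs x)) = G j (G k (fold G cs x))"
        using 2 comm[of k j "fold G cs x"] comm[of j k "fold G cs x"] as(2) bs(2) fX[of cs] cs(1) by (auto simp: rword_def)
      ultimately show ?thesis using snoc ls by simp
    next
      case 3
      have main: "fold G (as @ [k]) x = fold G (bs @ [Suc k]) x"
        if k: "k \<in> {1..<m}" "Suc k \<in> {1..<m}"
          and d: "inv w (Suc k) < inv w k" "inv w (Suc (Suc k)) < inv w (Suc k)"
          and a: "rword m as" "perm_of as = simple_tr k \<circ> w" "length as < length ks"
          and b: "rword m bs" "perm_of bs = simple_tr (Suc k) \<circ> w" "length bs < length ks"
        for k as bs
      proof -
        define u where "u = simple_tr k \<circ> (simple_tr (Suc k) \<circ> (simple_tr k \<circ> w))"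
        have u2: "u = simple_tr (Suc k) \<circ> (simple_tr k \<circ> (simple_tr (Suc k) \<circ> w))"
          by (auto simp: u_def fun_eq_iff transpose_def)
        obtain cs where cs: "rword m cs" "perm_of cs = u"
          using ex_rword[of u m] sp[OF k(1) sp[OF k(2) sp[OF k(1) w]]] unfolding u_def by blast
        have p1: "simple_tr k \<circ> w permutes {1..m}" "simple_tr (Suc k) \<circ> w permutes {1..m}"
          "simple_tr k \<circ> (simple_tr (Suc k) \<circ> w) permutes {1..m}"
          "simple_tr (Suc k) \<circ> (simple_tr k \<circ> w) permutes {1..m}"
          using sp w k by blast+
        have d1: "inv (simple_tr (Suc k) \<circ> (simple_tr k \<circ> w)) (Suc k) < inv (simple_tr (Suc k) \<circ> (simple_tr k \<circ> w)) k"
          "inv (simple_tr k \<circ> w) (Suc (Suc k)) < inv (simple_tr k \<circ> w) (Suc k)"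
          using d by (auto simp: inv_simple_tr_comp[OF p1(1)] inv_simple_tr_comp[OF w] transpose_def)
        have d2: "inv (simple_tr k \<circ> (simple_tr (Suc k) \<circ> w)) (Suc (Suc k)) < inv (simple_tr k \<circ> (simple_tr (Suc k) \<circ> w)) (Suc k)"
          "inv (simple_tr (Suc k) \<circ> w) (Suc k) < inv (simple_tr (Suc k) \<circ> w) k"
          using d by (auto simp: inv_simple_tr_comp[OF p1(2)] inv_simple_tr_comp[OF w] transpose_def)
        have "rword m (cs @ [k]) \<and> perm_of (cs @ [k]) = simple_tr (Suc k) \<circ> (simple_tr k \<circ> w)"
          using rword_extend[OF p1(4) k(1) d1(1) cs(1)] cs(2) unfolding u_def by blast
        then have a2: "rword m ((cs @ [k]) @ [Suc k]) \<and> perm_of ((cs @ [k]) @ [Suc k]) = simple_tr k \<circ> w"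
          using rword_extend[OF p1(1) k(2) d1(2)] by blast
        have A: "fold G as x = fold G ((cs @ [k]) @ [Suc k]) x"
          by (rule IH) (use a a2 in blast, use a2 in blast, use a a2 in argo, use a in blast)
        have "rword m (cs @ [Suc k]) \<and> perm_of (cs @ [Suc k]) = simple_tr k \<circ> (simple_tr (Suc k) \<circ> w)"
          using rword_extend[OF p1(3) k(2) d2(1) cs(1)] cs(2) unfolding u2 by blast
        then have b2: "rword m ((cs @ [Suc k]) @ [k]) \<and> perm_of ((cs @ [Suc k]) @ [k]) = simple_tr (Suc k) \<circ> w"
          using rword_extend[OF p1(2) k(1) d2(2)] by blast
        have B: "fold G bs x = fold G ((cs @ [Suc k]) @ [k]) x"
          by (rule IH) (use b b2 in blast, use b2 in blast, use b b2 in argo, use b in blast)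
        show ?thesis
          using A B braid[OF k, of "fold G cs x"] fX[of cs] cs(1) by (simp add: rword_def)
      qed
      from 3 show ?thesis
      proof
        assume "j = Suc k"
        with main[of k as bs] as(1,2) bs(1,2) as' bs' dk dj len show ?thesis by (simp add: snoc ls)
      next
        assume "k = Suc j"
        with main[of j bs as] as(1,2) bs(1,2) as' bs' dk dj len show ?thesis by (simp add: snoc ls)
      qed
    qed
  qed
qed

lemma gw_act_eq_fold:
  fixes G :: "nat \<Rightarrow> 'a tensor \<Rightarrow> 'a tensor"
  assumes "w permutes {1..m}"
    and "\<And>k x. k \<in> {1..<m} \<Longrightarrow> x \<in> X \<Longrightarrow> G k x \<in> X"
    and "\<And>j k x. j \<in> {1..<m} \<Longrightarrow> k \<in> {1..<m} \<Longrightarrow> Suc j < k \<Longrightarrow> x \<in> X \<Longrightarrow> G j (G k x) = G k (G j x)"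
    and "\<And>k x. k \<in> {1..<m} \<Longrightarrow> Suc k \<in> {1..<m} \<Longrightarrow> x \<in> X \<Longrightarrow>
      G k (G (Suc k) (G k x)) = G (Suc k) (G k (G (Suc k) x))"
    and "rword m ks" "perm_of ks = w" "x \<in> X"
  shows "gw_act G m w x = fold G ks x"
  unfolding gw_act_def
  using some_reduced[OF assms(1)] assms(5-7)
  by (intro fold_rword_cong[of m X G] assms(2-4)) blast+

section \<open>The Hecke operators in coordinates\<close>

interpretation tensor_vs: vector_space "(\<odot>) :: 'k::field \<Rightarrow> 'k tensor \<Rightarrow> 'k tensor"
  by (rule vector_space_tensor)

lemma tensor_sum_apply: "(\<Sum>a\<in>A. (f a :: 'b \<Rightarrow> 'k::comm_monoid_add)) w = (\<Sum>a\<in>A. f a w)"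
  by (induction A rule: infinite_finite_induct) auto

lemma scl_apply [simp]: "(c \<odot> x) w = c * x w"
  by (simp add: scl_def)

lemma bas_apply: "bas w u = (if u = w then 1 else 0)"
  by (simp add: bas_def)

lemma mono_word_inj_aux:
  "map Vec A @ map Dual B = map Vec A' @ map Dual B' \<Longrightarrow> A = A' \<and> B = B'"
proof (induction A arbitrary: A')
  case Nil
  then show ?case
    by (cases A'; cases B) (auto simp: inj_map_eq_map inj_on_def)
next
  case (Cons a A)
  then show ?case by (cases A'; cases B') auto
qed

lemma mono_word_eq_iff [simp]: "mono_word I J = mono_word I' J' \<longleftrightarrow> I = I' \<and> J = J'"
  using mono_word_inj_aux[of "rev I" J "rev I'" J'] by (auto simp: mono_word_def)

lemma finite_multi_idx: "finite (multi_idx n r s)"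
proof -
  have "multi_idx n r s \<subseteq> {I. set I \<subseteq> {1..n} \<and> length I = r} \<times> {J. set J \<subseteq> {1..n} \<and> length J = s}"
    by (auto simp: multi_idx_def)
  then show ?thesis
    by (rule finite_subset) (intro finite_cartesian_product finite_lists_length_eq finite_atLeastAtMost)
qed

lemma lin_ext_apply:
  "lin_ext n r s T x w = (\<Sum>(I, J)\<in>multi_idx n r s. x (mono_word I J) * T I J w)"
  by (simp add: lin_ext_def tensor_sum_apply case_prod_beta)

lemma mixed_zero: "x \<in> mixed n r s \<Longrightarrow> (I, J) \<notin> multi_idx n r s \<Longrightarrow> x (mono_word I J) = 0"
  unfolding mixed_def by force

lemma mixed_nonzero:
  assumes "x \<in> mixed n r s" "x w \<noteq> 0"
  obtains I J where "(I, J) \<in> multi_idx n r s" "w = mono_word I J"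
proof -
  have "w \<in> (\<lambda>(I, J). mono_word I J) ` multi_idx n r s"
    using assms unfolding mixed_def by blast
  then show ?thesis using that by auto
qed

lemma mixed_eqI:
  assumes "x \<in> mixed n r s" "y \<in> mixed n r s"
    and "\<And>I J. (I, J) \<in> multi_idx n r s \<Longrightarrow> x (mono_word I J) = y (mono_word I J)"
  shows "x = y"
proof
  fix w show "x w = y w"
    using assms mixed_nonzero[of x n r s w] mixed_nonzero[of y n r s w] by metis
qed

lemma bas_mixed: "(I, J) \<in> multi_idx n r s \<Longrightarrow> (bas (mono_word I J) :: 'a::zero_neq_one tensor) \<in> mixed n r s"
  by (force simp: mixed_def bas_def)

lemma mixed_subspace: "tensor_vs.subspace (mixed n r s :: 'k::field tensor set)"
  unfolding tensor_vs.subspace_def by (auto simp: mixed_def)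

lemma mixed_add: "x \<in> mixed n r s \<Longrightarrow> y \<in> mixed n r s \<Longrightarrow> (x + y :: 'k::field tensor) \<in> mixed n r s"
  by (simp add: mixed_def)

lemma mixed_scl: "x \<in> mixed n r s \<Longrightarrow> (c \<odot> x :: 'k::field tensor) \<in> mixed n r s"
  by (simp add: mixed_def)

lemma mixed_sum: "(\<And>a. a \<in> A \<Longrightarrow> f a \<in> mixed n r s) \<Longrightarrow> (\<Sum>a\<in>A. f a :: 'k::field tensor) \<in> mixed n r s"
  by (simp add: mixed_def tensor_sum_apply)

lemma lin_ext_mixed:
  "(\<And>I J. (I, J) \<in> multi_idx n r s \<Longrightarrow> T I J \<in> mixed n r s) \<Longrightarrow> lin_ext n r s T x \<in> mixed n r s"
  unfolding lin_ext_def by (rule mixed_sum) (auto intro: mixed_scl)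

lemma mixed_expand:
  assumes "x \<in> mixed n r s"
  shows "x = lin_ext n r s (\<lambda>I J. bas (mono_word I J)) x"
proof (rule mixed_eqI[OF assms])
  show "lin_ext n r s (\<lambda>I J. bas (mono_word I J)) x \<in> mixed n r s"
    by (rule lin_ext_mixed) (rule bas_mixed)
  fix I J assume IJ: "(I, J) \<in> multi_idx n r s"
  have "(\<Sum>p\<in>multi_idx n r s. case p of (I', J') \<Rightarrow> x (mono_word I' J') * bas (mono_word I' J') (mono_word I J))
      = (\<Sum>p\<in>multi_idx n r s. if p = (I, J) then x (mono_word I J) else 0)"
    by (rule sum.cong) (auto simp: bas_apply split: if_splits)
  then show "x (mono_word I J) = lin_ext n r s (\<lambda>I J. bas (mono_word I J)) x (mono_word I J)"
    using IJ by (simp add: lin_ext_apply finite_multi_idx)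
qed

lemma length_swap_at [simp]: "length (swap_at k I) = length I"
  by (simp add: swap_at_def)

lemma swap_at_append:
  "swap_at (Suc (length xs)) (xs @ a # b # ys) = xs @ b # a # ys"
  by (simp add: swap_at_def nth_append list_update_append)

lemma split_at:
  assumes "1 \<le> k" "k < length I"
  obtains xs a b ys where "I = xs @ a # b # ys" "k = Suc (length xs)"
proof
  show "I = take (k - 1) I @ I ! (k - 1) # I ! k # drop (Suc k) I"
    using assms by (metis Suc_pred' Cons_nth_drop_Suc append_take_drop_id less_imp_diff_less less_eq_Suc_le Suc_le_lessD One_nat_def)
  show "k = Suc (length (take (k - 1) I))" using assms by simp
qed

lemma swap_at_invol: "1 \<le> k \<Longrightarrow> k < length I \<Longrightarrow> swap_at k (swap_at k I) = I"
  by (erule (1) split_at) (simp add: swap_at_append)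

lemma mset_swap_at: "1 \<le> k \<Longrightarrow> k < length I \<Longrightarrow> mset (swap_at k I) = mset I"
  by (erule (1) split_at) (simp add: swap_at_append)

lemma set_swap_at: "1 \<le> k \<Longrightarrow> k < length I \<Longrightarrow> set (swap_at k I) = set I"
  by (metis mset_swap_at set_mset_mset)

lemma nth_swap_at:
  "1 \<le> k \<Longrightarrow> k < length I \<Longrightarrow> p < length I \<Longrightarrow> swap_at k I ! p = I ! (transpose (k - 1) k p)"
  by (auto simp: swap_at_def nth_list_update transpose_def)

text \<open>The matrix of g_k in the basis of words is symmetric, so coefficients transform by the
  same rule as basis vectors. With the other tensor part frozen, one operator serves both g_k and
  its starred version, and the relations become checks on at most four letters.\<close>

definition hop :: "'a::field \<Rightarrow> nat \<Rightarrow> (nat list \<Rightarrow> 'a) \<Rightarrow> nat list \<Rightarrow> 'a" where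
  "hop q k y I = (if I ! (k - 1) = I ! k then inverse q * y I
     else y (swap_at k I) + (if I ! (k - 1) < I ! k then (inverse q - q) * y I else 0))"

lemma hop_append:
  "hop q (Suc (length xs)) y (xs @ a # b # ys) = (if a = b then inverse q * y (xs @ a # b # ys)
     else y (xs @ b # a # ys) + (if a < b then (inverse q - q) * y (xs @ a # b # ys) else 0))"
  by (simp add: hop_def swap_at_append nth_append)

lemma hop_append2:
  "hop q (Suc (Suc (length xs))) y (xs @ a # b # c # ys) = (if b = c then inverse q * y (xs @ a # b # c # ys)
     else y (xs @ a # c # b # ys) + (if b < c then (inverse q - q) * y (xs @ a # b # c # ys) else 0))"
  using hop_append[of q "xs @ [a]" y b c ys] by simp

lemma hop_append3:
  "hop q (Suc (Suc (Suc (length xs + length ys)))) y (xs @ a # b # ys @ c # d # zs) =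
    (if c = d then inverse q * y (xs @ a # b # ys @ c # d # zs)
     else y (xs @ a # b # ys @ d # c # zs) + (if c < d then (inverse q - q) * y (xs @ a # b # ys @ c # d # zs) else 0))"
  using hop_append[of q "xs @ a # b # ys" y c d zs] by simp

lemma hop_quadratic:
  assumes "q \<noteq> 0" "1 \<le> k" "k < length I"
  shows "hop q k (hop q k y) I = (inverse q - q) * hop q k y I + y I"
  using assms(2,3)
proof (rule split_at)
  fix xs a b ys assume "I = xs @ a # b # ys" "k = Suc (length xs)"
  then show ?thesis
    using assms(1) by (cases a b rule: linorder_cases) (simp_all add: hop_append field_simps)
qed

lemma hop_braid:
  assumes "q \<noteq> 0" "1 \<le> k" "Suc k < length I"
  shows "hop q k (hop q (Suc k) (hop q k y)) I = hop q (Suc k) (hop q k (hop q (Suc k) y)) I"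
proof -
  have "k < length I" using assms by simp
  with \<open>1 \<le> k\<close> obtain xs a b zs where 1: "I = xs @ a # b # zs" "k = Suc (length xs)"
    by (rule split_at)
  then obtain c ys where 2: "zs = c # ys" using assms by (cases zs) auto
  show ?thesis
    unfolding 1 2 using assms(1)
    by (cases a b rule: linorder_cases; cases b c rule: linorder_cases; cases a c rule: linorder_cases)
      (simp_all add: hop_append hop_append2 field_simps)
qed

lemma hop_comm:
  assumes "1 \<le> j" "Suc j < k" "k < length I"
  shows "hop q j (hop q k y) I = hop q k (hop q j y) I"
proof -
  have "1 \<le> k" using assms by simp
  then obtain us c d zs where 1: "I = us @ c # d # zs" "k = Suc (length us)"
    using assms(3) by (rule split_at)
  have "j < length us" using assms 1 by simp
  with assms(1) obtain xs a b ys where 2: "us = xs @ a # b # ys" "j = Suc (length xs)"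
    by (rule split_at)
  show ?thesis
    unfolding 1 2 by (simp add: hop_append hop_append3 algebra_simps)
qed

lemma multi_idx_swap:
  assumes "(I, J) \<in> multi_idx n r s"
  shows "k \<in> {1..<r} \<Longrightarrow> (swap_at k I, J) \<in> multi_idx n r s"
    and "k \<in> {1..<s} \<Longrightarrow> (I, swap_at k J) \<in> multi_idx n r s"
  using assms by (auto simp: multi_idx_def set_swap_at)

lemma g_act_mixed: "k \<in> {1..<r} \<Longrightarrow> (g_act q n r s k x :: 'k::field tensor) \<in> mixed n r s"
  unfolding g_act_def
  by (rule lin_ext_mixed) (auto simp: Let_def intro!: bas_mixed mixed_add mixed_scl multi_idx_swap)

lemma gs_act_mixed: "k \<in> {1..<s} \<Longrightarrow> (gs_act q n r s k x :: 'k::field tensor) \<in> mixed n r s"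
  unfolding gs_act_def
  by (rule lin_ext_mixed) (auto simp: Let_def intro!: bas_mixed mixed_add mixed_scl multi_idx_swap)

lemma sum_two_delta:
  assumes "finite A" "a \<in> A" "b \<in> A"
  shows "(\<Sum>p\<in>A. (if p = a then F p else 0) + (if p = b then H p else 0)) = F a + (H b :: 'a::comm_monoid_add)"
  using assms by (simp add: sum.distrib)

text \<open>Only the basis vectors at \<open>I\<close> and \<open>swap_at k I\<close> contribute to
  the coefficient at \<open>I\<close>. For index pairs outside \<open>multi_idx\<close> both sides
  vanish, so the identity holds for all words.\<close>

lemma g_act_coeff:
  assumes x: "x \<in> mixed n r s" and k: "k \<in> {1..<r}"
  shows "g_act q n r s k x (mono_word I J) = hop q k (\<lambda>I. x (mono_word I J)) I"
proof (cases "(I, J) \<in> multi_idx n r s")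
  case True
  let ?T = "\<lambda>I' J'. (let a = I' ! (k - 1); b = I' ! k in
     if a = b then inverse q \<odot> bas (mono_word I' J')
     else if a > b then bas (mono_word (swap_at k I') J')
     else bas (mono_word (swap_at k I') J') + (inverse q - q) \<odot> bas (mono_word I' J'))"
  have sw: "swap_at k I' = I \<longleftrightarrow> I' = swap_at k I" if "(I', J') \<in> multi_idx n r s" for I' J'
  proof -
    have "swap_at k (swap_at k I) = I" "swap_at k (swap_at k I') = I'"
      using True that k by (auto simp: multi_idx_def intro!: swap_at_invol)
    then show ?thesis by metis
  qed
  have n: "swap_at k I ! (k - 1) = I ! k" "swap_at k I ! k = I ! (k - 1)"
    using True k by (auto simp: multi_idx_def nth_swap_at)
  then have ne: "I ! (k - 1) \<noteq> I ! k \<Longrightarrow> swap_at k I \<noteq> I" by auto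
  \<comment> \<open>If the two letters agree, both deltas sit at the same index; the factor 0 in the
    second summand then avoids counting it twice.\<close>
  have "g_act q n r s k x (mono_word I J) = (\<Sum>p\<in>multi_idx n r s.
     (if p = (I, J) then x (mono_word (fst p) (snd p)) * (if I ! (k - 1) = I ! k then inverse q else if I ! (k - 1) < I ! k then inverse q - q else 0) else 0)
   + (if p = (swap_at k I, J) then x (mono_word (fst p) (snd p)) * (if I ! (k - 1) = I ! k then 0 else 1) else 0))"
    unfolding g_act_def lin_ext_apply
  proof (rule sum.cong, simp, clarify)
    fix I' J' assume IJ': "(I', J') \<in> multi_idx n r s"
    show "x (mono_word I' J') * ?T I' J' (mono_word I J) =
     (if (I', J') = (I, J) then x (mono_word (fst (I', J')) (snd (I', J'))) * (if I ! (k - 1) = I ! k then inverse q else if I ! (k - 1) < I ! k then inverse q - q else 0) else 0)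
   + (if (I', J') = (swap_at k I, J) then x (mono_word (fst (I', J')) (snd (I', J'))) * (if I ! (k - 1) = I ! k then 0 else 1) else 0)"
    proof (cases "(I', J') = (I, J)")
      case True
      then have e: "I' = I" "J' = J" by simp_all
      show ?thesis
        unfolding e using ne by (cases "I ! (k - 1)" "I ! k" rule: linorder_cases) (simp_all add: Let_def bas_apply)
    next
      case F: False
      show ?thesis
      proof (cases "(I', J') = (swap_at k I, J)")
        case True
        then have e: "I' = swap_at k I" "J' = J" by simp_all
        show ?thesis
          using F sw[OF IJ'] ne n unfolding e by (cases "I ! (k - 1)" "I ! k" rule: linorder_cases) (simp_all add: Let_def bas_apply)
      next
        case False
        with F show ?thesis using sw[OF IJ'] by (cases "I' ! (k - 1)" "I' ! k" rule: linorder_cases) (auto simp: Let_def bas_apply)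
      qed
    qed
  qed
  also have "\<dots> = hop q k (\<lambda>I. x (mono_word I J)) I"
    using multi_idx_swap(1)[OF True k]
    by (subst sum_two_delta) (auto simp: finite_multi_idx True hop_def algebra_simps)
  finally show ?thesis .
next
  case False
  have "(swap_at k I, J) \<notin> multi_idx n r s"
  proof
    assume a: "(swap_at k I, J) \<in> multi_idx n r s"
    then have "swap_at k (swap_at k I) = I" using k by (intro swap_at_invol) (auto simp: multi_idx_def)
    with multi_idx_swap(1)[OF a k] False show False by simp
  qed
  then show ?thesis
    using False mixed_zero[OF x] mixed_zero[OF g_act_mixed[OF k]] by (simp add: hop_def)
qed

lemma gs_act_coeff:
  assumes x: "x \<in> mixed n r s" and k: "k \<in> {1..<s}"
  shows "gs_act q n r s k x (mono_word I J) = hop q k (\<lambda>J. x (mono_word I J)) J"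
proof (cases "(I, J) \<in> multi_idx n r s")
  case True
  let ?T = "\<lambda>I' J'. (let a = J' ! (k - 1); b = J' ! k in
     if a = b then inverse q \<odot> bas (mono_word I' J')
     else if a > b then bas (mono_word I' (swap_at k J'))
     else bas (mono_word I' (swap_at k J')) + (inverse q - q) \<odot> bas (mono_word I' J'))"
  have sw: "swap_at k J' = J \<longleftrightarrow> J' = swap_at k J" if "(I', J') \<in> multi_idx n r s" for I' J'
  proof -
    have "swap_at k (swap_at k J) = J" "swap_at k (swap_at k J') = J'"
      using True that k by (auto simp: multi_idx_def intro!: swap_at_invol)
    then show ?thesis by metis
  qed
  have n: "swap_at k J ! (k - 1) = J ! k" "swap_at k J ! k = J ! (k - 1)"
    using True k by (auto simp: multi_idx_def nth_swap_at)
  then have ne: "J ! (k - 1) \<noteq> J ! k \<Longrightarrow> swap_at k J \<noteq> J" by auto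
  have "gs_act q n r s k x (mono_word I J) = (\<Sum>p\<in>multi_idx n r s.
     (if p = (I, J) then x (mono_word (fst p) (snd p)) * (if J ! (k - 1) = J ! k then inverse q else if J ! (k - 1) < J ! k then inverse q - q else 0) else 0)
   + (if p = (I, swap_at k J) then x (mono_word (fst p) (snd p)) * (if J ! (k - 1) = J ! k then 0 else 1) else 0))"
    unfolding gs_act_def lin_ext_apply
  proof (rule sum.cong, simp, clarify)
    fix I' J' assume IJ': "(I', J') \<in> multi_idx n r s"
    show "x (mono_word I' J') * ?T I' J' (mono_word I J) =
     (if (I', J') = (I, J) then x (mono_word (fst (I', J')) (snd (I', J'))) * (if J ! (k - 1) = J ! k then inverse q else if J ! (k - 1) < J ! k then inverse q - q else 0) else 0)
   + (if (I', J') = (I, swap_at k J) then x (mono_word (fst (I', J')) (snd (I', J'))) * (if J ! (k - 1) = J ! k then 0 else 1) else 0)"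
    proof (cases "(I', J') = (I, J)")
      case True
      then have e: "I' = I" "J' = J" by simp_all
      show ?thesis
        unfolding e using ne by (cases "J ! (k - 1)" "J ! k" rule: linorder_cases) (simp_all add: Let_def bas_apply)
    next
      case F: False
      show ?thesis
      proof (cases "(I', J') = (I, swap_at k J)")
        case True
        then have e: "I' = I" "J' = swap_at k J" by simp_all
        show ?thesis
          using F sw[OF IJ'] ne n unfolding e by (cases "J ! (k - 1)" "J ! k" rule: linorder_cases) (simp_all add: Let_def bas_apply)
      next
        case False
        with F show ?thesis using sw[OF IJ'] by (cases "J' ! (k - 1)" "J' ! k" rule: linorder_cases) (auto simp: Let_def bas_apply)
      qed
    qed
  qed
  also have "\<dots> = hop q k (\<lambda>J. x (mono_word I J)) J"
    using multi_idx_swap(2)[OF True k]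
    by (subst sum_two_delta) (auto simp: finite_multi_idx True hop_def algebra_simps)
  finally show ?thesis .
next
  case False
  have "(I, swap_at k J) \<notin> multi_idx n r s"
  proof
    assume a: "(I, swap_at k J) \<in> multi_idx n r s"
    then have "swap_at k (swap_at k J) = J" using k by (intro swap_at_invol) (auto simp: multi_idx_def)
    with multi_idx_swap(2)[OF a k] False show False by simp
  qed
  then show ?thesis
    using False mixed_zero[OF x] mixed_zero[OF gs_act_mixed[OF k]] by (simp add: hop_def)
qed

lemmas tensor_apply = scl_apply plus_fun_apply zero_fun_apply

declare tensor_apply [simp del]

section \<open>Modules over the Hecke algebra and their antisymmetrizers\<close>

lemma card_inversions_inv:
  assumes w: "w permutes S"
  shows "card (inversions (inv w)) = card (inversions w)"
proof (rule bij_betw_same_card[symmetric])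
  have e: "inv w (w x) = x" "w (inv w x) = x" for x
    by (simp_all add: permutes_inverses[OF w])
  show "bij_betw (\<lambda>(x, y). (w y, w x)) (inversions w) (inversions (inv w))"
    by (rule bij_betw_byWitness[where f' = "\<lambda>(x, y). (inv w y, inv w x)"])
      (auto simp: inversions_def e)
qed

lemma card_inversions_right:
  assumes w: "w permutes {1..m}" and k: "k \<in> {1..<m}" and l: "w k < w (Suc k)"
  shows "card (inversions (w \<circ> simple_tr k)) = Suc (card (inversions w))"
proof -
  have s: "simple_tr k permutes {1..m}" using k by (intro simple_tr_permutes) auto
  have "inv (w \<circ> simple_tr k) = simple_tr k \<circ> inv w"
    using o_inv_distrib[OF permutes_bij[OF w] permutes_bij[OF s]] by simp
  moreover have "card (inversions (simple_tr k \<circ> inv w)) = Suc (card (inversions (inv w)))"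
    using permutes_inv[OF w] l permutes_inv_inv[OF w] by (intro card_inversions_up) auto
  ultimately show ?thesis
    using card_inversions_inv[OF w] card_inversions_inv[OF permutes_compose[OF s w]] by simp
qed

text \<open>The relations are demanded only on a subspace \<open>X\<close>: the generators, being
  \<open>lin_ext\<close> maps, ignore all coefficients outside the mixed tensor space, so the
  quadratic relation fails for general functions of words. Other choices of \<open>X\<close> are
  stable subspaces such as the kernel of E_i.\<close>

locale hecke_family =
  fixes q :: "'a::field" and m :: nat and X :: "'a tensor set" and G :: "nat \<Rightarrow> 'a tensor \<Rightarrow> 'a tensor"
  assumes q0: "q \<noteq> 0"
    and X: "tensor_vs.subspace X"
    and closed: "\<And>k x. k \<in> {1..<m} \<Longrightarrow> x \<in> X \<Longrightarrow> G k x \<in> X"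
    and G_add: "\<And>k x y. k \<in> {1..<m} \<Longrightarrow> x \<in> X \<Longrightarrow> y \<in> X \<Longrightarrow> G k (x + y) = G k x + G k y"
    and G_scl: "\<And>k c x. k \<in> {1..<m} \<Longrightarrow> x \<in> X \<Longrightarrow> G k (c \<odot> x) = c \<odot> G k x"
    and quad: "\<And>k x. k \<in> {1..<m} \<Longrightarrow> x \<in> X \<Longrightarrow> G k (G k x) = (inverse q - q) \<odot> G k x + x"
    and comm: "\<And>j k x. j \<in> {1..<m} \<Longrightarrow> k \<in> {1..<m} \<Longrightarrow> Suc j < k \<Longrightarrow> x \<in> X \<Longrightarrow>
      G j (G k x) = G k (G j x)"
    and braid: "\<And>k x. k \<in> {1..<m} \<Longrightarrow> Suc k \<in> {1..<m} \<Longrightarrow> x \<in> X \<Longrightarrow>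
      G k (G (Suc k) (G k x)) = G (Suc k) (G k (G (Suc k) x))"
begin

lemma fold_X: "set ks \<subseteq> {1..<m} \<Longrightarrow> x \<in> X \<Longrightarrow> fold G ks x \<in> X"
proof (induction ks arbitrary: x)
  case (Cons k ks)
  then show ?case using closed[of k x] by simp
qed simp

lemma fold_add: "set ks \<subseteq> {1..<m} \<Longrightarrow> x \<in> X \<Longrightarrow> y \<in> X \<Longrightarrow> fold G ks (x + y) = fold G ks x + fold G ks y"
proof (induction ks arbitrary: x y)
  case (Cons k ks)
  then show ?case using closed[of k x] closed[of k y] G_add[of k x y] by simp
qed simp

lemma fold_scl: "set ks \<subseteq> {1..<m} \<Longrightarrow> x \<in> X \<Longrightarrow> fold G ks (c \<odot> x) = c \<odot> fold G ks x"
proof (induction ks arbitrary: x)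
  case (Cons k ks)
  then show ?case using closed[of k x] G_scl[of k x c] by simp
qed simp

lemma gw_fold:
  assumes "rword m ks" "perm_of ks = w" "x \<in> X"
  shows "gw_act G m w x = fold G ks x"
proof -
  have "w permutes {1..m}"
    using assms(1,2) perm_of_permutes[of ks m] by (simp add: rword_def)
  from gw_act_eq_fold[where G = G and X = X, OF this closed comm braid assms] show ?thesis by blast
qed

lemma gw_rword:
  assumes "w permutes {1..m}"
  obtains ks where "rword m ks" "perm_of ks = w" "set ks \<subseteq> {1..<m}"
    "\<And>x. x \<in> X \<Longrightarrow> gw_act G m w x = fold G ks x"
proof -
  obtain ks where ks: "rword m ks" "perm_of ks = w" using ex_rword[OF assms] by blast
  moreover have "set ks \<subseteq> {1..<m}" using ks(1) by (simp add: rword_def)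
  ultimately show ?thesis using that gw_fold by blast
qed

lemma gw_X: "w permutes {1..m} \<Longrightarrow> x \<in> X \<Longrightarrow> gw_act G m w x \<in> X"
  by (metis gw_rword fold_X)

lemma gw_add: "w permutes {1..m} \<Longrightarrow> x \<in> X \<Longrightarrow> y \<in> X \<Longrightarrow>
    gw_act G m w (x + y) = gw_act G m w x + gw_act G m w y"
  by (metis gw_rword fold_add tensor_vs.subspace_add[OF X])

lemma gw_scl: "w permutes {1..m} \<Longrightarrow> x \<in> X \<Longrightarrow> gw_act G m w (c \<odot> x) = c \<odot> gw_act G m w x"
  by (metis gw_rword fold_scl tensor_vs.subspace_scale[OF X])

text \<open>The condition w k < w (k + 1) says that k followed by a reduced word of \<open>w\<close>
  is again reduced. The action is on the right, so the first letter acts first.\<close>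

lemma gw_G:
  assumes w: "w permutes {1..m}" and k: "k \<in> {1..<m}" and l: "w k < w (Suc k)" and x: "x \<in> X"
  shows "gw_act G m w (G k x) = gw_act G m (w \<circ> simple_tr k) x"
proof -
  obtain ks where ks: "rword m ks" "perm_of ks = w" using ex_rword[OF w] by blast
  have p: "perm_of (k # ks) = w \<circ> simple_tr k" using ks(2) by (simp add: perm_of_Cons)
  have "rword m (k # ks)"
    using ks k card_inversions_right[OF w k l] p by (simp add: rword_def)
  from gw_fold[OF this p x] gw_fold[OF ks closed[OF k x]] show ?thesis by simp
qed

definition antisym :: "(nat \<Rightarrow> nat) set \<Rightarrow> 'a tensor \<Rightarrow> 'a tensor" where
  "antisym St x = (\<Sum>w\<in>St. ((- q) ^ card (inversions w)) \<odot> gw_act G m w x)"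

context
  fixes St :: "(nat \<Rightarrow> nat) set"
  assumes St: "\<And>w. w \<in> St \<Longrightarrow> w permutes {1..m}"
begin

lemma antisym_X: "x \<in> X \<Longrightarrow> antisym St x \<in> X"
  unfolding antisym_def
  by (intro tensor_vs.subspace_sum[OF X] tensor_vs.subspace_scale[OF X] gw_X St)

lemma antisym_add: "x \<in> X \<Longrightarrow> y \<in> X \<Longrightarrow> antisym St (x + y) = antisym St x + antisym St y"
  unfolding antisym_def sum.distrib[symmetric]
  by (intro sum.cong refl) (simp only: gw_add St tensor_vs.scale_right_distrib)

lemma antisym_scl: "x \<in> X \<Longrightarrow> antisym St (c \<odot> x) = c \<odot> antisym St x"
  unfolding antisym_def tensor_vs.scale_sum_right
  by (intro sum.cong refl) (simp only: gw_scl St tensor_vs.scale_scale mult.commute)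

lemma antisym_zero: "antisym St 0 = 0"
  using antisym_scl[of 0 0] tensor_vs.subspace_0[OF X] by simp

lemma antisym_sum: "(\<And>a. a \<in> A \<Longrightarrow> g a \<in> X) \<Longrightarrow> antisym St (\<Sum>a\<in>A. g a) = (\<Sum>a\<in>A. antisym St (g a))"
proof (induction A rule: infinite_finite_induct)
  case (insert a A)
  then have "(\<Sum>a\<in>A. g a) \<in> X" by (intro tensor_vs.subspace_sum[OF X]) auto
  then show ?case using insert antisym_add[of "g a" "\<Sum>a\<in>A. g a"] by simp
qed (auto simp: antisym_zero)

context
  fixes k
  assumes k: "k \<in> {1..<m}" and St_k: "\<And>w. w \<in> St \<Longrightarrow> w \<circ> simple_tr k \<in> St" and fin: "finite St"
begin

text \<open>Pair the permutations \<open>w\<close> and \<open>w \<circ> simple_tr k\<close>, of which the second is the longer.\<close>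

lemma antisym_pairs:
  "antisym St x = (\<Sum>w\<in>{w\<in>St. w k < w (Suc k)}.
     ((- q) ^ card (inversions w)) \<odot> (gw_act G m w x + (- q) \<odot> gw_act G m (w \<circ> simple_tr k) x))"
proof -
  let ?A = "{w\<in>St. w k < w (Suc k)}" and ?B = "{w\<in>St. \<not> w k < w (Suc k)}"
  let ?F = "\<lambda>w. ((- q) ^ card (inversions w)) \<odot> gw_act G m w x"
  have ne: "w k \<noteq> w (Suc k)" if "w \<in> St" for w
    using permutes_inj[OF St[OF that]] by (metis inj_eq n_not_Suc_n)
  have cc: "(w \<circ> simple_tr k) \<circ> simple_tr k = w" for w
    by (simp add: fun_eq_iff)
  have "antisym St x = sum ?F ?A + sum ?F ?B"
    unfolding antisym_def by (subst sum.union_disjoint[symmetric]) (auto simp: fin intro!: sum.cong)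
  also have "sum ?F ?B = (\<Sum>w\<in>?A. ?F (w \<circ> simple_tr k))"
  proof (rule sum.reindex_bij_witness[where i = "\<lambda>w. w \<circ> simple_tr k" and j = "\<lambda>w. w \<circ> simple_tr k"])
    fix w assume w: "w \<in> ?B"
    show "w \<circ> simple_tr k \<circ> simple_tr k = w" by (rule cc)
    show "w \<circ> simple_tr k \<in> ?A" using w ne[of w] St_k[of w] by auto
    show "?F (w \<circ> simple_tr k \<circ> simple_tr k) = ?F w" unfolding cc ..
  next
    fix w assume w: "w \<in> ?A"
    show "w \<circ> simple_tr k \<circ> simple_tr k = w" by (rule cc)
    show "w \<circ> simple_tr k \<in> ?B" using w St_k[of w] by auto
  qed
  also have "sum ?F ?A + (\<Sum>w\<in>?A. ?F (w \<circ> simple_tr k)) = (\<Sum>w\<in>?A. ?F w + ?F (w \<circ> simple_tr k))"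
    by (simp add: sum.distrib)
  also have "\<dots> = (\<Sum>w\<in>?A. ((- q) ^ card (inversions w)) \<odot> (gw_act G m w x + (- q) \<odot> gw_act G m (w \<circ> simple_tr k) x))"
    using card_inversions_right[OF St k]
    by (intro sum.cong refl) (simp add: tensor_vs.scale_right_distrib tensor_vs.scale_right_diff_distrib mult.commute)
  finally show ?thesis .
qed

text \<open>On an eigenvector of g_k with eigenvalue 1/q each pair of terms carries the factor 1 +
  (-q)(1/q) = 0. Two equal neighbouring letters give such an eigenvector.\<close>

lemma antisym_kill:
  assumes x: "x \<in> X" and e: "G k x = inverse q \<odot> x"
  shows "antisym St x = 0"
  unfolding antisym_pairs
proof (rule sum.neutral, clarify)
  fix w assume w: "w \<in> St" "w k < w (Suc k)"
  have "gw_act G m (w \<circ> simple_tr k) x = gw_act G m w (G k x)"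
    using gw_G[OF St[OF w(1)] k w(2) x] by simp
  also have "\<dots> = inverse q \<odot> gw_act G m w x"
    unfolding e using gw_scl[OF St[OF w(1)] x] .
  finally have e': "gw_act G m (w \<circ> simple_tr k) x = inverse q \<odot> gw_act G m w x" .
  show "((- q) ^ card (inversions w)) \<odot> (gw_act G m w x + (- q) \<odot> gw_act G m (w \<circ> simple_tr k) x) = 0"
    unfolding e' using q0 by (simp add: fun_eq_iff tensor_apply)
qed

text \<open>By the quadratic relation each pair g_w - q g_ws, with s = s_k, is multiplied by -q when
  g_k is applied first.\<close>

lemma antisym_G:
  assumes x: "x \<in> X"
  shows "antisym St (G k x) = (- q) \<odot> antisym St x"
  unfolding antisym_pairs tensor_vs.scale_sum_right
proof (rule sum.cong[OF refl], clarify)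
  fix w assume w: "w \<in> St" "w k < w (Suc k)"
  note p = St[OF w(1)]
  note gX = closed[OF k x]
  have 1: "gw_act G m w (G k x) = gw_act G m (w \<circ> simple_tr k) x"
    using gw_G[OF p k w(2) x] .
  have "gw_act G m (w \<circ> simple_tr k) (G k x) = gw_act G m w (G k (G k x))"
    using gw_G[OF p k w(2) gX] by simp
  also have "\<dots> = (inverse q - q) \<odot> gw_act G m (w \<circ> simple_tr k) x + gw_act G m w x"
    unfolding quad[OF k x] using gw_add[OF p tensor_vs.subspace_scale[OF X gX] x] gw_scl[OF p gX] 1 by simp
  finally have 2: "gw_act G m (w \<circ> simple_tr k) (G k x) =
    (inverse q - q) \<odot> gw_act G m (w \<circ> simple_tr k) x + gw_act G m w x" .
  show "((- q) ^ card (inversions w)) \<odot> (gw_act G m w (G k x) + (- q) \<odot> gw_act G m (w \<circ> simple_tr k) (G k x)) =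
    (- q) \<odot> ((- q) ^ card (inversions w)) \<odot> (gw_act G m w x + (- q) \<odot> gw_act G m (w \<circ> simple_tr k) x)"
    unfolding 1 2 using q0 by (simp add: fun_eq_iff tensor_apply field_simps)
qed

end

end

end

lemma lin_ext_add: "lin_ext n r s T (x + y) = lin_ext n r s T x + lin_ext n r s T y"
  by (simp add: fun_eq_iff tensor_apply lin_ext_apply case_prod_beta algebra_simps sum.distrib)

lemma lin_ext_scl: "lin_ext n r s T (c \<odot> x) = c \<odot> lin_ext n r s T x"
  by (simp add: fun_eq_iff tensor_apply lin_ext_apply case_prod_beta sum_distrib_left mult.assoc)

lemma hecke_family_g:
  assumes "q \<noteq> 0"
  shows "hecke_family q r (mixed n r s) (g_act q n r s)"
proof
  show "q \<noteq> 0" by fact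
  show "tensor_vs.subspace (mixed n r s)" by (rule mixed_subspace)
  fix k and x :: "'a tensor" assume k: "k \<in> {1..<r}"
  note m = g_act_mixed[OF this]
  show "g_act q n r s k x \<in> mixed n r s" by (rule m)
  show "g_act q n r s k (x + y) = g_act q n r s k x + g_act q n r s k y" for y
    unfolding g_act_def by (rule lin_ext_add)
  show "g_act q n r s k (c \<odot> x) = c \<odot> g_act q n r s k x" for c
    unfolding g_act_def by (rule lin_ext_scl)
  assume x: "x \<in> mixed n r s"
  show "g_act q n r s k (g_act q n r s k x) = (inverse q - q) \<odot> g_act q n r s k x + x"
  proof (rule mixed_eqI)
    fix I J assume "(I, J) \<in> multi_idx n r s"
    then show "g_act q n r s k (g_act q n r s k x) (mono_word I J) = ((inverse q - q) \<odot> g_act q n r s k x + x) (mono_word I J)"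
      using k hop_quadratic[OF assms, of k I]
      by (simp add: tensor_apply g_act_coeff m x multi_idx_def)
  qed (auto intro: m mixed_add mixed_scl x)
  show "g_act q n r s j (g_act q n r s k x) = g_act q n r s k (g_act q n r s j x)"
    if "j \<in> {1..<r}" "Suc j < k" for j
  proof (rule mixed_eqI)
    fix I J assume "(I, J) \<in> multi_idx n r s"
    then show "g_act q n r s j (g_act q n r s k x) (mono_word I J) = g_act q n r s k (g_act q n r s j x) (mono_word I J)"
      using k that hop_comm[of j k I]
      by (simp add: g_act_coeff g_act_mixed x multi_idx_def)
  qed (auto intro: g_act_mixed that k)
  show "g_act q n r s k (g_act q n r s (Suc k) (g_act q n r s k x)) =
      g_act q n r s (Suc k) (g_act q n r s k (g_act q n r s (Suc k) x))" if "Suc k \<in> {1..<r}"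
  proof (rule mixed_eqI)
    fix I J assume "(I, J) \<in> multi_idx n r s"
    then show "g_act q n r s k (g_act q n r s (Suc k) (g_act q n r s k x)) (mono_word I J) =
      g_act q n r s (Suc k) (g_act q n r s k (g_act q n r s (Suc k) x)) (mono_word I J)"
      using k that hop_braid[OF assms, of k I]
      by (simp add: g_act_coeff g_act_mixed x multi_idx_def)
  qed (auto intro: g_act_mixed that k)
qed

lemma hecke_family_gs:
  assumes "q \<noteq> 0"
  shows "hecke_family q s (mixed n r s) (gs_act q n r s)"
proof
  show "q \<noteq> 0" by fact
  show "tensor_vs.subspace (mixed n r s)" by (rule mixed_subspace)
  fix k and x :: "'a tensor" assume k: "k \<in> {1..<s}"
  note m = gs_act_mixed[OF this]
  show "gs_act q n r s k x \<in> mixed n r s" by (rule m)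
  show "gs_act q n r s k (x + y) = gs_act q n r s k x + gs_act q n r s k y" for y
    unfolding gs_act_def by (rule lin_ext_add)
  show "gs_act q n r s k (c \<odot> x) = c \<odot> gs_act q n r s k x" for c
    unfolding gs_act_def by (rule lin_ext_scl)
  assume x: "x \<in> mixed n r s"
  show "gs_act q n r s k (gs_act q n r s k x) = (inverse q - q) \<odot> gs_act q n r s k x + x"
  proof (rule mixed_eqI)
    fix I J assume "(I, J) \<in> multi_idx n r s"
    then show "gs_act q n r s k (gs_act q n r s k x) (mono_word I J) = ((inverse q - q) \<odot> gs_act q n r s k x + x) (mono_word I J)"
      using k hop_quadratic[OF assms, of k J]
      by (simp add: tensor_apply gs_act_coeff m x multi_idx_def)
  qed (auto intro: m mixed_add mixed_scl x)
  show "gs_act q n r s j (gs_act q n r s k x) = gs_act q n r s k (gs_act q n r s j x)"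
    if "j \<in> {1..<s}" "Suc j < k" for j
  proof (rule mixed_eqI)
    fix I J assume "(I, J) \<in> multi_idx n r s"
    then show "gs_act q n r s j (gs_act q n r s k x) (mono_word I J) = gs_act q n r s k (gs_act q n r s j x) (mono_word I J)"
      using k that hop_comm[of j k J]
      by (simp add: gs_act_coeff gs_act_mixed x multi_idx_def)
  qed (auto intro: gs_act_mixed that k)
  show "gs_act q n r s k (gs_act q n r s (Suc k) (gs_act q n r s k x)) =
      gs_act q n r s (Suc k) (gs_act q n r s k (gs_act q n r s (Suc k) x))" if "Suc k \<in> {1..<s}"
  proof (rule mixed_eqI)
    fix I J assume "(I, J) \<in> multi_idx n r s"
    then show "gs_act q n r s k (gs_act q n r s (Suc k) (gs_act q n r s k x)) (mono_word I J) =
      gs_act q n r s (Suc k) (gs_act q n r s k (gs_act q n r s (Suc k) x)) (mono_word I J)"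
      using k that hop_braid[OF assms, of k J]
      by (simp add: gs_act_coeff gs_act_mixed x multi_idx_def)
  qed (auto intro: gs_act_mixed that k)
qed

lemma lin_ext_bas:
  assumes "(I, J) \<in> multi_idx n r s"
  shows "lin_ext n r s T (bas (mono_word I J)) = T I J"
proof
  fix w
  have "lin_ext n r s T (bas (mono_word I J)) w = (\<Sum>p\<in>multi_idx n r s. if p = (I, J) then T I J w else 0)"
    unfolding lin_ext_apply by (rule sum.cong) (auto simp: bas_apply split: if_splits)
  then show "lin_ext n r s T (bas (mono_word I J)) w = T I J w"
    using assms by (simp add: finite_multi_idx)
qed

lemma g_act_bas:
  assumes "(I, J) \<in> multi_idx n r s"
  shows "I ! k < I ! (k - 1) \<Longrightarrow> g_act q n r s k (bas (mono_word I J)) = bas (mono_word (swap_at k I) J)"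
    and "I ! k = I ! (k - 1) \<Longrightarrow> g_act q n r s k (bas (mono_word I J)) = inverse q \<odot> bas (mono_word I J)"
  unfolding g_act_def lin_ext_bas[OF assms] by (simp_all add: Let_def)

lemma gs_act_bas:
  assumes "(I, J) \<in> multi_idx n r s"
  shows "J ! k < J ! (k - 1) \<Longrightarrow> gs_act q n r s k (bas (mono_word I J)) = bas (mono_word I (swap_at k J))"
    and "J ! k = J ! (k - 1) \<Longrightarrow> gs_act q n r s k (bas (mono_word I J)) = inverse q \<odot> bas (mono_word I J)"
  unfolding gs_act_def lin_ext_bas[OF assms] by (simp_all add: Let_def)

text \<open>The right action of permutations on words: the letter at position \<open>p\<close> moves to position \<open>w p\<close>.\<close>

definition pact :: "(nat \<Rightarrow> nat) \<Rightarrow> nat list \<Rightarrow> nat list" where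
  "pact w I = map (\<lambda>p. I ! (inv w (Suc p) - 1)) [0..<length I]"

lemma length_pact [simp]: "length (pact w I) = length I"
  by (simp add: pact_def)

lemma nth_pact: "p < length I \<Longrightarrow> pact w I ! p = I ! (inv w (Suc p) - 1)"
  by (simp add: pact_def)

lemma pact_id [simp]: "pact id I = I"
  by (rule nth_equalityI) (auto simp: nth_pact)

lemma pact_comp:
  assumes u: "u permutes {1..length I}" and w: "w permutes {1..length I}"
  shows "pact u (pact w I) = pact (u \<circ> w) I"
proof (rule nth_equalityI)
  fix p assume "p < length (pact u (pact w I))"
  then have p: "p < length I" by simp
  have "inv u (Suc p) \<in> {1..length I}"
    using permutes_in_image[OF permutes_inv[OF u]] p by simp
  then have i: "inv u (Suc p) - 1 < length I" "Suc (inv u (Suc p) - 1) = inv u (Suc p)" by auto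
  show "pact u (pact w I) ! p = pact (u \<circ> w) I ! p"
    using p i by (simp add: nth_pact o_inv_distrib[OF permutes_bij[OF u] permutes_bij[OF w]])
qed simp

lemma pact_inj:
  assumes w: "w permutes {1..length I}" and e: "pact w I = pact w I'" and l: "length I' = length I"
  shows "I = I'"
proof -
  have c: "pact (inv w) (pact w K) = K" if "length K = length I" for K
  proof -
    have "pact (inv w) (pact w K) = pact (inv w \<circ> w) K"
      using w permutes_inv[OF w] by (intro pact_comp) (simp_all only: that)
    then show ?thesis by (simp only: permutes_inv_o[OF w] pact_id)
  qed
  have "I = pact (inv w) (pact w I)" using c by metis
  also have "\<dots> = I'" unfolding e using c[OF l] .
  finally show ?thesis .
qed

lemma pact_at:
  assumes "w permutes {1..length I}" "p \<in> {1..length I}"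
  shows "pact w I ! (w p - 1) = I ! (p - 1)"
proof -
  have "w p \<in> {1..length I}" using permutes_in_image[OF assms(1)] assms(2) by simp
  then have "w p - 1 < length I" "Suc (w p - 1) = w p" by auto
  then show ?thesis by (simp add: nth_pact permutes_inverses[OF assms(1)])
qed

lemma pact_simple_tr:
  assumes k: "1 \<le> k" "k < length I"
  shows "pact (simple_tr k) I = swap_at k I"
proof (rule nth_equalityI)
  fix p assume "p < length (pact (simple_tr k) I)"
  then have p: "p < length I" by simp
  have "simple_tr k (Suc p) - 1 = transpose (k - 1) k p"
    using k by (auto simp: transpose_def)
  then show "pact (simple_tr k) I ! p = swap_at k I ! p"
    using p k by (simp add: nth_pact nth_swap_at)
qed simp

lemma swap_pact:
  assumes "w permutes {1..length I}" "k \<in> {1..<length I}"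
  shows "swap_at k (pact w I) = pact (simple_tr k \<circ> w) I"
proof -
  have "simple_tr k permutes {1..length I}"
    using assms(2) by (intro simple_tr_permutes) auto
  from pact_comp[OF this assms(1)] show ?thesis
    using pact_simple_tr[of k "pact w I"] assms(2) by simp
qed

lemma mset_pact:
  assumes w: "w permutes {1..length I}"
  shows "mset (pact w I) = mset I"
proof -
  have "mset (pact (perm_of ks) I) = mset I" if "set ks \<subseteq> {1..<length I}" for ks
    using that
  proof (induction ks rule: rev_induct)
    case (snoc k ks)
    then have p: "perm_of ks permutes {1..length I}" by (intro perm_of_permutes) simp
    have "pact (perm_of (ks @ [k])) I = swap_at k (pact (perm_of ks) I)"
      unfolding perm_of_snoc using snoc.prems by (intro swap_pact[OF p, symmetric]) simp
    moreover have "mset (swap_at k (pact (perm_of ks) I)) = mset (pact (perm_of ks) I)"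
      using snoc.prems by (intro mset_swap_at) auto
    moreover have "mset (pact (perm_of ks) I) = mset I" using snoc by simp
    ultimately show ?case by metis
  next
    case Nil
    then show ?case unfolding perm_of_Nil pact_id by simp
  qed
  moreover obtain ks where "rword (length I) ks" "perm_of ks = w" using ex_rword[OF w] by blast
  ultimately show ?thesis by (auto simp: rword_def)
qed

lemma multi_idx_pact:
  assumes "(I, J) \<in> multi_idx n r s"
  shows "w permutes {1..r} \<Longrightarrow> (pact w I, J) \<in> multi_idx n r s"
    and "w permutes {1..s} \<Longrightarrow> (I, pact w J) \<in> multi_idx n r s"
  using assms mset_pact[of w I] mset_pact[of w J]
  by (auto simp: multi_idx_def dest!: mset_eq_setD)

text \<open>
  Induction along a reduced word of \<open>w\<close>: each letter exchanges two entries that stood at an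
  inversion of \<open>w\<close> in the initial word.
\<close>

lemma pact_rword_induct:
  assumes "rword m ks" "length I = m" "\<And>x y. (x, y) \<in> inversions (perm_of ks) \<Longrightarrow> R (I ! (x - 1)) (I ! (y - 1))"
    and Nil: "Q [] I"
    and snoc: "\<And>us k K. Q us K \<Longrightarrow> set us \<subseteq> {1..<m} \<Longrightarrow> k \<in> {1..<m} \<Longrightarrow> length K = m \<Longrightarrow> mset K = mset I \<Longrightarrow>
       R (K ! (k - 1)) (K ! k) \<Longrightarrow> Q (us @ [k]) (swap_at k K)"
  shows "Q ks (pact (perm_of ks) I)"
  using assms(1,3)
proof (induction ks rule: rev_induct)
  case Nil
  then show ?case unfolding perm_of_Nil pact_id using assms(4) by blast
next
  case (snoc k us)
  have r: "rword m us" "k \<in> {1..<m}" using snoc.prems(1) by (simp_all add: rword_snoc)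
  then have us: "set us \<subseteq> {1..<m}" by (simp add: rword_def)
  then have p: "perm_of us permutes {1..length I}" using assms(2) perm_of_permutes by simp
  have sub: "inversions (perm_of us) \<subseteq> inversions (perm_of (us @ [k]))"
    using rword_inversions_mono[OF snoc.prems(1)] by blast
  have Q: "Q us (pact (perm_of us) I)"
    using snoc.IH[OF r(1)] snoc.prems(2) sub by blast
  have "R (I ! (inv (perm_of us) k - 1)) (I ! (inv (perm_of us) (Suc k) - 1))"
    using snoc.prems(2) rword_snoc_inversion[OF snoc.prems(1)] by blast
  then have R: "R (pact (perm_of us) I ! (k - 1)) (pact (perm_of us) I ! k)"
    using r(2) assms(2) nth_pact[of "k - 1" I "perm_of us"] nth_pact[of k I "perm_of us"] less_imp_diff_less[of k m 1]
    by simp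
  show ?case
    unfolding perm_of_snoc
    using assms(5)[OF Q us r(2) _ mset_pact[OF p] R] assms(2) swap_pact[OF p, of k] r(2)
    by (metis length_pact)
qed

text \<open>Along a reduced word every generator meets a strictly decreasing pair of entries, the
  case of the action without a second term, so g_w merely permutes the word.\<close>

lemma gw_g_bas:
  assumes "q \<noteq> 0" "(I, J) \<in> multi_idx n r s" "w permutes {1..r}"
    and inv: "\<And>x y. (x, y) \<in> inversions w \<Longrightarrow> I ! (y - 1) < I ! (x - 1)"
  shows "gw_act (g_act q n r s) r w (bas (mono_word I J)) = bas (mono_word (pact w I) J)"
proof -
  interpret hecke_family q r "mixed n r s" "g_act q n r s" by (rule hecke_family_g) fact
  obtain ks where ks: "rword r ks" "perm_of ks = w" using ex_rword assms(3) by blast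
  have l: "length I = r" using assms(2) by (simp add: multi_idx_def)
  have i: "I ! (y - 1) < I ! (x - 1)" if "(x, y) \<in> inversions (perm_of ks)" for x y
    using inv[of x y] that unfolding ks(2) by blast
  have "fold (g_act q n r s) ks (bas (mono_word I J)) = bas (mono_word (pact (perm_of ks) I) J)
      \<and> (pact (perm_of ks) I, J) \<in> multi_idx n r s"
  proof (rule pact_rword_induct[OF ks(1) l, where R = "\<lambda>a b. b < a" and
        Q = "\<lambda>us K. fold (g_act q n r s) us (bas (mono_word I J)) = bas (mono_word K J) \<and> (K, J) \<in> multi_idx n r s"], rule i)
    fix us k K
    assume "fold (g_act q n r s) us (bas (mono_word I J)) = bas (mono_word K J) \<and> (K, J) \<in> multi_idx n r s"
      "k \<in> {1..<r}" "K ! k < K ! (k - 1)"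
    then show "fold (g_act q n r s) (us @ [k]) (bas (mono_word I J)) = bas (mono_word (swap_at k K) J)
        \<and> (swap_at k K, J) \<in> multi_idx n r s"
      using g_act_bas(1)[of K J n r s k q] multi_idx_swap(1)[of K J n r s k] by simp
  qed (use assms ks in auto)
  then show ?thesis
    using gw_fold[OF ks bas_mixed[OF assms(2)]] ks(2) by metis
qed

lemma gw_gs_bas:
  assumes "q \<noteq> 0" "(I, J) \<in> multi_idx n r s" "w permutes {1..s}"
    and inv: "\<And>x y. (x, y) \<in> inversions w \<Longrightarrow> J ! (y - 1) < J ! (x - 1)"
  shows "gw_act (gs_act q n r s) s w (bas (mono_word I J)) = bas (mono_word I (pact w J))"
proof -
  interpret hecke_family q s "mixed n r s" "gs_act q n r s" by (rule hecke_family_gs) fact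
  obtain ks where ks: "rword s ks" "perm_of ks = w" using ex_rword assms(3) by blast
  have l: "length J = s" using assms(2) by (simp add: multi_idx_def)
  have i: "J ! (y - 1) < J ! (x - 1)" if "(x, y) \<in> inversions (perm_of ks)" for x y
    using inv[of x y] that unfolding ks(2) by blast
  have "fold (gs_act q n r s) ks (bas (mono_word I J)) = bas (mono_word I (pact (perm_of ks) J))
      \<and> (I, pact (perm_of ks) J) \<in> multi_idx n r s"
  proof (rule pact_rword_induct[OF ks(1) l, where R = "\<lambda>a b. b < a" and
        Q = "\<lambda>us K. fold (gs_act q n r s) us (bas (mono_word I J)) = bas (mono_word I K) \<and> (I, K) \<in> multi_idx n r s"], rule i)
    fix us k K
    assume "fold (gs_act q n r s) us (bas (mono_word I J)) = bas (mono_word I K) \<and> (I, K) \<in> multi_idx n r s"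
      "k \<in> {1..<s}" "K ! k < K ! (k - 1)"
    then show "fold (gs_act q n r s) (us @ [k]) (bas (mono_word I J)) = bas (mono_word I (swap_at k K))
        \<and> (I, swap_at k K) \<in> multi_idx n r s"
      using gs_act_bas(1)[of I K n r s k q] multi_idx_swap(2)[of I K n r s k] by simp
  qed (use assms ks in auto)
  then show ?thesis
    using gw_fold[OF ks bas_mixed[OF assms(2)]] ks(2) by metis
qed

section \<open>Divided powers as operators on functions of words\<close>

fun lwt :: "nat \<Rightarrow> letter \<Rightarrow> int" where
  "lwt j (Vec a) = (if a = j then 1 else 0)"
| "lwt j (Dual a) = (if a = j then - 1 else 0)"

fun wt :: "nat \<Rightarrow> letter list \<Rightarrow> int" where
  "wt j [] = 0"
| "wt j (z # u) = lwt j z + wt j u"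

text \<open>The exponent of q in the action of K_i on the word.\<close>

definition hp :: "nat \<Rightarrow> letter list \<Rightarrow> int" where
  "hp i w = wt i w - wt (Suc i) w"

definition lhp :: "nat \<Rightarrow> letter \<Rightarrow> int" where
  "lhp i z = lwt i z - lwt (Suc i) z"

lemma hp_Nil [simp]: "hp i [] = 0"
  by (simp add: hp_def)

lemma hp_Cons [simp]: "hp i (z # u) = lhp i z + hp i u"
  by (simp add: hp_def lhp_def)

text \<open>
  The letter \<open>low z\<close> is the only one that \<open>E\<^sub>i\<close> may send to a multiple of \<open>z\<close>;
  \<open>lco q i z\<close> is the coefficient, which is zero if there is no such letter.
\<close>

fun low :: "letter \<Rightarrow> letter" where
  "low (Vec j) = Vec (Suc j)"
| "low (Dual j) = Dual (j - 1)"

fun lco :: "'a::field \<Rightarrow> nat \<Rightarrow> letter \<Rightarrow> 'a" where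
  "lco q i (Vec j) = (if j = i then 1 else 0)"
| "lco q i (Dual j) = (if j = Suc i then - inverse q else 0)"

text \<open>\<open>eop q i l x\<close> is the image of \<open>x\<close> under the \<open>l\<close>-th divided power of \<open>E\<^sub>i\<close>.\<close>

fun eop :: "'a::field \<Rightarrow> nat \<Rightarrow> nat \<Rightarrow> 'a tensor \<Rightarrow> 'a tensor" where
  "eop q i 0 x u = x u"
| "eop q i (Suc l) x [] = 0"
| "eop q i (Suc l) x (z # u) = eop q i (Suc l) (\<lambda>v. x (z # v)) u
     + lco q i z * q powi (int l - hp i u) * eop q i l (\<lambda>v. x (low z # v)) u"

lemma eop_0 [simp]: "eop q i 0 x = x"
  by (simp add: fun_eq_iff)

lemma eop_cong: "(\<And>v. length v = length u \<Longrightarrow> x v = y v) \<Longrightarrow> eop q i l x u = eop q i l y u"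
proof (induction q i l x u arbitrary: y rule: eop.induct)
  case (3 q i l x z u)
  show ?case
    using "3.IH"(1)[of "\<lambda>v. y (z # v)"] "3.IH"(2)[of "\<lambda>v. y (low z # v)"] "3.prems" by simp
qed simp_all

lemma eop_lin: "eop q i l (\<lambda>v. a * x v + b * y v) u = a * eop q i l x u + b * eop q i l y u"
proof (induction q i l x u arbitrary: y rule: eop.induct)
  case (3 q i l x z u)
  show ?case
    using "3.IH"(1)[of "\<lambda>v. y (z # v)"] "3.IH"(2)[of "\<lambda>v. y (low z # v)"] by (simp add: algebra_simps)
qed simp_all

lemma eop_add: "eop q i l (\<lambda>v. x v + y v) u = eop q i l x u + eop q i l y u"
  using eop_lin[of q i l 1 x 1 y u] by simp

lemma eop_scl: "eop q i l (\<lambda>v. a * x v) u = a * eop q i l x u"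
  using eop_lin[of q i l a x 0 x u] by simp

lemma eop_zero: "eop q i l (\<lambda>v. 0) u = 0"
  using eop_scl[of q i l 0 "\<lambda>v. 0" u] by simp

lemma eop_sum: "eop q i l (\<lambda>v. \<Sum>a\<in>A. f a v) u = (\<Sum>a\<in>A. eop q i l (f a) u)"
proof (induction A rule: infinite_finite_induct)
  case (insert a A)
  then show ?case using eop_add[of q i l "f a" "\<lambda>v. \<Sum>a\<in>A. f a v" u] by simp
qed (auto simp: eop_zero)

lemma lco_lhp: "lco q i z \<noteq> 0 \<Longrightarrow> lhp i (low z) = lhp i z - 2 \<and> lhp i z = 1"
  by (cases z) (auto simp: lhp_def split: if_splits)

lemma lco_low: "lco q i z \<noteq> 0 \<Longrightarrow> lco q i (low z) = 0"
  by (cases z) (auto split: if_splits)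

text \<open>E_i raises \<open>hp i\<close> by 2; this is the relation K_i E_i = q^2 E_i K_i, read at
  the word \<open>u\<close> that E_i produces.\<close>

lemma eop_shift:
  assumes q: "q \<noteq> 0"
  shows "eop q i 1 (\<lambda>v. q powi (c - hp i v) * x v) u = q powi (c - hp i u + 2) * eop q i 1 x u"
proof (induction u arbitrary: c x)
  case (Cons z u)
  have 1: "eop q i 1 (\<lambda>v. q powi (c - hp i (z # v)) * x (z # v)) u =
      q powi (c - hp i (z # u) + 2) * eop q i 1 (\<lambda>v. x (z # v)) u"
    using Cons.IH[of "c - lhp i z" "\<lambda>v. x (z # v)"] by (simp add: algebra_simps)
  have 2: "lco q i z * q powi (c - hp i (low z # u)) = lco q i z * q powi (c - hp i (z # u) + 2)"
  proof (cases "lco q i z = 0")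
    case False
    then have "c - hp i (low z # u) = c - hp i (z # u) + 2" using lco_lhp[of q i z] by simp
    then show ?thesis by (simp only:)
  qed simp
  have "eop q i 1 (\<lambda>v. q powi (c - hp i v) * x v) (z # u) =
      eop q i 1 (\<lambda>v. q powi (c - hp i (z # v)) * x (z # v)) u
      + q powi (- hp i u) * (lco q i z * q powi (c - hp i (low z # u))) * x (low z # u)"
    by (simp add: algebra_simps)
  then show ?case
    unfolding 1 2 by (simp add: algebra_simps)
qed simp

lemma qint_Suc:
  assumes q: "q \<noteq> 0" and q1: "q - inverse q \<noteq> 0"
  shows "q ^ l * qint q (Suc l) = q ^ Suc l * qint q l + 1"
proof -
  define a b where "a = q ^ l" and "b = inverse q ^ l"
  have ab: "a * b = 1" using q by (simp add: a_def b_def flip: power_mult_distrib)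
  have "a * (q * a - inverse q * b) = q * a * (a - b) + (q - inverse q)"
    using ab by algebra
  then show ?thesis
    using q1 by (simp add: qint_def add_divide_distrib flip: a_def b_def)
qed

text \<open>The recursion of \<open>eop\<close> is the coproduct of the divided power, in which the
  first letter receives E_i at most once because E_i squares to zero on V and on W. The identity E_i
  E_i^(l) = [l + 1] E_i^(l+1) confirms this and determines the divided powers wherever the quantum
  integers are invertible.\<close>

lemma eop_1_eop:
  assumes q: "q \<noteq> 0" and q1: "q - inverse q \<noteq> 0"
  shows "eop q i 1 (eop q i l x) u = qint q (Suc l) * eop q i (Suc l) x u"
proof (induction u arbitrary: l x)
  case Nil
  then show ?case by simp
next
  case (Cons z u)
  show ?case
  proof (cases l)
    case 0
    then show ?thesis using q1 by (simp add: qint_def)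
  next
    case (Suc l')
    let ?y = "\<lambda>v. x (z # v)" and ?y' = "\<lambda>v. x (low z # v)"
    let ?L = "lco q i z" and ?E = "eop q i l ?y' u"
    have "eop q i 1 (eop q i l x) (z # u) =
      eop q i 1 (\<lambda>v. eop q i l ?y v + ?L * (q powi (int l' - hp i v) * eop q i l' ?y' v)) u
      + ?L * q powi (- hp i u) * eop q i l x (low z # u)"
      unfolding Suc by (simp add: mult.assoc)
    also have "eop q i 1 (\<lambda>v. eop q i l ?y v + ?L * (q powi (int l' - hp i v) * eop q i l' ?y' v)) u
      = qint q (Suc l) * eop q i (Suc l) ?y u + ?L * (q powi (int l' - hp i u + 2) * (qint q l * ?E))"
      unfolding eop_add eop_scl eop_shift[OF q] Cons.IH unfolding Suc ..
    \<comment> \<open>No letter is sent by E_i to \<open>low z\<close> when \<open>lco q i z\<close>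
      is nonzero, so the second term of the recursion drops out here.\<close>
    also have "?L * q powi (- hp i u) * eop q i l x (low z # u) = ?L * q powi (- hp i u) * ?E"
      using lco_low[of q i z] unfolding Suc by auto
    finally have 1: "eop q i 1 (eop q i l x) (z # u) = qint q (Suc l) * eop q i (Suc l) ?y u
       + ?L * ?E * (q powi (int l' - hp i u + 2) * qint q l + q powi (- hp i u))"
      by (simp add: algebra_simps)
    have a: "q powi (int l' - hp i u + 2) = q powi (- hp i u) * q ^ Suc l"
      using q unfolding Suc by (simp add: power_int_add power_int_diff field_simps power2_eq_square power_int_minus)
    have b: "q powi (int l - hp i u) = q powi (- hp i u) * q ^ l"
      using q by (simp add: power_int_add power_int_diff field_simps power_int_minus)
    note c = qint_Suc[OF q q1, of l]
    have "q powi (int l' - hp i u + 2) * qint q l + q powi (- hp i u) = qint q (Suc l) * q powi (int l - hp i u)"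
    proof -
      have "q powi (- hp i u) * q ^ Suc l * qint q l + q powi (- hp i u) = q powi (- hp i u) * (q ^ Suc l * qint q l + 1)"
        by (simp add: algebra_simps)
      also have "\<dots> = qint q (Suc l) * (q powi (- hp i u) * q ^ l)"
        unfolding c[symmetric] by (simp only: mult_ac)
      finally show ?thesis unfolding a b .
    qed
    then show ?thesis
      unfolding 1 by (simp add: algebra_simps)
  qed
qed

section \<open>Comparison with the given operators\<close>

lemma tens_single: "(bas [a] \<otimes> y) [] = 0" "(bas [a] \<otimes> y) (z # u) = (if z = a then y u else 0)"
  for y :: "'a::field tensor"
proof -
  show "(bas [a] \<otimes> y) [] = 0" by (simp add: tens_def bas_apply)
  have "(bas [a] \<otimes> y) (z # u) = (\<Sum>k\<le>Suc (length u). if k = 1 then (if z = a then y u else 0) else 0)"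
    unfolding tens_def
  proof (rule sum.cong)
    fix k assume "k \<in> {..Suc (length u)}"
    then show "bas [a] (take k (z # u)) * y (drop k (z # u)) = (if k = 1 then (if z = a then y u else 0) else 0)"
      by (cases k; cases "k - 1"; cases u) (auto simp: bas_apply)
  qed simp
  then show "(bas [a] \<otimes> y) (z # u) = (if z = a then y u else 0)"
    by (simp del: sum.atMost_Suc)
qed

lemma tens_scl: "(c \<odot> x) \<otimes> y = c \<odot> (x \<otimes> y)" "x \<otimes> (c \<odot> y) = c \<odot> (x \<otimes> y)"
  for x y :: "'a::field tensor"
  by (simp_all add: fun_eq_iff tens_def tensor_apply sum_distrib_left algebra_simps)

lemma tens_add: "(x + x') \<otimes> y = x \<otimes> y + x' \<otimes> y" "x \<otimes> (y + y') = x \<otimes> y + x \<otimes> y'"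
  for x y :: "'a::field tensor"
  by (simp_all add: fun_eq_iff tens_def tensor_apply sum.distrib algebra_simps)

lemma tens_zero: "0 \<otimes> y = 0" "x \<otimes> 0 = 0" for x y :: "'a::field tensor"
  by (simp_all add: fun_eq_iff tens_def tensor_apply)

lemma bas_tens_single: "bas [a] \<otimes> bas w = (bas (a # w) :: 'a::field tensor)"
proof
  fix u show "(bas [a] \<otimes> bas w) u = (bas (a # w) u :: 'a)"
    by (cases u) (simp_all add: tens_single, simp_all add: bas_apply)
qed

lemma qh_word_alpha:
  assumes q: "q \<noteq> 0" and i: "1 \<le> i"
  shows "qh_word q (- alpha_check i) w = (q powi (- hp i w)) \<odot> bas w"
proof (induction w)
  case (Cons z w)
  have "qh_letter q (- alpha_check i) z = (q powi (- lhp i z)) \<odot> bas [z]"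
    by (cases z) (auto simp: alpha_check_def lhp_def)
  then have "qh_word q (- alpha_check i) (z # w) = (q powi (- lhp i z) * q powi (- hp i w)) \<odot> bas (z # w)"
    unfolding qh_word.simps Cons.IH by (simp only: tens_scl bas_tens_single tensor_vs.scale_scale mult.commute)
  then show ?case
    using q by (simp only: hp_Cons minus_add_distrib power_int_add simp_thms)
qed (simp add: fun_eq_iff tensor_apply)

lemma qh_word_eps:
  assumes q: "q \<noteq> 0"
  shows "qh_word q (\<lambda>j. if j = i then 1 else 0) w = (q powi (wt i w)) \<odot> bas w"
proof (induction w)
  case (Cons z w)
  have "qh_letter q (\<lambda>j. if j = i then 1 else 0) z = (q powi (lwt i z)) \<odot> bas [z]"
    by (cases z) auto
  then have "qh_word q (\<lambda>j. if j = i then 1 else 0) (z # w) = (q powi (lwt i z) * q powi (wt i w)) \<odot> bas (z # w)"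
    unfolding qh_word.simps Cons.IH by (simp only: tens_scl bas_tens_single tensor_vs.scale_scale mult.commute)
  then show ?case
    using q by (simp only: wt.simps power_int_add simp_thms)
qed (simp add: fun_eq_iff tensor_apply)

lemma E_letter_tens:
  assumes i: "1 \<le> i"
  shows "(E_letter q i a \<otimes> y) [] = 0"
    and "(E_letter q i a \<otimes> y) (z # u) = (if low z = a then lco q i z * y u else 0)"
proof -
  show "(E_letter q i a \<otimes> y) [] = 0"
    by (cases a) (auto simp: tens_zero tens_scl tens_single tensor_apply simp del: tensor_vs.scale_minus_left)
  show "(E_letter q i a \<otimes> y) (z # u) = (if low z = a then lco q i z * y u else 0)"
    using i by (cases a; cases z) (auto simp: tens_zero tens_scl tens_single tensor_apply simp del: tensor_vs.scale_minus_left)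
qed

lemma bas_neq: "v \<noteq> w \<Longrightarrow> bas w v = 0"
  by (simp add: bas_apply)

lemma E_word_eop:
  assumes q: "q \<noteq> 0" and i: "1 \<le> i"
  shows "E_word q i w u = eop q i 1 (bas w) u"
proof (induction w arbitrary: u)
  case Nil
  have "eop q i 1 (bas []) u = 0"
  proof (cases u)
    case (Cons z v)
    then show ?thesis using eop_zero[of q i 1 v] by (simp add: bas_apply)
  qed simp
  then show ?case by (simp add: tensor_apply)
next
  case (Cons a w)
  show ?case
  proof (cases u)
    case Nil
    then show ?thesis by (simp add: tensor_apply tens_single E_letter_tens[OF i])
  next
    case u: (Cons z v)
    have s: "(\<lambda>v. bas (a # w) (z # v)) = (if z = a then bas w else (\<lambda>v. 0 :: 'a))" for z
      by (auto simp: bas_apply fun_eq_iff)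
    show ?thesis
      unfolding u E_word.simps plus_fun_apply tens_single E_letter_tens[OF i] qh_word_alpha[OF q i] One_nat_def eop.simps s
      using Cons.IH[of v] bas_neq[of v w] by (auto simp: eop_zero tensor_apply)
  qed
qed

lemma E_act_eop:
  assumes q: "q \<noteq> 0" and i: "1 \<le> i" and x: "x \<in> mixed n r s"
  shows "E_act q n r s i x = eop q i 1 x"
proof
  fix u
  have "E_act q n r s i x u = (\<Sum>p\<in>multi_idx n r s. eop q i 1 (\<lambda>v. x (mono_word (fst p) (snd p)) * bas (mono_word (fst p) (snd p)) v) u)"
    unfolding E_act_def lin_ext_apply case_prod_beta E_word_eop[OF q i] eop_scl ..
  also have "\<dots> = eop q i 1 (\<lambda>v. \<Sum>p\<in>multi_idx n r s. x (mono_word (fst p) (snd p)) * bas (mono_word (fst p) (snd p)) v) u"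
    unfolding eop_sum ..
  also have "(\<lambda>v. \<Sum>p\<in>multi_idx n r s. x (mono_word (fst p) (snd p)) * bas (mono_word (fst p) (snd p)) v) = x"
    by (subst (2) mixed_expand[OF x]) (simp add: fun_eq_iff lin_ext_apply case_prod_beta)
  finally show "E_act q n r s i x u = eop q i 1 x u" .
qed

lemma mono_word_image_iff:
  "w \<in> (\<lambda>(I, J). mono_word I J) ` multi_idx n r s \<longleftrightarrow>
     length w = r + s \<and> (\<forall>p<r. w ! p \<in> Vec ` {1..n}) \<and> (\<forall>p<r + s. r \<le> p \<longrightarrow> w ! p \<in> Dual ` {1..n})"
  (is "?L \<longleftrightarrow> ?R")
proof
  assume ?L
  then obtain I J where IJ: "(I, J) \<in> multi_idx n r s" and w: "w = mono_word I J" by auto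
  have l: "length I = r" "length J = s" and st: "set I \<subseteq> {1..n}" "set J \<subseteq> {1..n}"
    using IJ by (auto simp: multi_idx_def)
  have 1: "w ! p \<in> Vec ` {1..n}" if "p < r" for p
    using that l st by (auto simp: w mono_word_def nth_append rev_nth intro!: imageI subsetD[OF st(1)])
  have 2: "w ! p \<in> Dual ` {1..n}" if "p < r + s" "r \<le> p" for p
    using that l st by (auto simp: w mono_word_def nth_append intro!: imageI subsetD[OF st(2)])
  show ?R using 1 2 l by (auto simp: w mono_word_def)
next
  assume R: ?R
  define ix where "ix z = (case z of Vec a \<Rightarrow> a | Dual a \<Rightarrow> a)" for z
  define I J where "I = rev (map ix (take r w))" and "J = map ix (drop r w)"
  have l: "length w = r + s" using R by simp
  have "map Vec (rev I) = take r w"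
  proof (rule nth_equalityI)
    fix p assume "p < length (map Vec (rev I))"
    then have p: "p < r" using l by (simp add: I_def)
    then have "w ! p \<in> Vec ` {1..n}" using R by blast
    then show "map Vec (rev I) ! p = take r w ! p"
      using p l by (auto simp: I_def ix_def)
  qed (use l in \<open>simp add: I_def\<close>)
  moreover have "map Dual J = drop r w"
  proof (rule nth_equalityI)
    fix p assume "p < length (map Dual J)"
    then have p: "r + p < r + s" using l by (simp add: J_def)
    then have "w ! (r + p) \<in> Dual ` {1..n}" using R by simp
    then show "map Dual J ! p = drop r w ! p"
      using p l by (auto simp: J_def ix_def)
  qed (use l in \<open>simp add: J_def\<close>)
  ultimately have w: "w = mono_word I J" by (simp add: mono_word_def)
  have "ix z \<in> {1..n}" if z: "z \<in> set w" for z
  proof -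
    obtain p where p: "p < r + s" "w ! p = z" using z l by (metis in_set_conv_nth)
    then have "z \<in> Vec ` {1..n} \<or> z \<in> Dual ` {1..n}" using R by (cases "p < r") auto
    then show ?thesis by (auto simp: ix_def)
  qed
  then have "set I \<subseteq> {1..n}" "set J \<subseteq> {1..n}"
    unfolding I_def J_def using set_take_subset[of r w] set_drop_subset[of r w] by auto
  then have "(I, J) \<in> multi_idx n r s"
    using l by (simp add: multi_idx_def I_def J_def)
  then show ?L using w by force
qed

lemma eop_support:
  "eop q i l x u \<noteq> 0 \<Longrightarrow> \<exists>w. x w \<noteq> 0 \<and> list_all2 (\<lambda>z z'. z' = z \<or> lco q i z \<noteq> 0 \<and> z' = low z) u w"
proof (induction q i l x u rule: eop.induct)
  case (1 q i x u)
  then show ?case by (auto intro!: exI[of _ u] simp: list_all2_refl)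
next
  case (3 q i l x z u)
  consider "eop q i (Suc l) (\<lambda>v. x (z # v)) u \<noteq> 0" | "lco q i z \<noteq> 0" "eop q i l (\<lambda>v. x (low z # v)) u \<noteq> 0"
    using "3.prems" by fastforce
  then show ?case
  proof cases
    case 1
    from "3.IH"(1)[OF 1] obtain w where "x (z # w) \<noteq> 0"
      "list_all2 (\<lambda>z z'. z' = z \<or> lco q i z \<noteq> 0 \<and> z' = low z) u w" by blast
    then show ?thesis by (intro exI[of _ "z # w"]) simp
  next
    case 2
    from "3.IH"(2)[OF 2(2)] obtain w where "x (low z # w) \<noteq> 0"
      "list_all2 (\<lambda>z z'. z' = z \<or> lco q i z \<noteq> 0 \<and> z' = low z) u w" by blast
    then show ?thesis using 2(1) by (intro exI[of _ "low z # w"]) simp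
  qed
qed simp

text \<open>For 1 <= i < n, the letters that E_i connects are of the same kind and both have indices
  between 1 and n.\<close>

lemma eop_mixed:
  assumes i: "i \<in> {1..<n}" and x: "x \<in> mixed n r s"
  shows "eop q i l x \<in> mixed n r s"
  unfolding mixed_def
proof (intro CollectI allI impI, rule ccontr)
  fix u assume u: "u \<notin> (\<lambda>(I, J). mono_word I J) ` multi_idx n r s" and "eop q i l x u \<noteq> 0"
  then obtain w where w: "x w \<noteq> 0" "list_all2 (\<lambda>z z'. z' = z \<or> lco q i z \<noteq> 0 \<and> z' = low z) u w"
    using eop_support by blast
  have "w \<in> (\<lambda>(I, J). mono_word I J) ` multi_idx n r s"
    using w(1) x by (auto simp: mixed_def)
  then have R: "length w = r + s" "\<And>p. p < r \<Longrightarrow> w ! p \<in> Vec ` {1..n}"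
     "\<And>p. p < r + s \<Longrightarrow> r \<le> p \<Longrightarrow> w ! p \<in> Dual ` {1..n}"
    unfolding mono_word_image_iff by blast+
  have l: "length u = r + s" using w(2) R(1) by (simp add: list_all2_lengthD)
  have step: "w ! p = u ! p \<or> lco q i (u ! p) \<noteq> 0 \<and> w ! p = low (u ! p)" if "p < r + s" for p
    using list_all2_nthD[OF w(2)] l that by simp
  have V: "z \<in> Vec ` {1..n}" if "z' \<in> Vec ` {1..n}" "z' = z \<or> lco q i z \<noteq> 0 \<and> z' = low z" for z z'
    using that i by (cases z) (auto split: if_splits)
  have D: "z \<in> Dual ` {1..n}" if "z' \<in> Dual ` {1..n}" "z' = z \<or> lco q i z \<noteq> 0 \<and> z' = low z" for z z'
    using that i by (cases z) (auto split: if_splits)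
  have "u \<in> (\<lambda>(I, J). mono_word I J) ` multi_idx n r s"
    unfolding mono_word_image_iff
    using l V[OF R(2) step] D[OF R(3) step] by simp
  with u show False ..
qed

section \<open>The ground ring\<close>

abbreviation ipoly :: "int poly \<Rightarrow> rat poly" where
  "ipoly \<equiv> map_poly of_int"

lemma ipoly_add: "ipoly (a + b) = ipoly a + ipoly b"
  by (rule poly_eqI) (simp add: coeff_map_poly)

lemma ipoly_mult: "ipoly (a * b) = ipoly a * ipoly b"
  by (rule poly_eqI) (simp add: coeff_map_poly coeff_mult)

lemma ipoly_X: "ipoly ([:0, 1:] ^ k) = [:0, 1:] ^ k"
proof (induction k)
  case (Suc k)
  then show ?case unfolding power_Suc ipoly_mult by (simp add: map_poly_pCons)
qed simp

lemma ZZqI: "x = Fract (ipoly p) ([:0, 1:] ^ k) \<Longrightarrow> x \<in> ZZq"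
  by (auto simp: ZZq_def)

lemma ZZq_add: "x \<in> ZZq \<Longrightarrow> y \<in> ZZq \<Longrightarrow> x + y \<in> ZZq"
proof -
  assume "x \<in> ZZq" "y \<in> ZZq"
  then obtain a k b l where "x = Fract (ipoly a) ([:0, 1:] ^ k)" "y = Fract (ipoly b) ([:0, 1:] ^ l)"
    by (auto simp: ZZq_def)
  then have "x + y = Fract (ipoly (a * [:0, 1:] ^ l + b * [:0, 1:] ^ k)) ([:0, 1:] ^ (k + l))"
    by (simp only: ipoly_add ipoly_mult ipoly_X power_add) simp
  then show "x + y \<in> ZZq" by (rule ZZqI)
qed

lemma ZZq_mult: "x \<in> ZZq \<Longrightarrow> y \<in> ZZq \<Longrightarrow> x * y \<in> ZZq"
proof -
  assume "x \<in> ZZq" "y \<in> ZZq"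
  then obtain a k b l where "x = Fract (ipoly a) ([:0, 1:] ^ k)" "y = Fract (ipoly b) ([:0, 1:] ^ l)"
    by (auto simp: ZZq_def)
  then have "x * y = Fract (ipoly (a * b)) ([:0, 1:] ^ (k + l))"
    by (simp only: ipoly_mult power_add mult_fract)
  then show "x * y \<in> ZZq" by (rule ZZqI)
qed

lemma ZZq_0: "0 \<in> ZZq"
  by (rule ZZqI[of _ 0 0]) (simp add: Zero_fract_def)

lemma ZZq_1: "1 \<in> ZZq"
  by (rule ZZqI[of _ 1 0]) (simp add: One_fract_def)

lemma ZZq_neg1: "- 1 \<in> ZZq"
proof -
  have "ipoly (- 1) = - 1" by (rule poly_eqI) (simp add: coeff_map_poly)
  then show ?thesis by (intro ZZqI[of _ "- 1" 0]) (simp add: One_fract_def)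
qed

lemma ZZq_uminus: "x \<in> ZZq \<Longrightarrow> - x \<in> ZZq"
  using ZZq_mult[OF ZZq_neg1] by simp

lemma ZZq_diff: "x \<in> ZZq \<Longrightarrow> y \<in> ZZq \<Longrightarrow> x - y \<in> ZZq"
  using ZZq_add[OF _ ZZq_uminus] by simp

lemma ZZq_sum: "(\<And>a. a \<in> A \<Longrightarrow> f a \<in> ZZq) \<Longrightarrow> sum f A \<in> ZZq"
  by (induction A rule: infinite_finite_induct) (auto simp: ZZq_0 ZZq_add)

lemma ZZq_power: "x \<in> ZZq \<Longrightarrow> x ^ k \<in> ZZq"
  by (induction k) (auto simp: ZZq_1 ZZq_mult)

lemma ZZq_qq: "qq \<in> ZZq"
  by (rule ZZqI[of _ "[:0, 1:]" 0]) (simp add: qq_def map_poly_pCons)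

lemma ZZq_inverse_qq: "inverse qq \<in> ZZq"
  by (rule ZZqI[of _ 1 1]) (simp add: qq_def)

lemma qq_power: "qq ^ k = Fract ([:0, 1:] ^ k) 1"
  by (induction k) (simp_all add: qq_def One_fract_def)

lemma qq_nz [simp]: "qq \<noteq> 0"
  by (simp add: qq_def Zero_fract_def eq_fract)

lemma qq_power_eq_1: "qq ^ k = 1 \<longleftrightarrow> k = 0"
proof
  assume "qq ^ k = 1"
  then have "[:0, 1:] ^ k = (1 :: rat poly)"
    by (simp add: qq_power One_fract_def eq_fract)
  then have "degree ([:0, 1:] ^ k :: rat poly) = 0" by simp
  then show "k = 0" by (simp add: degree_power_eq)
qed simp

text \<open>The indeterminate has infinite multiplicative order; this turns eigenvalue conditions
  for q^h into equations between integer weights.\<close>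

lemma qq_powi_eq: "qq powi a = qq powi b \<longleftrightarrow> a = b"
proof
  assume e: "qq powi a = qq powi b"
  have *: "x = y" if "qq powi x = qq powi y" "x \<le> y" for x y
  proof -
    have "qq powi y = qq powi x * qq powi (y - x)" by (simp flip: power_int_add)
    then have "qq powi (y - x) = 1" using that(1) by simp
    then have "qq ^ nat (y - x) = 1" using that(2) by (simp add: power_int_def)
    then show ?thesis using that(2) by (simp add: qq_power_eq_1)
  qed
  show "a = b" using *[of a b] *[of b a] e by linarith
qed simp

lemma qint_qq_nz:
  assumes "m > 0"
  shows "qint qq m \<noteq> 0"
proof -
  have *: "qq ^ k - inverse qq ^ k \<noteq> 0" if "k > 0" for k
  proof
    assume "qq ^ k - inverse qq ^ k = 0"
    then have "qq ^ k * qq ^ k = 1" by (simp add: field_simps flip: power_mult_distrib)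
    then have "qq ^ (k + k) = 1" by (simp add: power_add)
    then show False using that by (simp add: qq_power_eq_1)
  qed
  show ?thesis using *[OF assms] *[of 1] by (simp add: qint_def)
qed

lemma qq_diff_nz: "qq - inverse qq \<noteq> 0"
proof
  assume "qq - inverse qq = 0"
  then have "qint qq 1 = 0" unfolding qint_def by simp
  then show False using qint_qq_nz[of 1] by simp
qed

lemma qfact_Suc: "qfact q (Suc l) = qfact q l * qint q (Suc l)"
  by (simp add: qfact_def)

lemma qfact_qq_nz: "qfact qq l \<noteq> 0"
  by (simp add: qfact_def qint_qq_nz)

lemma E_div_eop:
  assumes i: "i \<in> {1..<n}" and x: "x \<in> mixed n r s"
  shows "E_div n r s i l x = eop qq i l x"
proof -
  have "(E_act qq n r s i ^^ l) x = qfact qq l \<odot> eop qq i l x"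
  proof (induction l)
    case 0
    then show ?case by (simp add: qfact_def)
  next
    case (Suc l)
    have m: "qfact qq l \<odot> eop qq i l x \<in> mixed n r s"
      by (intro mixed_scl eop_mixed i x)
    have "(E_act qq n r s i ^^ Suc l) x = eop qq i 1 (qfact qq l \<odot> eop qq i l x)"
      using Suc E_act_eop[OF qq_nz _ m, of i] i by simp
    also have "\<dots> = qfact qq (Suc l) \<odot> eop qq i (Suc l) x"
      unfolding fun_eq_iff scl_def eop_scl eop_1_eop[OF qq_nz qq_diff_nz] qfact_Suc by (simp add: mult.assoc)
    finally show ?case .
  qed
  then show ?thesis
    unfolding E_div_def using qfact_qq_nz[of l] by simp
qed

locale ground_field =
  fixes \<phi> :: "Qq \<Rightarrow> 'k::field"
  assumes alg: "ZZq_algebra \<phi>"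
begin

lemma phi_1: "\<phi> 1 = 1"
  and phi_add: "a \<in> ZZq \<Longrightarrow> b \<in> ZZq \<Longrightarrow> \<phi> (a + b) = \<phi> a + \<phi> b"
  and phi_mult: "a \<in> ZZq \<Longrightarrow> b \<in> ZZq \<Longrightarrow> \<phi> (a * b) = \<phi> a * \<phi> b"
  using alg by (auto simp: ZZq_algebra_def)

lemma phi_0: "\<phi> 0 = 0"
proof -
  have "\<phi> 0 + 0 = \<phi> 0 + \<phi> 0" using phi_add[OF ZZq_0 ZZq_0] by simp
  then show ?thesis unfolding add_left_cancel ..
qed

lemma phi_uminus: "a \<in> ZZq \<Longrightarrow> \<phi> (- a) = - \<phi> a"
  using phi_add[of a "- a"] ZZq_uminus[of a] phi_0 by (simp add: eq_neg_iff_add_eq_0 add.commute)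

lemma phi_diff: "a \<in> ZZq \<Longrightarrow> b \<in> ZZq \<Longrightarrow> \<phi> (a - b) = \<phi> a - \<phi> b"
  using phi_add[of a "- b"] ZZq_uminus[of b] phi_uminus[of b] by simp

lemma phi_sum: "(\<And>a. a \<in> A \<Longrightarrow> f a \<in> ZZq) \<Longrightarrow> \<phi> (sum f A) = (\<Sum>a\<in>A. \<phi> (f a))"
  by (induction A rule: infinite_finite_induct) (auto simp: phi_0 phi_add ZZq_sum)

lemma phi_power: "a \<in> ZZq \<Longrightarrow> \<phi> (a ^ k) = \<phi> a ^ k"
  by (induction k) (auto simp: phi_1 phi_mult ZZq_power)

lemma phi_qq_inverse: "\<phi> qq * \<phi> (inverse qq) = 1"
  using phi_mult[OF ZZq_qq ZZq_inverse_qq] phi_1 by simp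

lemma phi_qq_nz [simp]: "\<phi> qq \<noteq> 0"
  using phi_qq_inverse by auto

lemma phi_inverse_qq: "\<phi> (inverse qq) = inverse (\<phi> qq)"
  using phi_qq_inverse by (metis inverse_unique)

lemma ZZq_powi: "qq powi a \<in> ZZq"
  by (simp add: power_int_def ZZq_power ZZq_qq ZZq_inverse_qq flip: power_inverse)

lemma phi_powi: "\<phi> (qq powi a) = \<phi> qq powi a"
  by (simp add: power_int_def phi_power ZZq_qq ZZq_inverse_qq phi_inverse_qq flip: power_inverse)

lemma ZZq_lco: "lco qq i z \<in> ZZq"
  by (cases z) (auto simp: ZZq_0 ZZq_1 ZZq_inverse_qq ZZq_uminus)

lemma phi_lco: "\<phi> (lco qq i z) = lco (\<phi> qq) i z"
  by (cases z) (auto simp: phi_0 phi_1 ZZq_inverse_qq phi_uminus phi_inverse_qq)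

lemma eop_ZZq: "(\<And>v. x v \<in> ZZq) \<Longrightarrow> eop qq i l x u \<in> ZZq"
  by (induction "qq" i l x u rule: eop.induct) (auto simp: ZZq_0 intro!: ZZq_add ZZq_mult ZZq_lco ZZq_powi)

text \<open>The recursion uses only 0, 1, -1/q and powers of q, all of them in \<open>ZZq\<close>.
  So \<open>\<phi>\<close> passes through it, although it need not respect the inverse factorials in
  \<open>E_div\<close>.\<close>

lemma phi_eop: "(\<And>v. x v \<in> ZZq) \<Longrightarrow> \<phi> (eop qq i l x u) = eop (\<phi> qq) i l (\<lambda>v. \<phi> (x v)) u"
proof (induction "qq" i l x u rule: eop.induct)
  case (3 i l x z u)
  have "\<phi> (eop qq i (Suc l) x (z # u)) = \<phi> (eop qq i (Suc l) (\<lambda>v. x (z # v)) u)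
      + \<phi> (lco qq i z) * \<phi> (qq powi (int l - hp i u)) * \<phi> (eop qq i l (\<lambda>v. x (low z # v)) u)"
    unfolding eop.simps using "3.prems"
    by (simp add: phi_add phi_mult ZZq_mult ZZq_lco ZZq_powi eop_ZZq)
  then show ?case using 3 by (simp add: phi_lco phi_powi)
qed (auto simp: phi_0)

lemma E_div_base_eop:
  assumes i: "i \<in> {1..<n}" and x: "x \<in> mixed n r s"
  shows "E_div_base \<phi> n r s i l x = eop (\<phi> qq) i l x"
proof
  fix u
  have b: "bas w v \<in> ZZq" for w v by (simp add: bas_apply ZZq_0 ZZq_1)
  have pb: "(\<lambda>v. \<phi> (bas w v)) = bas w" for w by (auto simp: bas_apply phi_0 phi_1 fun_eq_iff)
  have "E_div_base \<phi> n r s i l x u =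
      (\<Sum>p\<in>multi_idx n r s. eop (\<phi> qq) i l (\<lambda>v. x (mono_word (fst p) (snd p)) * bas (mono_word (fst p) (snd p)) v) u)"
    unfolding E_div_base_def lin_ext_apply eop_scl
  proof (rule sum.cong[OF refl], clarify)
    fix I J assume IJ: "(I, J) \<in> multi_idx n r s"
    have "\<phi> (E_div n r s i l (bas (mono_word I J)) u) = eop (\<phi> qq) i l (bas (mono_word I J)) u"
      unfolding E_div_eop[OF i bas_mixed[OF IJ]] phi_eop[OF b] pb ..
    then show "x (mono_word I J) * (\<phi> \<circ> E_div n r s i l (bas (mono_word I J))) u =
      x (mono_word (fst (I, J)) (snd (I, J))) * eop (\<phi> qq) i l (bas (mono_word (fst (I, J)) (snd (I, J)))) u"
      by simp
  qed
  also have "\<dots> = eop (\<phi> qq) i l (\<lambda>v. \<Sum>p\<in>multi_idx n r s. x (mono_word (fst p) (snd p)) * bas (mono_word (fst p) (snd p)) v) u"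
    unfolding eop_sum ..
  also have "(\<lambda>v. \<Sum>p\<in>multi_idx n r s. x (mono_word (fst p) (snd p)) * bas (mono_word (fst p) (snd p)) v) = x"
    by (subst (2) mixed_expand[OF x]) (simp add: fun_eq_iff lin_ext_apply case_prod_beta)
  finally show "E_div_base \<phi> n r s i l x u = eop (\<phi> qq) i l x u" .
qed

end

section \<open>Singular vectors are determined on dominant words\<close>

text \<open>Under the i-th quantum sl_2 a letter spans a trivial module or is the upper or lower
  vector of a two-dimensional one; in the last case \<open>z'\<close> is its upper partner.\<close>

lemma lhp_cases: "lhp i z = 0 \<and> lco q i z = 0 \<or> lco q i z \<noteq> 0 \<and> lhp i z = 1 \<or>
    lhp i z = - 1 \<and> lco q i z = 0 \<and> (\<exists>z'. lco q i z' \<noteq> 0 \<and> low z' = z)"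
  if "q \<noteq> (0::'a::field)"
proof (cases z)
  case (Vec j)
  have "\<exists>z'. lco q i z' \<noteq> 0 \<and> low z' = z" if "j = Suc i"
    using that Vec by (intro exI[of _ "Vec i"]) simp
  then show ?thesis using Vec by (auto simp: lhp_def)
next
  case (Dual j)
  have "\<exists>z'. lco q i z' \<noteq> 0 \<and> low z' = z" if "j = i"
    using that Dual \<open>q \<noteq> 0\<close> by (intro exI[of _ "Dual (Suc i)"]) simp
  then show ?thesis using Dual \<open>q \<noteq> 0\<close> by (auto simp: lhp_def)
qed

lemma eop_zero': "(\<And>v. length v = length u \<Longrightarrow> x v = 0) \<Longrightarrow> eop q i l x u = 0"
  using eop_cong[of u x "\<lambda>v. 0" q i l] by (simp add: eop_zero)

text \<open>
  The hypothesis covers all powers \<open>l \<ge> a\<close> rather than all \<open>l > 0\<close>: only in this form does it pass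
  to the components of \<open>x\<close>, whose weights are \<open>- a - 1\<close>, \<open>- a\<close> and \<open>- a + 1\<close>.
\<close>

lemma eop_negative_weight:
  fixes q :: "'a::field"
  assumes q: "q \<noteq> 0"
  shows "0 < a \<Longrightarrow> (\<And>u. length u = N \<Longrightarrow> x u \<noteq> 0 \<Longrightarrow> hp i u = - int a) \<Longrightarrow>
    (\<And>l u. a \<le> l \<Longrightarrow> length u = N \<Longrightarrow> eop q i l x u = 0) \<Longrightarrow> length u = N \<Longrightarrow> x u = 0"
proof (induction N arbitrary: a x u)
  case 0
  then show ?case using "0.prems"(2)[of "[]"] by auto
next
  case (Suc N)
  have wt: "hp i u = - int a - lhp i z" if "length u = N" "x (z # u) \<noteq> 0" for u z
    using Suc.prems(2)[of "z # u"] that by simp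
  have e: "eop q i (Suc l) (\<lambda>v. x (z # v)) u + lco q i z * q powi (int l - hp i u) * eop q i l (\<lambda>v. x (low z # v)) u = 0"
    if "a \<le> Suc l" "length u = N" for l u z
    using Suc.prems(3)[of "Suc l" "z # u"] that by simp
  have e0: "eop q i l (\<lambda>v. x (z # v)) u = 0" if l: "a \<le> l" "length u = N" and "lco q i z = 0" for l u z
  proof -
    obtain l' where "l = Suc l'" using l Suc.prems(1) by (cases l) auto
    then show ?thesis using e[of l' u z] that by simp
  qed
  \<comment> \<open>The component at an upper letter has weight - a - 1. The correction term in the
    recursion belongs to \<open>low z\<close>, which has no correction of its own, so it vanishes
    for powers from a on. Hence the component is killed by all powers from a + 1 on, as the
    induction requires.\<close>
  have plus: "x (z # u) = 0" if z: "lco q i z \<noteq> 0" and u: "length u = N" for z u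
  proof (rule Suc.IH[of "Suc a" "\<lambda>v. x (z # v)", OF _ _ _ u])
    show "hp i u = - int (Suc a)" if "length u = N" "x (z # u) \<noteq> 0" for u
      using wt[OF that] lco_lhp[OF z] by simp
    show "eop q i l (\<lambda>v. x (z # v)) u = 0" if l: "Suc a \<le> l" "length u = N" for l u
    proof -
      obtain l' where l': "l = Suc l'" using l by (cases l) auto
      have "eop q i l' (\<lambda>v. x (low z # v)) u = 0"
        using l l' lco_low[OF z] by (intro e0) auto
      then show ?thesis using e[of l' u z] l l' by simp
    qed
  qed simp
  obtain z v where u: "u = z # v" "length v = N" using Suc.prems(4) by (cases u) auto
  consider "lhp i z = 0" "lco q i z = 0" | "lco q i z \<noteq> 0" |
    z' where "lhp i z = - 1" "lco q i z' \<noteq> 0" "low z' = z"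
    using lhp_cases[OF q, of i z] by blast
  then show ?case
  proof cases
    case 1
    show ?thesis
      unfolding u(1)
    proof (rule Suc.IH[of a "\<lambda>v. x (z # v)", OF Suc.prems(1) _ _ u(2)])
      show "hp i u = - int a" if "length u = N" "x (z # u) \<noteq> 0" for u
        using wt[OF that] 1 by simp
      show "eop q i l (\<lambda>v. x (z # v)) u = 0" if "a \<le> l" "length u = N" for l u
        using e0[OF that 1(2)] .
    qed
  next
    case 2
    then show ?thesis using plus u by simp
  next
    case 3
    \<comment> \<open>The component at the upper partner \<open>z'\<close> is already zero, so the
      equation at \<open>z'\<close> leaves only the term of \<open>z\<close>, one power lower:
      vanishing from a - 1 on. For a = 1 this includes the power 0, that is, the component
      itself.\<close>
    have e': "eop q i l (\<lambda>v. x (z # v)) u = 0" if l: "a \<le> Suc l" "length u = N" for l u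
    proof -
      have "eop q i (Suc l) (\<lambda>v. x (z' # v)) u = 0"
        using plus[OF 3(2)] l by (intro eop_zero') simp
      then show ?thesis using e[OF l, of z'] 3 q by simp
    qed
    show ?thesis
    proof (cases "a = 1")
      case True
      then show ?thesis using e'[of 0 v] u by simp
    next
      case False
      show ?thesis
        unfolding u(1)
      proof (rule Suc.IH[of "a - 1" "\<lambda>v. x (z # v)", OF _ _ _ u(2)])
        show "0 < a - 1" using False Suc.prems(1) by simp
        show "hp i u = - int (a - 1)" if "length u = N" "x (z # u) \<noteq> 0" for u
          using wt[OF that] 3 Suc.prems(1) by simp
        show "eop q i l (\<lambda>v. x (z # v)) u = 0" if "a - 1 \<le> l" "length u = N" for l u
          using e'[of l u] that by simp
      qed
    qed
  qed
qed

text \<open>The condition is imposed on all suffixes because \<open>eop\<close> peels off first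
  letters, so that an induction passes from a tensor to its components on suffixes. These are
  lattice words read from the right.\<close>

fun dom_word :: "nat \<Rightarrow> letter list \<Rightarrow> bool" where
  "dom_word n [] \<longleftrightarrow> True"
| "dom_word n (z # u) \<longleftrightarrow> (\<forall>i\<in>{1..<n}. 0 \<le> hp i (z # u)) \<and> dom_word n u"

text \<open>If some h i is negative, \<open>eop_negative_weight\<close> applies. Otherwise words in
  the support are dominant as soon as their tails are, and the component at a first letter
  \<open>z\<close> inherits the vanishing conditions once the component at \<open>low z\<close> is
  known to be zero.\<close>

lemma singular_vanish:
  fixes q :: "'a::field"
  assumes q: "q \<noteq> 0"
  shows "(\<And>u i. length u = N \<Longrightarrow> x u \<noteq> 0 \<Longrightarrow> i \<in> {1..<n} \<Longrightarrow> hp i u = h i) \<Longrightarrow>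
    (\<And>i l u. i \<in> {1..<n} \<Longrightarrow> 0 < l \<Longrightarrow> length u = N \<Longrightarrow> eop q i l x u = 0) \<Longrightarrow>
    (\<And>u. length u = N \<Longrightarrow> dom_word n u \<Longrightarrow> x u = 0) \<Longrightarrow> length u = N \<Longrightarrow> x u = 0"
proof (induction N arbitrary: x h u)
  case 0
  then show ?case by simp
next
  case (Suc N)
  show ?case
  proof (cases "\<exists>i\<in>{1..<n}. h i < 0")
    case True
    then obtain i where i: "i \<in> {1..<n}" "h i < 0" by blast
    show ?thesis
      by (rule eop_negative_weight[OF q, of "nat (- h i)" "Suc N" x i])
        (use i Suc.prems(1)[OF _ _ i(1)] Suc.prems(2)[OF i(1)] Suc.prems(4) in auto)
  next
    case False
    \<comment> \<open>A measure that drops from \<open>z\<close> to \<open>low z\<close> whenever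
      E_i couples the two components, so that the component at \<open>low z\<close> is treated
      before the one at \<open>z\<close>.\<close>
    define key where "key z = (case z of Vec j \<Rightarrow> n - j | Dual j \<Rightarrow> j)" for z
    have main: "x (z # v) = 0" if "length v = N" for z v
      using that
    proof (induction "key z" arbitrary: z v rule: less_induct)
      case less
      show ?case
      proof (rule Suc.IH[of "\<lambda>v. x (z # v)" "\<lambda>i. h i - lhp i z", OF _ _ _ less.prems])
        show "hp i u = h i - lhp i z" if "length u = N" "x (z # u) \<noteq> 0" "i \<in> {1..<n}" for u i
          using Suc.prems(1)[of "z # u" i] that by simp
        show "x (z # u) = 0" if "length u = N" "dom_word n u" for u
        proof (rule ccontr)
          assume nz: "x (z # u) \<noteq> 0"
          then have "dom_word n (z # u)"
            using False Suc.prems(1)[of "z # u"] that by auto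
          then show False using Suc.prems(3)[of "z # u"] that nz by simp
        qed
        show "eop q i l (\<lambda>v. x (z # v)) u = 0" if i: "i \<in> {1..<n}" and l: "0 < l" and u: "length u = N" for i l u
        proof -
          obtain l' where l': "l = Suc l'" using l by (cases l) auto
          have "eop q i l' (\<lambda>v. x (low z # v)) u = 0" if "lco q i z \<noteq> 0"
          proof (rule eop_zero')
            fix v :: "letter list" assume "length v = length u"
            moreover have "key (low z) < key z"
              using that i by (cases z) (auto simp: key_def split: if_splits)
            ultimately show "x (low z # v) = 0" using less.hyps u by simp
          qed
          then show ?thesis
            using Suc.prems(2)[OF i l, of "z # u"] u unfolding l' by (cases "lco q i z = 0") auto
        qed
      qed
    qed
    obtain z v where "u = z # v" "length v = N" using Suc.prems(4) by (cases u) auto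
    then show ?thesis using main by simp
  qed
qed

definition hw_words :: "nat \<Rightarrow> nat \<Rightarrow> nat \<Rightarrow> (nat \<Rightarrow> int) \<Rightarrow> letter list set" where
  "hw_words n r s \<mu> = {w \<in> (\<lambda>(I, J). mono_word I J) ` multi_idx n r s.
     (\<forall>i\<in>{1..n}. wt i w = \<mu> i) \<and> dom_word n w}"

lemma finite_hw_words: "finite (hw_words n r s \<mu>)"
  unfolding hw_words_def using finite_multi_idx by simp

definition sing_space :: "'a::field \<Rightarrow> nat \<Rightarrow> nat \<Rightarrow> nat \<Rightarrow> (nat \<Rightarrow> int) \<Rightarrow> 'a tensor set" where
  "sing_space q n r s \<mu> = {x \<in> mixed n r s. (\<forall>w. x w \<noteq> 0 \<longrightarrow> (\<forall>i\<in>{1..n}. wt i w = \<mu> i)) \<and>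
     (\<forall>i\<in>{1..<n}. \<forall>l>0. \<forall>u. eop q i l x u = 0)}"

lemma eop_fun_add: "eop q i l (x + y) u = eop q i l x u + eop q i l y u"
  unfolding plus_fun_def by (rule eop_add)

lemma eop_fun_scl: "eop q i l (c \<odot> x) u = c * eop q i l x u"
  unfolding scl_def by (rule eop_scl)

lemma eop_fun_zero: "eop q i l 0 u = 0"
  unfolding zero_fun_def by (rule eop_zero)

lemma sing_space_subspace: "tensor_vs.subspace (sing_space q n r s \<mu>)"
  unfolding tensor_vs.subspace_def
proof (intro conjI ballI allI)
  show "0 \<in> sing_space q n r s \<mu>"
    by (simp add: sing_space_def eop_fun_zero tensor_apply tensor_vs.subspace_0[OF mixed_subspace])
  fix x y assume "x \<in> sing_space q n r s \<mu>" "y \<in> sing_space q n r s \<mu>"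
  moreover have "x w \<noteq> 0 \<or> y w \<noteq> 0" if "(x + y) w \<noteq> 0" for w
    using that by (auto simp: tensor_apply)
  moreover have "eop q i l (x + y) u = 0"
    if "eop q i l x u = 0" "eop q i l y u = 0" for i l u
    using that by (simp only: eop_fun_add add_0)
  ultimately show "x + y \<in> sing_space q n r s \<mu>"
    unfolding sing_space_def mem_Collect_eq using mixed_add by metis
next
  fix c x assume "x \<in> sing_space q n r s \<mu>"
  then show "c \<odot> x \<in> sing_space q n r s \<mu>"
    by (auto simp: sing_space_def eop_fun_scl tensor_apply mixed_scl)
qed

lemma sing_space_vanish:
  assumes q: "q \<noteq> 0" and x: "x \<in> sing_space q n r s \<mu>"
    and v: "\<And>w. w \<in> hw_words n r s \<mu> \<Longrightarrow> x w = 0"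
  shows "x = 0"
proof
  have len: "length w = r + s" if "x w \<noteq> 0" for w
  proof -
    have "w \<in> (\<lambda>(I, J). mono_word I J) ` multi_idx n r s"
      using x that by (auto simp: sing_space_def mixed_def)
    then show ?thesis unfolding mono_word_image_iff by blast
  qed
  fix w
  have "x w = 0" if l: "length w = r + s"
  proof (rule singular_vanish[OF q, of "r + s" x n "\<lambda>i. \<mu> i - \<mu> (Suc i)", OF _ _ _ l])
    show "hp i u = \<mu> i - \<mu> (Suc i)" if "x u \<noteq> 0" "i \<in> {1..<n}" for u i
      using x that by (simp add: sing_space_def hp_def)
    show "eop q i l x u = 0" if "i \<in> {1..<n}" "0 < l" for i l u
      using x that by (simp add: sing_space_def)
    show "x u = 0" if "dom_word n u" for u
    proof (rule ccontr)
      assume nz: "x u \<noteq> 0"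
      then have "u \<in> hw_words n r s \<mu>"
        using x that by (auto simp: sing_space_def hw_words_def mixed_def)
      with v nz show False by blast
    qed
  qed
  then show "x w = 0 w" using len[of w] by (auto simp: tensor_apply)
qed

text \<open>Restriction to the dominant words is injective on \<open>sing_space\<close>, so its
  dimension is at most their number; an independent set of at least that size must span.\<close>

lemma sing_space_span:
  assumes q: "q \<noteq> 0" and S: "S \<subseteq> sing_space q n r s \<mu>" "finite S" "\<not> tensor_vs.dependent S"
    and card: "card (hw_words n r s \<mu>) \<le> card S"
  shows "sing_space q n r s \<mu> \<subseteq> tensor_vs.span S"
proof (rule ccontr)
  let ?P = "hw_words n r s \<mu>"
  assume "\<not> ?thesis"
  then obtain x where x: "x \<in> sing_space q n r s \<mu>" "x \<notin> tensor_vs.span S" by blast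
  have ind: "tensor_vs.independent (insert x S)"
    using S x by (simp add: tensor_vs.independent_insert)
  have nin: "x \<notin> S" using x(2) tensor_vs.span_base by blast
  define R where "R y = (\<lambda>w. if w \<in> ?P then y w else 0)" for y :: "'a tensor"
  have RS: "tensor_vs.subspace (sing_space q n r s \<mu>)" by (rule sing_space_subspace)
  interpret R: module_hom "(\<odot>) :: 'a \<Rightarrow> _" "(\<odot>)" R
    by unfold_locales (auto simp: R_def fun_eq_iff tensor_apply algebra_simps)
  have sub: "tensor_vs.span (insert x S) \<subseteq> sing_space q n r s \<mu>"
    using x(1) S(1) by (intro tensor_vs.span_minimal RS) auto
  have inj: "inj_on R (tensor_vs.span (insert x S))"
  proof (rule inj_onI)
    fix y z assume yz: "y \<in> tensor_vs.span (insert x S)" "z \<in> tensor_vs.span (insert x S)" "R y = R z"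
    then have "y - z \<in> sing_space q n r s \<mu>"
      using sub tensor_vs.span_diff by blast
    moreover have "(y - z) w = 0" if "w \<in> ?P" for w
      using fun_cong[OF yz(3), of w] that by (simp add: R_def)
    ultimately have "y - z = 0" by (rule sing_space_vanish[OF q])
    then show "y = z" by simp
  qed
  have i2: "tensor_vs.independent (R ` insert x S)"
    using R.independent_injective_image[OF ind inj] .
  have "R y \<in> tensor_vs.span (bas ` ?P)" for y
  proof -
    have R_eq: "R y = (\<Sum>w\<in>?P. y w \<odot> bas w)"
      by (auto simp: R_def fun_eq_iff tensor_sum_apply tensor_apply bas_apply finite_hw_words if_distrib cong: if_cong)
    show ?thesis
      unfolding R_eq by (intro tensor_vs.span_sum tensor_vs.span_scale tensor_vs.span_base imageI)
  qed
  then have "R ` insert x S \<subseteq> tensor_vs.span (bas ` ?P)" by blast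
  from tensor_vs.independent_span_bound[OF finite_imageI[OF finite_hw_words] i2 this]
  have "card (R ` insert x S) \<le> card (bas ` ?P :: 'a tensor set)" by (rule conjunct2)
  moreover have "card (R ` insert x S) = Suc (card S)"
    unfolding card_image[OF inj_on_subset[OF inj tensor_vs.span_superset]] using card_insert_disjoint[OF S(2) nin] .
  moreover have "card (bas ` ?P :: 'a tensor set) \<le> card ?P"
    by (rule card_image_le) (rule finite_hw_words)
  ultimately show False using card by simp
qed

section \<open>Weight spaces\<close>

lemma qh_act_coeff:
  assumes q: "q \<noteq> 0" and x: "x \<in> mixed n r s"
  shows "qh_act q n r s (\<lambda>j. if j = i then 1 else 0) x w = q powi (wt i w) * x w"
proof -
  have "qh_act q n r s (\<lambda>j. if j = i then 1 else 0) x w =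
      (\<Sum>p\<in>multi_idx n r s. q powi (wt i w) * (x (mono_word (fst p) (snd p)) * bas (mono_word (fst p) (snd p)) w))"
    unfolding qh_act_def lin_ext_apply qh_word_eps[OF q]
    by (rule sum.cong) (auto simp: tensor_apply bas_apply)
  also have "\<dots> = q powi (wt i w) * x w"
    by (subst (2) mixed_expand[OF x]) (simp add: lin_ext_apply case_prod_beta sum_distrib_left)
  finally show ?thesis .
qed

lemma weight_lattice_iff:
  "m \<in> weight_lattice n r s \<mu> \<longleftrightarrow> m \<in> lattice n r s \<and> (\<forall>w. m w \<noteq> 0 \<longrightarrow> (\<forall>i\<in>{1..n}. wt i w = \<mu> i))"
proof (cases "m \<in> lattice n r s")
  case True
  then have m: "m \<in> mixed n r s" by (simp add: lattice_def)
  have "qh_act qq n r s (\<lambda>j. if j = i then 1 else 0) m = (qq powi \<mu> i) \<odot> m \<longleftrightarrow>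
      (\<forall>w. m w \<noteq> 0 \<longrightarrow> wt i w = \<mu> i)" for i
    unfolding fun_eq_iff qh_act_coeff[OF qq_nz m] tensor_apply mult_cancel_right qq_powi_eq by blast
  then show ?thesis using True by (auto simp: weight_lattice_def)
qed (simp add: weight_lattice_def)

context ground_field
begin

lemma weight_space_support:
  assumes "x \<in> weight_space \<phi> n r s \<mu>"
  shows "x \<in> mixed n r s \<and> (\<forall>w. x w \<noteq> 0 \<longrightarrow> (\<forall>i\<in>{1..n}. wt i w = \<mu> i))"
proof -
  let ?W = "{x :: 'k tensor. x \<in> mixed n r s \<and> (\<forall>w. x w \<noteq> 0 \<longrightarrow> (\<forall>i\<in>{1..n}. wt i w = \<mu> i))}"
  have s: "tensor_vs.subspace ?W"
    unfolding tensor_vs.subspace_def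
  proof (intro conjI ballI allI)
    show "0 \<in> ?W" by (simp add: tensor_apply tensor_vs.subspace_0[OF mixed_subspace])
    fix x y assume xy: "x \<in> ?W" "y \<in> ?W"
    have "x w \<noteq> 0 \<or> y w \<noteq> 0" if "(x + y) w \<noteq> 0" for w
      using that by (auto simp: tensor_apply)
    with xy show "x + y \<in> ?W" by (simp add: mixed_add) blast
  next
    fix c x assume "x \<in> ?W"
    then show "c \<odot> x \<in> ?W" by (simp add: mixed_scl tensor_apply)
  qed
  have "(\<lambda>m. \<phi> \<circ> m) ` weight_lattice n r s \<mu> \<subseteq> ?W"
  proof (rule image_subsetI)
    fix m assume "m \<in> weight_lattice n r s \<mu>"
    then have m: "m \<in> mixed n r s" "\<And>w. m w \<noteq> 0 \<Longrightarrow> \<forall>i\<in>{1..n}. wt i w = \<mu> i"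
      by (auto simp: weight_lattice_iff lattice_def)
    moreover have "m w \<noteq> 0" if "(\<phi> \<circ> m) w \<noteq> 0" for w
      using that phi_0 by auto
    moreover have "\<phi> \<circ> m \<in> mixed n r s"
      using m(1) by (simp add: mixed_def phi_0)
    ultimately show "\<phi> \<circ> m \<in> ?W" by blast
  qed
  from tensor_vs.span_minimal[OF this s] assms show ?thesis
    unfolding weight_space_def by blast
qed

lemma span_singular_vectors:
  "tensor_vs.span (singular_vectors \<phi> n r s \<mu>) \<subseteq> sing_space (\<phi> qq) n r s \<mu>"
proof (rule tensor_vs.span_minimal[OF _ sing_space_subspace], rule subsetI)
  fix x assume x: "x \<in> singular_vectors \<phi> n r s \<mu>"
  then have w: "x \<in> mixed n r s" "\<forall>w. x w \<noteq> 0 \<longrightarrow> (\<forall>i\<in>{1..n}. wt i w = \<mu> i)"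
    using weight_space_support by (auto simp: singular_vectors_def)
  have "eop (\<phi> qq) i l x u = 0" if "i \<in> {1..<n}" "0 < l" for i l u
    using x that E_div_base_eop[OF that(1) w(1), of l] by (auto simp: singular_vectors_def tensor_apply)
  then show "x \<in> sing_space (\<phi> qq) n r s \<mu>"
    using w by (simp add: sing_space_def)
qed

text \<open>Testing E_i on the integral lift \<open>m\<close> is enough: over the rational functions
  quantum integers are invertible, so all divided powers kill \<open>m\<close>, and
  \<open>phi_eop\<close> carries this over. Over the target field E_i alone would not control its
  divided powers.\<close>

lemma singular_vectorsI:
  assumes m: "m \<in> lattice n r s" and wt: "\<And>w i. m w \<noteq> 0 \<Longrightarrow> i \<in> {1..n} \<Longrightarrow> wt i w = \<mu> i"
    and dom: "\<And>i j. i \<in> {1..n} \<Longrightarrow> j \<in> {1..n} \<Longrightarrow> i \<le> j \<Longrightarrow> \<mu> j \<le> \<mu> i"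
    and E: "\<And>i. i \<in> {1..<n} \<Longrightarrow> eop qq i 1 m = 0"
    and nz: "\<phi> \<circ> m \<noteq> 0"
  shows "\<phi> \<circ> m \<in> singular_vectors \<phi> n r s \<mu>"
proof -
  have mm: "m \<in> mixed n r s" and Z: "\<And>v. m v \<in> ZZq" using m by (auto simp: lattice_def)
  have pm: "\<phi> \<circ> m \<in> mixed n r s" using mm by (simp add: mixed_def phi_0)
  have "\<phi> \<circ> m \<in> weight_space \<phi> n r s \<mu>"
    unfolding weight_space_def by (rule tensor_vs.span_base) (use m wt in \<open>auto simp: weight_lattice_iff\<close>)
  moreover have "E_div_base \<phi> n r s i l (\<phi> \<circ> m) = 0" if i: "i \<in> {1..<n}" and l: "0 < l" for i l
  proof
    fix u
    have "eop qq i (Suc k) m = 0" for k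
    proof (induction k)
      case 0
      show ?case using E[OF i] by simp
    next
      case (Suc k)
      have "qint qq (Suc (Suc k)) * eop qq i (Suc (Suc k)) m v = 0" for v
        using eop_1_eop[OF qq_nz qq_diff_nz, of i "Suc k" m v] Suc eop_fun_zero[of qq i 1 v] by simp
      then show ?case using qint_qq_nz[of "Suc (Suc k)"] by (simp add: fun_eq_iff tensor_apply)
    qed
    moreover obtain k where "l = Suc k" using l by (cases l) auto
    ultimately have e: "eop qq i l m u = 0" by (simp add: tensor_apply)
    have "E_div_base \<phi> n r s i l (\<phi> \<circ> m) u = eop (\<phi> qq) i l (\<lambda>v. \<phi> (m v)) u"
      unfolding E_div_base_eop[OF i pm] by (simp add: comp_def)
    also have "\<dots> = \<phi> (eop qq i l m u)"
      by (rule phi_eop[OF Z, symmetric])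
    finally show "E_div_base \<phi> n r s i l (\<phi> \<circ> m) u = 0 u"
      unfolding e phi_0 by (simp add: tensor_apply)
  qed
  ultimately show ?thesis
    using nz dom by (simp add: singular_vectors_def)
qed

end

section \<open>Counting dominant words\<close>

lemma partitions_zero:
  assumes p: "p \<in> partitions m" and i: "m \<le> i"
  shows "p i = 0"
proof (rule ccontr)
  assume nz: "p i \<noteq> 0"
  have a: "antimono p" and fin: "finite {i. p i \<noteq> 0}" and sm: "(\<Sum>i | p i \<noteq> 0. p i) = m"
    using p by (auto simp: partitions_def)
  have "p j \<noteq> 0" if "j \<le> i" for j
    using antimonoD[OF a that] nz by simp
  then have "{..i} \<subseteq> {i. p i \<noteq> 0}" by auto
  then have "card {..i} \<le> card {i. p i \<noteq> 0}" by (rule card_mono[OF fin])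
  also have "\<dots> = (\<Sum>i | p i \<noteq> 0. 1)" by simp
  also have "\<dots> \<le> (\<Sum>i | p i \<noteq> 0. p i)" by (rule sum_mono) auto
  finally show False using sm i by simp
qed

lemma partitions_iff:
  assumes z: "\<And>i. M \<le> i \<Longrightarrow> p i = 0"
  shows "p \<in> partitions m \<longleftrightarrow> antimono p \<and> (\<Sum>i<M. p i) = m"
proof -
  have s: "{i. p i \<noteq> 0} \<subseteq> {..<M}"
  proof (rule subsetI)
    fix i assume "i \<in> {i. p i \<noteq> 0}"
    then show "i \<in> {..<M}" using z[of i] by (cases "M \<le> i") auto
  qed
  have "(\<Sum>i | p i \<noteq> 0. p i) = (\<Sum>i<M. p i)"
    by (rule sum.mono_neutral_left) (use s in auto)
  then show ?thesis
    using finite_subset[OF s] by (simp add: partitions_def)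
qed

lemma partitions_antimono: "p \<in> partitions m \<Longrightarrow> i \<le> j \<Longrightarrow> p j \<le> p i"
  by (auto simp: partitions_def dest: antimonoD)

section \<open>Young's lattice and the relation DU - UD = 1\<close>

definition addable :: "(nat \<Rightarrow> nat) \<Rightarrow> nat set" where
  "addable p = {j. j = 0 \<or> p j < p (j - 1)}"

definition removable :: "(nat \<Rightarrow> nat) \<Rightarrow> nat set" where
  "removable p = {j. p (Suc j) < p j}"

lemma antimono_Suc: "antimono p \<longleftrightarrow> (\<forall>j. p (Suc j) \<le> p j)" for p :: "nat \<Rightarrow> nat"
  by (metis antimonoD antimonoI lift_Suc_antimono_le le_SucI order_refl)

lemma partitions_remove:
  assumes p: "p \<in> partitions (Suc m)" and j: "j \<in> removable p"
  shows "p(j := p j - 1) \<in> partitions m"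
proof -
  have z: "p i = 0" if "Suc (Suc m) + j \<le> i" for i
    using partitions_zero[OF p] that by simp
  have P: "antimono p" "(\<Sum>i<Suc (Suc m) + j. p i) = Suc m"
    using p partitions_iff[where p = p, OF z] by blast+
  have "(\<Sum>i<Suc (Suc m) + j. p i) = p j + (\<Sum>i\<in>{..<Suc (Suc m) + j} - {j}. p i)"
    by (rule sum.remove) auto
  moreover have "(\<Sum>i<Suc (Suc m) + j. (p(j := p j - 1)) i) = p j - 1 + (\<Sum>i\<in>{..<Suc (Suc m) + j} - {j}. (p(j := p j - 1)) i)"
    by (subst sum.remove[of _ j]) auto
  moreover have "(\<Sum>i\<in>{..<Suc (Suc m) + j} - {j}. (p(j := p j - 1)) i) = (\<Sum>i\<in>{..<Suc (Suc m) + j} - {j}. p i)"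
    by (rule sum.cong) auto
  ultimately have "(\<Sum>i<Suc (Suc m) + j. (p(j := p j - 1)) i) = m"
    using P(2) j unfolding removable_def by simp
  moreover have "antimono (p(j := p j - 1))"
    using P(1) j unfolding antimono_Suc removable_def by (auto intro: le_trans diff_le_self)
  ultimately show ?thesis
    by (subst partitions_iff[of "Suc (Suc m) + j"]) (use z in auto)
qed

lemma partitions_add:
  assumes p: "p \<in> partitions m" and j: "j \<in> addable p"
  shows "p(j := Suc (p j)) \<in> partitions (Suc m)"
proof -
  have z: "p i = 0" if "Suc m + j \<le> i" for i
    using partitions_zero[OF p] that by simp
  have P: "antimono p" "(\<Sum>i<Suc m + j. p i) = m"
    using p partitions_iff[where p = p, OF z] by blast+
  have "(\<Sum>i<Suc m + j. p i) = p j + (\<Sum>i\<in>{..<Suc m + j} - {j}. p i)"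
    by (rule sum.remove) auto
  moreover have "(\<Sum>i<Suc m + j. (p(j := Suc (p j))) i) = Suc (p j) + (\<Sum>i\<in>{..<Suc m + j} - {j}. (p(j := Suc (p j))) i)"
    by (subst sum.remove[of _ j]) auto
  moreover have "(\<Sum>i\<in>{..<Suc m + j} - {j}. (p(j := Suc (p j))) i) = (\<Sum>i\<in>{..<Suc m + j} - {j}. p i)"
    by (rule sum.cong) auto
  ultimately have "(\<Sum>i<Suc m + j. (p(j := Suc (p j))) i) = Suc m"
    using P(2) by simp
  moreover have "antimono (p(j := Suc (p j)))"
    unfolding antimono_Suc
  proof
    fix k show "(p(j := Suc (p j))) (Suc k) \<le> (p(j := Suc (p j))) k"
      using P(1) j unfolding antimono_Suc addable_def by (cases "Suc k = j") (auto intro: le_SucI)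
  qed
  ultimately show ?thesis
    by (subst partitions_iff[of "Suc m + j"]) (use z in auto)
qed

lemma finite_removable: "p \<in> partitions m \<Longrightarrow> finite (removable p)"
  by (rule finite_subset[of _ "{..<m}"]) (auto simp: removable_def partitions_zero not_le[symmetric])

lemma addable_eq: "addable p = insert 0 (Suc ` removable p)"
proof -
  have "j \<in> addable p \<longleftrightarrow> j \<in> insert 0 (Suc ` removable p)" for j
    by (cases j) (auto simp: addable_def removable_def)
  then show ?thesis by blast
qed

lemma finite_addable: "p \<in> partitions m \<Longrightarrow> finite (addable p)"
  by (simp add: addable_eq finite_removable)

lemma card_addable: "p \<in> partitions m \<Longrightarrow> card (addable p) = Suc (card (removable p))"
  unfolding addable_eq by (subst card_insert_disjoint) (auto simp: finite_removable card_image)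

text \<open>Counts the paths from \<open>p\<close> down to the empty partition in Young's lattice,
  which correspond to the standard tableaux of shape \<open>p\<close>.\<close>

fun ypath :: "nat \<Rightarrow> (nat \<Rightarrow> nat) \<Rightarrow> nat" where
  "ypath 0 p = 1"
| "ypath (Suc m) p = (\<Sum>j\<in>removable p. ypath m (p(j := p j - 1)))"

text \<open>The off-diagonal part of DU - UD = 1: in different rows the order of adding and removing
  a box is immaterial. Only adjacent rows interact, and there both sides ask for a gap of at least
  two.\<close>

lemma add_remove_iff:
  assumes "j \<noteq> k"
  shows "j \<in> addable p \<and> k \<in> removable (p(j := Suc (p j))) \<longleftrightarrow>
    k \<in> removable p \<and> j \<in> addable (p(k := p k - 1))"
proof -
  show ?thesis
  proof (cases "j = Suc k")
    case True
    then show ?thesis by (auto simp: addable_def removable_def)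
  next
    case False
    then have "j \<noteq> 0 \<Longrightarrow> j - 1 \<noteq> k" by auto
    then show ?thesis using False assms by (auto simp: addable_def removable_def)
  qed
qed

text \<open>Expand every summand on the left by the box removed next, and (m + 1) times the count
  for \<open>p\<close> by the induction hypothesis for \<open>p\<close> with a box removed. The
  terms with two different rows agree by \<open>add_remove_iff\<close>. The terms returning to
  \<open>p\<close> occur once per addable row in the first expansion and once per removable row in
  the second; the one additional addable row gives the new summand.\<close>

lemma ypath_add:
  "p \<in> partitions m \<Longrightarrow> (\<Sum>j\<in>addable p. ypath (Suc m) (p(j := Suc (p j)))) = Suc m * ypath m p"
proof (induction m arbitrary: p)
  case 0
  then have p: "p = (\<lambda>i. 0)" using partitions_zero by blast
  have "addable p = {0}" "removable (p(0 := Suc (p 0))) = {0}"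
    by (auto simp: p addable_def removable_def)
  then show ?case by (simp del: fun_upd_apply)
next
  case (Suc m)
  note fa = finite_addable[OF Suc.prems] and fr = finite_removable[OF Suc.prems]
  have anti: "antimono p" using Suc.prems by (simp add: partitions_def)
  let ?A = "\<lambda>j. p(j := Suc (p j))" and ?R = "\<lambda>k. p(k := p k - 1)"
  let ?Z = "\<lambda>j k. ypath (Suc m) ((?A j)(k := p k - 1))"
  have Rj: "j \<in> removable (?A j)" for j
    using anti by (auto simp: removable_def antimono_Suc le_imp_less_Suc)
  have fRA: "finite (removable (?A j))" if "j \<in> addable p" for j
    using finite_removable[OF partitions_add[OF Suc.prems that]] .
  have 1: "ypath (Suc (Suc m)) (?A j) = ypath (Suc m) p + (\<Sum>k\<in>removable (?A j) - {j}. ?Z j k)" if "j \<in> addable p" for j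
  proof -
    have "ypath (Suc (Suc m)) (?A j) = (\<Sum>k\<in>removable (?A j). ypath (Suc m) ((?A j)(k := ?A j k - 1)))"
      by (simp only: ypath.simps)
    also have "\<dots> = ypath (Suc m) ((?A j)(j := ?A j j - 1)) + (\<Sum>k\<in>removable (?A j) - {j}. ypath (Suc m) ((?A j)(k := ?A j k - 1)))"
      by (rule sum.remove[OF fRA[OF that] Rj])
    also have "(?A j)(j := ?A j j - 1) = p" by simp
    also have "(\<Sum>k\<in>removable (?A j) - {j}. ypath (Suc m) ((?A j)(k := ?A j k - 1))) = (\<Sum>k\<in>removable (?A j) - {j}. ?Z j k)"
      by (rule sum.cong) auto
    finally show ?thesis .
  qed
  have 2: "Suc m * ypath m (?R k) = ypath (Suc m) p + (\<Sum>j\<in>addable (?R k) - {k}. ?Z j k)" if k: "k \<in> removable p" for k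
  proof -
    have Rk: "?R k \<in> partitions m" by (rule partitions_remove[OF Suc.prems k])
    have Ak: "k \<in> addable (?R k)"
      using k partitions_antimono[OF Suc.prems, of "k - 1" k] by (auto simp: addable_def removable_def)
    have restore: "(?R k)(k := Suc (?R k k)) = p" using k by (auto simp: removable_def)
    have "Suc m * ypath m (?R k) = (\<Sum>j\<in>addable (?R k). ypath (Suc m) ((?R k)(j := Suc (?R k j))))"
      using Suc.IH[OF Rk] by (rule sym)
    also have "\<dots> = ypath (Suc m) ((?R k)(k := Suc (?R k k))) + (\<Sum>j\<in>addable (?R k) - {k}. ypath (Suc m) ((?R k)(j := Suc (?R k j))))"
      by (rule sum.remove[OF finite_addable[OF Rk] Ak])
    also have "(\<Sum>j\<in>addable (?R k) - {k}. ypath (Suc m) ((?R k)(j := Suc (?R k j)))) = (\<Sum>j\<in>addable (?R k) - {k}. ?Z j k)"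
    proof (rule sum.cong[OF refl])
      fix j assume "j \<in> addable (?R k) - {k}"
      then have "(?R k)(j := Suc (?R k j)) = (?A j)(k := p k - 1)" by (auto simp: fun_eq_iff)
      then show "ypath (Suc m) ((?R k)(j := Suc (?R k j))) = ?Z j k" by (simp only:)
    qed
    finally show ?thesis unfolding restore .
  qed
  have swap: "(\<Sum>j\<in>addable p. \<Sum>k\<in>removable (?A j) - {j}. ?Z j k) = (\<Sum>k\<in>removable p. \<Sum>j\<in>addable (?R k) - {k}. ?Z j k)"
  proof -
    have f1: "\<forall>j\<in>addable p. finite (removable (?A j) - {j})" using fRA by blast
    have f2: "\<forall>k\<in>removable p. finite (addable (?R k) - {k})"
      using finite_addable[OF partitions_remove[OF Suc.prems]] by blast
    show ?thesis
      unfolding sum.Sigma[OF fa f1] sum.Sigma[OF fr f2]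
    proof (rule sum.reindex_bij_witness[where i = "\<lambda>(k, j). (j, k)" and j = "\<lambda>(j, k). (k, j)"])
      fix a assume a: "a \<in> (SIGMA j:addable p. removable (?A j) - {j})"
      obtain j k where e: "a = (j, k)" by (cases a)
      have "k \<noteq> j" "j \<in> addable p" "k \<in> removable (?A j)" using a unfolding e by blast+
      moreover from this have "k \<in> removable p" "j \<in> addable (?R k)"
        using add_remove_iff[of j k p] by blast+
      ultimately show "(case a of (j, k) \<Rightarrow> (k, j)) \<in> (SIGMA k:removable p. addable (?R k) - {k})"
        unfolding e by (simp del: fun_upd_apply)
    next
      fix b assume b: "b \<in> (SIGMA k:removable p. addable (?R k) - {k})"
      obtain k j where e: "b = (k, j)" by (cases b)
      have "j \<noteq> k" "k \<in> removable p" "j \<in> addable (?R k)" using b unfolding e by blast+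
      moreover from this have "j \<in> addable p" "k \<in> removable (?A j)"
        using add_remove_iff[of j k p] by blast+
      ultimately show "(case b of (k, j) \<Rightarrow> (j, k)) \<in> (SIGMA j:addable p. removable (?A j) - {j})"
        unfolding e by (simp del: fun_upd_apply)
    qed auto
  qed
  let ?D = "\<Sum>k\<in>removable p. \<Sum>j\<in>addable (?R k) - {k}. ?Z j k"
  have "(\<Sum>j\<in>addable p. ypath (Suc (Suc m)) (?A j)) = card (addable p) * ypath (Suc m) p + ?D"
    using 1 swap by (simp add: sum.distrib del: ypath.simps)
  moreover have "Suc m * ypath (Suc m) p = card (removable p) * ypath (Suc m) p + ?D"
  proof -
    have "Suc m * ypath (Suc m) p = (\<Sum>k\<in>removable p. Suc m * ypath m (?R k))"
      by (simp only: ypath.simps(2)[of m p] sum_distrib_left)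
    also have "\<dots> = (\<Sum>k\<in>removable p. ypath (Suc m) p + (\<Sum>j\<in>addable (?R k) - {k}. ?Z j k))"
      by (rule sum.cong[OF refl 2])
    finally show ?thesis by (simp add: sum.distrib del: ypath.simps)
  qed
  ultimately show ?case
    using card_addable[OF Suc.prems] by (simp add: algebra_simps del: ypath.simps fun_upd_apply)
qed

section \<open>Dominant words as walks on bipartitions\<close>

lemma wt_mono_word: "wt i (mono_word I J) = int (count_list I i) - int (count_list J i)"
proof -
  have a: "wt i (u @ v) = wt i u + wt i v" for u v by (induction u) auto
  have 1: "wt i (map Vec A) = int (count_list A i)" for A by (induction A) auto
  have 2: "wt i (map Dual A) = - int (count_list A i)" for A by (induction A) auto
  have 3: "count_list (rev A) i = count_list A i" for A by (induction A) auto
  show ?thesis by (simp add: mono_word_def a 1 2 3)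
qed

lemma sum_count_list_le: "finite Z \<Longrightarrow> (\<Sum>i\<in>Z. count_list J i) \<le> length J"
proof (induction J)
  case (Cons a J)
  have "(\<Sum>i\<in>Z. count_list (a # J) i) = (\<Sum>i\<in>Z. count_list J i) + (\<Sum>i\<in>Z. if i = a then 1 else 0)"
    by (simp flip: sum.distrib) (rule sum.cong, auto)
  also have "(\<Sum>i\<in>Z. if i = a then 1 else 0) \<le> (1::nat)" using Cons.prems by simp
  finally show ?case using Cons by simp
qed simp

lemma dom_word_hp: "dom_word n u \<Longrightarrow> i \<in> {1..<n} \<Longrightarrow> 0 \<le> hp i u"
  by (cases u) auto

text \<open>Row j of \<beta>, counted from zero, belongs to the coordinate n - j, so a first letter
  \<open>Dual (n - j)\<close> accounts for one box of that row; the row is removable because the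
  remaining suffix is dominant.\<close>

lemma hw_words_dual_step:
  assumes \<beta>: "\<beta> \<in> partitions (Suc s)" and n: "Suc s \<le> n"
    and w: "w \<in> hw_words n 0 (Suc s) (tilde_weight n (\<lambda>_. 0, \<beta>))"
  shows "\<exists>j\<in>removable \<beta>. \<exists>u\<in>hw_words n 0 s (tilde_weight n (\<lambda>_. 0, \<beta>(j := \<beta> j - 1))). w = Dual (n - j) # u"
proof -
  obtain J where J: "w = map Dual J" "length J = Suc s" "set J \<subseteq> {1..n}"
    and wt: "\<And>i. i \<in> {1..n} \<Longrightarrow> wt i w = - int (\<beta> (n - i))" and dom: "dom_word n w"
    using w by (auto simp: hw_words_def multi_idx_def mono_word_def tilde_weight_def)
  then obtain k J' where J': "J = k # J'" "length J' = s" by (cases J) auto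
  define u where "u = map Dual J'"
  have wu: "w = Dual k # u" using J J' by (simp add: u_def)
  have k: "k \<in> {1..n}" using J J' by simp
  define j where "j = n - k"
  have kj: "k = n - j" "j < n" using k by (auto simp: j_def)
  have wtu: "wt i u = - int (\<beta> (n - i)) + (if i = k then 1 else 0)" if "i \<in> {1..n}" for i
    using wt[OF that] by (auto simp: wu split: if_splits)
  have u0: "wt i u \<le> 0" for i
    using wt_mono_word[of i "[]" J'] by (simp add: u_def mono_word_def)
  have du: "dom_word n u" using dom by (simp add: wu)
  have pos: "\<beta> j > 0" using wtu[OF k] u0[of k] by (simp add: j_def)
  have "\<beta> (Suc j) < \<beta> j"
  proof (cases "k = 1")
    case True
    then have "\<beta> (Suc j) = 0" using partitions_zero[OF \<beta>] n k by (simp add: j_def)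
    then show ?thesis using pos by simp
  next
    case False
    then have k1: "k - 1 \<in> {1..<n}" "Suc (k - 1) = k" "n - (k - 1) = Suc j" "k - 1 \<in> {1..n}" using k by (auto simp: j_def)
    have "0 \<le> wt (k - 1) u - wt k u" using dom_word_hp[OF du k1(1)] k1(2) by (simp add: hp_def)
    then show ?thesis using wtu[OF k1(4)] wtu[OF k] k1 False by (simp add: j_def)
  qed
  then have rem: "j \<in> removable \<beta>" by (simp add: removable_def)
  have "u \<in> hw_words n 0 s (tilde_weight n (\<lambda>_. 0, \<beta>(j := \<beta> j - 1)))"
    unfolding hw_words_def
  proof (intro CollectI conjI ballI du)
    show "u \<in> (\<lambda>(I, J). mono_word I J) ` multi_idx n 0 s"
      using J J' by (intro image_eqI[of _ _ "([], J')"]) (auto simp: u_def mono_word_def multi_idx_def)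
    fix i assume i: "i \<in> {1..n}"
    have "n - i = j \<longleftrightarrow> i = k" using i k by (auto simp: j_def)
    then show "wt i u = tilde_weight n (\<lambda>_. 0, \<beta>(j := \<beta> j - 1)) i"
      using wtu[OF i] pos by (auto simp: tilde_weight_def)
  qed
  then show ?thesis using rem wu kj by auto
qed

lemma card_hw_words_dual:
  "\<beta> \<in> partitions s \<Longrightarrow> s \<le> n \<Longrightarrow> card (hw_words n 0 s (tilde_weight n (\<lambda>_. 0, \<beta>))) \<le> ypath s \<beta>"
proof (induction s arbitrary: \<beta>)
  case 0
  have "hw_words n 0 0 (tilde_weight n (\<lambda>_. 0, \<beta>)) \<subseteq> {[]}"
    by (auto simp: hw_words_def multi_idx_def mono_word_def)
  then have "card (hw_words n 0 0 (tilde_weight n (\<lambda>_. 0, \<beta>))) \<le> card {[] :: letter list}" by (intro card_mono) auto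
  then show ?case by simp
next
  case (Suc s)
  let ?H = "\<lambda>j. hw_words n 0 s (tilde_weight n (\<lambda>_. 0, \<beta>(j := \<beta> j - 1)))"
  have "hw_words n 0 (Suc s) (tilde_weight n (\<lambda>_. 0, \<beta>)) \<subseteq> (\<Union>j\<in>removable \<beta>. (#) (Dual (n - j)) ` ?H j)"
    using hw_words_dual_step[OF Suc.prems] by blast
  then have "card (hw_words n 0 (Suc s) (tilde_weight n (\<lambda>_. 0, \<beta>))) \<le> card (\<Union>j\<in>removable \<beta>. (#) (Dual (n - j)) ` ?H j)"
    using finite_removable[OF Suc.prems(1)] finite_hw_words by (intro card_mono) auto
  also have "\<dots> \<le> (\<Sum>j\<in>removable \<beta>. card ((#) (Dual (n - j)) ` ?H j))"
    by (rule card_UN_le[OF finite_removable[OF Suc.prems(1)]])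
  also have "\<dots> \<le> (\<Sum>j\<in>removable \<beta>. ypath s (\<beta>(j := \<beta> j - 1)))"
    using Suc.IH[OF partitions_remove[OF Suc.prems(1)]] Suc.prems(2)
    by (intro sum_mono order_trans[OF card_image_le[OF finite_hw_words]]) (simp del: fun_upd_apply)
  finally show ?case by simp
qed

text \<open>The coordinate k carries row k - 1 of \<alpha> and row n - k of \<beta>, and for large n
  not both are nonzero. If \<alpha> has a box there, the first letter created it; otherwise the
  letter cancelled a box of the second component, which is larger by this box for the
  suffix.\<close>

lemma hw_words_vec_step:
  assumes f: "f \<le> Suc r" "f \<le> s" and \<alpha>: "\<alpha> \<in> partitions (Suc r - f)" and \<beta>: "\<beta> \<in> partitions (s - f)"
    and n: "Suc r + s \<le> n" and w: "w \<in> hw_words n (Suc r) s (tilde_weight n (\<alpha>, \<beta>))"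
  shows "(\<exists>j\<in>removable \<alpha>. \<exists>u\<in>hw_words n r s (tilde_weight n (\<alpha>(j := \<alpha> j - 1), \<beta>)). w = Vec (Suc j) # u) \<or>
    f > 0 \<and> (\<exists>j\<in>addable \<beta>. \<exists>u\<in>hw_words n r s (tilde_weight n (\<alpha>, \<beta>(j := Suc (\<beta> j)))). w = Vec (n - j) # u)"
proof -
  obtain I J where IJ: "w = mono_word I J" "length I = Suc r" "length J = s" "set I \<subseteq> {1..n}" "set J \<subseteq> {1..n}"
    and wt: "\<And>i. i \<in> {1..n} \<Longrightarrow> wt i w = int (\<alpha> (i - 1)) - int (\<beta> (n - i))" and dom: "dom_word n w"
    using w by (auto simp: hw_words_def multi_idx_def tilde_weight_def)
  obtain k I' where I': "I = I' @ [k]" "length I' = r" using IJ(2) by (cases I rule: rev_cases) auto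
  define u where "u = mono_word I' J"
  have wu: "w = Vec k # u" using IJ I' by (simp add: u_def mono_word_def)
  have k: "k \<in> {1..n}" using IJ I' by simp
  have um: "u \<in> (\<lambda>(I, J). mono_word I J) ` multi_idx n r s"
    using IJ I' by (intro image_eqI[of _ _ "(I', J)"]) (auto simp: u_def multi_idx_def)
  have wtu: "wt i u = int (\<alpha> (i - 1)) - int (\<beta> (n - i)) - (if i = k then 1 else 0)" if "i \<in> {1..n}" for i
    using wt[OF that] by (auto simp: wu split: if_splits)
  have du: "dom_word n u" using dom by (simp add: wu)
  have \<alpha>0: "\<alpha> i = 0" if "Suc r - f \<le> i" for i using partitions_zero[OF \<alpha> that] .
  have \<beta>0: "\<beta> i = 0" if "s - f \<le> i" for i using partitions_zero[OF \<beta> that] .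
  show ?thesis
  proof (cases "\<alpha> (k - 1) > 0")
    case True
    then have kr: "k \<le> Suc r - f" using \<alpha>0[of "k - 1"] k by (cases "Suc r - f \<le> k - 1") auto
    have b0: "\<beta> (n - k) = 0" using kr n f k by (intro \<beta>0) auto
    have "\<alpha> k < \<alpha> (k - 1)"
    proof (cases "k = Suc r - f")
      case True
      then show ?thesis using \<open>\<alpha> (k - 1) > 0\<close> \<alpha>0[of k] by simp
    next
      case False
      then have kn: "k \<in> {1..<n}" "Suc k \<in> {1..n}" using kr n k by auto
      have b1: "\<beta> (n - Suc k) = 0" using kr False n f k by (intro \<beta>0) auto
      have "0 \<le> wt k u - wt (Suc k) u" using dom_word_hp[OF du kn(1)] by (simp add: hp_def)
      then show ?thesis using wtu[OF k] wtu[OF kn(2)] b0 b1 by simp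
    qed
    then have rem: "k - 1 \<in> removable \<alpha>" using k by (simp add: removable_def)
    have "u \<in> hw_words n r s (tilde_weight n (\<alpha>(k - 1 := \<alpha> (k - 1) - 1), \<beta>))"
      unfolding hw_words_def
    proof (intro CollectI conjI ballI du um)
      fix i assume i: "i \<in> {1..n}"
      have "i - 1 = k - 1 \<longleftrightarrow> i = k" using i k by auto
      then show "wt i u = tilde_weight n (\<alpha>(k - 1 := \<alpha> (k - 1) - 1), \<beta>) i"
        using wtu[OF i] True by (auto simp: tilde_weight_def)
    qed
    then show ?thesis using rem wu k by (intro disjI1 bexI[of _ "k - 1"] bexI[of _ u]) auto
  next
    case False
    define j where "j = n - k"
    have ak: "\<alpha> (k - 1) = 0" "\<alpha> k = 0"
      using False partitions_antimono[OF \<alpha>, of "k - 1" k] by auto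
    have "j \<in> addable \<beta>"
    proof (cases "k = n")
      case True
      then show ?thesis by (simp add: j_def addable_def)
    next
      case False
      then have kn: "k \<in> {1..<n}" "Suc k \<in> {1..n}" using k by auto
      have "0 \<le> wt k u - wt (Suc k) u" using dom_word_hp[OF du kn(1)] by (simp add: hp_def)
      then have "\<beta> (n - k) < \<beta> (n - Suc k)" using wtu[OF k] wtu[OF kn(2)] ak by simp
      then show ?thesis by (simp add: j_def addable_def)
    qed
    moreover have "u \<in> hw_words n r s (tilde_weight n (\<alpha>, \<beta>(j := Suc (\<beta> j))))"
      unfolding hw_words_def
    proof (intro CollectI conjI ballI du um)
      fix i assume i: "i \<in> {1..n}"
      have "n - i = j \<longleftrightarrow> i = k" using i k by (auto simp: j_def)
      then show "wt i u = tilde_weight n (\<alpha>, \<beta>(j := Suc (\<beta> j))) i"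
        using wtu[OF i] by (auto simp: tilde_weight_def)
    qed
    \<comment> \<open>With f = 0 the coordinates in which \<alpha> vanishes carry all s boxes of
      \<beta>. The suffix would have total weight - s - 1 there, more than its s dual letters can
      supply.\<close>
    moreover have "f > 0"
    proof (rule ccontr)
      assume "\<not> f > 0"
      then have f0: "f = 0" by simp
      define Z where "Z = {i\<in>{1..n}. \<alpha> (i - 1) = 0}"
      have "(\<Sum>i\<in>Z. int (\<beta> (n - i))) = (\<Sum>i\<in>{1..n}. int (\<beta> (n - i)))"
      proof (rule sum.mono_neutral_left)
        show "\<forall>i\<in>{1..n} - Z. int (\<beta> (n - i)) = 0"
        proof
          fix i assume i: "i \<in> {1..n} - Z"
          then have "i - 1 < Suc r" using \<alpha>0[of "i - 1"] f0 by (cases "Suc r \<le> i - 1") (auto simp: Z_def)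
          then have "s - f \<le> n - i" using n i by auto
          then show "int (\<beta> (n - i)) = 0" using \<beta>0 by simp
        qed
      qed (auto simp: Z_def)
      also have "\<dots> = (\<Sum>i<n. int (\<beta> i))"
        by (rule sum.reindex_bij_witness[where i = "\<lambda>i. n - i" and j = "\<lambda>i. n - i"]) auto
      also have "\<dots> = int s"
      proof -
        have "\<And>i. n \<le> i \<Longrightarrow> \<beta> i = 0" using \<beta>0 n by simp
        from partitions_iff[OF this] \<beta> f0 have "(\<Sum>i<n. \<beta> i) = s" by simp
        then show ?thesis by (simp flip: of_nat_sum)
      qed
      finally have A: "(\<Sum>i\<in>Z. int (\<beta> (n - i))) = int s" .
      have kZ: "k \<in> Z" "finite Z" using k ak by (auto simp: Z_def)
      have "(\<Sum>i\<in>Z. wt i u) = (\<Sum>i\<in>Z. - int (\<beta> (n - i)) - (if i = k then 1 else 0))"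
        by (rule sum.cong) (use wtu in \<open>auto simp: Z_def\<close>)
      also have "\<dots> = - int s - 1"
        using A kZ by (simp add: sum_subtractf sum_negf)
      finally have B: "(\<Sum>i\<in>Z. wt i u) = - int s - 1" .
      have "(\<Sum>i\<in>Z. wt i u) \<ge> (\<Sum>i\<in>Z. - int (count_list J i))"
        by (rule sum_mono) (simp add: u_def wt_mono_word)
      then have "int s + 1 \<le> int (\<Sum>i\<in>Z. count_list J i)" using B by (simp add: sum_negf)
      then have "s + 1 \<le> (\<Sum>i\<in>Z. count_list J i)" by linarith
      then show False using sum_count_list_le[OF kZ(2), of J] IJ(3) by simp
    qed
    moreover have "w = Vec (n - j) # u" using wu k by (simp add: j_def)
    ultimately show ?thesis by blast
  qed
qed

definition falling :: "nat \<Rightarrow> nat \<Rightarrow> nat" where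
  "falling s f = (\<Prod>i<f. s - i)"

text \<open>The two kinds of first letter give the two terms of Pascal's rule. In the second kind,
  \<open>ypath_add\<close> turns the sum over the boxes added to \<beta> into the factor s - f + 1
  that leads from \<open>falling s (f - 1)\<close> to \<open>falling s f\<close>.\<close>

lemma card_hw_words:
  "f \<le> r \<Longrightarrow> f \<le> s \<Longrightarrow> \<alpha> \<in> partitions (r - f) \<Longrightarrow> \<beta> \<in> partitions (s - f) \<Longrightarrow> r + s \<le> n \<Longrightarrow>
   card (hw_words n r s (tilde_weight n (\<alpha>, \<beta>))) \<le> (r choose f) * falling s f * (ypath (r - f) \<alpha> * ypath (s - f) \<beta>)"
proof (induction r arbitrary: f \<alpha> \<beta>)
  case 0
  then have "\<alpha> = (\<lambda>_. 0)" using partitions_zero[of \<alpha> 0] by auto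
  then show ?case using 0 card_hw_words_dual[of \<beta> s n] by (simp add: falling_def)
next
  case (Suc r)
  let ?A = "\<lambda>j. hw_words n r s (tilde_weight n (\<alpha>(j := \<alpha> j - 1), \<beta>))"
  let ?B = "\<lambda>j. hw_words n r s (tilde_weight n (\<alpha>, \<beta>(j := Suc (\<beta> j))))"
  let ?add = "if f > 0 then addable \<beta> else {}"
  have fr: "finite (removable \<alpha>)" "finite ?add"
    using finite_removable[OF Suc.prems(3)] finite_addable[OF Suc.prems(4)] by auto
  have "hw_words n (Suc r) s (tilde_weight n (\<alpha>, \<beta>)) \<subseteq>
      (\<Union>j\<in>removable \<alpha>. (#) (Vec (Suc j)) ` ?A j) \<union> (\<Union>j\<in>?add. (#) (Vec (n - j)) ` ?B j)"
    using hw_words_vec_step[OF Suc.prems(1-5)] by fastforce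
  then have "card (hw_words n (Suc r) s (tilde_weight n (\<alpha>, \<beta>))) \<le>
      card ((\<Union>j\<in>removable \<alpha>. (#) (Vec (Suc j)) ` ?A j) \<union> (\<Union>j\<in>?add. (#) (Vec (n - j)) ` ?B j))"
    using fr finite_hw_words by (intro card_mono finite_UnI finite_UN_I finite_imageI) auto
  also have "\<dots> \<le> card (\<Union>j\<in>removable \<alpha>. (#) (Vec (Suc j)) ` ?A j) + card (\<Union>j\<in>?add. (#) (Vec (n - j)) ` ?B j)"
    by (rule card_Un_le)
  also have "\<dots> \<le> (\<Sum>j\<in>removable \<alpha>. card (?A j)) + (\<Sum>j\<in>?add. card (?B j))"
    by (intro add_mono order_trans[OF card_UN_le] sum_mono card_image_le fr finite_hw_words)
  finally have main: "card (hw_words n (Suc r) s (tilde_weight n (\<alpha>, \<beta>))) \<le>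
    (\<Sum>j\<in>removable \<alpha>. card (?A j)) + (\<Sum>j\<in>?add. card (?B j))" .
  have 1: "(\<Sum>j\<in>removable \<alpha>. card (?A j)) \<le> (r choose f) * falling s f * (ypath (Suc r - f) \<alpha> * ypath (s - f) \<beta>)"
  proof (cases "f \<le> r")
    case True
    then have e: "Suc r - f = Suc (r - f)" by simp
    have "(\<Sum>j\<in>removable \<alpha>. card (?A j)) \<le>
      (\<Sum>j\<in>removable \<alpha>. (r choose f) * falling s f * (ypath (r - f) (\<alpha>(j := \<alpha> j - 1)) * ypath (s - f) \<beta>))"
      using Suc.prems True partitions_remove[of \<alpha> "r - f"] unfolding e
      by (intro sum_mono Suc.IH) (auto simp del: fun_upd_apply)
    also have "\<dots> = (r choose f) * falling s f * (ypath (Suc r - f) \<alpha> * ypath (s - f) \<beta>)"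
      unfolding e ypath.simps by (simp add: sum_distrib_left sum_distrib_right)
    finally show ?thesis .
  next
    case False
    then have "\<alpha> i = 0" for i using partitions_zero[OF Suc.prems(3)] by simp
    then have "removable \<alpha> = {}" by (simp add: removable_def)
    then show ?thesis by simp
  qed
  have 2: "(\<Sum>j\<in>?add. card (?B j)) \<le> (if f = 0 then 0 else r choose (f - 1)) * falling s f * (ypath (Suc r - f) \<alpha> * ypath (s - f) \<beta>)"
  proof (cases f)
    case 0
    then show ?thesis by simp
  next
    case (Suc g)
    have e: "Suc r - f = r - g" "s - g = Suc (s - f)" using Suc Suc.prems(2) by auto
    have "(\<Sum>j\<in>addable \<beta>. card (?B j)) \<le>
      (\<Sum>j\<in>addable \<beta>. (r choose g) * falling s g * (ypath (r - g) \<alpha> * ypath (s - g) (\<beta>(j := Suc (\<beta> j)))))"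
      using Suc.prems Suc partitions_add[OF Suc.prems(4)] e
      by (intro sum_mono Suc.IH) (auto simp del: fun_upd_apply)
    also have "\<dots> = (r choose g) * falling s g * (ypath (r - g) \<alpha> * (\<Sum>j\<in>addable \<beta>. ypath (s - g) (\<beta>(j := Suc (\<beta> j)))))"
      by (simp add: sum_distrib_left)
    also have "(\<Sum>j\<in>addable \<beta>. ypath (s - g) (\<beta>(j := Suc (\<beta> j)))) = (s - g) * ypath (s - f) \<beta>"
      using ypath_add[OF Suc.prems(4)] unfolding e(2) .
    finally show ?thesis using Suc e(1) by (simp add: falling_def mult_ac del: fun_upd_apply)
  qed
  have "(Suc r choose f) = (r choose f) + (if f = 0 then 0 else r choose (f - 1))"
    by (cases f) auto
  then show ?case using main 1 2 by (simp add: algebra_simps)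
qed

section \<open>Counting the index set\<close>

text \<open>As \<open>p\<close> is antitone, the set counted by \<open>conjugate p i\<close> is an
  initial segment of the natural numbers.\<close>

lemma conjugate_iff:
  assumes p: "p \<in> partitions m"
  shows "j < conjugate p i \<longleftrightarrow> i < p j"
proof -
  have sub: "{j. p j > i} \<subseteq> {..<m}"
  proof (rule subsetI)
    fix j assume "j \<in> {j. p j > i}"
    then show "j \<in> {..<m}" using partitions_zero[OF p, of j] by (cases "m \<le> j") auto
  qed
  then have fin: "finite {j. p j > i}" by (rule finite_subset) simp
  have down: "{j. p j > i} = {..<card {j. p j > i}}"
  proof (cases "{j. p j > i} = {}")
    case False
    have "{j. p j > i} = {..Max {j. p j > i}}"
    proof
      show "{j. p j > i} \<subseteq> {..Max {j. p j > i}}" using fin by auto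
      have M: "i < p (Max {j. p j > i})" using Max_in[OF fin False] by simp
      show "{..Max {j. p j > i}} \<subseteq> {j. p j > i}"
        using partitions_antimono[OF p] M by (auto intro: less_le_trans)
    qed
    then show ?thesis by (metis card_lessThan lessThan_Suc_atMost)
  qed simp
  show ?thesis unfolding conjugate_def using down by blast
qed

lemma diagram_conjugate: "p \<in> partitions m \<Longrightarrow> diagram (conjugate p) = {(i, j). i < p j}"
  by (simp add: diagram_def conjugate_iff)

lemma conjugate_partitions:
  assumes p: "p \<in> partitions m"
  shows "conjugate p \<in> partitions m"
proof -
  have pm: "p j \<le> m" for j
  proof (cases "j < m")
    case True
    have "(\<Sum>i<m. p i) = m" using partitions_iff[where M = m and p = p and m = m, OF partitions_zero[OF p]] p by simp
    then show ?thesis using member_le_sum[of j "{..<m}" p] True by simp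
  qed (simp add: partitions_zero[OF p])
  have z: "conjugate p i = 0" if "m \<le> i" for i
    using conjugate_iff[OF p, of 0 i] pm[of 0] that by (metis gr0I leD le_trans)
  have "(\<Sum>i<m. conjugate p i) = (\<Sum>i<m. \<Sum>j<m. if i < p j then 1 else 0)"
  proof (rule sum.cong[OF refl])
    fix i
    have "conjugate p i \<le> m"
      using conjugate_iff[OF p, of m i] partitions_zero[OF p, of m] by (metis le_refl not_less0 not_less)
    then have "{j\<in>{..<m}. j < conjugate p i} = {..<conjugate p i}" by auto
    then show "conjugate p i = (\<Sum>j<m. if i < p j then 1 else 0)"
      unfolding conjugate_iff[OF p, symmetric] by (simp flip: sum.inter_filter)
  qed
  also have "\<dots> = (\<Sum>j<m. \<Sum>i<m. if i < p j then 1 else 0)" by (rule sum.swap)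
  also have "\<dots> = (\<Sum>j<m. p j)"
  proof (rule sum.cong[OF refl])
    fix j
    have "{i\<in>{..<m}. i < p j} = {..<p j}" using pm[of j] by auto
    then show "(\<Sum>i<m. if i < p j then 1 else 0) = p j" by (simp flip: sum.inter_filter)
  qed
  also have "\<dots> = m" using partitions_iff[where M = m and p = p and m = m, OF partitions_zero[OF p]] p by simp
  finally have s: "(\<Sum>i<m. conjugate p i) = m" .
  have "antimono (conjugate p)"
  proof (rule antimonoI)
    fix x y :: nat assume "x \<le> y"
    then have "j < conjugate p x" if "j < conjugate p y" for j
      using that unfolding conjugate_iff[OF p] by simp
    then show "conjugate p y \<le> conjugate p x" by (metis leI less_irrefl)
  qed
  then show ?thesis using partitions_iff[of m "conjugate p" m, OF z] s by simp
qed

text \<open>Describes the cells of the conjugate diagram through \<open>p\<close> itself, so that a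
  removable row j of \<open>p\<close> corresponds to the corner (p j - 1, j).\<close>

lemma std_tableaux_conjugate:
  assumes p: "p \<in> partitions m"
  shows "t \<in> std_tableaux f M (conjugate p) \<longleftrightarrow>
    t \<in> extensional {(i, j). i < p j} \<and> bij_betw t {(i, j). i < p j} {f + 1..M} \<and>
    (\<forall>i j j'. j < j' \<and> i < p j' \<longrightarrow> t (i, j) < t (i, j')) \<and>
    (\<forall>i i' j. i < i' \<and> i' < p j \<longrightarrow> t (i, j) < t (i', j))"
  unfolding std_tableaux_def diagram_conjugate[OF p] conjugate_iff[OF p] by simp

lemma finite_diagram: "p \<in> partitions m \<Longrightarrow> finite (diagram p)"
proof -
  assume p: "p \<in> partitions m"
  have "diagram p \<subseteq> (\<Union>i\<in>{..<m}. {i} \<times> {..<p i})"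
    using partitions_zero[OF p] by (auto simp: diagram_def) (metis leI not_less0)
  then show ?thesis by (rule finite_subset) auto
qed

lemma finite_std_tableaux:
  assumes "p \<in> partitions m"
  shows "finite (std_tableaux f M p)"
proof (rule finite_subset)
  show "std_tableaux f M p \<subseteq> (\<Pi>\<^sub>E b\<in>diagram p. {f + 1..M})"
    by (auto simp: std_tableaux_def PiE_def bij_betw_def)
  show "finite (\<Pi>\<^sub>E b\<in>diagram p. {f + 1..M})"
    by (rule finite_PiE) (auto simp: finite_diagram[OF assms])
qed

lemma std_tableaux_extend:
  assumes p: "p \<in> partitions (Suc m)" and j: "j \<in> removable p"
    and t: "t \<in> std_tableaux f (f + m) (conjugate (p(j := p j - 1)))"
  shows "t((p j - 1, j) := Suc (f + m)) \<in> std_tableaux f (f + Suc m) (conjugate p)"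
proof -
  define p' where "p' = p(j := p j - 1)"
  have p': "p' \<in> partitions m" unfolding p'_def by (rule partitions_remove[OF p j])
  let ?c = "(p j - 1, j)" and ?D = "{(i, j). i < p j}" and ?D' = "{(i, j). i < p' j}"
  have pj: "p (Suc j) < p j" using j by (simp add: removable_def)
  have D: "?D = insert ?c ?D'" and c: "?c \<notin> ?D'"
    using pj by (auto simp: p'_def split: if_splits)
  have T: "t \<in> extensional ?D'" "bij_betw t ?D' {f + 1..f + m}"
    "\<And>i a b. a < b \<Longrightarrow> i < p' b \<Longrightarrow> t (i, a) < t (i, b)"
    "\<And>i i' b. i < i' \<Longrightarrow> i' < p' b \<Longrightarrow> t (i, b) < t (i', b)"
    using t unfolding p'_def[symmetric] std_tableaux_conjugate[OF p'] by blast+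
  have le: "t b \<le> f + m" if "b \<in> ?D'" for b
    using bij_betwE[OF T(2)] that by fastforce
  let ?t = "t(?c := Suc (f + m))"
  show ?thesis
    unfolding std_tableaux_conjugate[OF p]
  proof (intro conjI allI impI)
    show "?t \<in> extensional ?D"
      using T(1) unfolding D extensional_def by auto
    have bt: "bij_betw ?t ?D' {f + 1..f + m}"
      using T(2) c by (subst bij_betw_cong[of _ _ t]) auto
    have "bij_betw ?t (insert ?c ?D') (insert (?t ?c) {f + 1..f + m})"
      using notIn_Un_bij_betw[OF c _ bt] by simp
    moreover have "insert (?t ?c) {f + 1..f + m} = {f + 1..f + Suc m}" by auto
    ultimately show "bij_betw ?t ?D {f + 1..f + Suc m}" unfolding D by simp
  next
    fix i a b assume ab: "a < b \<and> i < p b"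
    have iab: "i < p a" using ab partitions_antimono[OF p, of a b] by simp
    have ne: "(i, a) \<noteq> ?c"
    proof
      assume "(i, a) = ?c"
      then show False using ab pj partitions_antimono[OF p, of "Suc j" b] by auto
    qed
    have ia: "(i, a) \<in> ?D'" using iab ne D by blast
    show "?t (i, a) < ?t (i, b)"
    proof (cases "(i, b) = ?c")
      case True
      then show ?thesis using le[OF ia] ne by simp
    next
      case False
      then have "(i, b) \<in> ?D'" using ab D by blast
      then show ?thesis
        unfolding fun_upd_other[OF ne] fun_upd_other[OF False] using T(3)[of a b i] ab by simp
    qed
  next
    fix i i' b assume ii: "i < i' \<and> i' < p b"
    have ne: "(i, b) \<noteq> ?c" using ii by auto
    have ia: "(i, b) \<in> ?D'" using ii ne D by auto
    show "?t (i, b) < ?t (i', b)"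
    proof (cases "(i', b) = ?c")
      case True
      then show ?thesis using le[OF ia] ne by simp
    next
      case False
      then have "(i', b) \<in> ?D'" using ii D by blast
      then show ?thesis
        unfolding fun_upd_other[OF ne] fun_upd_other[OF False] using T(4)[of i i' b] ii by simp
    qed
  qed
qed

text \<open>A path becomes a tableau by entering the largest number at the corner that is removed
  first. The cell of that number recovers the row j, hence injectivity.\<close>

lemma ypath_le_card_std:
  "p \<in> partitions m \<Longrightarrow> ypath m p \<le> card (std_tableaux f (f + m) (conjugate p))"
proof (induction m arbitrary: p)
  case 0
  have e: "{(i, j). i < p j} = {}" using partitions_zero[OF 0] by auto
  have "(\<lambda>b. undefined) \<in> std_tableaux f (f + 0) (conjugate p)"
    unfolding std_tableaux_conjugate[OF 0] e using partitions_zero[OF 0] by (simp add: bij_betw_def)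
  then have "card (std_tableaux f (f + 0) (conjugate p)) > 0"
    using finite_std_tableaux[OF conjugate_partitions[OF 0]] by (auto simp: card_gt_0_iff)
  then show ?case by simp
next
  case (Suc m)
  let ?R = "\<lambda>j. p(j := p j - 1)"
  let ?T = "\<lambda>j. std_tableaux f (f + m) (conjugate (?R j))"
  let ?g = "\<lambda>(j, t). t((p j - 1, j) := Suc (f + m))"
  have fT: "finite (?T j)" if "j \<in> removable p" for j
    using finite_std_tableaux[OF conjugate_partitions[OF partitions_remove[OF Suc.prems that]]] .
  have "ypath (Suc m) p \<le> (\<Sum>j\<in>removable p. card (?T j))"
    unfolding ypath.simps by (intro sum_mono Suc.IH partitions_remove[OF Suc.prems])
  also have "\<dots> = card (SIGMA j:removable p. ?T j)"
    using fT finite_removable[OF Suc.prems] by (subst card_SigmaI) auto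
  also have "\<dots> \<le> card (std_tableaux f (f + Suc m) (conjugate p))"
  proof (rule card_inj_on_le)
    show "finite (std_tableaux f (f + Suc m) (conjugate p))"
      by (rule finite_std_tableaux[OF conjugate_partitions[OF Suc.prems]])
    show "?g ` (SIGMA j:removable p. ?T j) \<subseteq> std_tableaux f (f + Suc m) (conjugate p)"
      using std_tableaux_extend[OF Suc.prems] by fastforce
    show "inj_on ?g (SIGMA j:removable p. ?T j)"
    proof (rule inj_onI)
      fix a b assume a: "a \<in> (SIGMA j:removable p. ?T j)" and b: "b \<in> (SIGMA j:removable p. ?T j)" and e: "?g a = ?g b"
      obtain j t k u where ab: "a = (j, t)" "b = (k, u)" by (cases a; cases b)
      have j: "j \<in> removable p" "t \<in> ?T j" and k: "k \<in> removable p" "u \<in> ?T k" using a b unfolding ab by blast+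
      have e': "t((p j - 1, j) := Suc (f + m)) = u((p k - 1, k) := Suc (f + m))" using e unfolding ab by simp
      note Ru = std_tableaux_conjugate[OF partitions_remove[OF Suc.prems k(1)], of u f "f + m"]
      note Rt = std_tableaux_conjugate[OF partitions_remove[OF Suc.prems j(1)], of t f "f + m"]
      have jk: "j = k"
      proof (rule ccontr)
        assume ne: "j \<noteq> k"
        have "p j > 0" using j(1) by (simp add: removable_def)
        then have "(p j - 1, j) \<in> {(i, l). i < (?R k) l}" using ne by simp
        then have "u (p j - 1, j) \<in> {f + 1..f + m}"
          using k(2) Ru bij_betwE by blast
        moreover have "u (p j - 1, j) = Suc (f + m)"
          using fun_cong[OF e', of "(p j - 1, j)"] ne by simp
        ultimately show False by simp
      qed
      \<comment> \<open>Tableaux are \<open>undefined\<close> outside their diagram, so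
        \<open>t\<close> and \<open>u\<close> agree on the removed corner as well.\<close>
      have un: "v (p k - 1, k) = undefined" if "v \<in> extensional {(i, l). i < (?R k) l}" for v :: "nat \<times> nat \<Rightarrow> nat"
        using that by (simp add: extensional_def)
      have "t (p k - 1, k) = u (p k - 1, k)"
        using un[of t] un[of u] j(2) k(2) Rt Ru unfolding jk by simp
      then have "t = u" using e' unfolding jk by (metis fun_upd_triv fun_upd_upd)
      then show "a = b" by (simp add: ab jk)
    qed
  qed
  finally show ?case .
qed

section \<open>The cycles s_(k,i) and the index set of the elements d\<close>

lemma s_perm_apply:
  assumes "k \<le> i"
  shows "s_perm k i x = (if x = k then i else if k < x \<and> x \<le> i then x - 1 else x)"
  using assms
proof (induction i arbitrary: x rule: dec_induct)
  case base
  then show ?case by (simp add: s_perm_def)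
next
  case (step i)
  have "s_perm k (Suc i) x = simple_tr i (s_perm k i x)"
    using step.hyps perm_of_snoc[of "[k..<i]" i] by (simp add: s_perm_def)
  then show ?case using step by (auto simp: transpose_def)
qed

lemma s_perm_permutes: "a \<le> k \<Longrightarrow> i \<le> b \<Longrightarrow> s_perm k i permutes {a..b}"
proof (cases "k \<le> i")
  case True
  have "perm_of ks permutes {a..b}" if "set ks \<subseteq> {a..<b}" for ks
    using that
  proof (induction ks rule: rev_induct)
    case (snoc c cs)
    have c: "set cs \<subseteq> {a..<b}" "a \<le> c" "Suc c \<le> b" using snoc.prems by auto
    have "perm_of cs permutes {a..b}" using snoc.IH[OF c(1)] .
    moreover have "simple_tr c permutes {a..b}" using c(2,3) by (rule simple_tr_permutes)
    ultimately show ?case unfolding perm_of_snoc by (rule permutes_compose)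
  qed (auto simp: permutes_id)
  then show "a \<le> k \<Longrightarrow> i \<le> b \<Longrightarrow> s_perm k i permutes {a..b}" unfolding s_perm_def by simp
next
  case False
  then show ?thesis by (simp add: s_perm_def permutes_id)
qed

lemma inversions_s_perm:
  assumes "k \<le> i"
  shows "inversions (s_perm k i) = {(k, y) | y. k < y \<and> y \<le> i}"
proof -
  have "x < y \<and> s_perm k i y < s_perm k i x \<longleftrightarrow> x = k \<and> k < y \<and> y \<le> i" for x y
    unfolding s_perm_apply[OF assms] using assms
    by (cases "x = k"; cases "k < x \<and> x \<le> i"; cases "y = k"; cases "k < y \<and> y \<le> i") auto
  then show ?thesis unfolding inversions_def by auto
qed

text \<open>The partial product of the factors with subscripts f, ..., a. The one with subscript a
  is applied last, so inductions run from a = f + 1 downwards.\<close>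

definition chain_perm :: "nat list \<Rightarrow> nat \<Rightarrow> nat \<Rightarrow> nat \<Rightarrow> nat" where
  "chain_perm J a f = fold (\<lambda>k. s_perm k (J ! (k - 1))) (rev [a..<Suc f])"

lemma chain_perm_step: "a \<le> f \<Longrightarrow> chain_perm J a f = s_perm a (J ! (a - 1)) \<circ> chain_perm J (Suc a) f"
  by (simp add: chain_perm_def upt_rec[of a] del: upt_Suc)

lemma chain_perm_Suc [simp]: "chain_perm J (Suc f) f = id"
  by (simp add: chain_perm_def)

lemma chain_perm_permutes:
  assumes "\<And>k. k \<in> {a..f} \<Longrightarrow> J ! (k - 1) \<in> {k..m}" "a \<le> Suc f"
  shows "chain_perm J a f permutes {a..m}"
  using assms(2,1)
proof (induction a rule: inc_induct)
  case base
  then show ?case by (simp only: chain_perm_Suc permutes_id)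
next
  case (step a)
  have 1: "chain_perm J (Suc a) f permutes {a..m}"
    by (rule permutes_subset[OF step.IH]) (use step in auto)
  have 2: "s_perm a (J ! (a - 1)) permutes {a..m}"
    using step.prems[of a] step.hyps by (intro s_perm_permutes) auto
  have af: "a \<le> f" using step.hyps by simp
  show ?case unfolding chain_perm_step[OF af] by (rule permutes_compose[OF 1 2])
qed

text \<open>The factors with subscripts above a fix a, so the image of a under the product is J ! (a
  - 1). Once this is read off, the last factor can be cancelled.\<close>

lemma chain_perm_inj:
  assumes J: "\<And>k. k \<in> {a..f} \<Longrightarrow> J ! (k - 1) \<in> {k..m}" and J': "\<And>k. k \<in> {a..f} \<Longrightarrow> J' ! (k - 1) \<in> {k..m}"
    and e: "\<And>k. k \<in> {a..f} \<Longrightarrow> chain_perm J a f k = chain_perm J' a f k" and k: "k \<in> {a..f}"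
  shows "J ! (k - 1) = J' ! (k - 1)"
  using assms
proof (induction "f - a" arbitrary: a k)
  case (0 a k)
  then have a: "a = f" "k = f" by auto
  have "chain_perm L f f f = L ! (f - 1)" if "L ! (f - 1) \<in> {f..m}" for L
    using chain_perm_step[of f f L] that s_perm_apply[of f "L ! (f - 1)" f] by simp
  then show ?case using 0 a by simp
next
  case (Suc d a k)
  have af: "a \<le> f" "Suc a \<le> f" using Suc.hyps by auto
  have val: "chain_perm L a f a = L ! (a - 1)" if L: "\<And>k. k \<in> {a..f} \<Longrightarrow> L ! (k - 1) \<in> {k..m}" for L
  proof -
    have "chain_perm L (Suc a) f permutes {Suc a..m}"
      using L af by (intro chain_perm_permutes) auto
    then have "chain_perm L (Suc a) f a = a" by (rule permutes_not_in) simp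
    then show ?thesis using chain_perm_step[OF af(1), of L] L[of a] af s_perm_apply[of a "L ! (a - 1)" a] by simp
  qed
  have ea: "J ! (a - 1) = J' ! (a - 1)"
    using val[OF Suc.prems(1)] val[OF Suc.prems(2)] Suc.prems(3)[of a] af by simp
  show ?case
  proof (cases "k = a")
    case True
    then show ?thesis using ea by simp
  next
    case False
    have "inj (s_perm a (J ! (a - 1)))"
      by (rule permutes_inj[OF s_perm_permutes[of a a _ "J ! (a - 1)"]]) auto
    then have "chain_perm J (Suc a) f l = chain_perm J' (Suc a) f l" if "l \<in> {Suc a..f}" for l
      using Suc.prems(3)[of l] that chain_perm_step[OF af(1)] ea by (auto dest: injD)
    then show ?thesis
      using Suc.hyps(1)[of "Suc a" k] Suc.hyps(2) Suc.prems False by auto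
  qed
qed

lemma D_perm_chain:
  "length I = f \<Longrightarrow> length J = f \<Longrightarrow> D_perm (I, J) = (chain_perm I 1 f, chain_perm J 1 f)"
  by (simp add: D_perm_def chain_perm_def)

lemma D_data_bounds:
  assumes "(I, J) \<in> D_data r s f"
  shows "length I = f" "length J = f" "k \<in> {1..f} \<Longrightarrow> I ! (k - 1) \<in> {k..r}" "k \<in> {1..f} \<Longrightarrow> J ! (k - 1) \<in> {k..s}"
    "i < j \<Longrightarrow> j < f \<Longrightarrow> I ! i < I ! j"
proof -
  have D: "length I = f" "length J = f" "sorted_wrt (<) I" "set I \<subseteq> {1..r}" "\<forall>k\<in>{1..f}. J ! (k - 1) \<in> {k..s}"
    using assms by (auto simp: D_data_def)
  then show "length I = f" "length J = f" "k \<in> {1..f} \<Longrightarrow> J ! (k - 1) \<in> {k..s}" by auto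
  show mono: "I ! i < I ! j" if "i < j" "j < f" for i j
    using D(1,3) that by (simp add: sorted_wrt_iff_nth_less)
  have "Suc i \<le> I ! i" if "i < f" for i
    using that
  proof (induction i)
    case 0
    then have "I ! 0 \<in> set I" using D(1) by simp
    then show ?case using D(4) by auto
  next
    case (Suc i)
    then show ?case using mono[of i "Suc i"] by simp
  qed
  moreover have "I ! i \<le> r" if "i < f" for i
    using subsetD[OF D(4) nth_mem[of i I]] D(1) that by simp
  ultimately show "I ! (k - 1) \<in> {k..r}" if "k \<in> {1..f}"
    using that by (cases k) auto
qed

lemma chain_perm_list_inj:
  assumes "length J = f" "length J' = f" "\<And>k. k \<in> {1..f} \<Longrightarrow> J ! (k - 1) \<in> {k..m}"
    "\<And>k. k \<in> {1..f} \<Longrightarrow> J' ! (k - 1) \<in> {k..m}"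
    "\<And>k. k \<in> {1..f} \<Longrightarrow> chain_perm J 1 f k = chain_perm J' 1 f k"
  shows "J = J'"
proof (rule nth_equalityI)
  fix i assume "i < length J"
  then show "J ! i = J' ! i"
    using chain_perm_inj[of 1 f J m J' "Suc i"] assms by simp
qed (use assms in simp)

lemma D_perm_inj: "inj_on D_perm (D_data r s f)"
proof (rule inj_onI)
  fix D D' assume d: "D \<in> D_data r s f" "D' \<in> D_data r s f" and e: "D_perm D = D_perm D'"
  obtain I J I' J' where DD: "D = (I, J)" "D' = (I', J')" by (cases D; cases D')
  note b = D_data_bounds[OF d(1)[unfolded DD]] and b' = D_data_bounds[OF d(2)[unfolded DD]]
  have c: "chain_perm I 1 f = chain_perm I' 1 f" "chain_perm J 1 f = chain_perm J' 1 f"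
    using e unfolding DD D_perm_chain[OF b(1,2)] D_perm_chain[OF b'(1,2)] by simp_all
  have "I = I'" using chain_perm_list_inj[OF b(1) b'(1) b(3) b'(3)] c(1) by simp
  moreover have "J = J'" using chain_perm_list_inj[OF b(2) b'(2) b(4) b'(4)] c(2) by simp
  ultimately show "D = D'" by (simp add: DD)
qed

lemma D_data_prod:
  "D_data r s f = {I. length I = f \<and> sorted_wrt (<) I \<and> set I \<subseteq> {1..r}} \<times>
     {J. length J = f \<and> (\<forall>k\<in>{1..f}. J ! (k - 1) \<in> {k..s})}"
  by (auto simp: D_data_def)

lemma finite_D_data: "finite (D_data r s f)"
proof (rule finite_subset)
  show "D_data r s f \<subseteq> {I. set I \<subseteq> {1..r} \<and> length I = f} \<times> {J. set J \<subseteq> {1..s} \<and> length J = f}"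
  proof (rule subrelI)
    fix I J assume d: "(I, J) \<in> D_data r s f"
    have "x \<in> {1..s}" if x: "x \<in> set J" for x
    proof -
      obtain i where "i < f" "J ! i = x" using x D_data_bounds(2)[OF d] by (auto simp: in_set_conv_nth)
      then show ?thesis using D_data_bounds(4)[OF d, of "Suc i"] by simp
    qed
    then show "(I, J) \<in> {I. set I \<subseteq> {1..r} \<and> length I = f} \<times> {J. set J \<subseteq> {1..s} \<and> length J = f}"
      using d by (auto simp: D_data_def)
  qed
qed (auto intro: finite_cartesian_product finite_lists_length_eq)

lemma card_D_data: "(r choose f) * falling s f \<le> card (D_data r s f)"
proof -
  let ?A = "{I. length I = f \<and> sorted_wrt (<) I \<and> set I \<subseteq> {1..r}}"
  let ?B = "\<lambda>f. {J. length J = f \<and> (\<forall>k\<in>{1..f}. J ! (k - 1) \<in> {k..s})}"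
  have fin: "finite {J. length J = f \<and> set J \<subseteq> {1..m}}" for m f :: nat
    using finite_lists_length_eq[of "{1..m}" f] by (simp add: conj_commute)
  have fA: "finite ?A" by (rule finite_subset[OF _ fin[of f r]]) auto
  have "card {S. S \<subseteq> {1..r} \<and> card S = f} \<le> card ?A"
  proof (rule card_inj_on_le[OF _ _ fA])
    have fs: "finite S" if "S \<subseteq> {1..r}" for S using that finite_subset by blast
    show "inj_on sorted_list_of_set {S. S \<subseteq> {1..r} \<and> card S = f}"
      by (rule inj_onI) (metis (mono_tags, lifting) fs mem_Collect_eq set_sorted_list_of_set)
    show "sorted_list_of_set ` {S. S \<subseteq> {1..r} \<and> card S = f} \<subseteq> ?A"
    proof (rule image_subsetI)
      fix S assume S: "S \<in> {S. S \<subseteq> {1..r} \<and> card S = f}"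
      then have "finite S" using fs by blast
      with S show "sorted_list_of_set S \<in> ?A" by simp
    qed
  qed
  then have 1: "r choose f \<le> card ?A" using n_subsets[of "{1..r}" f] by simp
  have 2: "falling s f \<le> card (?B f)"
  proof (induction f)
    case 0
    have "?B 0 = {[]}" by auto
    then show ?case by (simp add: falling_def)
  next
    case (Suc f)
    have fB: "finite (?B f)" for f
    proof (rule finite_subset[OF _ fin[of f s]], rule subsetI)
      fix J assume J: "J \<in> ?B f"
      have "x \<in> {1..s}" if x: "x \<in> set J" for x
      proof -
        obtain i where i: "i < f" "J ! i = x" using J x by (auto simp: in_set_conv_nth)
        moreover have "J ! (Suc i - 1) \<in> {Suc i..s}" using J i(1) by force
        ultimately show ?thesis by simp
      qed
      then show "J \<in> {J. length J = f \<and> set J \<subseteq> {1..s}}" using J by auto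
    qed
    have "falling s (Suc f) = falling s f * card {Suc f..s}" by (simp add: falling_def)
    also have "\<dots> \<le> card (?B f) * card {Suc f..s}" using Suc by simp
    also have "\<dots> = card (?B f \<times> {Suc f..s})" by (simp only: card_cartesian_product)
    also have "\<dots> \<le> card (?B (Suc f))"
    proof (rule card_inj_on_le[OF _ _ fB])
      show "inj_on (\<lambda>(J, x). J @ [x]) (?B f \<times> {Suc f..s})" by (auto simp: inj_on_def)
      show "(\<lambda>(J, x). J @ [x]) ` (?B f \<times> {Suc f..s}) \<subseteq> ?B (Suc f)"
        by (auto simp: nth_append)
    qed
    finally show ?case .
  qed
  show ?thesis
    unfolding D_data_prod card_cartesian_product by (rule mult_le_mono[OF 1 2])
qed

section \<open>Young subgroups and antisymmetrizers\<close>

locale young =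
  fixes f m :: nat and \<nu> :: "nat \<Rightarrow> nat"
  assumes fm: "f \<le> m" and part: "\<nu> \<in> partitions (m - f)"
begin

definition off :: "nat \<Rightarrow> nat" where
  "off i = f + (\<Sum>k<i. \<nu> k)"

text \<open>The set of entries of row i of \<open>row_tableau\<close>; \<open>off i\<close> is the
  number just before the first of them.\<close>

definition row :: "nat \<Rightarrow> nat set" where
  "row i = {off i<..off (Suc i)}"

lemma off_Suc: "off (Suc i) = off i + \<nu> i"
  by (simp add: off_def)

lemma off_mono: "i \<le> j \<Longrightarrow> off i \<le> off j"
  unfolding off_def by (intro add_left_mono sum_mono2) auto

lemma off_eq: "m - f \<le> M \<Longrightarrow> off M = m"
  unfolding off_def
  using partitions_iff[of M \<nu> "m - f"] partitions_zero[OF part] part fm by simp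

lemma off_le: "off i \<le> m"
  using off_mono[of i "max i (m - f)"] off_eq[of "max i (m - f)"] by simp

lemma row_sub: "row i \<subseteq> {f + 1..m}"
  unfolding row_def using off_le[of "Suc i"] by (auto simp: off_def)

lemma row_cover:
  assumes "x \<in> {f + 1..m}"
  obtains i where "x \<in> row i"
proof -
  define i where "i = (LEAST i. x \<le> off (Suc i))"
  have ex: "x \<le> off (Suc (m - f))" using off_eq[of "Suc (m - f)"] assms by simp
  then have 1: "x \<le> off (Suc i)" unfolding i_def by (rule LeastI)
  have "off i < x"
  proof (cases i)
    case 0
    then show ?thesis using assms by (simp add: off_def)
  next
    case (Suc j)
    then show ?thesis using not_less_Least[of j "\<lambda>i. x \<le> off (Suc i)"] unfolding i_def by simp
  qed
  then show ?thesis using 1 that[of i] by (simp add: row_def)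
qed

lemma row_less:
  assumes "x \<in> row i" "y \<in> row j" "i < j"
  shows "x < y"
  using assms off_mono[of "Suc i" j] by (simp add: row_def)

lemma row_disjoint: "x \<in> row i \<Longrightarrow> x \<in> row j \<Longrightarrow> i = j"
  using row_less[of x i x j] row_less[of x j x i] by (metis less_irrefl linorder_neqE_nat)

lemma row_convex: "x \<in> row i \<Longrightarrow> y \<in> row i \<Longrightarrow> x \<le> z \<Longrightarrow> z \<le> y \<Longrightarrow> z \<in> row i"
  by (simp add: row_def)

lemma row_tableau_eq: "j < \<nu> i \<Longrightarrow> row_tableau f \<nu> (i, j) = off i + j + 1"
  by (simp add: row_tableau_def diagram_def off_def)

lemma row_eq: "{row_tableau f \<nu> (i, j) | j. j < \<nu> i} = row i"
proof
  show "{row_tableau f \<nu> (i, j) | j. j < \<nu> i} \<subseteq> row i"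
    by (auto simp: row_def off_Suc row_tableau_eq)
  show "row i \<subseteq> {row_tableau f \<nu> (i, j) | j. j < \<nu> i}"
  proof
    fix x assume x: "x \<in> row i"
    then have "x - off i - 1 < \<nu> i" "x = off i + (x - off i - 1) + 1" by (auto simp: row_def off_Suc)
    then show "x \<in> {row_tableau f \<nu> (i, j) | j. j < \<nu> i}"
      using row_tableau_eq by (metis (mono_tags, lifting) mem_Collect_eq)
  qed
qed

lemma row_tableau_bij: "bij_betw (row_tableau f \<nu>) (diagram \<nu>) {f + 1..m}"
  unfolding bij_betw_def
proof
  show "inj_on (row_tableau f \<nu>) (diagram \<nu>)"
  proof (rule inj_onI, clarify)
    fix i j i' j' assume a: "(i, j) \<in> diagram \<nu>" "(i', j') \<in> diagram \<nu>"
      and e: "row_tableau f \<nu> (i, j) = row_tableau f \<nu> (i', j')"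
    then have l: "j < \<nu> i" "j' < \<nu> i'" by (auto simp: diagram_def)
    then have "row_tableau f \<nu> (i, j) \<in> row i" "row_tableau f \<nu> (i', j') \<in> row i'"
      using row_eq by blast+
    then have "i = i'" using row_disjoint e by metis
    then show "i = i' \<and> j = j'" using e l by (simp add: row_tableau_eq)
  qed
  show "row_tableau f \<nu> ` diagram \<nu> = {f + 1..m}"
  proof
    show "row_tableau f \<nu> ` diagram \<nu> \<subseteq> {f + 1..m}"
      using row_eq row_sub by (fastforce simp: diagram_def)
    show "{f + 1..m} \<subseteq> row_tableau f \<nu> ` diagram \<nu>"
    proof
      fix x assume "x \<in> {f + 1..m}"
      then obtain i where "x \<in> row i" by (rule row_cover)
      then obtain j where "j < \<nu> i" "x = row_tableau f \<nu> (i, j)" unfolding row_eq[symmetric] by blast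
      then show "x \<in> row_tableau f \<nu> ` diagram \<nu>" by (auto simp: diagram_def)
    qed
  qed
qed

definition Stab :: "(nat \<Rightarrow> nat) set" where
  "Stab = row_stabilizer f m \<nu>"

lemma Stab_iff: "w \<in> Stab \<longleftrightarrow> w permutes {f + 1..m} \<and> (\<forall>i. w ` row i = row i)"
  unfolding Stab_def row_stabilizer_def row_eq by simp

lemma permutes_up: "w permutes {f + 1..m} \<Longrightarrow> w permutes {1..m}"
  by (rule permutes_subset) auto

lemma Stab_permutes: "w \<in> Stab \<Longrightarrow> w permutes {1..m}"
  using Stab_iff permutes_up by blast

lemma Stab_row: "w \<in> Stab \<Longrightarrow> w x \<in> row i \<longleftrightarrow> x \<in> row i"
proof -
  assume w: "w \<in> Stab"
  then have "w ` row i = row i" and "inj w"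
    using permutes_inj by (auto simp: Stab_iff)
  then show ?thesis by (metis inj_image_mem_iff)
qed

lemma Stab_inv_row: "w \<in> Stab \<Longrightarrow> inv w x \<in> row i \<longleftrightarrow> x \<in> row i"
  using Stab_row[of w "inv w x" i] permutes_inverses(1)[OF Stab_permutes, of w x] by simp

lemma Stab_finite: "finite Stab"
  by (rule finite_subset[OF _ finite_permutations[of "{f + 1..m}"]]) (auto simp: Stab_iff)

lemma Stab_id: "id \<in> Stab"
  by (simp add: Stab_iff permutes_id)

lemma Stab_comp: "u \<in> Stab \<Longrightarrow> w \<in> Stab \<Longrightarrow> u \<circ> w \<in> Stab"
  unfolding Stab_iff image_comp[symmetric] using permutes_compose by metis

lemma Stab_inv: "w \<in> Stab \<Longrightarrow> inv w \<in> Stab"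
proof -
  assume w: "w \<in> Stab"
  then have p: "w permutes {f + 1..m}" by (simp add: Stab_iff)
  have "inv w ` row i = row i" for i
  proof -
    have "inv w ` (w ` row i) = row i" by (simp add: image_comp permutes_inv_o[OF p])
    then show ?thesis using w by (simp add: Stab_iff)
  qed
  then show ?thesis using permutes_inv[OF p] by (simp add: Stab_iff)
qed

lemma Stab_simple_tr:
  assumes k: "k \<in> row i" "Suc k \<in> row i"
  shows "simple_tr k \<in> Stab"
  unfolding Stab_iff
proof (intro conjI allI)
  show "simple_tr k permutes {f + 1..m}" using k row_sub[of i] by (intro simple_tr_permutes) auto
  fix j
  have "simple_tr k x \<in> row j" if "x \<in> row j" for x
  proof (cases "i = j")
    case True
    then show ?thesis using k that by (auto simp: transpose_def)
  next
    case False
    then have "x \<noteq> k" "x \<noteq> Suc k" using row_disjoint k that by auto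
    then show ?thesis using that by simp
  qed
  then show "simple_tr k ` row j = row j"
    by (metis image_subsetI subset_antisym subsetI image_eqI transpose_involutory)
qed

text \<open>Distinct rows occupy disjoint intervals, and \<open>w\<close> preserves each of them, so
  their relative order cannot be reversed.\<close>

lemma Stab_inversions:
  assumes w: "w \<in> Stab" and xy: "(x, y) \<in> inversions w"
  shows "\<exists>i. x \<in> row i \<and> y \<in> row i"
proof -
  have "w permutes {f + 1..m}" using w by (simp add: Stab_iff)
  from inversions_subset[OF this] xy have xy': "x \<in> {f + 1..m}" "y \<in> {f + 1..m}" by auto
  have l: "x < y" "w y < w x" using xy by (auto simp: inversions_def)
  obtain i where i: "x \<in> row i" using row_cover[OF xy'(1)] .
  obtain j where j: "y \<in> row j" using row_cover[OF xy'(2)] .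
  have "w x \<in> row i" "w y \<in> row j" using Stab_row[OF w] i j by auto
  then have "i = j" using row_less[of x i y j] row_less[of "w x" i "w y" j] row_less[OF j i] l
    by (metis less_asym linorder_neqE_nat)
  then show ?thesis using i j by blast
qed

text \<open>An element with the most inversions: an ascent inside a row could be used to lengthen it
  within \<open>Stab\<close>.\<close>

lemma longest:
  obtains w0 where "w0 \<in> Stab" "\<And>k i. k \<in> row i \<Longrightarrow> Suc k \<in> row i \<Longrightarrow> inv w0 (Suc k) < inv w0 k"
proof -
  let ?l = "\<lambda>w. card (inversions w)"
  have "Max (?l ` Stab) \<in> ?l ` Stab" using Stab_finite Stab_id by (intro Max_in) auto
  then obtain w0 where w0: "w0 \<in> Stab" "?l w0 = Max (?l ` Stab)" by auto
  have max: "?l w \<le> ?l w0" if "w \<in> Stab" for w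
    using w0(2) that Stab_finite by simp
  have "inv w0 (Suc k) < inv w0 k" if k: "k \<in> row i" "Suc k \<in> row i" for k i
  proof (rule ccontr)
    assume "\<not> ?thesis"
    then have "inv w0 k < inv w0 (Suc k)"
      using inv_neq[OF Stab_permutes[OF w0(1)], of k "Suc k"] by simp
    from card_inversions_up[OF Stab_permutes[OF w0(1)] this]
    show False using max[OF Stab_comp[OF Stab_simple_tr[OF k] w0(1)]] by simp
  qed
  then show ?thesis using w0(1) that by blast
qed

definition row_inc :: "nat list \<Rightarrow> bool" where
  "row_inc K \<longleftrightarrow> (\<forall>i x y. x \<in> row i \<longrightarrow> y \<in> row i \<longrightarrow> x < y \<longrightarrow> K ! (x - 1) < K ! (y - 1))"

definition row_dec :: "nat list \<Rightarrow> bool" where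
  "row_dec K \<longleftrightarrow> (\<forall>i x y. x \<in> row i \<longrightarrow> y \<in> row i \<longrightarrow> x < y \<longrightarrow> K ! (y - 1) < K ! (x - 1))"

lemma row_dec_adjacent:
  assumes "\<And>k i. k \<in> row i \<Longrightarrow> Suc k \<in> row i \<Longrightarrow> K ! k < K ! (k - 1)"
  shows "row_dec K"
  unfolding row_dec_def
proof (intro allI impI)
  fix i x y assume x: "x \<in> row i" and y: "y \<in> row i" and l: "x < y"
  from l have "Suc x \<le> y" by simp
  then show "K ! (y - 1) < K ! (x - 1)"
    using y
  proof (induction y rule: dec_induct)
    case base
    then show ?case using assms[OF x] by simp
  next
    case (step y)
    have "y \<in> row i" using row_convex[OF x step.prems, of y] step.hyps by simp
    then have "K ! y < K ! (x - 1)"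
      using step.IH less_trans[OF assms[OF _ step.prems]] by blast
    then show ?case by simp
  qed
qed

end

locale young_hecke = young f m \<nu> + hecke_family q m X G
  for f m \<nu> and q :: "'a::field" and X :: "'a tensor set" and G
begin

lemma row_generator: "k \<in> row i \<Longrightarrow> Suc k \<in> row i \<Longrightarrow> k \<in> {1..<m}"
  using row_sub[of i] by (auto simp: subset_iff)

lemma antisym_act_eq: "antisym_act G q f m \<nu> x = antisym Stab x"
  unfolding antisym_act_def antisym_def Stab_def[symmetric]
  by (rule sum.cong) (simp_all add: perm_len_eq[OF Stab_permutes])

lemma Stab_G:
  assumes "k \<in> row i" "Suc k \<in> row i" "x \<in> X"
  shows "antisym Stab (G k x) = (- q) \<odot> antisym Stab x"
    and "G k x = inverse q \<odot> x \<Longrightarrow> antisym Stab x = 0"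
  using antisym_G[OF Stab_permutes row_generator[OF assms(1,2)] _ Stab_finite assms(3)]
    antisym_kill[OF Stab_permutes row_generator[OF assms(1,2)] _ Stab_finite assms(3)]
    Stab_comp[OF _ Stab_simple_tr[OF assms(1,2)]] by blast+

text \<open>The eigenvalue -q from \<open>Stab_G\<close> is collected once for every letter of a
  reduced word of \<open>w\<close>.\<close>

lemma antisym_gw:
  assumes w: "w \<in> Stab" and x: "x \<in> X"
  shows "antisym Stab (gw_act G m w x) = ((- q) ^ card (inversions w)) \<odot> antisym Stab x"
proof -
  obtain ks where ks: "rword m ks" "perm_of ks = w" "gw_act G m w x = fold G ks x"
    using gw_rword[OF Stab_permutes[OF w]] x by metis
  have "rword m ks \<Longrightarrow> perm_of ks \<in> Stab \<Longrightarrow> antisym Stab (fold G ks x) = ((- q) ^ length ks) \<odot> antisym Stab x" for ks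
  proof (induction ks rule: rev_induct)
    case Nil
    then show ?case by simp
  next
    case (snoc k ks)
    have r: "rword m ks" using snoc.prems(1) unfolding rword_snoc by blast
    have s: "set ks \<subseteq> {1..<m}" using r by (simp add: rword_def)
    have p: "perm_of ks permutes {1..m}" using s by (rule perm_of_permutes)
    \<comment> \<open>The last letter creates an inversion of an element of \<open>Stab\<close>,
      which lies inside one row; this also keeps the shortened word in \<open>Stab\<close>.\<close>
    obtain i where i: "inv (perm_of ks) k \<in> row i" "inv (perm_of ks) (Suc k) \<in> row i"
      using Stab_inversions[OF snoc.prems(2) rword_snoc_inversion[OF snoc.prems(1)]] by blast
    have "perm_of (ks @ [k]) (inv (perm_of ks) k) = Suc k" "perm_of (ks @ [k]) (inv (perm_of ks) (Suc k)) = k"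
      unfolding perm_of_snoc by (simp_all add: permutes_inverses[OF p])
    then have k: "k \<in> row i" "Suc k \<in> row i"
      using Stab_row[OF snoc.prems(2)] i by metis+
    have "simple_tr k \<circ> perm_of (ks @ [k]) \<in> Stab"
      by (rule Stab_comp[OF Stab_simple_tr[OF k] snoc.prems(2)])
    then have "perm_of ks \<in> Stab" unfolding perm_of_snoc simple_tr_cancel .
    from snoc.IH[OF r this] show ?case
      using Stab_G(1)[OF k fold_X[OF s x]] by simp
  qed
  from this[OF ks(1)] show ?thesis using ks w by (simp add: rword_def)
qed

text \<open>Here \<open>\<beta>\<close> sends a word to a basis vector with the other tensor part
  fixed, and \<open>L\<close> collects the admissible words. The abstraction covers the vector side
  and the dual side at once.\<close>

context
  fixes \<beta> :: "nat list \<Rightarrow> 'a tensor" and L :: "nat list set"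
  assumes L: "\<And>K. K \<in> L \<Longrightarrow> length K = m \<and> \<beta> K \<in> X"
    and Lp: "\<And>K w. K \<in> L \<Longrightarrow> w permutes {1..m} \<Longrightarrow> pact w K \<in> L"
    and pure: "\<And>K w. K \<in> L \<Longrightarrow> w permutes {1..m} \<Longrightarrow> (\<And>x y. (x, y) \<in> inversions w \<Longrightarrow> K ! (y - 1) < K ! (x - 1)) \<Longrightarrow>
      gw_act G m w (\<beta> K) = \<beta> (pact w K)"
begin

lemma gw_row_dec:
  assumes "K \<in> L" "row_dec K" "w \<in> Stab"
  shows "gw_act G m w (\<beta> K) = \<beta> (pact w K)"
proof (rule pure[OF assms(1) Stab_permutes[OF assms(3)]])
  fix x y assume xy: "(x, y) \<in> inversions w"
  then have "x < y" by (simp add: inversions_def)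
  then show "K ! (y - 1) < K ! (x - 1)"
    using Stab_inversions[OF assms(3) xy] assms(2) unfolding row_dec_def by blast
qed

lemma antisym_row_dec:
  assumes "K \<in> L" "row_dec K"
  shows "antisym Stab (\<beta> K) = (\<Sum>w\<in>Stab. ((- q) ^ card (inversions w)) \<odot> \<beta> (pact w K))"
  unfolding antisym_def by (rule sum.cong) (simp_all add: gw_row_dec[OF assms])

text \<open>A row-increasing word is obtained from a row-decreasing one by the longest element.\<close>

lemma antisym_row_inc:
  assumes w0: "w0 \<in> Stab" "\<And>k i. k \<in> row i \<Longrightarrow> Suc k \<in> row i \<Longrightarrow> inv w0 (Suc k) < inv w0 k"
    and K: "K \<in> L" "row_inc K"
  shows "antisym Stab (\<beta> K) =
    (\<Sum>w\<in>Stab. ((- q) ^ (card (inversions (inv w0)) + card (inversions (w \<circ> inv w0)))) \<odot> \<beta> (pact w K))"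
proof -
  let ?K = "pact w0 K"
  note p0 = Stab_permutes[OF w0(1)]
  have lK: "length K = m" using L[OF K(1)] by simp
  have K': "?K \<in> L" by (rule Lp[OF K(1) p0])
  have dec: "row_dec ?K"
  proof (rule row_dec_adjacent)
    fix k i assume k: "k \<in> row i" "Suc k \<in> row i"
    have km: "k \<in> {1..<m}" by (rule row_generator[OF k])
    have "K ! (inv w0 (Suc k) - 1) < K ! (inv w0 k - 1)"
      using K(2) w0(2)[OF k] Stab_inv_row[OF w0(1)] k unfolding row_inc_def by blast
    moreover have "?K ! k = K ! (inv w0 (Suc k) - 1)" using km lK by (intro nth_pact) simp
    moreover have "?K ! (k - 1) = K ! (inv w0 k - 1)"
      using km lK nth_pact[of "k - 1" K w0] by (simp add: less_imp_diff_less)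
    ultimately show "?K ! k < ?K ! (k - 1)" by simp
  qed
  have restore: "pact (inv w0) ?K = K"
  proof -
    have "pact (inv w0) ?K = pact (inv w0 \<circ> w0) K"
      using p0 permutes_inv[OF p0] lK by (intro pact_comp) simp_all
    then show ?thesis by (simp only: permutes_inv_o[OF p0] pact_id)
  qed
  have "antisym Stab (\<beta> K) = antisym Stab (gw_act G m (inv w0) (\<beta> ?K))"
    unfolding gw_row_dec[OF K' dec Stab_inv[OF w0(1)]] restore ..
  also have "\<dots> = ((- q) ^ card (inversions (inv w0))) \<odot> antisym Stab (\<beta> ?K)"
    using L[OF K'] by (intro antisym_gw Stab_inv w0(1)) simp
  also have "\<dots> = (\<Sum>w\<in>Stab. ((- q) ^ (card (inversions (inv w0)) + card (inversions w))) \<odot> \<beta> (pact w ?K))"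
    unfolding antisym_row_dec[OF K' dec] tensor_vs.scale_sum_right by (simp add: power_add)
  also have "\<dots> = (\<Sum>w\<in>Stab. ((- q) ^ (card (inversions (inv w0)) + card (inversions (w \<circ> inv w0)))) \<odot> \<beta> (pact w K))"
  proof (rule sum.reindex_bij_witness[where i = "\<lambda>w. w \<circ> inv w0" and j = "\<lambda>w. w \<circ> w0"])
    fix w assume w: "w \<in> Stab"
    show c: "w \<circ> w0 \<circ> inv w0 = w" by (simp add: comp_assoc permutes_inv_o[OF p0])
    show "w \<circ> w0 \<in> Stab" by (rule Stab_comp[OF w w0(1)])
    show "w \<circ> inv w0 \<circ> w0 = w" by (simp add: comp_assoc permutes_inv_o[OF p0])
    show "w \<circ> inv w0 \<in> Stab" by (rule Stab_comp[OF w Stab_inv[OF w0(1)]])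
    have "pact w ?K = pact (w \<circ> w0) K"
      using p0 Stab_permutes[OF w] lK by (intro pact_comp) simp_all
    then show "((- q) ^ (card (inversions (inv w0)) + card (inversions (w \<circ> w0 \<circ> inv w0)))) \<odot> \<beta> (pact (w \<circ> w0) K) =
      ((- q) ^ (card (inversions (inv w0)) + card (inversions w))) \<odot> \<beta> (pact w ?K)"
      unfolding c by (simp only:)
  qed
  finally show ?thesis .
qed

end

end

section \<open>Leading words\<close>

definition cnt :: "(nat \<Rightarrow> int) \<Rightarrow> int \<Rightarrow> nat \<Rightarrow> nat list \<Rightarrow> nat" where
  "cnt \<kappa> c p I = length (filter (\<lambda>a. \<kappa> a \<le> c) (take p I))"

text \<open>The dominance order on words: the larger word has its letters of small key earlier. The
  free key function makes it possible to reverse the order of the letters on the dual side.\<close>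

definition dmd :: "(nat \<Rightarrow> int) \<Rightarrow> nat list \<Rightarrow> nat list \<Rightarrow> bool" where
  "dmd \<kappa> I I' \<longleftrightarrow> (\<forall>p c. cnt \<kappa> c p I \<le> cnt \<kappa> c p I')"

lemma cnt_Suc: "p < length I \<Longrightarrow> cnt \<kappa> c (Suc p) I = cnt \<kappa> c p I + (if \<kappa> (I ! p) \<le> c then 1 else 0)"
  by (simp add: cnt_def take_Suc_conv_app_nth)

lemma dmd_refl [simp]: "dmd \<kappa> I I"
  by (simp add: dmd_def)

lemma dmd_trans: "dmd \<kappa> I J \<Longrightarrow> dmd \<kappa> J K \<Longrightarrow> dmd \<kappa> I K"
  unfolding dmd_def by (meson order_trans)

lemma dmd_antisym:
  assumes "inj \<kappa>" "length I = length J" "dmd \<kappa> I J" "dmd \<kappa> J I"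
  shows "I = J"
proof (rule nth_equalityI[OF assms(2)])
  fix p assume p: "p < length I"
  have e: "cnt \<kappa> c p I = cnt \<kappa> c p J" for c p
    using assms(3,4) by (simp add: dmd_def order_antisym)
  have "\<kappa> (I ! p) \<le> c \<longleftrightarrow> \<kappa> (J ! p) \<le> c" for c
    using e[of c p] e[of c "Suc p"] p assms(2) by (simp add: cnt_Suc split: if_splits)
  then have "\<kappa> (I ! p) = \<kappa> (J ! p)" by (metis order_antisym order_refl)
  then show "I ! p = J ! p" using assms(1) by (simp add: inj_eq)
qed

lemma cnt_swap:
  assumes "1 \<le> k" "k < length I"
  shows "cnt \<kappa> c p (swap_at k I) =
    (if p = k then cnt \<kappa> c (k - 1) I + (if \<kappa> (I ! k) \<le> c then 1 else 0) else cnt \<kappa> c p I)"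
  using assms
proof (rule split_at)
  fix xs a b ys assume I: "I = xs @ a # b # ys" and k: "k = Suc (length xs)"
  consider "p \<le> length xs" | "p = Suc (length xs)" | p' where "p = Suc (Suc (length xs + p'))"
    by (metis add_Suc le_Suc_ex not_less_eq_eq nat_less_le Suc_leI not_le)
  then show ?thesis
    by cases (simp_all add: I k swap_at_append cnt_def nth_append)
qed

text \<open>The exchange affects only the counts for the prefix of length k. The last claim is an
  analogue of the lifting property of Bruhat order; if both exchanged letters of \<open>I\<close>
  exceed the bound c, it follows from the counts for the prefix of length k + 1.\<close>

lemma dmd_swap:
  assumes k: "1 \<le> k" "k < length I" and d: "\<kappa> (I ! k) < \<kappa> (I ! (k - 1))"
  shows "dmd \<kappa> I (swap_at k I)"
    and "\<not> dmd \<kappa> (swap_at k I) I"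
    and "dmd \<kappa> J I \<Longrightarrow> length J = length I \<Longrightarrow> dmd \<kappa> (swap_at k J) (swap_at k I)"
proof -
  have s: "cnt \<kappa> c k L = cnt \<kappa> c (k - 1) L + (if \<kappa> (L ! (k - 1)) \<le> c then 1 else 0)"
    "cnt \<kappa> c (Suc k) L = cnt \<kappa> c k L + (if \<kappa> (L ! k) \<le> c then 1 else 0)" if "length L = length I" for L c
    using k that cnt_Suc[of "k - 1" L \<kappa> c] cnt_Suc[of k L \<kappa> c] by (simp_all add: less_imp_diff_less)
  show "dmd \<kappa> I (swap_at k I)"
    unfolding dmd_def cnt_swap[OF k] using d s(1)[OF refl] by auto
  show "\<not> dmd \<kappa> (swap_at k I) I"
  proof
    assume "dmd \<kappa> (swap_at k I) I"
    then have "cnt \<kappa> (\<kappa> (I ! k)) k (swap_at k I) \<le> cnt \<kappa> (\<kappa> (I ! k)) k I" unfolding dmd_def by blast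
    then show False unfolding cnt_swap[OF k] using d s(1)[OF refl, of "\<kappa> (I ! k)"] by simp
  qed
  assume J: "dmd \<kappa> J I" "length J = length I"
  have k': "k < length J" using k(2) J(2) by simp
  have le: "cnt \<kappa> c p J \<le> cnt \<kappa> c p I" for c p using J(1) by (simp add: dmd_def)
  show "dmd \<kappa> (swap_at k J) (swap_at k I)"
    unfolding dmd_def cnt_swap[OF k] cnt_swap[OF k(1) k']
  proof (intro allI)
    fix p c
    show "(if p = k then cnt \<kappa> c (k - 1) J + (if \<kappa> (J ! k) \<le> c then 1 else 0) else cnt \<kappa> c p J)
      \<le> (if p = k then cnt \<kappa> c (k - 1) I + (if \<kappa> (I ! k) \<le> c then 1 else 0) else cnt \<kappa> c p I)"
    proof (cases "\<kappa> (I ! k) \<le> c")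
      case True
      then show ?thesis using le[of c p] le[of c "k - 1"] by simp
    next
      case False
      then show ?thesis
        using d le[of c p] le[of c "Suc k"] s[OF refl, of c] s[OF J(2), of c] by (auto split: if_splits)
    qed
  qed
qed

lemma dmd_pact:
  assumes w: "w permutes {1..length I}" and inv: "\<And>x y. (x, y) \<in> inversions w \<Longrightarrow> \<kappa> (I ! (x - 1)) < \<kappa> (I ! (y - 1))"
  shows "dmd \<kappa> (pact w I) I"
proof -
  obtain ks where ks: "rword (length I) ks" "perm_of ks = w" using ex_rword[OF w] by blast
  have "dmd \<kappa> (pact (perm_of ks) I) I"
  proof (rule pact_rword_induct[OF ks(1) refl, where R = "\<lambda>a b. \<kappa> a < \<kappa> b" and Q = "\<lambda>us K. dmd \<kappa> K I"])
    show "\<kappa> (I ! (x - 1)) < \<kappa> (I ! (y - 1))" if "(x, y) \<in> inversions (perm_of ks)" for x y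
      using inv that unfolding ks(2) .
    fix us k K assume K: "dmd \<kappa> K I" "k \<in> {1..<length I}" "length K = length I" "\<kappa> (K ! (k - 1)) < \<kappa> (K ! k)"
    then have k: "1 \<le> k" "k < length (swap_at k K)" by simp_all
    have "\<kappa> (swap_at k K ! k) < \<kappa> (swap_at k K ! (k - 1))"
      using K by (simp add: nth_swap_at less_imp_diff_less)
    from dmd_swap(1)[OF k this] have "dmd \<kappa> (swap_at k K) K"
      using K by (simp add: swap_at_invol)
    then show "dmd \<kappa> (swap_at k K) I" using K(1) dmd_trans by blast
  qed simp
  then show ?thesis unfolding ks(2) .
qed

abbreviation vkey :: "nat \<Rightarrow> int" where "vkey \<equiv> int"

text \<open>The rows of the initial dual word decrease while those of the initial vector word
  increase. With the letters reversed here, the initial rows are the largest rearrangements on both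
  sides.\<close>

abbreviation wkey :: "nat \<Rightarrow> int" where "wkey \<equiv> \<lambda>a. - int a"

text \<open>
  Only words with the letters of \<open>I0\<close> and \<open>J0\<close> are compared, first in the vector part and then,
  if these agree, in the dual part.
\<close>

definition leading :: "nat \<Rightarrow> nat \<Rightarrow> nat \<Rightarrow> 'a::field tensor \<Rightarrow> nat list \<Rightarrow> nat list \<Rightarrow> bool" where
  "leading n r s x I0 J0 \<longleftrightarrow> x \<in> mixed n r s \<and> (I0, J0) \<in> multi_idx n r s \<and> x (mono_word I0 J0) \<noteq> 0 \<and>
     (\<forall>I J. mset I = mset I0 \<longrightarrow> mset J = mset J0 \<longrightarrow> x (mono_word I J) \<noteq> 0 \<longrightarrow>
        dmd vkey I I0 \<and> (I = I0 \<longrightarrow> dmd wkey J J0))"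

text \<open>The new coefficient at \<open>swap_at k I0\<close> is the old one at \<open>I0\<close>:
  the extra term of the Hecke action involves the old coefficient at \<open>swap_at k I0\<close>,
  which vanishes because this word lies strictly above \<open>I0\<close>. So nothing can cancel,
  whatever q is.\<close>

lemma leading_g:
  assumes l: "leading n r s x I0 J0" and k: "k \<in> {1..<r}" and d: "I0 ! k < I0 ! (k - 1)"
  shows "leading n r s (g_act q n r s k x) (swap_at k I0) J0"
proof -
  have x: "x \<in> mixed n r s" and IJ: "(I0, J0) \<in> multi_idx n r s" and nz: "x (mono_word I0 J0) \<noteq> 0"
    and le: "\<And>I J. mset I = mset I0 \<Longrightarrow> mset J = mset J0 \<Longrightarrow> x (mono_word I J) \<noteq> 0 \<Longrightarrow>
        dmd vkey I I0 \<and> (I = I0 \<longrightarrow> dmd wkey J J0)"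
    using l unfolding leading_def by blast+
  have len: "length I0 = r" using IJ by (simp add: multi_idx_def)
  have k': "1 \<le> k" "k < length I0" using k len by auto
  have dv: "vkey (I0 ! k) < vkey (I0 ! (k - 1))" using d by simp
  note sw = dmd_swap[OF k' dv]
  note c = g_act_coeff[OF x k]
  have top: "x (mono_word (swap_at k I0) J) = 0" if "mset J = mset J0" for J
    using le[of "swap_at k I0" J] sw(2) mset_swap_at[OF k'] that by blast
  have val: "g_act q n r s k x (mono_word (swap_at k I0) J) = x (mono_word I0 J)" if "mset J = mset J0" for J
    unfolding c hop_def using top[OF that] k' d by (simp add: nth_swap_at swap_at_invol less_imp_diff_less)
  show ?thesis
    unfolding leading_def
  proof (intro conjI allI impI)
    show "g_act q n r s k x \<in> mixed n r s" by (rule g_act_mixed[OF k])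
    show "(swap_at k I0, J0) \<in> multi_idx n r s" by (rule multi_idx_swap(1)[OF IJ k])
    show "g_act q n r s k x (mono_word (swap_at k I0) J0) \<noteq> 0" using val[of J0] nz by simp
    fix I J assume ms: "mset I = mset (swap_at k I0)" "mset J = mset J0" and nz': "g_act q n r s k x (mono_word I J) \<noteq> 0"
    then have mI: "mset I = mset I0" using mset_swap_at[OF k'] by simp
    then have lI: "length I = length I0" by (rule mset_eq_length)
    then have kI: "1 \<le> k" "k < length I" using k' by auto
    have "x (mono_word I J) \<noteq> 0 \<or> x (mono_word (swap_at k I) J) \<noteq> 0"
      by (rule ccontr) (use nz' in \<open>simp add: c hop_def split: if_splits\<close>)
    then consider "x (mono_word I J) \<noteq> 0" | "x (mono_word (swap_at k I) J) \<noteq> 0" by blast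
    then show "dmd vkey I (swap_at k I0)"
    proof cases
      case 1
      then have "dmd vkey I I0" using le[OF mI ms(2)] by blast
      then show ?thesis using sw(1) dmd_trans by blast
    next
      case 2
      then have "dmd vkey (swap_at k I) I0" using le[of "swap_at k I" J] mset_swap_at[OF kI] mI ms(2) by simp
      from sw(3)[OF this] show ?thesis using lI swap_at_invol[OF kI] by simp
    qed
    assume "I = swap_at k I0"
    then show "dmd wkey J J0" using nz' val[OF ms(2)] le[OF refl ms(2)] by simp
  qed
qed

text \<open>Mirror image of \<open>leading_g\<close>; an ascent takes the place of the descent
  because \<open>wkey\<close> reverses the letters.\<close>

lemma leading_gs:
  assumes l: "leading n r s x I0 J0" and k: "k \<in> {1..<s}" and d: "J0 ! (k - 1) < J0 ! k"
  shows "leading n r s (gs_act q n r s k x) I0 (swap_at k J0)"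
proof -
  have x: "x \<in> mixed n r s" and IJ: "(I0, J0) \<in> multi_idx n r s" and nz: "x (mono_word I0 J0) \<noteq> 0"
    and le: "\<And>I J. mset I = mset I0 \<Longrightarrow> mset J = mset J0 \<Longrightarrow> x (mono_word I J) \<noteq> 0 \<Longrightarrow>
        dmd vkey I I0 \<and> (I = I0 \<longrightarrow> dmd wkey J J0)"
    using l unfolding leading_def by blast+
  have len: "length J0 = s" using IJ by (simp add: multi_idx_def)
  have k': "1 \<le> k" "k < length J0" using k len by auto
  have dv: "wkey (J0 ! k) < wkey (J0 ! (k - 1))" using d by simp
  note sw = dmd_swap[OF k' dv]
  note c = gs_act_coeff[OF x k]
  have top: "x (mono_word I0 (swap_at k J0)) = 0"
    using le[of I0 "swap_at k J0"] sw(2) mset_swap_at[OF k'] by blast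
  have val: "gs_act q n r s k x (mono_word I0 (swap_at k J0)) = x (mono_word I0 J0)"
    unfolding c hop_def using top k' d by (simp add: nth_swap_at swap_at_invol less_imp_diff_less)
  show ?thesis
    unfolding leading_def
  proof (intro conjI allI impI)
    show "gs_act q n r s k x \<in> mixed n r s" by (rule gs_act_mixed[OF k])
    show "(I0, swap_at k J0) \<in> multi_idx n r s" by (rule multi_idx_swap(2)[OF IJ k])
    show "gs_act q n r s k x (mono_word I0 (swap_at k J0)) \<noteq> 0" using val nz by simp
    fix I J assume ms: "mset I = mset I0" "mset J = mset (swap_at k J0)" and nz': "gs_act q n r s k x (mono_word I J) \<noteq> 0"
    then have mJ: "mset J = mset J0" using mset_swap_at[OF k'] by simp
    then have lJ: "length J = length J0" by (rule mset_eq_length)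
    then have kJ: "1 \<le> k" "k < length J" using k' by auto
    have mJ': "mset (swap_at k J) = mset J0" using mset_swap_at[OF kJ] mJ by simp
    have cs: "x (mono_word I J) \<noteq> 0 \<or> x (mono_word I (swap_at k J)) \<noteq> 0"
      by (rule ccontr) (use nz' in \<open>simp add: c hop_def split: if_splits\<close>)
    show "dmd vkey I I0" using cs le[OF ms(1) mJ] le[OF ms(1) mJ'] by blast
    assume I: "I = I0"
    from cs show "dmd wkey J (swap_at k J0)"
    proof
      assume 1: "x (mono_word I J) \<noteq> 0"
      then have "dmd wkey J J0" using le[OF ms(1) mJ] I by blast
      then show ?thesis using sw(1) dmd_trans by blast
    next
      assume 2: "x (mono_word I (swap_at k J)) \<noteq> 0"
      then have "dmd wkey (swap_at k J) J0" using le[OF ms(1) mJ'] I by blast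
      from sw(3)[OF this] show ?thesis using lJ swap_at_invol[OF kJ] by simp
    qed
  qed
qed

lemma leading_gw_g:
  assumes q: "q \<noteq> 0" and l: "leading n r s x I0 J0" and w: "w permutes {1..r}"
    and inv: "\<And>x y. (x, y) \<in> inversions w \<Longrightarrow> I0 ! (y - 1) < I0 ! (x - 1)"
  shows "leading n r s (gw_act (g_act q n r s) r w x) (pact w I0) J0"
proof -
  interpret hecke_family q r "mixed n r s" "g_act q n r s" by (rule hecke_family_g[OF q])
  have x: "x \<in> mixed n r s" and len: "length I0 = r" using l by (auto simp: leading_def multi_idx_def)
  obtain ks where ks: "rword r ks" "perm_of ks = w" using ex_rword w by blast
  have "leading n r s (fold (g_act q n r s) ks x) (pact (perm_of ks) I0) J0"
  proof (rule pact_rword_induct[OF ks(1) len, where R = "\<lambda>a b. b < a" and Q = "\<lambda>us K. leading n r s (fold (g_act q n r s) us x) K J0"])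
    show "I0 ! (y - 1) < I0 ! (x - 1)" if "(x, y) \<in> inversions (perm_of ks)" for x y
      using inv that unfolding ks(2) .
    show "leading n r s (fold (g_act q n r s) [] x) I0 J0" using l by simp
    fix us k K
    assume "leading n r s (fold (g_act q n r s) us x) K J0" "k \<in> {1..<r}" "K ! k < K ! (k - 1)"
    then show "leading n r s (fold (g_act q n r s) (us @ [k]) x) (swap_at k K) J0"
      using leading_g by fastforce
  qed
  then show ?thesis unfolding ks(2) gw_fold[OF ks x] .
qed

lemma leading_gw_gs:
  assumes q: "q \<noteq> 0" and l: "leading n r s x I0 J0" and w: "w permutes {1..s}"
    and inv: "\<And>x y. (x, y) \<in> inversions w \<Longrightarrow> J0 ! (x - 1) < J0 ! (y - 1)"
  shows "leading n r s (gw_act (gs_act q n r s) s w x) I0 (pact w J0)"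
proof -
  interpret hecke_family q s "mixed n r s" "gs_act q n r s" by (rule hecke_family_gs[OF q])
  have x: "x \<in> mixed n r s" and len: "length J0 = s" using l by (auto simp: leading_def multi_idx_def)
  obtain ks where ks: "rword s ks" "perm_of ks = w" using ex_rword w by blast
  have "leading n r s (fold (gs_act q n r s) ks x) I0 (pact (perm_of ks) J0)"
  proof (rule pact_rword_induct[OF ks(1) len, where R = "\<lambda>a b. a < b" and Q = "\<lambda>us K. leading n r s (fold (gs_act q n r s) us x) I0 K"])
    show "J0 ! (x - 1) < J0 ! (y - 1)" if "(x, y) \<in> inversions (perm_of ks)" for x y
      using inv that unfolding ks(2) .
    show "leading n r s (fold (gs_act q n r s) [] x) I0 J0" using l by simp
    fix us k K
    assume "leading n r s (fold (gs_act q n r s) us x) I0 K" "k \<in> {1..<s}" "K ! (k - 1) < K ! k"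
    then show "leading n r s (fold (gs_act q n r s) (us @ [k]) x) I0 (swap_at k K)"
      using leading_gs by fastforce
  qed
  then show ?thesis unfolding ks(2) gw_fold[OF ks x] .
qed

text \<open>Triangularity with nonzero diagonal: in a linear relation, choose a term whose leading
  word is maximal among those occurring and compare coefficients at that word.\<close>

lemma leading_independent:
  fixes v :: "'i \<Rightarrow> 'a::field tensor"
  assumes fin: "finite A" and l: "\<And>a. a \<in> A \<Longrightarrow> leading n r s (v a) (fst (K a)) (snd (K a))"
    and ms: "\<And>a b. a \<in> A \<Longrightarrow> b \<in> A \<Longrightarrow> mset (fst (K a)) = mset (fst (K b)) \<and> mset (snd (K a)) = mset (snd (K b))"
    and inj: "inj_on K A"
  shows "inj_on v A \<and> \<not> tensor_vs.dependent (v ` A)"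
proof -
  let ?w = "\<lambda>a. mono_word (fst (K a)) (snd (K a))"
  \<comment> \<open>The strict lexicographic order on leading words. It is treated on
    \<open>A\<close> only, because antisymmetry of \<open>dmd\<close> is available for words of
    equal length.\<close>
  define lt where "lt a b \<longleftrightarrow> (dmd vkey (fst (K a)) (fst (K b)) \<and> fst (K a) \<noteq> fst (K b)) \<or>
     (fst (K a) = fst (K b) \<and> dmd wkey (snd (K a)) (snd (K b)) \<and> snd (K a) \<noteq> snd (K b))" for a b
  have len: "length (fst (K a)) = length (fst (K b))" "length (snd (K a)) = length (snd (K b))" if "a \<in> A" "b \<in> A" for a b
    using ms[OF that] mset_eq_length by blast+
  have as1: "fst (K a) = fst (K b)" if "a \<in> A" "b \<in> A" "dmd vkey (fst (K a)) (fst (K b))" "dmd vkey (fst (K b)) (fst (K a))" for a b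
    using dmd_antisym[of vkey, OF _ len(1)[OF that(1,2)] that(3,4)] by (simp add: inj_def)
  have as2: "snd (K a) = snd (K b)" if "a \<in> A" "b \<in> A" "dmd wkey (snd (K a)) (snd (K b))" "dmd wkey (snd (K b)) (snd (K a))" for a b
    using dmd_antisym[of wkey, OF _ len(2)[OF that(1,2)] that(3,4)] by (simp add: inj_def)
  have asym: "asymp_on A lt"
    by (rule asymp_onI) (use as1 as2 in \<open>auto simp: lt_def\<close>)
  have trans: "transp_on A lt"
  proof (rule transp_onI)
    fix a b c assume abc: "a \<in> A" "b \<in> A" "c \<in> A" "lt a b" "lt b c"
    consider "fst (K a) = fst (K b)" "fst (K b) = fst (K c)" | "fst (K a) = fst (K b)" "fst (K b) \<noteq> fst (K c)"
      | "fst (K a) \<noteq> fst (K b)" by blast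
    then show "lt a c"
    proof cases
      case 1
      then have d: "dmd wkey (snd (K a)) (snd (K b))" "dmd wkey (snd (K b)) (snd (K c))" "snd (K a) \<noteq> snd (K b)"
        using abc(4,5) by (simp_all add: lt_def)
      have "snd (K a) \<noteq> snd (K c)"
        using as2[OF abc(1,2) d(1)] d by auto
      then show ?thesis using 1 dmd_trans[OF d(1,2)] by (simp add: lt_def)
    next
      case 2
      then show ?thesis using abc(4,5) by (simp add: lt_def)
    next
      case 3
      have d: "dmd vkey (fst (K a)) (fst (K b))" "dmd vkey (fst (K b)) (fst (K c))"
        using 3 abc(4,5) by (auto simp: lt_def)
      have "fst (K a) \<noteq> fst (K c)"
        using as1[OF abc(1,2) d(1)] d(2) 3 by auto
      then show ?thesis using dmd_trans[OF d] by (simp add: lt_def)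
    qed
  qed
  have below: "lt b a" if ab: "a \<in> A" "b \<in> A" "a \<noteq> b" "v a (?w b) \<noteq> 0" for a b
  proof -
    have "dmd vkey (fst (K b)) (fst (K a)) \<and> (fst (K b) = fst (K a) \<longrightarrow> dmd wkey (snd (K b)) (snd (K a)))"
      using l[OF ab(1)] ms[OF ab(2,1)] ab(4) unfolding leading_def by blast
    moreover have "K a \<noteq> K b" using inj ab(1-3) by (auto dest: inj_onD)
    ultimately show ?thesis unfolding lt_def by (metis prod_eqI)
  qed
  have diag: "v a (?w a) \<noteq> 0" if "a \<in> A" for a
    using l[OF that] unfolding leading_def by blast
  have injv: "inj_on v A"
  proof (rule inj_onI, rule ccontr)
    fix a b assume ab: "a \<in> A" "b \<in> A" "v a = v b" "a \<noteq> b"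
    have "lt b a" using below[OF ab(1,2,4)] diag[OF ab(2)] ab(3) by simp
    moreover have "lt a b" using below[OF ab(2,1)] diag[OF ab(1)] ab(3,4) by simp
    ultimately show False using asym ab by (meson asymp_onD)
  qed
  have "\<not> tensor_vs.dependent (v ` A)"
  proof
    assume "tensor_vs.dependent (v ` A)"
    then obtain c where c: "\<exists>y\<in>v ` A. c y \<noteq> 0" "(\<Sum>y\<in>v ` A. c y \<odot> y) = 0"
      using tensor_vs.dependent_finite[OF finite_imageI[OF fin]] by blast
    let ?B = "{a\<in>A. c (v a) \<noteq> 0}"
    have B: "finite ?B" "?B \<noteq> {}" using fin c(1) by auto
    obtain b where b: "b \<in> ?B" and bmax: "\<And>a. a \<in> ?B \<Longrightarrow> a \<noteq> b \<Longrightarrow> \<not> lt b a"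
      using Finite_Set.bex_max_element[OF B(1) asymp_on_subset[OF asym] transp_on_subset[OF trans] B(2)] by blast
    have "0 = (\<Sum>y\<in>v ` A. c y \<odot> y) (?w b)" using c(2) by (simp add: tensor_apply)
    also have "\<dots> = (\<Sum>a\<in>A. c (v a) * v a (?w b))"
      by (simp add: sum.reindex[OF injv] tensor_sum_apply tensor_apply)
    also have "\<dots> = (\<Sum>a\<in>A. if a = b then c (v b) * v b (?w b) else 0)"
    proof (rule sum.cong[OF refl])
      fix a assume a: "a \<in> A"
      show "c (v a) * v a (?w b) = (if a = b then c (v b) * v b (?w b) else 0)"
        using bmax[of a] below[OF a, of b] a b by auto
    qed
    also have "\<dots> = c (v b) * v b (?w b)" using b fin by simp
    finally show False using b diag[of b] by simp
  qed
  then show ?thesis using injv by blast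
qed

section \<open>The divided powers commute with the Hecke operators\<close>

text \<open>The diagonal entries of the Hecke matrix on two adjacent letters of the written word.
  Positions in the vector part run from right to left, which is why \<open>b\<close> stands before
  \<open>a\<close> there. Pairs of different kinds get the value 0.\<close>

fun dco :: "'a::field \<Rightarrow> letter \<Rightarrow> letter \<Rightarrow> 'a" where
  "dco q (Vec b) (Vec a) = (if a = b then inverse q else if a < b then inverse q - q else 0)"
| "dco q (Dual a) (Dual b) = (if a = b then inverse q else if a < b then inverse q - q else 0)"
| "dco q _ _ = 0"

fun sco :: "letter \<Rightarrow> letter \<Rightarrow> 'a::field" where
  "sco (Vec b) (Vec a) = (if a = b then 0 else 1)"
| "sco (Dual a) (Dual b) = (if a = b then 0 else 1)"
| "sco _ _ = 0"

text \<open>The Hecke operator exchanging the letters at positions \<open>p\<close> and \<open>p + 1\<close>, counted from zero on the left.\<close>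

fun wop :: "'a::field \<Rightarrow> nat \<Rightarrow> 'a tensor \<Rightarrow> 'a tensor" where
  "wop q 0 x (y # z # u) = dco q y z * x (y # z # u) + sco y z * x (z # y # u)"
| "wop q (Suc p) x (z # u) = wop q p (\<lambda>v. x (z # v)) u"
| "wop q _ x _ = 0"

lemma wop_append:
  "wop q (length us) x (us @ y # z # v) = dco q y z * x (us @ y # z # v) + sco y z * x (us @ z # y # v)"
  by (induction us arbitrary: x) auto

lemma wop_lin: "wop q p (\<lambda>v. a * x v + b * y v) u = a * wop q p x u + b * wop q p y u"
proof (induction q p x u arbitrary: y rule: wop.induct)
  case (1 q x c d u)
  show ?case by (simp add: algebra_simps)
next
  case (2 q p x z u)
  show ?case using 2[of "\<lambda>v. y (z # v)"] by simp
qed simp_all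

lemma wop_scl: "wop q p (\<lambda>v. a * x v) u = a * wop q p x u"
  using wop_lin[of q p a x 0 x u] by simp

lemma hp_powi_Cons: "q \<noteq> 0 \<Longrightarrow> q powi (- hp i (c # v)) = q powi (- lhp i c) * q powi (- hp i v)"
  for q :: "'a::field"
  by (simp only: hp_Cons minus_add_distrib power_int_add simp_thms)

lemma wop_weight:
  assumes q': "q' \<noteq> 0"
  shows "wop q p (\<lambda>v. q' powi (- hp i v) * x v) u = q' powi (- hp i u) * wop q p x u"
proof (induction q p x u rule: wop.induct)
  case (1 q x c d u)
  have "hp i (d # c # u) = hp i (c # d # u)" by simp
  then show ?case unfolding wop.simps by (simp only: distrib_left mult_ac)
next
  case (2 q p x z u)
  show ?case
    unfolding wop.simps hp_powi_Cons[OF q'] mult.assoc wop_scl 2 ..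
qed simp_all

text \<open>E_i commutes with the braiding of two vector letters and of two dual letters.
  \<open>X\<close> stands for the coefficients with all remaining letters frozen.\<close>

lemma E_wop_two:
  fixes X :: "letter \<Rightarrow> letter \<Rightarrow> 'a::field"
  assumes q: "q \<noteq> 0"
  shows "lco q i z * (dco q y (low z) * X y (low z) + sco y (low z) * X (low z) y)
    + lco q i y * q powi (- lhp i z) * (dco q (low y) z * X (low y) z + sco (low y) z * X z (low y)) =
    dco q y z * (lco q i z * X y (low z) + lco q i y * q powi (- lhp i z) * X (low y) z)
    + sco y z * (lco q i y * X z (low y) + lco q i z * q powi (- lhp i y) * X (low z) y)"
proof (cases y; cases z)
  fix a b assume e: "y = Vec b" "z = Vec a"
  show ?thesis
    unfolding e using q
    by (cases "a = i"; cases "b = i"; cases "a = Suc i"; cases "b = Suc i"; cases a b rule: linorder_cases)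
      (auto simp: lhp_def field_simps)
next
  fix a b assume e: "y = Dual a" "z = Dual b"
  show ?thesis
    unfolding e using q
    by (cases "a = i"; cases "b = i"; cases "a = Suc i"; cases "b = Suc i"; cases a b rule: linorder_cases)
      (auto simp: lhp_def field_simps)
qed auto

lemma eop_1_Cons: "eop q i 1 x (z # u) = eop q i 1 (\<lambda>v. x (z # v)) u + lco q i z * q powi (- hp i u) * x (low z # u)"
  by simp

lemma eop_1_Nil: "eop q i 1 x [] = 0"
  by simp

text \<open>When E_i acts on a letter left of the exchanged pair, the pair enters only through its
  weight, which the exchange preserves (\<open>wop_weight\<close>); a letter to its right is not
  involved in the exchange. What remains is \<open>E_wop_two\<close>.\<close>

lemma eop_wop:
  assumes q: "q \<noteq> 0"
  shows "eop q i 1 (wop q p x) u = wop q p (eop q i 1 x) u"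
proof (induction p arbitrary: x u)
  case 0
  show ?case
  proof (cases u)
    case Nil
    then show ?thesis by simp
  next
    case (Cons y u')
    show ?thesis
    proof (cases u')
      case Nil
      then show ?thesis unfolding Cons eop_1_Cons by simp
    next
      case u': (Cons z v)
      let ?X = "\<lambda>a b. x (a # b # v)"
      let ?k = "q powi (- hp i v)"
      note k = hp_powi_Cons[OF q]
      have "eop q i 1 (wop q 0 x) (y # z # v) =
        dco q y z * eop q i 1 (\<lambda>v. x (y # z # v)) v + sco y z * eop q i 1 (\<lambda>v. x (z # y # v)) v
        + ?k * (lco q i z * (dco q y (low z) * ?X y (low z) + sco y (low z) * ?X (low z) y)
          + lco q i y * q powi (- lhp i z) * (dco q (low y) z * ?X (low y) z + sco (low y) z * ?X z (low y)))"
        unfolding eop_1_Cons wop.simps eop_lin k by (simp add: algebra_simps)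
      also have "\<dots> = dco q y z * eop q i 1 (\<lambda>v. x (y # z # v)) v + sco y z * eop q i 1 (\<lambda>v. x (z # y # v)) v
        + ?k * (dco q y z * (lco q i z * ?X y (low z) + lco q i y * q powi (- lhp i z) * ?X (low y) z)
          + sco y z * (lco q i y * ?X z (low y) + lco q i z * q powi (- lhp i y) * ?X (low z) y))"
        unfolding E_wop_two[OF q, of i z y ?X] ..
      also have "\<dots> = wop q 0 (eop q i 1 x) (y # z # v)"
        unfolding eop_1_Cons wop.simps k by (simp add: algebra_simps)
      finally show ?thesis unfolding Cons u' .
    qed
  qed
next
  case (Suc p)
  show ?case
  proof (cases u)
    case Nil
    then show ?thesis by simp
  next
    case (Cons z v)
    have "wop q (Suc p) (eop q i 1 x) (z # v) =
      wop q p (\<lambda>v. 1 * eop q i 1 (\<lambda>v. x (z # v)) v + lco q i z * (q powi (- hp i v) * x (low z # v))) v"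
      unfolding wop.simps eop_1_Cons by (simp add: mult.assoc)
    also have "\<dots> = eop q i 1 (wop q p (\<lambda>v. x (z # v))) v + lco q i z * (q powi (- hp i v) * wop q p (\<lambda>v. x (low z # v)) v)"
      unfolding wop_lin wop_weight[OF q] Suc.IH by simp
    also have "\<dots> = eop q i 1 (wop q (Suc p) x) (z # v)"
      unfolding eop_1_Cons wop.simps by (simp add: mult.assoc)
    finally show ?thesis unfolding Cons ..
  qed
qed

section \<open>Transfer of the commutation to g_k and its starred version\<close>

definition is_vec :: "letter \<Rightarrow> bool" where
  "is_vec z \<longleftrightarrow> (\<exists>a. z = Vec a)"

definition in_range :: "nat \<Rightarrow> letter \<Rightarrow> bool" where
  "in_range n z \<longleftrightarrow> (\<exists>a\<in>{1..n}. z = Vec a \<or> z = Dual a)"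

lemma mono_word_image_iff':
  "w \<in> (\<lambda>(I, J). mono_word I J) ` multi_idx n r s \<longleftrightarrow>
     map is_vec w = replicate r True @ replicate s False \<and> (\<forall>z\<in>set w. in_range n z)"
  (is "?L \<longleftrightarrow> ?R")
proof
  assume ?L
  then obtain I J where IJ: "(I, J) \<in> multi_idx n r s" and w: "w = mono_word I J" by auto
  have l: "length I = r" "length J = s" "set I \<subseteq> {1..n}" "set J \<subseteq> {1..n}"
    using IJ by (simp_all add: multi_idx_def)
  have "map is_vec w = replicate r True @ replicate s False"
    using l(1,2) by (simp add: w mono_word_def is_vec_def comp_def map_replicate_const)
  moreover have "in_range n z" if "z \<in> set w" for z
    using that l(3,4) unfolding w mono_word_def in_range_def by auto
  ultimately show ?R by blast
next
  assume R: ?R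
  from R have l: "length w = r + s" by (metis length_append length_map length_replicate)
  have t: "is_vec (w ! p) \<longleftrightarrow> p < r" if "p < r + s" for p
  proof -
    have "is_vec (w ! p) = (replicate r True @ replicate s False) ! p"
      using R l that by (metis nth_map)
    then show ?thesis using that by (simp add: nth_append)
  qed
  have g: "in_range n (w ! p)" if "p < r + s" for p using R l that by simp
  have 1: "z \<in> Vec ` {1..n}" if "is_vec z" "in_range n z" for z
    using that by (auto simp: is_vec_def in_range_def)
  have 2: "z \<in> Dual ` {1..n}" if "\<not> is_vec z" "in_range n z" for z
    using that by (auto simp: is_vec_def in_range_def)
  show ?L
    unfolding mono_word_image_iff
  proof (intro conjI allI impI l)
    show "w ! p \<in> Vec ` {1..n}" if "p < r" for p
      using 1[of "w ! p"] t[of p] g[of p] that by simp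
    show "w ! p \<in> Dual ` {1..n}" if "p < r + s" "r \<le> p" for p
      using 2[of "w ! p"] t[of p] g[of p] that by simp
  qed
qed

lemma wop_support:
  assumes "wop q p x w \<noteq> 0"
  shows "\<exists>w'. x w' \<noteq> 0 \<and> map is_vec w' = map is_vec w \<and> set w' = set w"
  using assms
proof (induction q p x w rule: wop.induct)
  case (1 q x y z u)
  show ?case
  proof (cases "x (y # z # u) = 0")
    case True
    then have s: "sco y z \<noteq> (0 :: 'a)" "x (z # y # u) \<noteq> 0" using 1 by auto
    have "is_vec y = is_vec z"
    proof (cases y)
      case (Vec a)
      then show ?thesis using s(1) by (cases z) (auto simp: is_vec_def)
    next
      case (Dual a)
      then show ?thesis using s(1) by (cases z) (auto simp: is_vec_def)
    qed
    then show ?thesis using s(2) by (intro exI[of _ "z # y # u"]) auto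
  qed auto
next
  case (2 q p x z u)
  from "2.IH" "2.prems" obtain w' where "x (z # w') \<noteq> 0" "map is_vec w' = map is_vec u" "set w' = set u"
    by auto
  then show ?case by (intro exI[of _ "z # w'"]) simp
qed simp_all

lemma wop_mixed:
  assumes x: "x \<in> mixed n r s"
  shows "wop q p x \<in> mixed n r s"
  unfolding mixed_def
proof (intro CollectI allI impI, rule ccontr)
  fix w assume w: "w \<notin> (\<lambda>(I, J). mono_word I J) ` multi_idx n r s" "wop q p x w \<noteq> 0"
  from wop_support[OF w(2)] obtain w' where w': "x w' \<noteq> 0" "map is_vec w' = map is_vec w" "set w' = set w" by blast
  have "w' \<in> (\<lambda>(I, J). mono_word I J) ` multi_idx n r s"
    using w'(1) x by (auto simp: mixed_def)
  then show False using w(1) w'(2,3) unfolding mono_word_image_iff' by simp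
qed

lemma g_act_wop:
  assumes x: "x \<in> mixed n r s" and k: "k \<in> {1..<r}"
  shows "g_act q n r s k x = wop q (r - 1 - k) x"
proof (rule mixed_eqI[OF g_act_mixed[OF k] wop_mixed[OF x]])
  fix I J assume IJ: "(I, J) \<in> multi_idx n r s"
  then have "1 \<le> k" "k < length I" using k by (auto simp: multi_idx_def)
  then obtain xs a b ys where I: "I = xs @ a # b # ys" "k = Suc (length xs)" by (rule split_at)
  have p: "r - 1 - k = length (map Vec (rev ys))" using IJ I by (auto simp: multi_idx_def)
  have m: "mono_word (xs @ c # d # ys) J = map Vec (rev ys) @ Vec d # Vec c # map Vec (rev xs) @ map Dual J" for c d
    by (simp add: mono_word_def)
  show "g_act q n r s k x (mono_word I J) = wop q (r - 1 - k) x (mono_word I J)"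
    unfolding g_act_coeff[OF x k] p unfolding I hop_append m wop_append by (auto simp: algebra_simps)
qed

lemma gs_act_wop:
  assumes x: "x \<in> mixed n r s" and k: "k \<in> {1..<s}"
  shows "gs_act q n r s k x = wop q (r + k - 1) x"
proof (rule mixed_eqI[OF gs_act_mixed[OF k] wop_mixed[OF x]])
  fix I J assume IJ: "(I, J) \<in> multi_idx n r s"
  then have "1 \<le> k" "k < length J" using k by (auto simp: multi_idx_def)
  then obtain xs a b ys where J: "J = xs @ a # b # ys" "k = Suc (length xs)" by (rule split_at)
  have p: "r + k - 1 = length (map Vec (rev I) @ map Dual xs)" using IJ J by (auto simp: multi_idx_def)
  have m: "mono_word I (xs @ c # d # ys) = (map Vec (rev I) @ map Dual xs) @ Dual c # Dual d # map Dual ys" for c d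
    by (simp add: mono_word_def)
  show "gs_act q n r s k x (mono_word I J) = wop q (r + k - 1) x (mono_word I J)"
    unfolding gs_act_coeff[OF x k] p unfolding J hop_append m wop_append by (auto simp: algebra_simps)
qed

lemma eop_g_act:
  assumes q: "q \<noteq> 0" and i: "i \<in> {1..<n}" and x: "x \<in> mixed n r s" and k: "k \<in> {1..<r}"
  shows "eop q i 1 (g_act q n r s k x) = g_act q n r s k (eop q i 1 x)"
  unfolding g_act_wop[OF x k] g_act_wop[OF eop_mixed[OF i x] k] using eop_wop[OF q] by blast

lemma eop_gs_act:
  assumes q: "q \<noteq> 0" and i: "i \<in> {1..<n}" and x: "x \<in> mixed n r s" and k: "k \<in> {1..<s}"
  shows "eop q i 1 (gs_act q n r s k x) = gs_act q n r s k (eop q i 1 x)"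
  unfolding gs_act_wop[OF x k] gs_act_wop[OF eop_mixed[OF i x] k] using eop_wop[OF q] by blast

lemma g_gs_comm:
  assumes x: "x \<in> mixed n r s" and j: "j \<in> {1..<r}" and k: "k \<in> {1..<s}"
  shows "gs_act q n r s k (g_act q n r s j x) = g_act q n r s j (gs_act q n r s k x)"
proof (rule mixed_eqI[OF gs_act_mixed[OF k] g_act_mixed[OF j]])
  fix I J
  show "gs_act q n r s k (g_act q n r s j x) (mono_word I J) = g_act q n r s j (gs_act q n r s k x) (mono_word I J)"
    unfolding gs_act_coeff[OF g_act_mixed[OF j] k] g_act_coeff[OF gs_act_mixed[OF k] j] hop_def
      g_act_coeff[OF x j] gs_act_coeff[OF x k] by (simp add: algebra_simps)
qed

context hecke_family
begin

text \<open>Used for three kinds of operators \<open>T\<close>: E_i, a generator of the other Hecke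
  algebra, and the antisymmetrizer of the other side.\<close>

context
  fixes T :: "'a tensor \<Rightarrow> 'a tensor"
  assumes TX: "\<And>x. x \<in> X \<Longrightarrow> T x \<in> X" and TG: "\<And>k x. k \<in> {1..<m} \<Longrightarrow> x \<in> X \<Longrightarrow> T (G k x) = G k (T x)"
begin

lemma T_fold: "set ks \<subseteq> {1..<m} \<Longrightarrow> x \<in> X \<Longrightarrow> T (fold G ks x) = fold G ks (T x)"
proof (induction ks arbitrary: x)
  case (Cons k ks)
  then show ?case using closed[of k x] TG[of k x] by simp
qed simp

lemma T_gw: "w permutes {1..m} \<Longrightarrow> x \<in> X \<Longrightarrow> T (gw_act G m w x) = gw_act G m w (T x)"
  by (metis gw_rword T_fold TX)

lemma T_antisym:
  assumes T_add: "\<And>x y. x \<in> X \<Longrightarrow> y \<in> X \<Longrightarrow> T (x + y) = T x + T y"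
    and T_scl: "\<And>c x. x \<in> X \<Longrightarrow> T (c \<odot> x) = c \<odot> T x"
    and St: "\<And>w. w \<in> St \<Longrightarrow> w permutes {1..m}" and x: "x \<in> X"
  shows "T (antisym St x) = antisym St (T x)"
proof -
  have T0: "T 0 = 0" using T_scl[of 0 0] tensor_vs.subspace_0[OF X] by simp
  have T_sum: "T (\<Sum>a\<in>A. g a) = (\<Sum>a\<in>A. T (g a))" if "\<And>a. a \<in> A \<Longrightarrow> g a \<in> X" for A :: "(nat \<Rightarrow> nat) set" and g
    using that
  proof (induction A rule: infinite_finite_induct)
    case (insert a A)
    then have "(\<Sum>a\<in>A. g a) \<in> X" by (intro tensor_vs.subspace_sum[OF X]) auto
    then show ?case using insert T_add[of "g a" "\<Sum>a\<in>A. g a"] by simp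
  qed (auto simp: T0)
  have "T (antisym St x) = (\<Sum>w\<in>St. T (((- q) ^ card (inversions w)) \<odot> gw_act G m w x))"
    unfolding antisym_def by (rule T_sum) (intro tensor_vs.subspace_scale[OF X] gw_X St x)
  also have "\<dots> = antisym St (T x)"
    unfolding antisym_def
    by (intro sum.cong refl) (simp only: T_scl[OF gw_X[OF St x]] T_gw[OF St x])
  finally show ?thesis .
qed

end

end

section \<open>Tensor products of tensors\<close>

lemma tens_Nil: "(x \<otimes> y) [] = x [] * (y [] :: 'a::field)"
  by (simp add: tens_def)

lemma tens_Cons: "(x \<otimes> y) (z # u) = x [] * y (z # u) + ((\<lambda>v. x (z # v)) \<otimes> y) u" for y :: "'a::field tensor"
  unfolding tens_def by (simp only: length_Cons sum.atMost_Suc_shift) simp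

lemma tens_support:
  fixes y :: "'a::field tensor"
  assumes "(x \<otimes> y) w \<noteq> 0"
  obtains u v where "w = u @ v" "x u \<noteq> 0" "y v \<noteq> 0"
proof -
  obtain k where "x (take k w) * y (drop k w) \<noteq> 0"
    using assms unfolding tens_def by (meson sum.not_neutral_contains_not_neutral)
  then show ?thesis using that[of "take k w" "drop k w"] by simp
qed

lemma bas_tens: "bas u \<otimes> bas v = (bas (u @ v) :: 'a::field tensor)"
proof
  fix w
  have "(\<lambda>v'. bas [] (z # v') :: 'a) = (\<lambda>v'. 0)" for z by (simp add: bas_apply)
  moreover have "(\<lambda>v'. bas (a # u) (z # v') :: 'a) = (if z = a then bas u else (\<lambda>v'. 0))" for a u z
    by (auto simp: bas_apply fun_eq_iff)
  moreover have "((\<lambda>v'. 0) \<otimes> y) w = 0" for y :: "'a tensor" and w by (simp add: tens_def)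
  ultimately show "(bas u \<otimes> bas v) w = (bas (u @ v) w :: 'a)"
  proof (induction w arbitrary: u)
    case Nil
    then show ?case by (simp add: tens_Nil bas_apply)
  next
    case (Cons z w)
    show ?case
    proof (cases u)
      case Nil
      then show ?thesis using Cons.prems by (simp add: tens_Cons) (simp add: bas_apply)
    next
      case u: (Cons a u')
      have "bas (a # u') [] = (0 :: 'a)" by (simp add: bas_apply)
      moreover have "(bas ((a # u') @ v) (z # w) :: 'a) = (if z = a then bas (u' @ v) w else 0)"
        by (simp add: bas_apply)
      ultimately show ?thesis
        unfolding u tens_Cons Cons.prems(2) using Cons.IH[OF Cons.prems, of u'] Cons.prems(3) by simp
    qed
  qed
qed

lemma tens_sum_left: "(\<Sum>a\<in>A. g a) \<otimes> y = (\<Sum>a\<in>A. g a \<otimes> y)" for y :: "'a::field tensor"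
  by (induction A rule: infinite_finite_induct) (simp_all add: tens_zero tens_add)

lemma tens_sum_right: "x \<otimes> (\<Sum>a\<in>A. g a) = (\<Sum>a\<in>A. x \<otimes> g a)" for x :: "'a::field tensor"
  by (induction A rule: infinite_finite_induct) (simp_all add: tens_zero tens_add)

text \<open>The action of the inverse of K_i.\<close>

definition kop :: "'a::field \<Rightarrow> nat \<Rightarrow> 'a tensor \<Rightarrow> 'a tensor" where
  "kop q i x = (\<lambda>v. q powi (- hp i v) * x v)"

lemma hp_append: "hp i (u @ v) = hp i u + hp i v"
  by (induction u) simp_all

lemma kop_tens:
  assumes q: "q \<noteq> 0"
  shows "(kop q i x \<otimes> kop q i y) u = q powi (- hp i u) * (x \<otimes> y) u"
  unfolding tens_def kop_def sum_distrib_left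
proof (rule sum.cong[OF refl])
  fix k
  have "hp i u = hp i (take k u) + hp i (drop k u)" by (simp flip: hp_append)
  then have "q powi (- hp i u) = q powi (- hp i (take k u)) * q powi (- hp i (drop k u))"
    using q by (simp only: minus_add_distrib power_int_add simp_thms)
  then show "q powi (- hp i (take k u)) * x (take k u) * (q powi (- hp i (drop k u)) * y (drop k u)) =
    q powi (- hp i u) * (x (take k u) * y (drop k u))" by (simp only: mult_ac)
qed

lemma tens_lin: "((\<lambda>v. a v + c * b v) \<otimes> y) u = (a \<otimes> y) u + c * (b \<otimes> y) u" for y :: "'a::field tensor"
  by (simp add: tens_def sum.distrib sum_distrib_left algebra_simps)

text \<open>The coproduct of E_i for a splitting at an arbitrary place, obtained from the recursion,
  which splits off one letter at a time.\<close>

lemma eop_tens: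
  assumes q: "q \<noteq> 0"
  shows "eop q i 1 (x \<otimes> y) u = (eop q i 1 x \<otimes> kop q i y) u + (x \<otimes> eop q i 1 y) u"
proof (induction u arbitrary: x)
  case Nil
  show ?case by (simp add: tens_Nil)
next
  case (Cons z u)
  let ?xz = "\<lambda>v. x (z # v)" and ?xl = "\<lambda>v. x (low z # v)"
  have e: "(\<lambda>v. eop q i 1 x (z # v)) = (\<lambda>v. eop q i 1 ?xz v + lco q i z * kop q i ?xl v)"
    unfolding eop_1_Cons kop_def mult.assoc ..
  have l1: "eop q i 1 (x \<otimes> y) (z # u) =
      x [] * eop q i 1 (\<lambda>v. y (z # v)) u + eop q i 1 (?xz \<otimes> y) u
      + lco q i z * q powi (- hp i u) * (x [] * y (low z # u) + (?xl \<otimes> y) u)"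
    unfolding eop_1_Cons tens_Cons eop_add eop_scl ..
  have l2: "(eop q i 1 x \<otimes> kop q i y) (z # u) =
      (eop q i 1 ?xz \<otimes> kop q i y) u + lco q i z * (q powi (- hp i u) * (?xl \<otimes> y) u)"
    unfolding tens_Cons e tens_lin kop_tens[OF q] eop_1_Nil by simp
  have l3: "(x \<otimes> eop q i 1 y) (z # u) = x [] * (eop q i 1 (\<lambda>v. y (z # v)) u + lco q i z * q powi (- hp i u) * y (low z # u))
      + (?xz \<otimes> eop q i 1 y) u"
    unfolding tens_Cons eop_1_Cons ..
  show ?case unfolding l1 l2 l3 Cons.IH by (simp add: algebra_simps)
qed

lemma eop_single:
  assumes q: "q \<noteq> 0" and i: "1 \<le> i"
  shows "eop q i 1 (bas [a]) = E_letter q i a"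
proof
  fix u
  have "E_word q i [a] u = (E_letter q i a \<otimes> bas []) u"
    by (simp add: tensor_apply tens_zero)
  moreover have "x \<otimes> bas [] = x" for x :: "'a tensor"
  proof
    fix w
    have "(x \<otimes> bas []) w = (\<Sum>k\<le>length w. if k = length w then x w else 0)"
      unfolding tens_def by (rule sum.cong) (auto simp: bas_apply)
    then show "(x \<otimes> bas []) w = x w" by simp
  qed
  ultimately show "eop q i 1 (bas [a]) u = E_letter q i a u"
    using E_word_eop[OF q i, of "[a]" u] by metis
qed

definition cap_words :: "nat \<Rightarrow> nat \<Rightarrow> nat list set" where
  "cap_words n f = {c. length c = f \<and> set c \<subseteq> {1..n}}"

lemma finite_cap_words: "finite (cap_words n f)"
  using finite_lists_length_eq[of "{1..n}" f] by (simp add: cap_words_def conj_commute)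

text \<open>The vector part is numbered from the middle outwards, so the k-th cap occupies position
  k on both sides; hence the same list \<open>c\<close> appears twice.\<close>

lemma v_pow_eq: "v_pow n f = (\<Sum>c\<in>cap_words n f. bas (mono_word c c) :: 'a::field tensor)"
proof (induction f)
  case 0
  have "cap_words n 0 = {[]}" by (auto simp: cap_words_def)
  then show ?case by (simp add: mono_word_def)
next
  case (Suc f)
  have "v_pow n (Suc f) = (\<Sum>k=1..n. \<Sum>c\<in>cap_words n f. bas (mono_word (c @ [k]) (c @ [k])) :: 'a tensor)"
    by (simp add: Suc tens_sum_left tens_sum_right bas_tens mono_word_def)
  also have "\<dots> = (\<Sum>(k, c)\<in>{1..n} \<times> cap_words n f. bas (mono_word (c @ [k]) (c @ [k])))"
    by (rule sum.cartesian_product)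
  also have "\<dots> = (\<Sum>c\<in>cap_words n (Suc f). bas (mono_word c c))"
  proof (rule sum.reindex_bij_witness[where i = "\<lambda>c. (last c, butlast c)" and j = "\<lambda>(k, c). c @ [k]"])
    fix c assume "c \<in> cap_words n (Suc f)"
    then have c: "c \<noteq> []" "length c = Suc f" "set c \<subseteq> {1..n}" by (auto simp: cap_words_def)
    show "(case (last c, butlast c) of (k, c) \<Rightarrow> c @ [k]) = c" using c(1) by simp
    show "(last c, butlast c) \<in> {1..n} \<times> cap_words n f"
      using c(2,3) subsetD[OF c(3) last_in_set[OF c(1)]] in_set_butlastD[of _ c] unfolding cap_words_def by auto
  qed (auto simp: cap_words_def)
  finally show ?case .
qed

lemma hp_mono_word_same: "hp i (mono_word c c) = 0"
  by (simp add: hp_def wt_mono_word)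

lemma v_pow_support:
  assumes "(v_pow n f :: 'a::field tensor) w \<noteq> 0"
  obtains c where "c \<in> cap_words n f" "w = mono_word c c"
proof -
  obtain c where "c \<in> cap_words n f" "(bas (mono_word c c) w :: 'a) \<noteq> 0"
    using assms unfolding v_pow_eq tensor_sum_apply by (meson sum.not_neutral_contains_not_neutral)
  then show ?thesis using that[of c] by (auto simp: bas_apply split: if_splits)
qed

lemma kop_v_pow: "kop q i (v_pow n f) = v_pow n f"
proof
  fix w
  show "kop q i (v_pow n f) w = v_pow n f w"
  proof (cases "(v_pow n f :: 'a tensor) w = 0")
    case False
    then obtain c where "w = mono_word c c" by (rule v_pow_support)
    then show ?thesis by (simp add: kop_def hp_mono_word_same)
  qed (simp add: kop_def)
qed

lemma kop_tens_fun: "q \<noteq> 0 \<Longrightarrow> kop q i (x \<otimes> y) = kop q i x \<otimes> kop q i y"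
  by (simp add: fun_eq_iff kop_tens) (simp add: kop_def)

lemma eop_tens_fun: "q \<noteq> 0 \<Longrightarrow> eop q i 1 (x \<otimes> y) = eop q i 1 x \<otimes> kop q i y + x \<otimes> eop q i 1 y"
  unfolding fun_eq_iff plus_fun_apply by (intro allI eop_tens)

lemma eop_fun_sum: "eop q i l (\<Sum>a\<in>A. g a) u = (\<Sum>a\<in>A. eop q i l (g a) u)"
proof -
  have "(\<Sum>a\<in>A. g a) = (\<lambda>v. \<Sum>a\<in>A. g a v)" by (simp add: fun_eq_iff tensor_sum_apply)
  then show ?thesis using eop_sum[where f = g and A = A] by simp
qed

lemma nth_append_plus: "length c = f \<Longrightarrow> (c @ xs) ! (f + z) = xs ! z"
  by auto

text \<open>In the outermost cap E_i sends the summands k = i + 1 and k = i to multiples of the same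
  tensor. The first coefficient is 1/q, from the inverse of K_i on the dual letter i + 1; the second
  is -1/q, from E_i on the dual letter i.\<close>

lemma eop_v_pow:
  assumes q: "q \<noteq> 0" and i: "i \<in> {1..<n}"
  shows "eop q i 1 (v_pow n f) = 0"
proof (induction f)
  case 0
  have "eop q i 1 (bas []) u = 0" for u
    using E_word_eop[of q i "[]" u] q i by (simp add: tensor_apply)
  then show ?case by (simp add: fun_eq_iff tensor_apply)
next
  case (Suc f)
  let ?v = "v_pow n f :: 'a tensor"
  have i1: "1 \<le> i" using i by simp
  have 1: "eop q i 1 (bas [Vec k] \<otimes> ?v \<otimes> bas [Dual k]) =
      (if k = Suc i then bas [Vec i] \<otimes> ?v \<otimes> (inverse q \<odot> bas [Dual (Suc i)]) else 0)
      + (if k = i then bas [Vec i] \<otimes> ?v \<otimes> ((- inverse q) \<odot> bas [Dual (Suc i)]) else 0)" for k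
  proof -
    have kd: "kop q i (bas [Dual (Suc i)]) = inverse q \<odot> bas [Dual (Suc i)]"
      by (auto simp: kop_def fun_eq_iff tensor_apply bas_apply hp_Cons lhp_def power_int_minus)
    have a: "eop q i 1 (bas [Vec k] \<otimes> ?v \<otimes> bas [Dual k]) =
        E_letter q i (Vec k) \<otimes> (?v \<otimes> kop q i (bas [Dual k])) + bas [Vec k] \<otimes> (?v \<otimes> E_letter q i (Dual k))"
      unfolding eop_tens_fun[OF q] eop_single[OF q i1] Suc kop_tens_fun[OF q] kop_v_pow
      by (simp add: tens_zero)
    show ?thesis
      unfolding a by (auto simp: tens_zero kd simp del: tensor_vs.scale_minus_left)
  qed
  have "eop q i 1 (v_pow n (Suc f)) u = (\<Sum>k=1..n. eop q i 1 (bas [Vec k] \<otimes> ?v \<otimes> bas [Dual k]) u)" for u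
    unfolding v_pow.simps eop_fun_sum ..
  also have "(\<Sum>k=1..n. eop q i 1 (bas [Vec k] \<otimes> ?v \<otimes> bas [Dual k]) u) = 0" for u
    unfolding 1 using i
    by (simp add: tensor_apply sum.distrib if_distrib[of "\<lambda>x. x u"] tens_scl del: tensor_vs.scale_minus_left cong: if_cong)
  finally show ?case by (simp add: fun_eq_iff tensor_apply)
qed

lemma eop_1_support:
  "eop q i 1 x u \<noteq> 0 \<Longrightarrow> \<exists>p<length u. lco q i (u ! p) \<noteq> 0 \<and> x (u[p := low (u ! p)]) \<noteq> 0"
proof (induction u arbitrary: x)
  case (Cons z u)
  consider "eop q i 1 (\<lambda>v. x (z # v)) u \<noteq> 0" | "lco q i z \<noteq> 0" "x (low z # u) \<noteq> 0"
    using Cons.prems unfolding eop_1_Cons by fastforce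
  then show ?case
  proof cases
    case 1
    from Cons.IH[OF 1] obtain p where "p < length u" "lco q i (u ! p) \<noteq> 0" "x (z # u[p := low (u ! p)]) \<noteq> 0" by blast
    then show ?thesis by (intro exI[of _ "Suc p"]) simp
  next
    case 2
    then show ?thesis by (intro exI[of _ 0]) simp
  qed
qed simp

section \<open>The vectors attached to a bipartition\<close>

lemma concat_rows:
  assumes "\<And>k. length (g k) = \<nu> k"
  shows "length (concat (map g [0..<M])) = (\<Sum>k<M. \<nu> k)"
    and "i < M \<Longrightarrow> j < \<nu> i \<Longrightarrow> concat (map g [0..<M]) ! ((\<Sum>k<i. \<nu> k) + j) = g i ! j"
proof -
  show len: "length (concat (map g [0..<M])) = (\<Sum>k<M. \<nu> k)" for M
    by (induction M) (simp_all add: assms)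
  show "i < M \<Longrightarrow> j < \<nu> i \<Longrightarrow> concat (map g [0..<M]) ! ((\<Sum>k<i. \<nu> k) + j) = g i ! j"
  proof (induction M)
    case (Suc M)
    show ?case
    proof (cases "i = M")
      case True
      then show ?thesis using len[of M] by (simp add: nth_append)
    next
      case False
      then have iM: "i < M" using Suc.prems by simp
      have "(\<Sum>k<i. \<nu> k) + j < (\<Sum>k<Suc i. \<nu> k)" using Suc.prems by simp
      also have "\<dots> \<le> (\<Sum>k<M. \<nu> k)" using iM by (intro sum_mono2) auto
      finally have "(\<Sum>k<i. \<nu> k) + j < length (concat (map g [0..<M]))" unfolding len .
      then show ?thesis using Suc iM by (simp add: nth_append)
    qed
  qed simp
qed

context young
begin

lemma nu_le: "\<nu> i \<le> m - f"
proof -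
  have "off i + \<nu> i \<le> m" using off_le[of "Suc i"] by (simp add: off_Suc)
  then show ?thesis by (simp add: off_def)
qed

lemma rows_nth:
  assumes len: "\<And>k. length (g k) = \<nu> k" and c: "length c = f" and x: "x \<in> row i"
  shows "(c @ concat (map g [0..<m - f])) ! (x - 1) = g i ! (x - off i - 1)" "x - off i - 1 < \<nu> i"
proof -
  have x': "off i < x" "x \<le> off i + \<nu> i" using x by (auto simp: row_def off_Suc)
  show j: "x - off i - 1 < \<nu> i" using x' by simp
  then have im: "i < m - f" using partitions_zero[OF part, of i] by (cases "m - f \<le> i") auto
  have "x - 1 = f + ((\<Sum>k<i. \<nu> k) + (x - off i - 1))" using x' by (simp add: off_def)
  then have "(c @ concat (map g [0..<m - f])) ! (x - 1) = concat (map g [0..<m - f]) ! ((\<Sum>k<i. \<nu> k) + (x - off i - 1))"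
    using nth_append_plus[OF c] by (simp only:)
  also have "\<dots> = g i ! (x - off i - 1)" by (rule concat_rows(2)[where g = g and \<nu> = \<nu>, OF len im j])
  finally show "(c @ concat (map g [0..<m - f])) ! (x - 1) = g i ! (x - off i - 1)" .
qed

lemma rows_length:
  assumes "\<And>k. length (g k) = \<nu> k"
  shows "length (concat (map g [0..<m - f])) = m - f"
  unfolding concat_rows(1)[of g \<nu>, OF assms]
  using partitions_iff[where p = \<nu> and m = "m - f" and M = "m - f", OF partitions_zero[OF part]] part by simp

end

locale shape =
  fixes n r s f :: nat and lam :: "(nat \<Rightarrow> nat) \<times> (nat \<Rightarrow> nat)"
  assumes rsn: "r + s \<le> n" and lam: "(f, lam) \<in> Lambda_rs r s"
begin

definition \<alpha> :: "nat \<Rightarrow> nat" where "\<alpha> = conjugate (fst lam)"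
definition \<beta> :: "nat \<Rightarrow> nat" where "\<beta> = conjugate (snd lam)"

lemma f_le: "f \<le> r" "f \<le> s"
  and lam_part: "fst lam \<in> partitions (r - f)" "snd lam \<in> partitions (s - f)"
  using lam by (auto simp: Lambda_rs_def)

sublocale V: young f r \<alpha>
  using f_le lam_part conjugate_partitions by unfold_locales (simp_all add: \<alpha>_def)

sublocale W: young f s \<beta>
  using f_le lam_part conjugate_partitions by unfold_locales (simp_all add: \<beta>_def)

text \<open>The vector letters by increasing position, that is \<open>i_lambda\<close> reversed. The
  rows of the row tableau then occupy the positions f + 1, ..., r in order.\<close>

definition A :: "nat list" where
  "A = concat (map (\<lambda>k. [1..<Suc (\<alpha> k)]) [0..<r - f])"

definition B :: "nat list" where
  "B = concat (map (\<lambda>k. rev [n + 1 - \<beta> k..<Suc n]) [0..<s - f])"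

lemma beta_le: "\<beta> k \<le> n"
  using W.nu_le[of k] rsn by simp

lemma A_eq: "A = rev (i_lambda (r - f) \<alpha>)"
  by (simp add: A_def i_lambda_def rev_concat rev_map comp_def)

lemma B_eq: "B = j_lambda n (s - f) \<beta>"
  by (simp add: B_def j_lambda_def)

lemma len_rows: "length [1..<Suc (\<alpha> k)] = \<alpha> k" "length (rev [n + 1 - \<beta> k..<Suc n]) = \<beta> k"
  using beta_le[of k] by (simp_all del: upt_Suc)

lemma length_A: "length A = r - f" and length_B: "length B = s - f"
  unfolding A_def B_def by (rule V.rows_length W.rows_length; rule len_rows)+

text \<open>A letter shows the column, counted from 1, of its position in the row tableau.
  \<open>B_letter\<close> says the same with columns counted down from n.\<close>

lemma A_letter:
  assumes c: "length c = f" and x: "x \<in> V.row i"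
  shows "(c @ A) ! (x - 1) = x - V.off i"
proof -
  note a = V.rows_nth[of "\<lambda>k. [1..<Suc (\<alpha> k)]", OF len_rows(1) c x]
  have "V.off i < x" using x by (simp add: V.row_def)
  then show ?thesis using a unfolding A_def by (simp del: upt_Suc)
qed

lemma B_letter:
  assumes c: "length c = f" and x: "x \<in> W.row i"
  shows "(c @ B) ! (x - 1) = n + 1 - (x - W.off i)"
proof -
  note a = W.rows_nth[of "\<lambda>k. rev [n + 1 - \<beta> k..<Suc n]", OF len_rows(2) c x]
  have "W.off i < x" using x by (simp add: W.row_def)
  moreover have "rev [n + 1 - \<beta> i..<Suc n] ! (x - W.off i - 1) = n - (x - W.off i - 1)"
    using a(2) beta_le[of i] by (simp add: rev_nth del: upt_Suc)
  ultimately show ?thesis using a(1) unfolding B_def by simp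
qed

lemma A_range: "set A \<subseteq> {1..r - f}"
proof -
  have "x \<le> r - f" if "x < Suc (\<alpha> k)" for x k
    using V.nu_le[of k] that by linarith
  then show ?thesis by (auto simp: A_def simp del: upt_Suc)
qed

lemma B_range: "set B \<subseteq> {n + 1 - (s - f)..n}"
proof -
  have "n + 1 - (s - f) \<le> x" if "n + 1 - \<beta> k \<le> x" for x k
    using W.nu_le[of k] that by linarith
  then show ?thesis by (auto simp: B_def simp del: upt_Suc)
qed

lemma AB_multi: "c \<in> cap_words n f \<Longrightarrow> (c @ A, c @ B) \<in> multi_idx n r s"
  using A_range B_range rsn f_le by (auto simp: cap_words_def multi_idx_def length_A length_B subset_iff)

lemma row_inc_A:
  assumes "length c = f"
  shows "V.row_inc (c @ A)"
  unfolding V.row_inc_def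
proof (intro allI impI)
  fix i x y assume x: "x \<in> V.row i" and y: "y \<in> V.row i" and l: "x < y"
  have "V.off i < x" using x by (simp add: V.row_def)
  then show "(c @ A) ! (x - 1) < (c @ A) ! (y - 1)"
    unfolding A_letter[OF assms x] A_letter[OF assms y] using l by simp
qed

lemma row_dec_B:
  assumes "length c = f"
  shows "W.row_dec (c @ B)"
  unfolding W.row_dec_def
proof (intro allI impI)
  fix i x y assume x: "x \<in> W.row i" and y: "y \<in> W.row i" and l: "x < y"
  have "y - W.off i \<le> n"
    using y beta_le[of i] unfolding W.row_def W.off_Suc greaterThanAtMost_iff by linarith
  moreover have "W.off i < x" using x by (simp add: W.row_def)
  ultimately show "(c @ B) ! (y - 1) < (c @ B) ! (x - 1)"
    unfolding B_letter[OF assms x] B_letter[OF assms y] using l by simp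
qed

lemma v_f_lambda_eq:
  "v_f_lambda n r s f lam = (\<Sum>c\<in>cap_words n f. bas (mono_word (c @ A) (c @ B)) :: 'a::field tensor)"
proof -
  have "i_lambda (r - f) (conjugate (fst lam)) = rev A" "j_lambda n (s - f) (conjugate (snd lam)) = B"
    by (simp_all add: A_eq B_eq \<alpha>_def \<beta>_def)
  then show ?thesis
    unfolding v_f_lambda_def bipart_conj_def fst_conv snd_conv v_pow_eq tens_sum_left tens_sum_right bas_tens
    by (simp add: mono_word_def)
qed

lemma v_f_lambda_mixed: "(v_f_lambda n r s f lam :: 'a::field tensor) \<in> mixed n r s"
  unfolding v_f_lambda_eq by (intro mixed_sum bas_mixed AB_multi)

text \<open>
  Raising a letter of the initial word in the vector part creates two equal neighbours in a row,
  and likewise in the dual part.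
\<close>

definition rep_V :: "nat list \<Rightarrow> bool" where
  "rep_V I \<longleftrightarrow> (\<exists>k i. k \<in> V.row i \<and> Suc k \<in> V.row i \<and> I ! k = I ! (k - 1))"

definition rep_W :: "nat list \<Rightarrow> bool" where
  "rep_W J \<longleftrightarrow> (\<exists>k i. k \<in> W.row i \<and> Suc k \<in> W.row i \<and> J ! k = J ! (k - 1))"

text \<open>In a row 1, 2, ... the letter before i + 1 is i, and i >= 1 ensures that it still
  belongs to the row.\<close>

lemma rep_V_raise:
  assumes c: "length c = f" and p: "p < r - f" "A ! p = Suc i" and i: "1 \<le> i"
  shows "rep_V (c @ A[p := i])"
proof -
  have "f + p + 1 \<in> {f + 1..r}" using p(1) by simp
  then obtain l where l: "f + p + 1 \<in> V.row l" by (rule V.row_cover)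
  have "(c @ A) ! (f + p + 1 - 1) = Suc i" using c p by (simp add: nth_append)
  then have e: "f + p + 1 - V.off l = Suc i" using A_letter[OF c l] by simp
  have l': "f + p \<in> V.row l" using l e i by (simp add: V.row_def)
  have "f + 1 \<le> f + p" using V.row_sub[of l] l' by auto
  then have p1: "1 \<le> p" by simp
  then have fp: "f + p - 1 = f + (p - 1)" by simp
  have "(c @ A) ! (f + p - 1) = f + p - V.off l" by (rule A_letter[OF c l'])
  then have "A ! (p - 1) = i" unfolding fp nth_append_plus[OF c] using e l' by (simp add: V.row_def)
  then have "(c @ A[p := i]) ! (f + p - 1) = i"
    unfolding fp nth_append_plus[OF c] using p1 by simp
  moreover have "(c @ A[p := i]) ! (f + p) = i" using c p(1) by (simp add: nth_append length_A)
  ultimately show ?thesis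
    unfolding rep_V_def using l l' by (intro exI[of _ "f + p"] exI[of _ l]) simp
qed

text \<open>In a row n, n - 1, ... the letter before i is i + 1, and i < n ensures that it still
  belongs to the row.\<close>

lemma rep_W_raise:
  assumes c: "length c = f" and p: "p < s - f" "B ! p = i" and i: "i \<in> {1..<n}"
  shows "rep_W (c @ B[p := Suc i])"
proof -
  have "f + p + 1 \<in> {f + 1..s}" using p(1) by simp
  then obtain l where l: "f + p + 1 \<in> W.row l" by (rule W.row_cover)
  have "(c @ B) ! (f + p + 1 - 1) = i" using c p by (simp add: nth_append)
  then have e: "n + 1 - (f + p + 1 - W.off l) = i" using B_letter[OF c l] by simp
  have bl: "f + p + 1 - W.off l \<le> n"
    using l beta_le[of l] unfolding W.row_def W.off_Suc greaterThanAtMost_iff by linarith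
  have l': "f + p \<in> W.row l" using l e i by (auto simp: W.row_def)
  have "f + 1 \<le> f + p" using W.row_sub[of l] l' by auto
  then have p1: "1 \<le> p" by simp
  then have fp: "f + p - 1 = f + (p - 1)" by simp
  have "W.off l < f + p" using l' by (simp add: W.row_def)
  moreover have "(c @ B) ! (f + p - 1) = n + 1 - (f + p - W.off l)" by (rule B_letter[OF c l'])
  ultimately have "B ! (p - 1) = Suc i" unfolding fp nth_append_plus[OF c] using e bl by linarith
  then have "(c @ B[p := Suc i]) ! (f + p - 1) = Suc i"
    unfolding fp nth_append_plus[OF c] using p1 by simp
  moreover have "(c @ B[p := Suc i]) ! (f + p) = Suc i" using c p(1) by (simp add: nth_append length_B)
  ultimately show ?thesis
    unfolding rep_W_def using l l' by (intro exI[of _ "f + p"] exI[of _ l]) simp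
qed

text \<open>Of the three terms of the coproduct the one on the caps vanishes by
  \<open>eop_v_pow\<close>. The other two are kept apart because they are killed by different
  antisymmetrizers.\<close>

lemma eop_v_f_lambda:
  fixes q :: "'a::field"
  assumes q: "q \<noteq> 0" and i: "i \<in> {1..<n}"
  obtains y1 y2 where "eop q i 1 (v_f_lambda n r s f lam) = y1 + y2" "y1 \<in> mixed n r s" "y2 \<in> mixed n r s"
    "\<And>I J. y1 (mono_word I J) \<noteq> 0 \<Longrightarrow> rep_V I" "\<And>I J. y2 (mono_word I J) \<noteq> 0 \<Longrightarrow> rep_W J"
proof -
  let ?a = "map Vec (rev A)" and ?b = "map Dual B" and ?v = "v_pow n f :: 'a tensor"
  define y1 where "y1 = eop q i 1 (bas ?a) \<otimes> kop q i (?v \<otimes> bas ?b)"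
  define y2 where "y2 = bas ?a \<otimes> ?v \<otimes> eop q i 1 (bas ?b)"
  have i1: "1 \<le> i" using i by simp
  have "i_lambda (r - f) (conjugate (fst lam)) = rev A" "j_lambda n (s - f) (conjugate (snd lam)) = B"
    by (simp_all add: A_eq B_eq \<alpha>_def \<beta>_def)
  then have "v_f_lambda n r s f lam = bas ?a \<otimes> ?v \<otimes> bas ?b"
    unfolding v_f_lambda_def bipart_conj_def by simp
  then have e: "eop q i 1 (v_f_lambda n r s f lam) = y1 + y2"
    unfolding y1_def y2_def by (simp only: eop_tens_fun[OF q] eop_v_pow[OF q i] tens_zero add_0)
  have s1: "\<exists>c p. c \<in> cap_words n f \<and> p < r - f \<and> A ! p = Suc i \<and> w = mono_word (c @ A[p := i]) (c @ B)" if w: "y1 w \<noteq> 0" for w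
  proof -
    obtain u v where uv: "w = u @ v" "eop q i 1 (bas ?a) u \<noteq> 0" "kop q i (?v \<otimes> bas ?b) v \<noteq> 0"
      using w unfolding y1_def by (rule tens_support)
    have "(?v \<otimes> bas ?b) v \<noteq> 0" using uv(3) by (auto simp: kop_def)
    then obtain v1 v2 where v: "v = v1 @ v2" "?v v1 \<noteq> 0" "(bas ?b v2 :: 'a) \<noteq> 0" by (rule tens_support)
    obtain c where c: "c \<in> cap_words n f" "v1 = mono_word c c" using v(2) by (rule v_pow_support)
    have v2: "v2 = ?b" using v(3) by (simp add: bas_apply split: if_splits)
    obtain p where p: "p < length u" "lco q i (u ! p) \<noteq> 0" "(bas ?a (u[p := low (u ! p)]) :: 'a) \<noteq> 0"
      using eop_1_support[OF uv(2)] by blast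
    have ua: "u[p := low (u ! p)] = ?a" using p(3) by (simp add: bas_apply split: if_splits)
    then have lu: "length u = r - f" using length_A by (metis length_list_update length_map length_rev)
    have "?a ! p = low (u ! p)" using ua p(1) by (metis nth_list_update_eq)
    then have low: "Vec (rev A ! p) = low (u ! p)" using p(1) lu length_A by simp
    have up: "u ! p = Vec i" "rev A ! p = Suc i"
      using p(2) low by (cases "u ! p"; simp split: if_splits)+
    have "u = ?a[p := Vec i]" using ua up(1) by (metis list_update_id list_update_overwrite)
    also have "\<dots> = map Vec ((rev A)[p := i])" by (simp add: map_update)
    also have "(rev A)[p := i] = rev (A[r - f - 1 - p := i])"
      using p(1) lu length_A by (simp add: rev_update)
    finally have u: "u = map Vec (rev (A[r - f - 1 - p := i]))" .
    have "A ! (r - f - 1 - p) = Suc i" using up(2) p(1) lu length_A by (simp add: rev_nth)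
    moreover have "w = mono_word (c @ A[r - f - 1 - p := i]) (c @ B)"
      unfolding uv(1) v(1) c(2) v2 u mono_word_def by simp
    moreover have "r - f - 1 - p < r - f" using p(1) lu by simp
    ultimately show ?thesis using c(1) by blast
  qed
  have s2: "\<exists>c p. c \<in> cap_words n f \<and> p < s - f \<and> B ! p = i \<and> w = mono_word (c @ A) (c @ B[p := Suc i])" if w: "y2 w \<noteq> 0" for w
  proof -
    obtain u v where uv: "w = u @ v" "(bas ?a u :: 'a) \<noteq> 0" "(?v \<otimes> eop q i 1 (bas ?b)) v \<noteq> 0"
      using w unfolding y2_def by (rule tens_support)
    have u: "u = ?a" using uv(2) by (simp add: bas_apply split: if_splits)
    obtain v1 v2 where v: "v = v1 @ v2" "?v v1 \<noteq> 0" "eop q i 1 (bas ?b) v2 \<noteq> 0" using uv(3) by (rule tens_support)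
    obtain c where c: "c \<in> cap_words n f" "v1 = mono_word c c" using v(2) by (rule v_pow_support)
    obtain p where p: "p < length v2" "lco q i (v2 ! p) \<noteq> 0" "(bas ?b (v2[p := low (v2 ! p)]) :: 'a) \<noteq> 0"
      using eop_1_support[OF v(3)] by blast
    have vb: "v2[p := low (v2 ! p)] = ?b" using p(3) by (simp add: bas_apply split: if_splits)
    then have lv: "length v2 = s - f" using length_B by (metis length_list_update length_map)
    have "?b ! p = low (v2 ! p)" using vb p(1) by (metis nth_list_update_eq)
    then have low: "Dual (B ! p) = low (v2 ! p)" using p(1) lv length_B by simp
    have vp: "v2 ! p = Dual (Suc i)" "B ! p = i"
      using p(2) low by (cases "v2 ! p"; simp split: if_splits)+
    have "v2 = ?b[p := Dual (Suc i)]" using vb vp(1) by (metis list_update_id list_update_overwrite)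
    also have "\<dots> = map Dual (B[p := Suc i])" by (simp add: map_update)
    finally have "v2 = map Dual (B[p := Suc i])" .
    then have "w = mono_word (c @ A) (c @ B[p := Suc i])"
      unfolding uv(1) v(1) c(2) u mono_word_def by simp
    then show ?thesis using c(1) vp(2) p(1) lv by (intro exI[of _ c] exI[of _ p]) simp
  qed
  have y1m: "y1 \<in> mixed n r s"
    unfolding mixed_def
  proof (intro CollectI allI impI, rule ccontr)
    fix w assume w: "w \<notin> (\<lambda>(I, J). mono_word I J) ` multi_idx n r s" "y1 w \<noteq> 0"
    obtain c p where c: "c \<in> cap_words n f" "w = mono_word (c @ A[p := i]) (c @ B)" using s1[OF w(2)] by blast
    have "set (A[p := i]) \<subseteq> {1..n}" using set_update_subset_insert[of A p i] A_range i rsn by fastforce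
    then have "(c @ A[p := i], c @ B) \<in> multi_idx n r s" using AB_multi[OF c(1)] by (auto simp: multi_idx_def)
    then show False using w(1) c(2) by auto
  qed
  have y2m: "y2 \<in> mixed n r s"
    unfolding mixed_def
  proof (intro CollectI allI impI, rule ccontr)
    fix w assume w: "w \<notin> (\<lambda>(I, J). mono_word I J) ` multi_idx n r s" "y2 w \<noteq> 0"
    obtain c p where c: "c \<in> cap_words n f" "w = mono_word (c @ A) (c @ B[p := Suc i])" using s2[OF w(2)] by blast
    have "set B \<subseteq> {1..n}" using AB_multi[OF c(1)] by (auto simp: multi_idx_def)
    then have "set (B[p := Suc i]) \<subseteq> {1..n}" using set_update_subset_insert[of B p "Suc i"] i by fastforce
    then have "(c @ A, c @ B[p := Suc i]) \<in> multi_idx n r s" using AB_multi[OF c(1)] by (auto simp: multi_idx_def)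
    then show False using w(1) c(2) by auto
  qed
  have r1: "rep_V I" if "y1 (mono_word I J) \<noteq> 0" for I J
    using s1[OF that] rep_V_raise[OF _ _ _ i1] by (auto simp: cap_words_def)
  have r2: "rep_W J" if "y2 (mono_word I J) \<noteq> 0" for I J
    using s2[OF that] rep_W_raise[OF _ _ _ i] by (auto simp: cap_words_def)
  show ?thesis by (rule that[OF e y1m y2m r1 r2])
qed

end

text \<open>Makes closure results such as \<open>gw_X\<close> and \<open>antisym_X\<close> available
  for stable subspaces, in particular the kernel of E_i and a weight space.\<close>

lemma hecke_family_subset:
  assumes "hecke_family q m X G" "tensor_vs.subspace Y" "Y \<subseteq> X" "\<And>k x. k \<in> {1..<m} \<Longrightarrow> x \<in> Y \<Longrightarrow> G k x \<in> Y"
  shows "hecke_family q m Y G"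
proof -
  interpret hecke_family q m X G by fact
  have X: "x \<in> X" if "x \<in> Y" for x using that assms(3) by blast
  show ?thesis
  proof (rule hecke_family.intro)
    show "q \<noteq> 0" by (rule q0)
    show "tensor_vs.subspace Y" by (rule assms(2))
    fix k x assume k: "k \<in> {1..<m}" and x: "x \<in> Y"
    show "G k x \<in> Y" using k x by (rule assms(4))
    show "G k (x + y) = G k x + G k y" if "y \<in> Y" for y using k X[OF x] X[OF that] by (rule G_add)
    show "G k (c \<odot> x) = c \<odot> G k x" for c using k X[OF x] by (rule G_scl)
    show "G k (G k x) = (inverse q - q) \<odot> G k x + x" using k X[OF x] by (rule quad)
    show "G j (G k x) = G k (G j x)" if "j \<in> {1..<m}" "Suc j < k" for j using that(1) k that(2) X[OF x] by (rule comm)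
    show "G k (G (Suc k) (G k x)) = G (Suc k) (G k (G (Suc k) x))" if "Suc k \<in> {1..<m}"
      using k that X[OF x] by (rule braid)
  qed
qed

section \<open>Standard tableaux and their permutations\<close>

context young
begin

lemma d_perm_facts:
  assumes t: "t \<in> std_tableaux f m \<nu>"
  shows "d_perm f m \<nu> t permutes {f + 1..m}" "\<And>b. b \<in> diagram \<nu> \<Longrightarrow> d_perm f m \<nu> t (row_tableau f \<nu> b) = t b"
proof -
  let ?P = "\<lambda>w. w permutes {f + 1..m} \<and> (\<forall>b\<in>diagram \<nu>. w (row_tableau f \<nu> b) = t b)"
  let ?R = "row_tableau f \<nu>"
  have tb: "bij_betw t (diagram \<nu>) {f + 1..m}" using t by (simp add: std_tableaux_def)
  note rb = row_tableau_bij
  define w where "w x = (if x \<in> {f + 1..m} then t (the_inv_into (diagram \<nu>) ?R x) else x)" for x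
  have wr: "w (?R b) = t b" if "b \<in> diagram \<nu>" for b
    using that rb by (auto simp: w_def the_inv_into_f_f bij_betw_def)
  have "bij_betw w {f + 1..m} {f + 1..m}"
  proof -
    have "bij_betw (t \<circ> the_inv_into (diagram \<nu>) ?R) {f + 1..m} {f + 1..m}"
      by (rule bij_betw_trans[OF bij_betw_the_inv_into[OF rb] tb])
    moreover have "bij_betw w {f + 1..m} {f + 1..m} \<longleftrightarrow> bij_betw (t \<circ> the_inv_into (diagram \<nu>) ?R) {f + 1..m} {f + 1..m}"
      by (rule bij_betw_cong) (simp add: w_def)
    ultimately show ?thesis by blast
  qed
  then have "w permutes {f + 1..m}" by (rule bij_imp_permutes) (auto simp: w_def)
  then have w: "?P w" using wr by blast
  have "w' = w" if w': "?P w'" for w'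
  proof
    fix x show "w' x = w x"
    proof (cases "x \<in> {f + 1..m}")
      case True
      then have "x \<in> ?R ` diagram \<nu>" using rb by (simp add: bij_betw_def)
      then obtain b where "b \<in> diagram \<nu>" "x = ?R b" by blast
      then show ?thesis using w w' by simp
    next
      case False
      then show ?thesis using w w' permutes_not_in by metis
    qed
  qed
  then have "?P (d_perm f m \<nu> t)"
    unfolding d_perm_def by (rule theI[where P = ?P, OF w])
  then show "d_perm f m \<nu> t permutes {f + 1..m}" "\<And>b. b \<in> diagram \<nu> \<Longrightarrow> d_perm f m \<nu> t (?R b) = t b" by blast+
qed

lemma row_position:
  assumes "x \<in> row i"
  shows "(i, x - off i - 1) \<in> diagram \<nu>" "row_tableau f \<nu> (i, x - off i - 1) = x"
  using assms by (auto simp: diagram_def row_tableau_eq row_def off_Suc)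

text \<open>Otherwise the cell of y would lie weakly below and to the right of the cell of x, where
  a standard tableau has entries at least as large. Since the letters depend on columns only, d(t)
  exchanges distinct letters, always in the same direction.\<close>

lemma d_perm_inversion:
  assumes t: "t \<in> std_tableaux f m \<nu>" and xy: "(x, y) \<in> inversions (d_perm f m \<nu> t)"
  obtains i i' where "x \<in> row i" "y \<in> row i'" "y - off i' < x - off i"
proof -
  note d = d_perm_facts[OF t]
  have "x \<in> {f + 1..m}" "y \<in> {f + 1..m}" using inversions_subset[OF d(1)] xy by auto
  then obtain i i' where x: "x \<in> row i" and y: "y \<in> row i'" using row_cover by metis
  define j j' where "j = x - off i - 1" and "j' = y - off i' - 1"
  have ij: "(i, j) \<in> diagram \<nu>" "row_tableau f \<nu> (i, j) = x" "(i', j') \<in> diagram \<nu>" "row_tableau f \<nu> (i', j') = y"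
    using row_position[OF x] row_position[OF y] by (simp_all add: j_def j'_def)
  have l: "x < y" "t (i', j') < t (i, j)"
    using xy d(2)[OF ij(1)] d(2)[OF ij(3)] ij by (auto simp: inversions_def)
  have pos: "off i < x" "off i' < y" using x y by (auto simp: row_def)
  have T: "\<And>i j j'. j < j' \<Longrightarrow> j' < \<nu> i \<Longrightarrow> t (i, j) < t (i, j')"
    "\<And>i i' j. i < i' \<Longrightarrow> j < \<nu> i' \<Longrightarrow> t (i, j) < t (i', j)"
    using t by (auto simp: std_tableaux_def)
  have D: "j < \<nu> i" "j' < \<nu> i'" using ij by (auto simp: diagram_def)
  have "j' < j"
  proof (rule ccontr)
    assume "\<not> j' < j"
    then have jj: "j \<le> j'" by simp
    have ii: "i \<le> i'" using row_less[OF y x] l(1) by (metis less_asym not_le)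
    have "t (i, j) \<le> t (i', j')"
    proof (cases "i = i'")
      case True
      then show ?thesis using T(1)[of j j' i] jj D by (cases "j = j'") auto
    next
      case False
      then have "i < i'" using ii by simp
      moreover have "j' < \<nu> i" using D(2) partitions_antimono[OF part ii] by simp
      ultimately show ?thesis
        using T(1)[of j j' i] T(2)[of i i' j'] jj D by (cases "j = j'") auto
    qed
    then show False using l(2) by simp
  qed
  then have "y - off i' < x - off i" using pos by (simp add: j_def j'_def)
  then show ?thesis using x y that by blast
qed

text \<open>Columns increase, so a standard tableau is determined by the sets of entries of its
  columns. This is the form required later, because a leading word shows only the column of an
  entry.\<close>

lemma std_tableau_columns:
  assumes t: "t \<in> std_tableaux f m \<nu>" and u: "u \<in> std_tableaux f m \<nu>"
    and same: "\<And>i j i' j'. (i, j) \<in> diagram \<nu> \<Longrightarrow> (i', j') \<in> diagram \<nu> \<Longrightarrow> t (i, j) = u (i', j') \<Longrightarrow> j = j'"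
  shows "t = u"
proof -
  have bt: "t ` diagram \<nu> = {f + 1..m}" and bu: "u ` diagram \<nu> = {f + 1..m}"
    using t u by (auto simp: std_tableaux_def bij_betw_def)
  have col: "t (i, j) = u (i, j)" if "(i, j) \<in> diagram \<nu>" for i j
  proof -
    let ?h = "conjugate \<nu> j"
    have h: "i < ?h \<longleftrightarrow> (i, j) \<in> diagram \<nu>" for i
      using conjugate_iff[OF part] by (simp add: diagram_def)
    have srt: "sorted_wrt (<) (map (\<lambda>i. v (i, j)) [0..<?h])" if "v \<in> std_tableaux f m \<nu>" for v
      unfolding sorted_wrt_iff_nth_less
    proof (intro allI impI)
      fix a b assume ab: "a < b" "b < length (map (\<lambda>i. v (i, j)) [0..<?h])"
      then have "(b, j) \<in> diagram \<nu>" using h by simp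
      then have "v (a, j) < v (b, j)" using that ab(1) by (auto simp: std_tableaux_def diagram_def)
      then show "map (\<lambda>i. v (i, j)) [0..<?h] ! a < map (\<lambda>i. v (i, j)) [0..<?h] ! b" using ab by simp
    qed
    have "(\<lambda>i. t (i, j)) ` {..<?h} = (\<lambda>i. u (i, j)) ` {..<?h}"
    proof
      show "(\<lambda>i. t (i, j)) ` {..<?h} \<subseteq> (\<lambda>i. u (i, j)) ` {..<?h}"
      proof (rule image_subsetI)
        fix i assume "i \<in> {..<?h}"
        then have ij: "(i, j) \<in> diagram \<nu>" using h by simp
        then obtain i' j' where i': "(i', j') \<in> diagram \<nu>" "t (i, j) = u (i', j')" using bt bu by fast
        then have "j = j'" using same ij by blast
        then show "t (i, j) \<in> (\<lambda>i. u (i, j)) ` {..<?h}" using i' h by auto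
      qed
      show "(\<lambda>i. u (i, j)) ` {..<?h} \<subseteq> (\<lambda>i. t (i, j)) ` {..<?h}"
      proof (rule image_subsetI)
        fix i assume "i \<in> {..<?h}"
        then have ij: "(i, j) \<in> diagram \<nu>" using h by simp
        then obtain i' j' where i': "(i', j') \<in> diagram \<nu>" "t (i', j') = u (i, j)" using bt bu by (metis (no_types, lifting) image_iff old.prod.exhaust)
        then have "j' = j" using same ij by blast
        then show "u (i, j) \<in> (\<lambda>i. t (i, j)) ` {..<?h}" using i' h by force
      qed
    qed
    then have "set (map (\<lambda>i. t (i, j)) [0..<?h]) = set (map (\<lambda>i. u (i, j)) [0..<?h])"
      by (simp add: atLeast0LessThan)
    then have "map (\<lambda>i. t (i, j)) [0..<?h] = map (\<lambda>i. u (i, j)) [0..<?h]"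
      using srt[OF t] srt[OF u] strict_sorted_equal by blast
    moreover have "i \<in> set [0..<?h]" using h that by simp
    ultimately show ?thesis by (meson map_eq_conv)
  qed
  have "t \<in> extensional (diagram \<nu>)" "u \<in> extensional (diagram \<nu>)" using t u by (auto simp: std_tableaux_def)
  then show ?thesis using col by (intro extensionalityI) auto
qed

end

section \<open>The vectors are killed by E_i and have the right weight\<close>

context shape
begin

lemma V_hecke: "q \<noteq> 0 \<Longrightarrow> young_hecke f r \<alpha> q (mixed n r s) (g_act q n r s)"
  by (intro young_hecke.intro V.young_axioms hecke_family_g)

lemma W_hecke: "q \<noteq> 0 \<Longrightarrow> young_hecke f s \<beta> q (mixed n r s) (gs_act q n r s)"
  by (intro young_hecke.intro W.young_axioms hecke_family_gs)

definition start :: "'a::field \<Rightarrow> 'a tensor" where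
  "start q = antisym_act (gs_act q n r s) q f s \<beta> (antisym_act (g_act q n r s) q f r \<alpha> (v_f_lambda n r s f lam))"

lemma antisym_mixed:
  assumes "q \<noteq> 0" "x \<in> mixed n r s"
  shows "antisym_act (g_act q n r s) q f r \<alpha> x \<in> mixed n r s" "antisym_act (gs_act q n r s) q f s \<beta> x \<in> mixed n r s"
proof -
  interpret VH: young_hecke f r \<alpha> q "mixed n r s" "g_act q n r s" by (rule V_hecke[OF assms(1)])
  interpret WH: young_hecke f s \<beta> q "mixed n r s" "gs_act q n r s" by (rule W_hecke[OF assms(1)])
  show "antisym_act (g_act q n r s) q f r \<alpha> x \<in> mixed n r s"
    unfolding VH.antisym_act_eq by (rule VH.antisym_X[OF V.Stab_permutes assms(2)])
  show "antisym_act (gs_act q n r s) q f s \<beta> x \<in> mixed n r s"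
    unfolding WH.antisym_act_eq by (rule WH.antisym_X[OF W.Stab_permutes assms(2)])
qed

lemma start_mixed: "q \<noteq> 0 \<Longrightarrow> start q \<in> mixed n r s"
  unfolding start_def by (intro antisym_mixed v_f_lambda_mixed)

text \<open>E_i commutes with both antisymmetrizers. The part with a repetition in a row of the
  vector word is killed by the first of them, the other part by the second, which may be moved in
  front because the two commute.\<close>

lemma eop_start:
  assumes q: "q \<noteq> 0" and i: "i \<in> {1..<n}"
  shows "eop q i 1 (start q) = 0"
proof -
  interpret VH: young_hecke f r \<alpha> q "mixed n r s" "g_act q n r s" by (rule V_hecke[OF q])
  interpret WH: young_hecke f s \<beta> q "mixed n r s" "gs_act q n r s" by (rule W_hecke[OF q])
  let ?x0 = "v_f_lambda n r s f lam :: 'a tensor"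
  let ?NV = "VH.antisym V.Stab" and ?NW = "WH.antisym W.Stab" and ?T = "eop q i 1"
  note mx = v_f_lambda_mixed
  have Tadd: "?T (x + y) = ?T x + ?T y" for x y by (simp only: fun_eq_iff eop_fun_add plus_fun_apply simp_thms)
  have Tscl: "?T (c \<odot> x) = c \<odot> ?T x" for c x by (simp only: fun_eq_iff eop_fun_scl scl_apply simp_thms)
  obtain y1 y2 where y: "?T ?x0 = y1 + y2" "y1 \<in> mixed n r s" "y2 \<in> mixed n r s"
    and rV: "\<And>I J. y1 (mono_word I J) \<noteq> 0 \<Longrightarrow> rep_V I" and rW: "\<And>I J. y2 (mono_word I J) \<noteq> 0 \<Longrightarrow> rep_W J"
    using eop_v_f_lambda[OF q i] by blast
  have NV: "?NV x \<in> mixed n r s" if "x \<in> mixed n r s" for x by (rule VH.antisym_X[OF V.Stab_permutes that])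
  have NW: "?NW x \<in> mixed n r s" if "x \<in> mixed n r s" for x by (rule WH.antisym_X[OF W.Stab_permutes that])
  have TV: "?T (?NV x) = ?NV (?T x)" if "x \<in> mixed n r s" for x
    by (rule VH.T_antisym[OF eop_mixed[OF i] eop_g_act[OF q i] Tadd Tscl V.Stab_permutes that])
  have TW: "?T (?NW x) = ?NW (?T x)" if "x \<in> mixed n r s" for x
    by (rule WH.T_antisym[OF eop_mixed[OF i] eop_gs_act[OF q i] Tadd Tscl W.Stab_permutes that])
  \<comment> \<open>This is \<open>T_antisym\<close> on the starred side with a generator g_k as
    \<open>T\<close>; \<open>NN\<close> then uses it on the vector side with the starred
    antisymmetrizer as \<open>T\<close>.\<close>
  have gNW: "?NW (g_act q n r s k x) = g_act q n r s k (?NW x)" if "k \<in> {1..<r}" "x \<in> mixed n r s" for k x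
    by (rule WH.T_antisym[OF VH.closed[OF that(1)] g_gs_comm[OF _ that(1), symmetric] VH.G_add[OF that(1)] VH.G_scl[OF that(1)]
          W.Stab_permutes that(2), symmetric])
  have NN: "?NW (?NV x) = ?NV (?NW x)" if "x \<in> mixed n r s" for x
    by (rule VH.T_antisym[OF NW gNW WH.antisym_add[OF W.Stab_permutes] WH.antisym_scl[OF W.Stab_permutes] V.Stab_permutes that])
  have "?NV y1 = 0"
  proof -
    have "?NV y1 = (\<Sum>p\<in>multi_idx n r s. ?NV (y1 (mono_word (fst p) (snd p)) \<odot> bas (mono_word (fst p) (snd p))))"
      by (subst (1) mixed_expand[OF y(2)])
        (simp add: lin_ext_def case_prod_beta VH.antisym_sum[OF V.Stab_permutes] mixed_scl bas_mixed)
    also have "\<dots> = 0"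
    proof (rule sum.neutral, clarify)
      fix I J assume IJ: "(I, J) \<in> multi_idx n r s"
      note b = bas_mixed[OF IJ]
      have "y1 (mono_word I J) = 0 \<or> ?NV (bas (mono_word I J)) = 0"
      proof (rule disjCI)
        assume "?NV (bas (mono_word I J)) \<noteq> 0"
        then have "\<not> rep_V I"
          unfolding rep_V_def using VH.Stab_G(2)[OF _ _ b g_act_bas(2)[OF IJ]] by blast
        then show "y1 (mono_word I J) = 0" using rV by blast
      qed
      then show "?NV (y1 (mono_word (fst (I, J)) (snd (I, J))) \<odot> bas (mono_word (fst (I, J)) (snd (I, J)))) = 0"
        using VH.antisym_scl[OF V.Stab_permutes b] by auto
    qed
    finally show ?thesis .
  qed
  moreover have "?NW y2 = 0"
  proof -
    have "?NW y2 = (\<Sum>p\<in>multi_idx n r s. ?NW (y2 (mono_word (fst p) (snd p)) \<odot> bas (mono_word (fst p) (snd p))))"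
      by (subst (1) mixed_expand[OF y(3)])
        (simp add: lin_ext_def case_prod_beta WH.antisym_sum[OF W.Stab_permutes] mixed_scl bas_mixed)
    also have "\<dots> = 0"
    proof (rule sum.neutral, clarify)
      fix I J assume IJ: "(I, J) \<in> multi_idx n r s"
      note b = bas_mixed[OF IJ]
      have "y2 (mono_word I J) = 0 \<or> ?NW (bas (mono_word I J)) = 0"
      proof (rule disjCI)
        assume "?NW (bas (mono_word I J)) \<noteq> 0"
        then have "\<not> rep_W J"
          unfolding rep_W_def using WH.Stab_G(2)[OF _ _ b gs_act_bas(2)[OF IJ]] by blast
        then show "y2 (mono_word I J) = 0" using rW by blast
      qed
      then show "?NW (y2 (mono_word (fst (I, J)) (snd (I, J))) \<odot> bas (mono_word (fst (I, J)) (snd (I, J)))) = 0"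
        using WH.antisym_scl[OF W.Stab_permutes b] by auto
    qed
    finally show ?thesis .
  qed
  ultimately have "?NW (?NV y1) = 0" "?NW (?NV y2) = 0"
    using NN[OF y(3)] VH.antisym_zero[OF V.Stab_permutes] WH.antisym_zero[OF W.Stab_permutes] by simp_all
  moreover have "?T (start q) = ?NW (?NV (y1 + y2))"
    unfolding start_def VH.antisym_act_eq WH.antisym_act_eq TW[OF NV[OF mx]] TV[OF mx] y(1) by (rule refl)
  moreover have "?NV (y1 + y2) = ?NV y1 + ?NV y2"
    by (rule VH.antisym_add[OF V.Stab_permutes y(2,3)])
  moreover have "?NW (?NV y1 + ?NV y2) = ?NW (?NV y1) + ?NW (?NV y2)"
    by (rule WH.antisym_add[OF W.Stab_permutes NV[OF y(2)] NV[OF y(3)]])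
  ultimately show ?thesis by (simp only: add_0)
qed

lemma gd_act_eq:
  assumes "(Is, Js) \<in> D_data r s f" "d = D_perm (Is, Js)"
  shows "gd_act q n r s f d x = fold (\<lambda>k x. gw_act (gs_act q n r s) s (s_perm k (Js ! (k - 1)))
    (gw_act (g_act q n r s) r (s_perm k (Is ! (k - 1))) x)) (rev [1..<Suc f]) x"
proof -
  have "(THE D. D \<in> D_data r s f \<and> D_perm D = d) = (Is, Js)"
    using assms inj_onD[OF D_perm_inj] by (intro the_equality) auto
  then show ?thesis unfolding gd_act_def by simp
qed

lemma v_vec_eq:
  "v_vec q n r s f lam t d = gd_act q n r s f d (gw_act (gs_act q n r s) s (d_perm f s \<beta> (snd t))
     (gw_act (g_act q n r s) r (d_perm f r \<alpha> (fst t)) (start q)))"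
  by (simp add: v_vec_def Let_def start_def bipart_conj_def \<alpha>_def \<beta>_def)

lemma D_perms:
  assumes "(Is, Js) \<in> D_data r s f" "k \<in> {1..f}"
  shows "s_perm k (Is ! (k - 1)) permutes {1..r}" "s_perm k (Js ! (k - 1)) permutes {1..s}"
  using D_data_bounds(3,4)[OF assms] assms(2) by (auto intro!: s_perm_permutes)

lemma t_perms:
  assumes "t \<in> std_bitableaux r s f (bipart_conj lam)"
  shows "fst t \<in> std_tableaux f r \<alpha>" "snd t \<in> std_tableaux f s \<beta>"
    "d_perm f r \<alpha> (fst t) permutes {1..r}" "d_perm f s \<beta> (snd t) permutes {1..s}"
proof -
  show "fst t \<in> std_tableaux f r \<alpha>" "snd t \<in> std_tableaux f s \<beta>"
    using assms by (auto simp: std_bitableaux_def bipart_conj_def \<alpha>_def \<beta>_def)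
  then show "d_perm f r \<alpha> (fst t) permutes {1..r}" "d_perm f s \<beta> (snd t) permutes {1..s}"
    using V.permutes_up V.d_perm_facts(1) W.permutes_up W.d_perm_facts(1) by blast+
qed

text \<open>Applied with \<open>Y\<close> the kernel of E_i and \<open>Y\<close> a weight space:
  both are stable under the generators and contain the starting vector.\<close>

lemma v_vec_in:
  assumes q: "q \<noteq> 0" and Y: "tensor_vs.subspace Y" "Y \<subseteq> mixed n r s"
    and g: "\<And>k x. k \<in> {1..<r} \<Longrightarrow> x \<in> Y \<Longrightarrow> g_act q n r s k x \<in> Y"
    and gs: "\<And>k x. k \<in> {1..<s} \<Longrightarrow> x \<in> Y \<Longrightarrow> gs_act q n r s k x \<in> Y"
    and st: "start q \<in> Y" and t: "t \<in> std_bitableaux r s f (bipart_conj lam)" and d: "d \<in> D_set r s f"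
  shows "v_vec q n r s f lam t d \<in> Y"
proof -
  interpret VH: hecke_family q r Y "g_act q n r s" by (rule hecke_family_subset[OF hecke_family_g[OF q] Y g])
  interpret WH: hecke_family q s Y "gs_act q n r s" by (rule hecke_family_subset[OF hecke_family_gs[OF q] Y gs])
  obtain Is Js where D: "(Is, Js) \<in> D_data r s f" "d = D_perm (Is, Js)" using d by (auto simp: D_set_def)
  have "fold (\<lambda>k x. gw_act (gs_act q n r s) s (s_perm k (Js ! (k - 1)))
    (gw_act (g_act q n r s) r (s_perm k (Is ! (k - 1))) x)) ks x \<in> Y" if "set ks \<subseteq> {1..f}" "x \<in> Y" for ks x
    using that
  proof (induction ks arbitrary: x)
    case (Cons k ks)
    then have k: "k \<in> {1..f}" by simp
    show ?case
      using Cons.IH[OF _ WH.gw_X[OF D_perms(2)[OF D(1) k] VH.gw_X[OF D_perms(1)[OF D(1) k] Cons.prems(2)]]] Cons.prems(1)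
      by simp
  qed simp
  moreover have "set (rev [1..<Suc f]) \<subseteq> {1..f}" by auto
  ultimately show ?thesis
    unfolding v_vec_eq gd_act_eq[OF D]
    using WH.gw_X[OF t_perms(4)[OF t] VH.gw_X[OF t_perms(3)[OF t] st]] by blast
qed

lemma lin_ext_0: "lin_ext n r s T 0 = 0"
  using lin_ext_scl[of n r s T 0 0] by simp

lemma g_act_0: "g_act q n r s k 0 = 0" "gs_act q n r s k 0 = 0"
  by (simp_all only: g_act_def gs_act_def lin_ext_0)

lemma eop_v_vec:
  assumes q: "q \<noteq> 0" and i: "i \<in> {1..<n}"
    and t: "t \<in> std_bitableaux r s f (bipart_conj lam)" and d: "d \<in> D_set r s f"
  shows "eop q i 1 (v_vec q n r s f lam t d) = 0"
proof -
  let ?Y = "{x \<in> mixed n r s. eop q i 1 x = 0}"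
  have "tensor_vs.subspace ?Y"
    unfolding tensor_vs.subspace_def
  proof (intro conjI ballI allI)
    show "0 \<in> ?Y" using tensor_vs.subspace_0[OF mixed_subspace] eop_fun_zero[of q i 1] by (simp add: fun_eq_iff tensor_apply)
    fix x y assume "x \<in> ?Y" "y \<in> ?Y"
    then show "x + y \<in> ?Y" using eop_fun_add[of q i 1 x y] by (simp add: mixed_add fun_eq_iff tensor_apply)
  next
    fix c x assume "x \<in> ?Y"
    then show "c \<odot> x \<in> ?Y" using eop_fun_scl[of q i 1 c x] by (simp add: mixed_scl fun_eq_iff tensor_apply)
  qed
  moreover have "g_act q n r s k x \<in> ?Y" if "k \<in> {1..<r}" "x \<in> ?Y" for k x
    using that eop_g_act[OF q i _ that(1), of x s] g_act_mixed[OF that(1)] by (auto simp: g_act_0)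
  moreover have "gs_act q n r s k x \<in> ?Y" if "k \<in> {1..<s}" "x \<in> ?Y" for k x
    using that eop_gs_act[OF q i _ that(1), of x r] gs_act_mixed[OF that(1)] by (auto simp: g_act_0)
  ultimately have "v_vec q n r s f lam t d \<in> ?Y"
    using start_mixed[OF q] eop_start[OF q i] by (intro v_vec_in[OF q _ _ _ _ _ t d]) auto
  then show ?thesis by blast
qed

lemma count_list_mset: "count_list xs x = count (mset xs) x"
  by (induction xs) auto

lemma wt_mset: "mset I = mset I' \<Longrightarrow> mset J = mset J' \<Longrightarrow> wt i (mono_word I J) = wt i (mono_word I' J')"
  by (simp add: wt_mono_word count_list_mset)

text \<open>Row k of \<open>A\<close> contains the letter i exactly when i <= \<alpha> k, so the
  number of occurrences is a part of the conjugate of \<alpha>, that is, of the original partition;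
  similarly for \<open>B\<close>. The two copies of \<open>c\<close> cancel.\<close>

lemma wt_AB:
  assumes i: "i \<in> {1..n}"
  shows "wt i (mono_word (c @ A) (c @ B)) = tilde_weight n lam i"
proof -
  have cc: "count_list (concat xss) i = (\<Sum>xs\<leftarrow>xss. count_list xs i)" for xss :: "nat list list"
    by (induction xss) auto
  have cu: "count_list [a..<b] i = (if a \<le> i \<and> i < b then 1 else 0)" for a b :: nat
  proof (cases "a \<le> i \<and> i < b")
    case True
    then show ?thesis using count_list_0_iff[of "[a..<b]" i]
      by (simp add: count_list_mset distinct_count_atmost_1[THEN iffD1, OF distinct_upt])
  next
    case False
    then show ?thesis by (auto simp: count_list_0_iff)
  qed
  have cr: "count_list (rev xs) i = count_list xs i" for xs :: "nat list" by (simp add: count_list_mset)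
  have sm: "(\<Sum>k\<leftarrow>[0..<M]. if k < h then 1 else 0) = h" if "h \<le> M" for h M :: nat
  proof -
    have "(\<Sum>k\<leftarrow>[0..<M]. if k < h then 1 else 0) = (\<Sum>k<M. if k < h then 1 else (0::nat))"
      by (simp add: sum_list_distinct_conv_sum_set atLeast0LessThan)
    also have "\<dots> = card {k\<in>{..<M}. k < h}" by (simp flip: sum.inter_filter)
    also have "{k\<in>{..<M}. k < h} = {..<h}" using that by auto
    finally show ?thesis by simp
  qed
  have le: "p j \<le> m" if "p \<in> partitions m" for p and j m :: nat
  proof -
    have "\<not> m < p j"
    proof
      assume "m < p j"
      then have "j < conjugate p m" using conjugate_iff[OF that] by simp
      then show False using partitions_zero[OF conjugate_partitions[OF that], of m] by simp
    qed
    then show ?thesis by simp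
  qed
  have "count_list A i = (\<Sum>k\<leftarrow>[0..<r - f]. if k < fst lam (i - 1) then 1 else 0)"
    unfolding A_def cc map_map comp_def cu
  proof (rule arg_cong[where f = sum_list], rule map_cong[OF refl])
    fix k
    have "1 \<le> i \<and> i < Suc (\<alpha> k) \<longleftrightarrow> i - 1 < \<alpha> k" using i by auto
    also have "\<dots> \<longleftrightarrow> k < fst lam (i - 1)"
      using conjugate_iff[OF conjugate_partitions[OF lam_part(1)], of k "i - 1"]
        conjugate_iff[OF lam_part(1), of "i - 1" k] by (simp add: \<alpha>_def) (metis)?
    finally show "(if 1 \<le> i \<and> i < Suc (\<alpha> k) then 1 else 0) = (if k < fst lam (i - 1) then 1 else 0)" by simp
  qed
  then have 1: "count_list A i = fst lam (i - 1)" using sm[OF le[OF lam_part(1)]] by simp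
  have "count_list B i = (\<Sum>k\<leftarrow>[0..<s - f]. if k < snd lam (n - i) then 1 else 0)"
    unfolding B_def cc map_map comp_def cr cu
  proof (rule arg_cong[where f = sum_list], rule map_cong[OF refl])
    fix k
    have "n + 1 - \<beta> k \<le> i \<and> i < Suc n \<longleftrightarrow> n - i < \<beta> k" using i beta_le[of k] by auto
    also have "\<dots> \<longleftrightarrow> k < snd lam (n - i)"
      using conjugate_iff[OF lam_part(2), of "n - i" k] by (simp add: \<beta>_def) (metis)?
    finally show "(if n + 1 - \<beta> k \<le> i \<and> i < Suc n then 1 else 0) = (if k < snd lam (n - i) then 1 else 0)" by simp
  qed
  then have 2: "count_list B i = snd lam (n - i)" using sm[OF le[OF lam_part(2)]] by simp
  show ?thesis
    by (simp add: wt_mono_word tilde_weight_def 1 2)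
qed

end

context shape
begin

lemma start_in:
  assumes q: "q \<noteq> 0" and Y: "tensor_vs.subspace Y" "Y \<subseteq> mixed n r s"
    and g: "\<And>k x. k \<in> {1..<r} \<Longrightarrow> x \<in> Y \<Longrightarrow> g_act q n r s k x \<in> Y"
    and gs: "\<And>k x. k \<in> {1..<s} \<Longrightarrow> x \<in> Y \<Longrightarrow> gs_act q n r s k x \<in> Y"
    and v: "v_f_lambda n r s f lam \<in> Y"
  shows "start q \<in> Y"
proof -
  interpret VH: young_hecke f r \<alpha> q Y "g_act q n r s"
    by (intro young_hecke.intro V.young_axioms hecke_family_subset[OF hecke_family_g[OF q] Y g])
  interpret WH: young_hecke f s \<beta> q Y "gs_act q n r s"
    by (intro young_hecke.intro W.young_axioms hecke_family_subset[OF hecke_family_gs[OF q] Y gs])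
  show ?thesis
    unfolding start_def VH.antisym_act_eq WH.antisym_act_eq
    by (intro WH.antisym_X[OF W.Stab_permutes] VH.antisym_X[OF V.Stab_permutes] v)
qed

lemma v_vec_weight:
  fixes q :: "'a::field"
  assumes q: "q \<noteq> 0" and t: "t \<in> std_bitableaux r s f (bipart_conj lam)" and d: "d \<in> D_set r s f"
  shows "v_vec q n r s f lam t d \<in> mixed n r s \<and>
    (\<forall>w. v_vec q n r s f lam t d w \<noteq> 0 \<longrightarrow> (\<forall>i\<in>{1..n}. wt i w = tilde_weight n lam i))"
proof -
  let ?Y = "{x \<in> (mixed n r s :: 'a tensor set). \<forall>w. x w \<noteq> 0 \<longrightarrow> (\<forall>i\<in>{1..n}. wt i w = tilde_weight n lam i)}"
  have Y: "tensor_vs.subspace ?Y"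
    unfolding tensor_vs.subspace_def
  proof (intro conjI ballI allI)
    show "0 \<in> ?Y" by (simp add: tensor_apply tensor_vs.subspace_0[OF mixed_subspace])
    fix x y assume xy: "x \<in> ?Y" "y \<in> ?Y"
    have "x w \<noteq> 0 \<or> y w \<noteq> 0" if "(x + y) w \<noteq> 0" for w
      using that by (auto simp: tensor_apply)
    with xy show "x + y \<in> ?Y" by (simp add: mixed_add) blast
  next
    fix c x assume "x \<in> ?Y"
    then show "c \<odot> x \<in> ?Y" by (simp add: mixed_scl tensor_apply)
  qed
  have g: "g_act q n r s k x \<in> ?Y" if k: "k \<in> {1..<r}" and x: "x \<in> ?Y" for k x
  proof -
    have xm: "x \<in> mixed n r s" using x by blast
    have "wt i w = tilde_weight n lam i" if nz: "g_act q n r s k x w \<noteq> 0" and i: "i \<in> {1..n}" for i w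
    proof -
      obtain I J where IJ: "(I, J) \<in> multi_idx n r s" "w = mono_word I J"
        using nz by (rule mixed_nonzero[OF g_act_mixed[OF k]])
      have kl: "1 \<le> k" "k < length I" using IJ k by (auto simp: multi_idx_def)
      have "x (mono_word I J) \<noteq> 0 \<or> x (mono_word (swap_at k I) J) \<noteq> 0"
        by (rule ccontr) (use nz in \<open>simp add: IJ g_act_coeff[OF xm k] hop_def split: if_splits\<close>)
      then have "wt i (mono_word I J) = tilde_weight n lam i \<or> wt i (mono_word (swap_at k I) J) = tilde_weight n lam i"
        using x i by blast
      then show ?thesis unfolding IJ(2) using wt_mset[OF mset_swap_at[OF kl] refl, of i J] by simp
    qed
    then show ?thesis using g_act_mixed[OF k] by blast
  qed
  have gs: "gs_act q n r s k x \<in> ?Y" if k: "k \<in> {1..<s}" and x: "x \<in> ?Y" for k x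
  proof -
    have xm: "x \<in> mixed n r s" using x by blast
    have "wt i w = tilde_weight n lam i" if nz: "gs_act q n r s k x w \<noteq> 0" and i: "i \<in> {1..n}" for i w
    proof -
      obtain I J where IJ: "(I, J) \<in> multi_idx n r s" "w = mono_word I J"
        using nz by (rule mixed_nonzero[OF gs_act_mixed[OF k]])
      have kl: "1 \<le> k" "k < length J" using IJ k by (auto simp: multi_idx_def)
      have "x (mono_word I J) \<noteq> 0 \<or> x (mono_word I (swap_at k J)) \<noteq> 0"
        by (rule ccontr) (use nz in \<open>simp add: IJ gs_act_coeff[OF xm k] hop_def split: if_splits\<close>)
      then have "wt i (mono_word I J) = tilde_weight n lam i \<or> wt i (mono_word I (swap_at k J)) = tilde_weight n lam i"
        using x i by blast
      then show ?thesis unfolding IJ(2) using wt_mset[OF refl mset_swap_at[OF kl], of i I] by simp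
    qed
    then show ?thesis using gs_act_mixed[OF k] by blast
  qed
  have bY: "bas (mono_word (c @ A) (c @ B)) \<in> ?Y" if "c \<in> cap_words n f" for c
  proof -
    have "wt i w = tilde_weight n lam i" if "(bas (mono_word (c @ A) (c @ B)) w :: 'a) \<noteq> 0" "i \<in> {1..n}" for i w
    proof -
      have "w = mono_word (c @ A) (c @ B)" using that(1) by (simp add: bas_apply split: if_splits)
      then show ?thesis using wt_AB[OF that(2)] by simp
    qed
    then show ?thesis using bas_mixed[OF AB_multi[OF that]] by blast
  qed
  have "v_f_lambda n r s f lam \<in> ?Y"
    unfolding v_f_lambda_eq by (rule tensor_vs.subspace_sum[OF Y bY])
  from start_in[OF q Y _ g gs this] have "start q \<in> ?Y" by blast
  from v_vec_in[OF q Y _ g gs this t d] show ?thesis by blast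
qed

end

section \<open>Base change\<close>

locale shape_field = shape n r s f lam + ground_field \<phi>
  for n r s f lam and \<phi> :: "Qq \<Rightarrow> 'k::field"
begin

text \<open>As \<open>\<phi>\<close> is meaningful on integral tensors only, base change is treated
  as a relation between a lattice vector and its image, and every operator is shown to preserve
  it.\<close>

definition tr :: "Qq tensor \<Rightarrow> 'k tensor \<Rightarrow> bool" where
  "tr x y \<longleftrightarrow> x \<in> lattice n r s \<and> y = \<phi> \<circ> x"

lemma trI:
  assumes "x \<in> mixed n r s" "y \<in> mixed n r s"
    and "\<And>I J. (I, J) \<in> multi_idx n r s \<Longrightarrow> x (mono_word I J) \<in> ZZq \<and> y (mono_word I J) = \<phi> (x (mono_word I J))"
  shows "tr x y"
proof -
  have "x w \<in> ZZq \<and> y w = \<phi> (x w)" for w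
  proof (cases "\<exists>I J. (I, J) \<in> multi_idx n r s \<and> w = mono_word I J")
    case False
    then have "x w = 0" "y w = 0" using mixed_nonzero[OF assms(1), of w] mixed_nonzero[OF assms(2), of w] by blast+
    then show ?thesis by (simp add: ZZq_0 phi_0)
  qed (use assms(3) in auto)
  then show ?thesis using assms(1) by (auto simp: tr_def lattice_def fun_eq_iff)
qed

lemma trD:
  assumes "tr x y"
  shows "x \<in> mixed n r s" "y \<in> mixed n r s" "x w \<in> ZZq" "y w = \<phi> (x w)"
  using assms by (auto simp: tr_def lattice_def mixed_def phi_0)

lemma hop_tr:
  assumes "\<And>I. x I \<in> ZZq" "\<And>I. y I = \<phi> (x I)"
  shows "hop qq k x I \<in> ZZq \<and> hop (\<phi> qq) k y I = \<phi> (hop qq k x I)"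
  using assms ZZq_diff[OF ZZq_inverse_qq ZZq_qq] phi_diff[OF ZZq_inverse_qq ZZq_qq]
  by (simp add: hop_def ZZq_mult ZZq_add ZZq_inverse_qq phi_mult phi_add phi_inverse_qq)

lemma tr_g:
  assumes k: "k \<in> {1..<r}" and x: "tr x y"
  shows "tr (g_act qq n r s k x) (g_act (\<phi> qq) n r s k y)"
proof (rule trI[OF g_act_mixed[OF k] g_act_mixed[OF k]])
  fix I J
  show "g_act qq n r s k x (mono_word I J) \<in> ZZq \<and>
    g_act (\<phi> qq) n r s k y (mono_word I J) = \<phi> (g_act qq n r s k x (mono_word I J))"
    unfolding g_act_coeff[OF trD(1)[OF x] k] g_act_coeff[OF trD(2)[OF x] k]
    by (rule hop_tr) (rule trD(3,4)[OF x])+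
qed

lemma tr_gs:
  assumes k: "k \<in> {1..<s}" and x: "tr x y"
  shows "tr (gs_act qq n r s k x) (gs_act (\<phi> qq) n r s k y)"
proof (rule trI[OF gs_act_mixed[OF k] gs_act_mixed[OF k]])
  fix I J
  show "gs_act qq n r s k x (mono_word I J) \<in> ZZq \<and>
    gs_act (\<phi> qq) n r s k y (mono_word I J) = \<phi> (gs_act qq n r s k x (mono_word I J))"
    unfolding gs_act_coeff[OF trD(1)[OF x] k] gs_act_coeff[OF trD(2)[OF x] k]
    by (rule hop_tr) (rule trD(3,4)[OF x])+
qed

lemma tr_sum:
  assumes "\<And>a. a \<in> S \<Longrightarrow> tr (g a) (h a)"
  shows "tr (\<Sum>a\<in>S. g a) (\<Sum>a\<in>S. h a)"
proof (rule trI)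
  show "(\<Sum>a\<in>S. g a) \<in> mixed n r s" by (rule mixed_sum[OF trD(1)[OF assms]])
  show "(\<Sum>a\<in>S. h a) \<in> mixed n r s" by (rule mixed_sum[OF trD(2)[OF assms]])
  fix I J
  show "(\<Sum>a\<in>S. g a) (mono_word I J) \<in> ZZq \<and> (\<Sum>a\<in>S. h a) (mono_word I J) = \<phi> ((\<Sum>a\<in>S. g a) (mono_word I J))"
    unfolding tensor_sum_apply using trD(3,4)[OF assms] by (simp add: ZZq_sum phi_sum)
qed

lemma tr_scl:
  assumes "c \<in> ZZq" "tr x y"
  shows "tr (c \<odot> x) (\<phi> c \<odot> y)"
  by (rule trI) (use trD[OF assms(2)] assms(1) in \<open>auto simp: mixed_scl tensor_apply ZZq_mult phi_mult\<close>)

text \<open>Both sides fold over the same word, as the choice made in \<open>gw_act\<close> does not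
  depend on the ring.\<close>

lemma tr_gw:
  assumes "\<And>k x y. k \<in> {1..<m} \<Longrightarrow> tr x y \<Longrightarrow> tr (G k x) (H k y)" and w: "w permutes {1..m}" and x: "tr x y"
  shows "tr (gw_act G m w x) (gw_act H m w y)"
proof -
  have "tr (fold G ks x) (fold H ks y)" if "set ks \<subseteq> {1..<m}" "tr x y" for ks x y
    using that
  proof (induction ks arbitrary: x y)
    case (Cons k ks)
    then show ?case using Cons.IH[OF _ assms(1)[of k x y]] by simp
  qed simp
  then show ?thesis
    unfolding gw_act_def using some_reduced[OF w] x by (simp add: rword_def)
qed

lemma tr_antisym:
  assumes G: "\<And>k x y. k \<in> {1..<m} \<Longrightarrow> tr x y \<Longrightarrow> tr (G k x) (H k y)"
    and St: "\<And>w. w \<in> row_stabilizer f m \<nu> \<Longrightarrow> w permutes {1..m}" and x: "tr x y"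
  shows "tr (antisym_act G qq f m \<nu> x) (antisym_act H (\<phi> qq) f m \<nu> y)"
proof -
  have z: "(- qq) ^ l \<in> ZZq" "(- \<phi> qq) ^ l = \<phi> ((- qq) ^ l)" for l
    using ZZq_uminus[OF ZZq_qq] by (simp_all add: ZZq_power phi_power phi_uminus ZZq_qq)
  show ?thesis
    unfolding antisym_act_def z(2) by (intro tr_sum tr_scl z(1) tr_gw[OF G St x])
qed

lemma tr_v_vec:
  assumes t: "t \<in> std_bitableaux r s f (bipart_conj lam)" and d: "d \<in> D_set r s f"
  shows "tr (v_vec qq n r s f lam t d) (v_vec (\<phi> qq) n r s f lam t d)"
proof -
  have "tr (bas (mono_word (c @ A) (c @ B))) (bas (mono_word (c @ A) (c @ B)))" if "c \<in> cap_words n f" for c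
    by (rule trI) (use AB_multi[OF that] in \<open>auto intro: bas_mixed simp: bas_apply ZZq_0 ZZq_1 phi_0 phi_1\<close>)
  then have "tr (v_f_lambda n r s f lam) (v_f_lambda n r s f lam)"
    unfolding v_f_lambda_eq by (rule tr_sum)
  then have st: "tr (start qq) (start (\<phi> qq))"
    unfolding start_def
    by (intro tr_antisym tr_g tr_gs V.Stab_permutes W.Stab_permutes) (auto simp: V.Stab_def W.Stab_def)
  obtain Is Js where D: "(Is, Js) \<in> D_data r s f" "d = D_perm (Is, Js)" using d by (auto simp: D_set_def)
  have "tr (fold (\<lambda>k x. gw_act (gs_act qq n r s) s (s_perm k (Js ! (k - 1)))
      (gw_act (g_act qq n r s) r (s_perm k (Is ! (k - 1))) x)) ks x)
     (fold (\<lambda>k x. gw_act (gs_act (\<phi> qq) n r s) s (s_perm k (Js ! (k - 1)))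
      (gw_act (g_act (\<phi> qq) n r s) r (s_perm k (Is ! (k - 1))) x)) ks y)" if "set ks \<subseteq> {1..f}" "tr x y" for ks x y
    using that
  proof (induction ks arbitrary: x y)
    case (Cons k ks)
    then have k: "k \<in> {1..f}" by simp
    have "tr (gw_act (gs_act qq n r s) s (s_perm k (Js ! (k - 1))) (gw_act (g_act qq n r s) r (s_perm k (Is ! (k - 1))) x))
      (gw_act (gs_act (\<phi> qq) n r s) s (s_perm k (Js ! (k - 1))) (gw_act (g_act (\<phi> qq) n r s) r (s_perm k (Is ! (k - 1))) y))"
      by (rule tr_gw[OF tr_gs D_perms(2)[OF D(1) k] tr_gw[OF tr_g D_perms(1)[OF D(1) k] Cons.prems(2)]])
    from Cons.IH[OF _ this] Cons.prems(1) show ?case by simp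
  qed simp
  moreover have "set (rev [1..<Suc f]) \<subseteq> {1..f}" by auto
  moreover have "tr (gw_act (gs_act qq n r s) s (d_perm f s \<beta> (snd t)) (gw_act (g_act qq n r s) r (d_perm f r \<alpha> (fst t)) (start qq)))
    (gw_act (gs_act (\<phi> qq) n r s) s (d_perm f s \<beta> (snd t)) (gw_act (g_act (\<phi> qq) n r s) r (d_perm f r \<alpha> (fst t)) (start (\<phi> qq))))"
    by (rule tr_gw[OF tr_gs t_perms(4)[OF t] tr_gw[OF tr_g t_perms(3)[OF t] st]])
  ultimately show ?thesis
    unfolding v_vec_eq gd_act_eq[OF D] by blast
qed

lemma tilde_weight_dominant:
  assumes "i \<in> {1..n}" "j \<in> {1..n}" "i \<le> j"
  shows "tilde_weight n lam j \<le> tilde_weight n lam i"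
proof -
  have "fst lam (j - 1) \<le> fst lam (i - 1)" using partitions_antimono[OF lam_part(1), of "i - 1" "j - 1"] assms by simp
  moreover have "snd lam (n - i) \<le> snd lam (n - j)" using partitions_antimono[OF lam_part(2), of "n - j" "n - i"] assms by simp
  ultimately show ?thesis by (simp add: tilde_weight_def)
qed

lemma v_vec_singular:
  assumes t: "t \<in> std_bitableaux r s f (bipart_conj lam)" and d: "d \<in> D_set r s f"
    and nz: "v_vec (\<phi> qq) n r s f lam t d \<noteq> 0"
  shows "v_vec (\<phi> qq) n r s f lam t d \<in> singular_vectors \<phi> n r s (tilde_weight n lam)"
proof -
  have e: "v_vec (\<phi> qq) n r s f lam t d = \<phi> \<circ> v_vec qq n r s f lam t d"
    and l: "v_vec qq n r s f lam t d \<in> lattice n r s"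
    using tr_v_vec[OF t d] by (simp_all add: tr_def)
  show ?thesis
    unfolding e
  proof (rule singular_vectorsI[OF l])
    show "wt i w = tilde_weight n lam i" if "v_vec qq n r s f lam t d w \<noteq> 0" "i \<in> {1..n}" for w i
      using v_vec_weight[OF qq_nz t d] that by blast
    show "eop qq i 1 (v_vec qq n r s f lam t d) = 0" if "i \<in> {1..<n}" for i
      by (rule eop_v_vec[OF qq_nz that t d])
    show "\<phi> \<circ> v_vec qq n r s f lam t d \<noteq> 0" using nz unfolding e .
  qed (rule tilde_weight_dominant)
qed

end

section \<open>The leading words of the vectors\<close>

context young
begin

lemma pact_prefix:
  assumes w: "w permutes {f + 1..m}" and c: "length c = f" and p: "p < f"
  shows "pact w (c @ xs) ! p = c ! p"
proof -
  have "inv w (Suc p) = Suc p" using permutes_not_in[OF permutes_inv[OF w]] p by simp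
  then show ?thesis using c p nth_pact[of p "c @ xs" w] by (simp add: nth_append)
qed

text \<open>Letters within a row are distinct and \<open>w\<close> preserves rows, so the word shows
  where each position has gone.\<close>

lemma pact_row_id:
  assumes w: "w \<in> Stab" and K: "row_inc K \<or> row_dec K" and l: "length K = m" and e: "pact w K = K"
  shows "w = id"
proof -
  have p: "w permutes {f + 1..m}" using w by (simp add: Stab_iff)
  have "inv w x = x" for x
  proof (cases "x \<in> {f + 1..m}")
    case True
    then obtain i where i: "x \<in> row i" by (rule row_cover)
    have i': "inv w x \<in> row i" using Stab_inv_row[OF w] i by simp
    have "x - 1 < m" "Suc (x - 1) = x" using True by auto
    then have "K ! (inv w x - 1) = K ! (x - 1)"
      using nth_pact[of "x - 1" K w] l e by simp
    then show ?thesis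
      using K i i' unfolding row_inc_def row_dec_def by (metis less_irrefl linorder_neqE_nat)
  next
    case False
    then show ?thesis using permutes_not_in[OF permutes_inv[OF p]] by blast
  qed
  then have "inv w = id" by auto
  then show ?thesis using permutes_inv_inv[OF p] by (metis inv_id)
qed

end

text \<open>A sorted list has its small letters first, so no rearrangement has more of them in a
  prefix; the common tail contributes equally to both sides.\<close>

lemma dmd_sorted:
  assumes c: "sorted c" and ms: "mset c' = mset c"
  shows "dmd vkey (c' @ xs) (c @ xs)"
  unfolding dmd_def
proof (intro allI)
  fix p v
  let ?F = "\<lambda>l. length (filter (\<lambda>a. vkey a \<le> v) l)"
  have len: "length c' = length c" using ms by (rule mset_eq_length)
  have F: "?F c' = ?F c" using ms by (metis mset_filter size_mset)
  have "?F (take p c') \<le> ?F (take p c)"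
  proof (cases "\<forall>a\<in>set (take p c). vkey a \<le> v")
    case True
    then have "?F (take p c) = length (take p c)" by (simp add: filter_id_conv[THEN iffD2])
    then show ?thesis using len length_filter_le[of _ "take p c'"] by (simp add: order_trans)
  next
    case False
    then obtain a where a: "a \<in> set (take p c)" "\<not> vkey a \<le> v" by blast
    have "\<not> vkey b \<le> v" if "b \<in> set (drop p c)" for b
    proof -
      have "a \<le> b" using c a(1) that by (metis append_take_drop_id sorted_append)
      then show ?thesis using a(2) by simp
    qed
    then have "?F (drop p c) = 0" by simp
    moreover have "?F c = ?F (take p c) + ?F (drop p c)" by (metis append_take_drop_id filter_append length_append)
    moreover have "?F c' = ?F (take p c') + ?F (drop p c')" by (metis append_take_drop_id filter_append length_append)
    ultimately show ?thesis using F by simp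
  qed
  then show "cnt vkey v p (c' @ xs) \<le> cnt vkey v p (c @ xs)"
    using len by (simp add: cnt_def)
qed

context shape
begin

text \<open>The choice also fixes the order relations: these letters lie above all letters of
  \<open>A\<close> and below all letters of \<open>B\<close>.\<close>

definition c0 :: "nat list" where
  "c0 = [r - f + 1..<r + 1]"

lemma c0: "length c0 = f" "p < f \<Longrightarrow> c0 ! p = r - f + 1 + p" "sorted c0" "c0 \<in> cap_words n f"
  using f_le rsn by (auto simp: c0_def cap_words_def simp del: upt_Suc)

text \<open>The coefficients are powers of -q; what matters is that they are nonzero in every field.
  The rows of the vector words increase, so the Hecke action is not a mere permutation there, and
  \<open>antisym_row_inc\<close> is used; on the dual side \<open>antisym_row_dec\<close> applies
  directly.\<close>

lemma start_expand:
  fixes q :: "'a::field"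
  assumes q: "q \<noteq> 0"
  obtains u v :: "(nat \<Rightarrow> nat) \<Rightarrow> 'a" where "\<And>w. u w \<noteq> 0" "\<And>w. v w \<noteq> 0"
    "start q = (\<Sum>c\<in>cap_words n f. \<Sum>w\<in>V.Stab. \<Sum>w'\<in>W.Stab.
       (u w * v w') \<odot> bas (mono_word (pact w (c @ A)) (pact w' (c @ B))))"
proof -
  interpret VH: young_hecke f r \<alpha> q "mixed n r s" "g_act q n r s" by (rule V_hecke[OF q])
  interpret WH: young_hecke f s \<beta> q "mixed n r s" "gs_act q n r s" by (rule W_hecke[OF q])
  obtain w0 where w0: "w0 \<in> V.Stab" "\<And>k i. k \<in> V.row i \<Longrightarrow> Suc k \<in> V.row i \<Longrightarrow> inv w0 (Suc k) < inv w0 k"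
    using V.longest by blast
  define u where "u w = (- q) ^ (card (inversions (inv w0)) + card (inversions (w \<circ> inv w0)))" for w
  define v where "v w = (- q) ^ card (inversions w)" for w :: "nat \<Rightarrow> nat"
  have V: "VH.antisym V.Stab (bas (mono_word K J)) = (\<Sum>w\<in>V.Stab. u w \<odot> bas (mono_word (pact w K) J))"
    if K: "(K, J) \<in> multi_idx n r s" "V.row_inc K" for K J
    unfolding u_def
  proof (rule VH.antisym_row_inc[where \<beta> = "\<lambda>K. bas (mono_word K J)" and L = "{K. (K, J) \<in> multi_idx n r s}", OF _ _ _ w0 _ K(2)])
    fix K' assume "K' \<in> {K. (K, J) \<in> multi_idx n r s}"
    then have K': "(K', J) \<in> multi_idx n r s" by simp
    show "length K' = r \<and> (bas (mono_word K' J) :: 'a tensor) \<in> mixed n r s"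
      using K' bas_mixed[OF K'] by (simp add: multi_idx_def)
    show "pact w K' \<in> {K. (K, J) \<in> multi_idx n r s}" if "w permutes {1..r}" for w
      using multi_idx_pact(1)[OF K' that] by simp
    show "gw_act (g_act q n r s) r w (bas (mono_word K' J)) = bas (mono_word (pact w K') J)"
      if "w permutes {1..r}" "\<And>x y. (x, y) \<in> inversions w \<Longrightarrow> K' ! (y - 1) < K' ! (x - 1)" for w
      using q K' that by (rule gw_g_bas)
  qed (assumption, assumption, rule CollectI, rule K(1))
  have W: "WH.antisym W.Stab (bas (mono_word I K)) = (\<Sum>w\<in>W.Stab. v w \<odot> bas (mono_word I (pact w K)))"
    if K: "(I, K) \<in> multi_idx n r s" "W.row_dec K" for I K
    unfolding v_def
  proof (rule WH.antisym_row_dec[where \<beta> = "\<lambda>K. bas (mono_word I K)" and L = "{K. (I, K) \<in> multi_idx n r s}", OF _ _ _ _ K(2)])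
    fix K' assume "K' \<in> {K. (I, K) \<in> multi_idx n r s}"
    then have K': "(I, K') \<in> multi_idx n r s" by simp
    show "length K' = s \<and> (bas (mono_word I K') :: 'a tensor) \<in> mixed n r s"
      using K' bas_mixed[OF K'] by (simp add: multi_idx_def)
    show "pact w K' \<in> {K. (I, K) \<in> multi_idx n r s}" if "w permutes {1..s}" for w
      using multi_idx_pact(2)[OF K' that] by simp
    show "gw_act (gs_act q n r s) s w (bas (mono_word I K')) = bas (mono_word I (pact w K'))"
      if "w permutes {1..s}" "\<And>x y. (x, y) \<in> inversions w \<Longrightarrow> K' ! (y - 1) < K' ! (x - 1)" for w
      using q K' that by (rule gw_gs_bas)
  qed (rule CollectI, rule K(1))
  have len: "length c = f" if "c \<in> cap_words n f" for c using that by (simp add: cap_words_def)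
  have m1: "(pact w (c @ A), c @ B) \<in> multi_idx n r s" if "c \<in> cap_words n f" "w \<in> V.Stab" for c w
    using multi_idx_pact(1)[OF AB_multi[OF that(1)] V.Stab_permutes[OF that(2)]] .
  have "VH.antisym V.Stab (v_f_lambda n r s f lam) = (\<Sum>c\<in>cap_words n f. VH.antisym V.Stab (bas (mono_word (c @ A) (c @ B))))"
    unfolding v_f_lambda_eq by (rule VH.antisym_sum[OF V.Stab_permutes bas_mixed[OF AB_multi]])
  also have "\<dots> = (\<Sum>c\<in>cap_words n f. \<Sum>w\<in>V.Stab. u w \<odot> bas (mono_word (pact w (c @ A)) (c @ B)))"
    by (rule sum.cong[OF refl V[OF AB_multi row_inc_A[OF len]]])
  finally have 1: "VH.antisym V.Stab (v_f_lambda n r s f lam) = \<dots>" .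
  have "start q = WH.antisym W.Stab (\<Sum>c\<in>cap_words n f. \<Sum>w\<in>V.Stab. u w \<odot> bas (mono_word (pact w (c @ A)) (c @ B)))"
    unfolding start_def VH.antisym_act_eq WH.antisym_act_eq 1 ..
  also have "\<dots> = (\<Sum>c\<in>cap_words n f. WH.antisym W.Stab (\<Sum>w\<in>V.Stab. u w \<odot> bas (mono_word (pact w (c @ A)) (c @ B))))"
    by (rule WH.antisym_sum[OF W.Stab_permutes], assumption) (intro mixed_sum mixed_scl bas_mixed m1)
  also have "\<dots> = (\<Sum>c\<in>cap_words n f. \<Sum>w\<in>V.Stab. WH.antisym W.Stab (u w \<odot> bas (mono_word (pact w (c @ A)) (c @ B))))"
    by (intro sum.cong refl WH.antisym_sum[OF W.Stab_permutes] mixed_scl bas_mixed m1)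
  also have "\<dots> = (\<Sum>c\<in>cap_words n f. \<Sum>w\<in>V.Stab. \<Sum>w'\<in>W.Stab.
       (u w * v w') \<odot> bas (mono_word (pact w (c @ A)) (pact w' (c @ B))))"
  proof (intro sum.cong refl)
    fix c w assume cw: "c \<in> cap_words n f" "w \<in> V.Stab"
    note m = m1[OF cw]
    have "WH.antisym W.Stab (u w \<odot> bas (mono_word (pact w (c @ A)) (c @ B))) =
       u w \<odot> WH.antisym W.Stab (bas (mono_word (pact w (c @ A)) (c @ B)))"
      by (rule WH.antisym_scl[OF W.Stab_permutes bas_mixed[OF m]])
    also have "\<dots> = (\<Sum>w'\<in>W.Stab. (u w * v w') \<odot> bas (mono_word (pact w (c @ A)) (pact w' (c @ B))))"
      unfolding W[OF m row_dec_B[OF len[OF cw(1)]]] tensor_vs.scale_sum_right tensor_vs.scale_scale ..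
    finally show "WH.antisym W.Stab (u w \<odot> bas (mono_word (pact w (c @ A)) (c @ B))) =
      (\<Sum>w'\<in>W.Stab. (u w * v w') \<odot> bas (mono_word (pact w (c @ A)) (pact w' (c @ B))))" .
  qed
  finally show ?thesis
    using that[of u v] q by (simp add: u_def v_def)
qed

text \<open>The content forces c to be a rearrangement of \<open>c0\<close>, of which the sorted one
  is largest, and row permutations can only lower words with increasing rows, or with decreasing
  rows on the dual side. The top word arises only from \<open>c0\<close> and two identity
  permutations, so its coefficient cannot cancel.\<close>

lemma leading_start:
  assumes q: "q \<noteq> 0"
  shows "leading n r s (start q) (c0 @ A) (c0 @ B)"
proof -
  obtain u v where uv: "\<And>w. u w \<noteq> 0" "\<And>w. v w \<noteq> 0"
    and ex: "start q = (\<Sum>c\<in>cap_words n f. \<Sum>w\<in>V.Stab. \<Sum>w'\<in>W.Stab.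
       (u w * v w') \<odot> bas (mono_word (pact w (c @ A)) (pact w' (c @ B))))"
    using start_expand[OF q] by blast
  have len: "length (c @ A) = r" "length (c @ B) = s" if "length c = f" for c
    using that f_le by (simp_all add: length_A length_B)
  have prefV: "c = c'" if "pact w (c @ A) = c' @ A" "length c = f" "length c' = f" "w \<in> V.Stab" for c c' w
  proof (rule nth_equalityI)
    show "length c = length c'" using that by simp
    fix p assume p: "p < length c"
    have "pact w (c @ A) ! p = c ! p"
      using that p by (intro V.pact_prefix) (simp_all add: V.Stab_iff)
    then show "c ! p = c' ! p" using that p by (simp add: nth_append)
  qed
  have uniqV: "c = c0 \<and> w = id" if "pact w (c @ A) = c0 @ A" "length c = f" "w \<in> V.Stab" for c w
  proof -
    have "c = c0" using prefV[OF that(1,2) c0(1) that(3)] .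
    then show ?thesis
      using V.pact_row_id[OF that(3) _ len(1)[OF c0(1)]] row_inc_A[OF c0(1)] that(1) by simp
  qed
  have uniqW: "w = id" if "pact w (c0 @ B) = c0 @ B" "w \<in> W.Stab" for w
    using W.pact_row_id[OF that(2) _ len(2)[OF c0(1)]] row_dec_B[OF c0(1)] that(1) by simp
  have val: "start q (mono_word I J) = (\<Sum>c\<in>cap_words n f. \<Sum>w\<in>V.Stab. \<Sum>w'\<in>W.Stab.
       if I = pact w (c @ A) \<and> J = pact w' (c @ B) then u w * v w' else 0)" for I J
    unfolding ex tensor_sum_apply tensor_apply by (intro sum.cong refl) (simp add: bas_apply)
  have "start q (mono_word (c0 @ A) (c0 @ B)) = (\<Sum>c\<in>cap_words n f. \<Sum>w\<in>V.Stab. \<Sum>w'\<in>W.Stab.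
       if c = c0 then if w = id then if w' = id then u id * v id else 0 else 0 else 0)"
    unfolding val
  proof (intro sum.cong refl)
    fix c w w' assume c: "c \<in> cap_words n f" and w: "w \<in> V.Stab" "w' \<in> W.Stab"
    have lc: "length c = f" using c by (simp add: cap_words_def)
    have "c0 @ A = pact w (c @ A) \<and> c0 @ B = pact w' (c @ B) \<longleftrightarrow> c = c0 \<and> w = id \<and> w' = id"
      using uniqV[OF _ lc w(1)] uniqW[OF _ w(2)] by (metis pact_id)
    then show "(if c0 @ A = pact w (c @ A) \<and> c0 @ B = pact w' (c @ B) then u w * v w' else 0) =
      (if c = c0 then if w = id then if w' = id then u id * v id else 0 else 0 else 0)" by simp
  qed
  also have "\<dots> = u id * v id"
  proof -
    have i: "(\<Sum>w'\<in>W.Stab. if w' = id then u id * v id else 0) = u id * v id"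
      using W.Stab_id W.Stab_finite by simp
    have ii: "(\<Sum>w'\<in>W.Stab. if b then (if w' = id then u id * v id else 0) else 0) = (if b then u id * v id else 0)" for b
      using i by simp
    have "(\<Sum>c\<in>cap_words n f. \<Sum>w\<in>V.Stab. \<Sum>w'\<in>W.Stab.
       if c = c0 then if w = id then if w' = id then u id * v id else 0 else 0 else 0) =
       (\<Sum>c\<in>cap_words n f. if c = c0 then (\<Sum>w\<in>V.Stab. if w = id then u id * v id else 0) else 0)"
      by (intro sum.cong refl) (auto simp: ii)
    also have "\<dots> = (\<Sum>w\<in>V.Stab. if w = id then u id * v id else 0)"
      using c0(4) finite_cap_words by simp
    also have "\<dots> = u id * v id" using V.Stab_id V.Stab_finite by simp
    finally show ?thesis .
  qed
  finally have nz: "start q (mono_word (c0 @ A) (c0 @ B)) \<noteq> 0" using uv by simp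
  have dom: "dmd vkey I (c0 @ A) \<and> (I = c0 @ A \<longrightarrow> dmd wkey J (c0 @ B))"
    if ms: "mset I = mset (c0 @ A)" and IJ: "start q (mono_word I J) \<noteq> 0" for I J
  proof -
    have "\<exists>c\<in>cap_words n f. \<exists>w\<in>V.Stab. \<exists>w'\<in>W.Stab. I = pact w (c @ A) \<and> J = pact w' (c @ B)"
    proof (rule ccontr)
      assume "\<not> ?thesis"
      then have no: "\<not> (I = pact w (c @ A) \<and> J = pact w' (c @ B))"
        if "c \<in> cap_words n f" "w \<in> V.Stab" "w' \<in> W.Stab" for c w w' using that by blast
      have "start q (mono_word I J) = 0"
        unfolding val by (intro sum.neutral ballI) (simp only: no if_False)
      with IJ show False by blast
    qed
    then obtain c w w' where cw: "c \<in> cap_words n f" "w \<in> V.Stab" "w' \<in> W.Stab" "I = pact w (c @ A)" "J = pact w' (c @ B)"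
      by blast
    have lc: "length c = f" using cw by (simp add: cap_words_def)
    have pw: "w permutes {1..length (c @ A)}" using V.Stab_permutes[OF cw(2)] len[OF lc] by simp
    have pw': "w' permutes {1..length (c @ B)}" using W.Stab_permutes[OF cw(3)] len[OF lc] by simp
    \<comment> \<open>The letters of \<open>A\<close> cancel. Here the restriction to words of fixed
      content is used.\<close>
    have "mset c = mset c0" using ms mset_pact[OF pw] cw(4) by simp
    then have "dmd vkey (c @ A) (c0 @ A)" using dmd_sorted[OF c0(3)] by blast
    moreover have "dmd vkey I (c @ A)"
      unfolding cw(4)
    proof (rule dmd_pact[OF pw])
      fix x y assume xy: "(x, y) \<in> inversions w"
      then have "x < y" by (simp add: inversions_def)
      then show "vkey ((c @ A) ! (x - 1)) < vkey ((c @ A) ! (y - 1))"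
        using V.Stab_inversions[OF cw(2) xy] row_inc_A[OF lc] unfolding V.row_inc_def by auto
    qed
    moreover have "dmd wkey J (c0 @ B)" if "I = c0 @ A"
    proof -
      have "c = c0" using prefV[OF _ lc c0(1) cw(2)] that cw(4) by simp
      moreover have "dmd wkey J (c @ B)"
        unfolding cw(5)
      proof (rule dmd_pact[OF pw'])
        fix x y assume xy: "(x, y) \<in> inversions w'"
        then have "x < y" by (simp add: inversions_def)
        then show "wkey ((c @ B) ! (x - 1)) < wkey ((c @ B) ! (y - 1))"
          using W.Stab_inversions[OF cw(3) xy] row_dec_B[OF lc] unfolding W.row_dec_def by auto
      qed
      ultimately show ?thesis by simp
    qed
    ultimately show ?thesis using dmd_trans by blast
  qed
  show ?thesis
    unfolding leading_def using start_mixed[OF q] AB_multi[OF c0(4)] nz dom by blast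
qed

text \<open>The i_k increase, so a factor with smaller subscript a moves only positions up to i_a,
  which is less than i_k.\<close>

lemma chain_perm_val:
  assumes D: "(Is, Js) \<in> D_data r s f" and k: "a \<le> k" "k \<le> f" and a: "1 \<le> a"
  shows "chain_perm Is a f k = Is ! (k - 1)"
proof -
  have "a \<le> Suc f" using k by simp
  then show ?thesis
    using k a
  proof (induction a rule: inc_induct)
    case base
    then show ?case by simp
  next
    case (step a)
    then have af: "a \<le> f" by simp
    have aI: "Is ! (a - 1) \<in> {a..r}" using D_data_bounds(3)[OF D, of a] step.prems af by simp
    show ?case
    proof (cases "k = a")
      case True
      have "chain_perm Is (Suc a) f permutes {Suc a..r}"
        using D_data_bounds(3)[OF D] step.hyps by (intro chain_perm_permutes) auto
      then have "chain_perm Is (Suc a) f a = a" by (rule permutes_not_in) simp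
      then show ?thesis using True chain_perm_step[OF af, of Is] s_perm_apply[of a "Is ! (a - 1)" a] aI by simp
    next
      case False
      then have "chain_perm Is (Suc a) f k = Is ! (k - 1)" using step by simp
      moreover have "Is ! (a - 1) < Is ! (k - 1)"
        using D_data_bounds(5)[OF D, of "a - 1" "k - 1"] False step.prems by simp
      ultimately show ?thesis
        using chain_perm_step[OF af, of Is] s_perm_apply[of a "Is ! (a - 1)" "Is ! (k - 1)"] aI by simp
    qed
  qed
qed

text \<open>The factor with subscript a moves the cap letter r - f + a from position a to the right.
  On the vector side it passes only smaller letters of the tail, as the caps with larger subscripts
  already stand beyond i_a. On the dual side it passes later cap letters and tail letters, all
  larger. Both directions raise the leading word.\<close>

lemma leading_chain:
  assumes q: "q \<noteq> 0" and D: "(Is, Js) \<in> D_data r s f" and l: "leading n r s x I1 J1"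
    and I1: "\<And>p. p < f \<Longrightarrow> I1 ! p = c0 ! p" "\<And>p. f \<le> p \<Longrightarrow> p < r \<Longrightarrow> I1 ! p \<le> r - f"
    and J1: "\<And>p. p < f \<Longrightarrow> J1 ! p = c0 ! p" "\<And>p. f \<le> p \<Longrightarrow> p < s \<Longrightarrow> r < J1 ! p"
    and a: "a \<le> Suc f" "1 \<le> a"
  shows "leading n r s (fold (\<lambda>k x. gw_act (gs_act q n r s) s (s_perm k (Js ! (k - 1)))
    (gw_act (g_act q n r s) r (s_perm k (Is ! (k - 1))) x)) (rev [a..<Suc f]) x)
    (pact (chain_perm Is a f) I1) (pact (chain_perm Js a f) J1)"
  using a
proof (induction a rule: inc_induct)
  case base
  show ?case using l by (simp only: chain_perm_Suc pact_id) simp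
next
  case (step a)
  have af: "a \<in> {1..f}" "a \<le> f" using step.hyps step.prems by auto
  have len: "length I1 = r" "length J1 = s" using l by (auto simp: leading_def multi_idx_def)
  let ?u = "chain_perm Is (Suc a) f" and ?v = "chain_perm Js (Suc a) f"
  have pu: "?u permutes {Suc a..r}" and pv: "?v permutes {Suc a..s}"
    using D_data_bounds(3,4)[OF D] af by (intro chain_perm_permutes; auto)+
  have pu': "?u permutes {1..length I1}" and pv': "?v permutes {1..length J1}"
    using permutes_subset[OF pu] permutes_subset[OF pv] len by auto
  note sI = D_perms(1)[OF D af(1)] and sJ = D_perms(2)[OF D af(1)]
  have bI: "Is ! (a - 1) \<in> {a..r}" and bJ: "Js ! (a - 1) \<in> {a..s}"
    using D_data_bounds(3,4)[OF D af(1)] by auto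
  have a1: "a - 1 < r" "a - 1 < s" using af f_le by auto
  have Ka: "pact ?u I1 ! (a - 1) = r - f + a"
  proof -
    have "inv ?u a = a" using permutes_not_in[OF permutes_inv[OF pu]] by simp
    then have "pact ?u I1 ! (a - 1) = I1 ! (a - 1)" using nth_pact[of "a - 1" I1 ?u] af(1) len a1 by simp
    then show ?thesis using I1(1)[of "a - 1"] c0(2)[of "a - 1"] af by simp
  qed
  have Kb: "pact ?v J1 ! (a - 1) = r - f + a"
  proof -
    have "inv ?v a = a" using permutes_not_in[OF permutes_inv[OF pv]] by simp
    then have "pact ?v J1 ! (a - 1) = J1 ! (a - 1)" using nth_pact[of "a - 1" J1 ?v] af(1) len a1 by simp
    then show ?thesis using J1(1)[of "a - 1"] c0(2)[of "a - 1"] af by simp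
  qed
  have invI: "pact ?u I1 ! (y - 1) < pact ?u I1 ! (x - 1)" if "(x, y) \<in> inversions (s_perm a (Is ! (a - 1)))" for x y
  proof -
    have xy: "x = a" "a < y" "y \<le> Is ! (a - 1)"
      using that inversions_s_perm[of a "Is ! (a - 1)"] bI by auto
    define z where "z = inv ?u y"
    have z: "z \<in> {Suc a..r}" "?u z = y"
      using permutes_in_image[OF permutes_inv[OF pu], of y] xy bI permutes_inverses(1)[OF pu] by (auto simp: z_def)
    \<comment> \<open>The letter passed at \<open>y\<close> started at \<open>z\<close>. If it were
      a cap letter, it would by now stand at i_z, beyond i_a.\<close>
    have "f < z"
    proof (rule ccontr)
      assume "\<not> f < z"
      then have "?u z = Is ! (z - 1)" using z by (intro chain_perm_val[OF D]) auto
      moreover have "Is ! (a - 1) < Is ! (z - 1)"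
        using D_data_bounds(5)[OF D, of "a - 1" "z - 1"] z \<open>\<not> f < z\<close> af by auto
      ultimately show False using z xy by simp
    qed
    then have "I1 ! (z - 1) \<le> r - f" using I1(2)[of "z - 1"] z by auto
    moreover have "pact ?u I1 ! (y - 1) = I1 ! (z - 1)"
      using nth_pact[of "y - 1" I1 ?u] xy bI len by (simp add: z_def)
    ultimately show ?thesis unfolding xy(1) Ka using af by simp
  qed
  have invJ: "pact ?v J1 ! (x - 1) < pact ?v J1 ! (y - 1)" if "(x, y) \<in> inversions (s_perm a (Js ! (a - 1)))" for x y
  proof -
    have xy: "x = a" "a < y" "y \<le> Js ! (a - 1)"
      using that inversions_s_perm[of a "Js ! (a - 1)"] bJ by auto
    define z where "z = inv ?v y"
    have z: "z \<in> {Suc a..s}"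
      using permutes_in_image[OF permutes_inv[OF pv], of y] xy bJ by (auto simp: z_def)
    have "r - f + a < J1 ! (z - 1)"
    proof (cases "z \<le> f")
      case True
      then show ?thesis using J1(1)[of "z - 1"] c0(2)[of "z - 1"] z by auto
    next
      case False
      then have "r < J1 ! (z - 1)" using J1(2)[of "z - 1"] z by auto
      then show ?thesis using af f_le by simp
    qed
    moreover have "pact ?v J1 ! (y - 1) = J1 ! (z - 1)"
      using nth_pact[of "y - 1" J1 ?v] xy bJ len by (simp add: z_def)
    ultimately show ?thesis unfolding xy(1) Kb by simp
  qed
  have eI: "pact (chain_perm Is a f) I1 = pact (s_perm a (Is ! (a - 1))) (pact ?u I1)"
    unfolding chain_perm_step[OF af(2)] using sI pu' len by (intro pact_comp[symmetric]) simp_all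
  have eJ: "pact (chain_perm Js a f) J1 = pact (s_perm a (Js ! (a - 1))) (pact ?v J1)"
    unfolding chain_perm_step[OF af(2)] using sJ pv' len by (intro pact_comp[symmetric]) simp_all
  have up: "rev [a..<Suc f] = rev [Suc a..<Suc f] @ [a]" using af by (simp add: upt_conv_Cons del: upt_Suc)
  have IH: "leading n r s (fold (\<lambda>k x. gw_act (gs_act q n r s) s (s_perm k (Js ! (k - 1)))
    (gw_act (g_act q n r s) r (s_perm k (Is ! (k - 1))) x)) (rev [Suc a..<Suc f]) x) (pact ?u I1) (pact ?v J1)"
    using step.IH by simp
  show ?case
    unfolding eI eJ up fold_append
    using leading_gw_gs[OF q leading_gw_g[OF q IH sI invI] sJ invJ] by simp
qed

definition keyV :: "(nat \<times> nat \<Rightarrow> nat) \<Rightarrow> (nat \<Rightarrow> nat) \<Rightarrow> nat list" where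
  "keyV t d = pact d (pact (d_perm f r \<alpha> t) (c0 @ A))"

definition keyW :: "(nat \<times> nat \<Rightarrow> nat) \<Rightarrow> (nat \<Rightarrow> nat) \<Rightarrow> nat list" where
  "keyW t d = pact d (pact (d_perm f s \<beta> t) (c0 @ B))"

lemma len0: "length (c0 @ A) = r" "length (c0 @ B) = s"
  using f_le by (simp_all add: c0 length_A length_B)

text \<open>The dual letters are at least n + 1 - (s - f), which exceeds r because n >= r +
  s.\<close>

lemma tail_letters:
  "x \<in> V.row i \<Longrightarrow> (c0 @ A) ! (x - 1) \<le> r - f"
  "x \<in> W.row i \<Longrightarrow> r < (c0 @ B) ! (x - 1)"
proof -
  show "(c0 @ A) ! (x - 1) \<le> r - f" if x: "x \<in> V.row i"
    using x V.nu_le[of i] unfolding A_letter[OF c0(1) x] V.row_def V.off_Suc greaterThanAtMost_iff by linarith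
  show "r < (c0 @ B) ! (x - 1)" if x: "x \<in> W.row i"
  proof -
    have "x - W.off i \<le> s - f" using x W.nu_le[of i] unfolding W.row_def W.off_Suc greaterThanAtMost_iff by linarith
    then show ?thesis using B_letter[OF c0(1) x] rsn f_le by simp
  qed
qed

text \<open>By \<open>d_perm_inversion\<close> the factor for t exchanges decreasing letters on the
  vector side and increasing letters on the dual side, the directions required by
  \<open>leading_gw_g\<close> and \<open>leading_gw_gs\<close>.\<close>

lemma leading_v_vec:
  assumes q: "q \<noteq> 0" and t: "t \<in> std_bitableaux r s f (bipart_conj lam)"
    and D: "(Is, Js) \<in> D_data r s f"
  shows "leading n r s (v_vec q n r s f lam t (D_perm (Is, Js)))
    (keyV (fst t) (chain_perm Is 1 f)) (keyW (snd t) (chain_perm Js 1 f))"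
proof -
  note tp = t_perms[OF t]
  let ?dV = "d_perm f r \<alpha> (fst t)" and ?dW = "d_perm f s \<beta> (snd t)"
  have iV: "(c0 @ A) ! (y - 1) < (c0 @ A) ! (x - 1)" if xy: "(x, y) \<in> inversions ?dV" for x y
  proof -
    obtain i i' where "x \<in> V.row i" "y \<in> V.row i'" "y - V.off i' < x - V.off i"
      using V.d_perm_inversion[OF tp(1) xy] .
    then show ?thesis using A_letter[OF c0(1)] by simp
  qed
  have iW: "(c0 @ B) ! (x - 1) < (c0 @ B) ! (y - 1)" if xy: "(x, y) \<in> inversions ?dW" for x y
  proof -
    obtain i i' where i: "x \<in> W.row i" "y \<in> W.row i'" "y - W.off i' < x - W.off i"
      using W.d_perm_inversion[OF tp(2) xy] .
    have "x - W.off i \<le> n" using i(1) beta_le[of i] unfolding W.row_def W.off_Suc greaterThanAtMost_iff by linarith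
    then show ?thesis unfolding B_letter[OF c0(1) i(1)] B_letter[OF c0(1) i(2)] using i(3) by simp
  qed
  have l1: "leading n r s (gw_act (gs_act q n r s) s ?dW (gw_act (g_act q n r s) r ?dV (start q)))
    (pact ?dV (c0 @ A)) (pact ?dW (c0 @ B))"
    by (rule leading_gw_gs[OF q leading_gw_g[OF q leading_start[OF q] tp(3) iV] tp(4) iW])
  have V1: "pact ?dV (c0 @ A) ! p = c0 ! p" if "p < f" for p
    by (rule V.pact_prefix[OF V.d_perm_facts(1)[OF tp(1)] c0(1) that])
  have W1: "pact ?dW (c0 @ B) ! p = c0 ! p" if "p < f" for p
    by (rule W.pact_prefix[OF W.d_perm_facts(1)[OF tp(2)] c0(1) that])
  have V2: "pact ?dV (c0 @ A) ! p \<le> r - f" if p: "f \<le> p" "p < r" for p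
  proof -
    have "inv ?dV (Suc p) \<in> {f + 1..r}"
      using permutes_in_image[OF permutes_inv[OF V.d_perm_facts(1)[OF tp(1)]], of "Suc p"] p by simp
    then obtain i where "inv ?dV (Suc p) \<in> V.row i" by (rule V.row_cover)
    from tail_letters(1)[OF this] show ?thesis using nth_pact[of p "c0 @ A" ?dV] p len0 by simp
  qed
  have W2: "r < pact ?dW (c0 @ B) ! p" if p: "f \<le> p" "p < s" for p
  proof -
    have "inv ?dW (Suc p) \<in> {f + 1..s}"
      using permutes_in_image[OF permutes_inv[OF W.d_perm_facts(1)[OF tp(2)]], of "Suc p"] p by simp
    then obtain i where "inv ?dW (Suc p) \<in> W.row i" by (rule W.row_cover)
    from tail_letters(2)[OF this] show ?thesis using nth_pact[of p "c0 @ B" ?dW] p len0 by simp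
  qed
  show ?thesis
    unfolding v_vec_eq gd_act_eq[OF D refl] keyV_def keyW_def
    by (rule leading_chain[OF q D l1 V1 V2 W1 W2]) simp_all
qed

lemma c0_letter: "k \<in> {1..f} \<Longrightarrow> (c0 @ xs) ! (k - 1) = r - f + k"
proof -
  assume k: "k \<in> {1..f}"
  then have "k - 1 < f" by auto
  then show ?thesis using k c0(1) c0(2)[of "k - 1"] by (simp add: nth_append)
qed

text \<open>A letter that occurs only once can be followed through the permutation.\<close>

lemma cap_position:
  assumes e: "pact w K = pact w' K" and w: "w permutes {1..length K}" "w' permutes {1..length K}"
    and k: "k \<in> {1..length K}" and u: "\<And>p. p \<in> {1..length K} \<Longrightarrow> K ! (p - 1) = K ! (k - 1) \<Longrightarrow> p = k"
  shows "w k = w' k"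
proof -
  have wk: "w k \<in> {1..length K}" using permutes_in_image[OF w(1)] k by simp
  then have wk': "w k - 1 < length K" "Suc (w k - 1) = w k" by auto
  have i: "inv w' (w k) \<in> {1..length K}" using permutes_in_image[OF permutes_inv[OF w(2)]] wk by simp
  have "K ! (k - 1) = pact w' K ! (w k - 1)" using pact_at[OF w(1) k] e by simp
  also have "\<dots> = K ! (inv w' (w k) - 1)" using nth_pact[of "w k - 1" K w'] wk' by simp
  finally have "inv w' (w k) = k" using u[OF i] by simp
  then show ?thesis using permutes_inverses(1)[OF w(2), of "w k"] by simp
qed

text \<open>Cap letters occur once and d(t) fixes their initial positions, so their final positions
  give the chain on 1, ..., f and with it \<open>I\<close>. After the chain is undone, the letter at
  position t (i, j) is j + 1, so every entry of t reveals its column.\<close>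

lemma keyV_inj:
  assumes t: "t \<in> std_tableaux f r \<alpha>" "t' \<in> std_tableaux f r \<alpha>"
    and I: "length I = f" "length I' = f" "\<And>k. k \<in> {1..f} \<Longrightarrow> I ! (k - 1) \<in> {k..r}" "\<And>k. k \<in> {1..f} \<Longrightarrow> I' ! (k - 1) \<in> {k..r}"
    and e: "keyV t (chain_perm I 1 f) = keyV t' (chain_perm I' 1 f)"
  shows "t = t' \<and> I = I'"
proof -
  let ?K = "c0 @ A" and ?d = "d_perm f r \<alpha> t" and ?d' = "d_perm f r \<alpha> t'"
  let ?c = "chain_perm I 1 f" and ?c' = "chain_perm I' 1 f"
  note d = V.d_perm_facts[OF t(1)] and d' = V.d_perm_facts[OF t(2)]
  have p: "?d permutes {1..length ?K}" "?d' permutes {1..length ?K}"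
    unfolding len0 by (rule V.permutes_up[OF d(1)], rule V.permutes_up[OF d'(1)])
  have c: "?c permutes {1..length ?K}" "?c' permutes {1..length ?K}"
    unfolding len0 using I by (intro chain_perm_permutes; simp)+
  have e': "pact (?c \<circ> ?d) ?K = pact (?c' \<circ> ?d') ?K"
    using e unfolding keyV_def pact_comp[OF c(1) p(1)] pact_comp[OF c(2) p(2)] .
  have "?c k = ?c' k" if k: "k \<in> {1..f}" for k
  proof -
    have "(?c \<circ> ?d) k = (?c' \<circ> ?d') k"
    proof (rule cap_position[OF e'])
      show "?c \<circ> ?d permutes {1..length ?K}" "?c' \<circ> ?d' permutes {1..length ?K}"
        using p c by (auto intro: permutes_compose)
      show "k \<in> {1..length ?K}" using k f_le len0 by auto
      fix x assume x: "x \<in> {1..length ?K}" "?K ! (x - 1) = ?K ! (k - 1)"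
      have kk: "?K ! (k - 1) = r - f + k" by (rule c0_letter[OF k])
      show "x = k"
      proof (cases "x \<le> f")
        case True
        then have "?K ! (x - 1) = r - f + x" using x(1) by (intro c0_letter) simp
        then show ?thesis using x kk by simp
      next
        case False
        then have "x \<in> {f + 1..r}" using x len0 by auto
        then obtain i where "x \<in> V.row i" by (rule V.row_cover)
        from tail_letters(1)[OF this] show ?thesis using x kk k by simp
      qed
    qed
    moreover have "?d k = k" "?d' k = k" using permutes_not_in[OF d(1)] permutes_not_in[OF d'(1)] k by simp_all
    ultimately show ?thesis by simp
  qed
  then have II: "I = I'" using chain_perm_list_inj[OF I] by blast
  have eq: "pact ?d ?K = pact ?d' ?K"
    by (rule pact_inj[where w = ?c']) (use e c(2) in \<open>simp_all add: keyV_def II\<close>)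
  have "t = t'"
  proof (rule V.std_tableau_columns[OF t])
    fix i j i' j' assume ij: "(i, j) \<in> diagram \<alpha>" "(i', j') \<in> diagram \<alpha>" and tt: "t (i, j) = t' (i', j')"
    have at: "pact (d_perm f r \<alpha> v) ?K ! (v (i, j) - 1) = Suc j"
      if v: "v \<in> std_tableaux f r \<alpha>" "(i, j) \<in> diagram \<alpha>" for v i j
    proof -
      have j: "j < \<alpha> i" using v(2) by (simp add: diagram_def)
      define x where "x = row_tableau f \<alpha> (i, j)"
      have x: "x \<in> V.row i" "x - V.off i = Suc j"
        using j V.row_tableau_eq[OF j] by (auto simp: x_def V.row_def V.off_Suc)
      have xr: "x \<in> {1..length ?K}" using V.row_sub[of i] x(1) len0 by auto
      have pv: "d_perm f r \<alpha> v permutes {1..length ?K}"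
        unfolding len0 by (rule V.permutes_up[OF V.d_perm_facts(1)[OF v(1)]])
      have "d_perm f r \<alpha> v x = v (i, j)" unfolding x_def by (rule V.d_perm_facts(2)[OF v])
      then show ?thesis using pact_at[OF pv xr] A_letter[OF c0(1) x(1)] x(2) by simp
    qed
    show "j = j'" using at[OF t(1) ij(1)] at[OF t(2) ij(2)] tt eq by simp
  qed
  then show ?thesis using II by blast
qed

lemma keyW_inj:
  assumes t: "t \<in> std_tableaux f s \<beta>" "t' \<in> std_tableaux f s \<beta>"
    and J: "length J = f" "length J' = f" "\<And>k. k \<in> {1..f} \<Longrightarrow> J ! (k - 1) \<in> {k..s}" "\<And>k. k \<in> {1..f} \<Longrightarrow> J' ! (k - 1) \<in> {k..s}"
    and e: "keyW t (chain_perm J 1 f) = keyW t' (chain_perm J' 1 f)"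
  shows "t = t' \<and> J = J'"
proof -
  let ?K = "c0 @ B" and ?d = "d_perm f s \<beta> t" and ?d' = "d_perm f s \<beta> t'"
  let ?c = "chain_perm J 1 f" and ?c' = "chain_perm J' 1 f"
  note d = W.d_perm_facts[OF t(1)] and d' = W.d_perm_facts[OF t(2)]
  have p: "?d permutes {1..length ?K}" "?d' permutes {1..length ?K}"
    unfolding len0 by (rule W.permutes_up[OF d(1)], rule W.permutes_up[OF d'(1)])
  have c: "?c permutes {1..length ?K}" "?c' permutes {1..length ?K}"
    unfolding len0 using J by (intro chain_perm_permutes; simp)+
  have e': "pact (?c \<circ> ?d) ?K = pact (?c' \<circ> ?d') ?K"
    using e unfolding keyW_def pact_comp[OF c(1) p(1)] pact_comp[OF c(2) p(2)] .
  have "?c k = ?c' k" if k: "k \<in> {1..f}" for k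
  proof -
    have "(?c \<circ> ?d) k = (?c' \<circ> ?d') k"
    proof (rule cap_position[OF e'])
      show "?c \<circ> ?d permutes {1..length ?K}" "?c' \<circ> ?d' permutes {1..length ?K}"
        using p c by (auto intro: permutes_compose)
      show "k \<in> {1..length ?K}" using k f_le len0 by auto
      fix x assume x: "x \<in> {1..length ?K}" "?K ! (x - 1) = ?K ! (k - 1)"
      have kk: "?K ! (k - 1) = r - f + k" by (rule c0_letter[OF k])
      show "x = k"
      proof (cases "x \<le> f")
        case True
        then have "?K ! (x - 1) = r - f + x" using x(1) by (intro c0_letter) simp
        then show ?thesis using x kk by simp
      next
        case False
        then have "x \<in> {f + 1..s}" using x len0 by auto
        then obtain i where "x \<in> W.row i" by (rule W.row_cover)
        from tail_letters(2)[OF this] have "r < r - f + k" using x(2) kk by simp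
        moreover have "r - f + k \<le> r" using k f_le by auto
        ultimately show ?thesis by simp
      qed
    qed
    moreover have "?d k = k" "?d' k = k" using permutes_not_in[OF d(1)] permutes_not_in[OF d'(1)] k by simp_all
    ultimately show ?thesis by simp
  qed
  then have JJ: "J = J'" using chain_perm_list_inj[OF J] by blast
  have eq: "pact ?d ?K = pact ?d' ?K"
    by (rule pact_inj[where w = ?c']) (use e c(2) in \<open>simp_all add: keyW_def JJ\<close>)
  have "t = t'"
  proof (rule W.std_tableau_columns[OF t])
    fix i j i' j' assume ij: "(i, j) \<in> diagram \<beta>" "(i', j') \<in> diagram \<beta>" and tt: "t (i, j) = t' (i', j')"
    have at: "pact (d_perm f s \<beta> v) ?K ! (v (i, j) - 1) = n - j \<and> j < n"
      if v: "v \<in> std_tableaux f s \<beta>" "(i, j) \<in> diagram \<beta>" for v i j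
    proof -
      have j: "j < \<beta> i" using v(2) by (simp add: diagram_def)
      define x where "x = row_tableau f \<beta> (i, j)"
      have x: "x \<in> W.row i" "x - W.off i = Suc j"
        using j W.row_tableau_eq[OF j] by (auto simp: x_def W.row_def W.off_Suc)
      have xr: "x \<in> {1..length ?K}" using W.row_sub[of i] x(1) len0 by auto
      have pv: "d_perm f s \<beta> v permutes {1..length ?K}"
        unfolding len0 by (rule W.permutes_up[OF W.d_perm_facts(1)[OF v(1)]])
      have "d_perm f s \<beta> v x = v (i, j)" unfolding x_def by (rule W.d_perm_facts(2)[OF v])
      then show ?thesis using pact_at[OF pv xr] B_letter[OF c0(1) x(1)] x(2) j beta_le[of i] by simp
    qed
    \<comment> \<open>The letters are now n - j; the bound j < n makes this injective despite
      truncated subtraction.\<close>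
    show "j = j'" using at[OF t(1) ij(1)] at[OF t(2) ij(2)] tt eq by auto
  qed
  then show ?thesis using JJ by blast
qed

section \<open>Size of the index set and linear independence\<close>

lemma index_card:
  "card (hw_words n r s (tilde_weight n lam)) \<le> card (std_bitableaux r s f (bipart_conj lam) \<times> D_set r s f)"
proof -
  have "card (hw_words n r s (tilde_weight n (fst lam, snd lam))) \<le>
      (r choose f) * falling s f * (ypath (r - f) (fst lam) * ypath (s - f) (snd lam))"
    by (rule card_hw_words[OF f_le lam_part rsn])
  also have "\<dots> \<le> card (D_data r s f) * (card (std_tableaux f r \<alpha>) * card (std_tableaux f s \<beta>))"
    using ypath_le_card_std[OF lam_part(1), of f] ypath_le_card_std[OF lam_part(2), of f] f_le
    by (intro mult_le_mono card_D_data) (simp_all add: \<alpha>_def \<beta>_def)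
  also have "card (D_data r s f) = card (D_set r s f)"
    unfolding D_set_def by (rule card_image[OF D_perm_inj, symmetric])
  finally show ?thesis
    by (simp add: card_cartesian_product std_bitableaux_def bipart_conj_def \<alpha>_def \<beta>_def mult_ac)
qed

lemma index_finite: "finite (std_bitableaux r s f (bipart_conj lam) \<times> D_set r s f)"
  using finite_std_tableaux[OF V.part] finite_std_tableaux[OF W.part] finite_D_data
  by (simp add: std_bitableaux_def bipart_conj_def \<alpha>_def \<beta>_def D_set_def)

text \<open>Injectivity of the parametrization is included because the final count compares the size
  of the set of vectors with that of the index set; nonvanishing is part of being singular.\<close>

lemma v_vec_independent:
  fixes q :: "'a::field"
  assumes q: "q \<noteq> 0"
  shows "inj_on (\<lambda>(t, d). v_vec q n r s f lam t d) (std_bitableaux r s f (bipart_conj lam) \<times> D_set r s f) \<and>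
    \<not> tensor_vs.dependent (S_set q n r s f lam) \<and> 0 \<notin> S_set q n r s f lam"
proof -
  let ?A = "std_bitableaux r s f (bipart_conj lam) \<times> D_set r s f"
  let ?v = "\<lambda>(t, d). v_vec q n r s f lam t d :: 'a tensor"
  let ?K = "\<lambda>(t, d). (keyV (fst t) (fst d), keyW (snd t) (snd d))"
  have D: "\<exists>Is Js. (Is, Js) \<in> D_data r s f \<and> d = D_perm (Is, Js) \<and> fst d = chain_perm Is 1 f \<and> snd d = chain_perm Js 1 f"
    if d: "d \<in> D_set r s f" for d
  proof -
    obtain Is Js where D: "(Is, Js) \<in> D_data r s f" "d = D_perm (Is, Js)" using d by (auto simp: D_set_def)
    then show ?thesis using D_perm_chain[OF D_data_bounds(1,2)[OF D(1)]] by (intro exI[of _ Is] exI[of _ Js]) simp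
  qed
  have lead: "leading n r s (?v a) (fst (?K a)) (snd (?K a))" if a: "a \<in> ?A" for a
  proof -
    obtain t d where td: "a = (t, d)" "t \<in> std_bitableaux r s f (bipart_conj lam)" "d \<in> D_set r s f"
      using a by blast
    obtain Is Js where IJ: "(Is, Js) \<in> D_data r s f" "d = D_perm (Is, Js)" "fst d = chain_perm Is 1 f" "snd d = chain_perm Js 1 f"
      using D[OF td(3)] by blast
    show ?thesis using leading_v_vec[OF q td(2) IJ(1)] unfolding td(1) IJ(2)[symmetric] IJ(3)[symmetric] IJ(4)[symmetric] by simp
  qed
  have ms: "mset (fst (?K a)) = mset (c0 @ A) \<and> mset (snd (?K a)) = mset (c0 @ B)" if a: "a \<in> ?A" for a
  proof -
    obtain t d where td: "a = (t, d)" "t \<in> std_bitableaux r s f (bipart_conj lam)" "d \<in> D_set r s f"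
      using a by blast
    obtain Is Js where IJ: "(Is, Js) \<in> D_data r s f" "fst d = chain_perm Is 1 f" "snd d = chain_perm Js 1 f"
      using D[OF td(3)] by blast
    have "fst d permutes {1..r}" "snd d permutes {1..s}"
      unfolding IJ using D_data_bounds(3,4)[OF IJ(1)] by (intro chain_perm_permutes; simp)+
    then show ?thesis
      unfolding td(1) using t_perms(3,4)[OF td(2)] len0 mset_pact by (simp add: keyV_def keyW_def)
  qed
  have inj: "inj_on ?K ?A"
  proof (rule inj_onI)
    fix a b assume a: "a \<in> ?A" and b: "b \<in> ?A" and e: "?K a = ?K b"
    obtain t d t' d' where td: "a = (t, d)" "t \<in> std_bitableaux r s f (bipart_conj lam)" "d \<in> D_set r s f"
      "b = (t', d')" "t' \<in> std_bitableaux r s f (bipart_conj lam)" "d' \<in> D_set r s f"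
      using a b by blast
    obtain Is Js where IJ: "(Is, Js) \<in> D_data r s f" "d = D_perm (Is, Js)" "fst d = chain_perm Is 1 f" "snd d = chain_perm Js 1 f"
      using D[OF td(3)] by blast
    obtain Is' Js' where IJ': "(Is', Js') \<in> D_data r s f" "d' = D_perm (Is', Js')" "fst d' = chain_perm Is' 1 f" "snd d' = chain_perm Js' 1 f"
      using D[OF td(6)] by blast
    note bd = D_data_bounds[OF IJ(1)] and bd' = D_data_bounds[OF IJ'(1)]
    have "fst t = fst t' \<and> Is = Is'"
      using e IJ IJ' unfolding td by (intro keyV_inj t_perms(1)[OF td(2)] t_perms(1)[OF td(5)] bd(1) bd'(1) bd(3) bd'(3)) simp_all
    moreover have "snd t = snd t' \<and> Js = Js'"
      using e IJ IJ' unfolding td by (intro keyW_inj t_perms(2)[OF td(2)] t_perms(2)[OF td(5)] bd(2) bd'(2) bd(4) bd'(4)) simp_all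
    ultimately show "a = b" unfolding td(1,4) IJ(2) IJ'(2) by (simp add: prod_eq_iff)
  qed
  have S: "S_set q n r s f lam = ?v ` ?A"
    by (auto simp: S_set_def)
  have "0 \<notin> ?v ` ?A"
  proof
    assume "0 \<in> ?v ` ?A"
    then obtain a where "a \<in> ?A" "?v a = 0" by force
    then show False using lead[of a] by (simp add: leading_def tensor_apply)
  qed
  moreover have "inj_on ?v ?A \<and> \<not> tensor_vs.dependent (?v ` ?A)"
    using ms by (intro leading_independent[OF index_finite lead _ inj]) simp_all
  ultimately show ?thesis unfolding S by blast
qed

end

theorem theorem4p13:
  fixes \<phi> :: "Qq \<Rightarrow> 'k::field"
    and r s n f :: nat
    and lam :: "(nat \<Rightarrow> nat) \<times> (nat \<Rightarrow> nat)"
  assumes "ZZq_algebra \<phi>"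
    and "r > 0" and "s > 0" and "n > 0" and "n \<ge> r + s"
    and "(f, lam) \<in> Lambda_rs r s"
  shows "inj_on (\<lambda>(t, d). v_vec (\<phi> qq) n r s f lam t d)
             (std_bitableaux r s f (bipart_conj lam) \<times> D_set r s f) \<and>
         is_basis_of (S_set (\<phi> qq) n r s f lam)
             (module.span (\<odot>) (singular_vectors \<phi> n r s (tilde_weight n lam)))"
proof -
  interpret shape_field n r s f lam \<phi>
    by unfold_locales (use assms in auto)
  let ?A = "std_bitableaux r s f (bipart_conj lam) \<times> D_set r s f"
  let ?S = "S_set (\<phi> qq) n r s f lam" and ?U = "singular_vectors \<phi> n r s (tilde_weight n lam)"
  have ind: "inj_on (\<lambda>(t, d). v_vec (\<phi> qq) n r s f lam t d) ?A" "\<not> tensor_vs.dependent ?S" "0 \<notin> ?S"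
    using v_vec_independent[OF phi_qq_nz] by blast+
  have img: "?S = (\<lambda>(t, d). v_vec (\<phi> qq) n r s f lam t d) ` ?A"
    by (auto simp: S_set_def)
  have fin: "finite ?S" unfolding img by (rule finite_imageI[OF index_finite])
  have card: "card (hw_words n r s (tilde_weight n lam)) \<le> card ?S"
    unfolding img card_image[OF ind(1)] by (rule index_card)
  have sub: "?S \<subseteq> ?U"
  proof
    fix x assume x: "x \<in> ?S"
    then obtain t d where "x = v_vec (\<phi> qq) n r s f lam t d" "t \<in> std_bitableaux r s f (bipart_conj lam)" "d \<in> D_set r s f"
      by (auto simp: S_set_def)
    then show "x \<in> ?U" using v_vec_singular[of t d] x ind(3) by metis
  qed
  \<comment> \<open>The span of \<open>?S\<close> lies in the span of the singular vectors, and that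
    lies in \<open>sing_space\<close>. As \<open>?S\<close> reaches the dimension bound of the
    latter, all three spaces coincide.\<close>
  have "?S \<subseteq> sing_space (\<phi> qq) n r s (tilde_weight n lam)"
    using sub tensor_vs.span_superset span_singular_vectors by blast
  from sing_space_span[OF phi_qq_nz this fin ind(2) card]
  have "tensor_vs.span ?U \<subseteq> tensor_vs.span ?S" using span_singular_vectors by blast
  moreover have "tensor_vs.span ?S \<subseteq> tensor_vs.span ?U" by (rule tensor_vs.span_mono[OF sub])
  ultimately show ?thesis
    using ind(1,2) unfolding is_basis_of_def by blast
qed

end
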